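(* There exists a constant $C>0$ such that, for all $\varepsilon,\alpha\in(0,1)$, all integers $n\ge 1$, and every admissible choice of $(\widetilde{\mathcal Y}^{2,\varepsilon,(n)}_0,\widetilde{\mathcal Z}^{2,\varepsilon,(n)})$ with corresponding process $\widetilde{\mathcal Y}^{2,\varepsilon,(n)}$ (see context), $$E\Big[\big|Y_0^{\varepsilon,\alpha}-\{\mathcal Y_0^{1,\varepsilon}+\alpha\,\widetilde{\mathcal Y}_0^{2,\varepsilon,(n)}\}\big|^2\Big]\le \alpha^2 C\Big\{\frac1n+\big\|\widetilde{\mathcal Y}_T^{2,\varepsilon,(n)}\big\|_2^2\Big\},$$ where $\|\cdot\|_2=E[|\cdot|^2]^{1/2}$. The constant $C$ does not depend on $\varepsilon,\alpha,n$ or on the choice of $(\widetilde{\mathcal Y}^{2,\varepsilon,(n)}_0,\widetilde{\mathcal Z}^{2,\varepsilon,(n)})$.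
   Context: **Probability space and FBSDE.** Let $T>0$ and let $(\Omega,\mathcal F,\{\mathcal F_t\}_{0\le t\le T},P)$ be a filtered probability space with a $d$-dimensional Brownian motion $W$ and a square-integrable $\mathbb R^d$-valued random variable $\xi$ independent of $W$; the filtration is generated by $\{W_t+\xi\}_{0\le t\le T}$. For $\varepsilon,\alpha\in(0,1)$ consider $$dX_t^\varepsilon=\mu(t,X_t^\varepsilon)dt+\varepsilon\sigma(t,X_t^\varepsilon)dW_t,\quad X_0^\varepsilon=\xi,$$ $$-dY_t^{\varepsilon,\alpha}=\alpha f(t,X_t^\varepsilon,Y_t^{\varepsilon,\alpha},Z_t^{\varepsilon,\alpha})dt-Z_t^{\varepsilon,\alpha}dW_t,\quad Y_T^{\varepsilon,\alpha}=g(X_T^\varepsilon),$$ with $\mu:[0,T]\times\mathbb R^d\to\mathbb R^d$, $\sigma:[0,T]\times\mathbb R^d\to\mathbb R^{d\times d}$, $f:[0,T]\times\mathbb R^d\times\mathbb R\times\mathbb R^d\to\mathbb R$, $g:\mathbb R^d\to\mathbb R$ such that the FBSDE has a unique solution. ($Z$ is viewed as a row vector.) These functions do not depend on $\varepsilon,\alpha$. **Standing assumptions.** $\mu$ and $\sigma$ are bounded and smooth in $x$ with bounded derivatives of every order. $f$ is uniformly Lipschitz continuous and of at most linear growth in the variables $(x,y,z)$. $g$ is of class $C_b^2$. $\mu,\sigma,f$ are uniformly Hölder-$1/2$ continuous in $t$. There is $\varepsilon_0>0$ with $\sigma(t,x)\sigma(t,x)^\top\ge\varepsilon_0 I$ for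 all $t\in[0,T]$, $x\in\mathbb R^d$. **Linear part.** Put $\sigma^\varepsilon=\varepsilon\sigma$ and $\mathcal L^\varepsilon=\sum_i\mu^i(t,x)\partial_{x_i}+\frac12\sum_{i,j}[\sigma^\varepsilon(\sigma^\varepsilon)^\top]_{i,j}(t,x)\partial_{x_i}\partial_{x_j}$. Let $\mathcal U^1$ (depending on $\varepsilon$) be the solution of $\partial_t\mathcal U^1+\mathcal L^\varepsilon\mathcal U^1=0$ for $t<T$, $\mathcal U^1(T,x)=g(x)$, i.e. $\mathcal U^1(t,x)=E[g(X_T^{t,x,\varepsilon})]$, where $X^{t,x,\varepsilon}$ solves the forward SDE started from $x$ at time $t$. Then $(\mathcal Y^{1,\varepsilon}_t,\mathcal Z^{1,\varepsilon}_t)=(\mathcal U^1(t,X^\varepsilon_t),(\partial_x\mathcal U^1\sigma^\varepsilon)(t,X_t^\varepsilon))$ solves the linear BSDE $-d\mathcal Y_t^{1,\varepsilon}=-\mathcal Z_t^{1,\varepsilon}dW_t$, $\mathcal Y_T^{1,\varepsilon}=g(X_T^\varepsilon)$. **Euler–Maruyama scheme.** For $n\ge1$ and $\varphi(s)=\max\{kT/n:\ k\in\mathbb Z_{\ge 0},\ s\ge kT/n\}$, $$\bar X_t^{\varepsilon,(n)}=\xi+\int_0^t\mu(\varphi(s),\bar X^{\varepsilon,(n)}_{\varphi(s)})ds+\int_0^t\sigma^\varepsilon(\varphi(s),\bar X^{\varepsilon,(n)}_{\varphi(s)})dW_s .$$ Set $\overline{\mathcal Y}_t^{1,\varepsilon,(n)}=\mathcal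 U^1(t,\bar X_t^{\varepsilon,(n)})$ and $\overline{\mathcal Z}_t^{1,\varepsilon,(n)}=(\partial_x\mathcal U^1\sigma^\varepsilon)(t,\bar X_t^{\varepsilon,(n)})$. **Controlled process.** An admissible choice is a pair consisting of a square-integrable $\mathcal F_0$-measurable random variable $\widetilde{\mathcal Y}^{2,\varepsilon,(n)}_0$ and a progressively measurable $\mathbb R^d$-valued process $\widetilde{\mathcal Z}^{2,\varepsilon,(n)}$ with $E\int_0^T|\widetilde{\mathcal Z}^{2,\varepsilon,(n)}_s|^2ds<\infty$. The corresponding process $\widetilde{\mathcal Y}^{2,\varepsilon,(n)}$ is defined forward in time by $$\widetilde{\mathcal Y}_t^{2,\varepsilon,(n)}=\widetilde{\mathcal Y}_0^{2,\varepsilon,(n)}-\int_0^t f\big(s,\bar X_s^{\varepsilon,(n)},\overline{\mathcal Y}_s^{1,\varepsilon,(n)}+\alpha\widetilde{\mathcal Y}_s^{2,\varepsilon,(n)},\overline{\mathcal Z}_s^{1,\varepsilon,(n)}+\alpha\widetilde{\mathcal Z}_s^{2,\varepsilon,(n)}\big)ds+\int_0^t\widetilde{\mathcal Z}_s^{2,\varepsilon,(n)}dW_s .$$ (In the numerical method, $\|\widetilde{\mathcal Y}_T^{2,\varepsilon,(n)}\|_2^2$ is the loss minimized over such pairs.) *)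

theory Defs
  imports "HOL-Probability.Probability"
begin

text \<open>The filtration is the raw one, without augmentation by null sets; path properties and
  equations between processes are therefore only required almost surely.\<close>

definition generated_filtration ::
    "'w measure \<Rightarrow> (real \<Rightarrow> 'w \<Rightarrow> 'b::topological_space) \<Rightarrow> real \<Rightarrow> 'w measure" where
  "generated_filtration M V t =
     sigma (space M) {V s -` A \<inter> space M | s A. s \<in> {0..t} \<and> A \<in> sets borel}"

definition indep_of_path ::
    "'w measure \<Rightarrow> ('w \<Rightarrow> real ^ 'd) \<Rightarrow> real \<Rightarrow> (real \<Rightarrow> 'w \<Rightarrow> real ^ 'd) \<Rightarrow> bool" where
  "indep_of_path M \<xi> t V \<longleftrightarrow>
     prob_space.indep_set M
       {\<xi> -` A \<inter> space M | A. A \<in> sets borel} (sets (generated_filtration M V t))"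

definition brownian_motion ::
    "'w measure \<Rightarrow> real \<Rightarrow> (real \<Rightarrow> 'w \<Rightarrow> real ^ 'd) \<Rightarrow> bool" where
  "brownian_motion M T W \<longleftrightarrow>
     (\<forall>t\<in>{0..T}. W t \<in> borel_measurable M) \<and>
     (AE \<omega> in M. W 0 \<omega> = 0) \<and>
     (AE \<omega> in M. continuous_on {0..T} (\<lambda>t. W t \<omega>)) \<and>
     (\<forall>s t. 0 \<le> s \<and> s < t \<and> t \<le> T \<longrightarrow>
        (\<forall>i. distributed M lborel (\<lambda>\<omega>. (W t \<omega> - W s \<omega>) $ i)
               (\<lambda>x. ennreal (normal_density 0 (sqrt (t - s)) x))) \<and>
        prob_space.indep_vars M (\<lambda>_. borel) (\<lambda>i \<omega>. (W t \<omega> - W s \<omega>) $ i) UNIV \<and>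
        indep_of_path M (\<lambda>\<omega>. W t \<omega> - W s \<omega>) s W)"

definition progressive ::
    "(real \<Rightarrow> 'w measure) \<Rightarrow> real \<Rightarrow> real \<Rightarrow> (real \<Rightarrow> 'w \<Rightarrow> 'b::topological_space) \<Rightarrow> bool" where
  "progressive F a b H \<longleftrightarrow>
     (\<forall>t\<in>{a..b}. (\<lambda>(s, \<omega>). H s \<omega>) \<in>
        borel_measurable (restrict_space borel {a..t} \<Otimes>\<^sub>M F t))"

definition square_integrable_process ::
    "'w measure \<Rightarrow> (real \<Rightarrow> 'w measure) \<Rightarrow> real \<Rightarrow> real \<Rightarrow>
     (real \<Rightarrow> 'w \<Rightarrow> 'b::real_normed_vector) \<Rightarrow> bool" where
  "square_integrable_process M F a b H \<longleftrightarrow>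
     progressive F a b H \<and>
     (\<integral>\<^sup>+\<omega>. (\<integral>\<^sup>+s\<in>{a..b}. ennreal ((norm (H s \<omega>))\<^sup>2) \<partial>lborel) \<partial>M) < \<infinity>"

text \<open>A simple integrand is given by a number m of steps, grid points
  \<open>\<tau> 0 \<le> \<dots> \<le> \<tau> m\<close> and bounded coefficients \<open>\<eta> i\<close>, measurable
  at time \<open>\<tau> i\<close>; it takes the value \<open>\<eta> i\<close> on the
  interval \<open>{\<tau> i <.. \<tau> (Suc i)}\<close>.\<close>

definition simple_integrand ::
    "(real \<Rightarrow> 'w measure) \<Rightarrow> real \<Rightarrow> real \<Rightarrow> nat \<Rightarrow> (nat \<Rightarrow> real) \<Rightarrow>
     (nat \<Rightarrow> 'w \<Rightarrow> real ^ 'd) \<Rightarrow> bool" where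
  "simple_integrand F a b m \<tau> \<eta> \<longleftrightarrow>
     (\<forall>i<m. a \<le> \<tau> i \<and> \<tau> i \<le> \<tau> (Suc i) \<and> \<tau> (Suc i) \<le> b \<and>
        \<eta> i \<in> borel_measurable (F (\<tau> i)) \<and>
        (\<exists>B. \<forall>\<omega>\<in>space (F (\<tau> i)). norm (\<eta> i \<omega>) \<le> B))"

definition simple_process ::
    "nat \<Rightarrow> (nat \<Rightarrow> real) \<Rightarrow> (nat \<Rightarrow> 'w \<Rightarrow> real ^ 'd) \<Rightarrow> real \<Rightarrow> 'w \<Rightarrow> real ^ 'd" where
  "simple_process m \<tau> \<eta> s \<omega> =
     (\<Sum>i<m. indicat_real {\<tau> i <.. \<tau> (Suc i)} s *\<^sub>R \<eta> i \<omega>)"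

definition simple_integral ::
    "(real \<Rightarrow> 'w \<Rightarrow> real ^ 'd) \<Rightarrow> nat \<Rightarrow> (nat \<Rightarrow> real) \<Rightarrow> (nat \<Rightarrow> 'w \<Rightarrow> real ^ 'd) \<Rightarrow>
     real \<Rightarrow> 'w \<Rightarrow> real" where
  "simple_integral W m \<tau> \<eta> t \<omega> =
     (\<Sum>i<m. \<eta> i \<omega> \<bullet> (W (min t (\<tau> (Suc i))) \<omega> - W (min t (\<tau> i)) \<omega>))"

text \<open>\<open>ito_integral M F W a b H I\<close>: the process \<open>I\<close> is a version with almost surely
  continuous paths of the stochastic integral of the row vector process \<open>H\<close> against \<open>W\<close>
  from \<open>a\<close> to \<open>t\<close>, for \<open>t \<in> {a..b}\<close>. By the Ito isometry the limit does not depend on the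
  approximating sequence, so \<open>I\<close> is determined up to indistinguishability on \<open>{a..b}\<close>.\<close>

definition ito_integral ::
    "'w measure \<Rightarrow> (real \<Rightarrow> 'w measure) \<Rightarrow> (real \<Rightarrow> 'w \<Rightarrow> real ^ 'd) \<Rightarrow> real \<Rightarrow> real \<Rightarrow>
     (real \<Rightarrow> 'w \<Rightarrow> real ^ 'd) \<Rightarrow> (real \<Rightarrow> 'w \<Rightarrow> real) \<Rightarrow> bool" where
  "ito_integral M F W a b H I \<longleftrightarrow>
     square_integrable_process M F a b H \<and>
     (\<forall>t\<in>{a..b}. I t \<in> borel_measurable M) \<and>
     (AE \<omega> in M. continuous_on {a..b} (\<lambda>t. I t \<omega>)) \<and>
     (\<exists>m \<tau> \<eta>.
        (\<forall>k. simple_integrand F a b (m k) (\<tau> k) (\<eta> k)) \<and>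
        (\<lambda>k. \<integral>\<^sup>+\<omega>. (\<integral>\<^sup>+s\<in>{a..b}.
            ennreal ((norm (simple_process (m k) (\<tau> k) (\<eta> k) s \<omega> - H s \<omega>))\<^sup>2)
            \<partial>lborel) \<partial>M) \<longlonglongrightarrow> 0 \<and>
        (\<forall>t\<in>{a..b}. (\<lambda>k. \<integral>\<^sup>+\<omega>.
            ennreal ((simple_integral W (m k) (\<tau> k) (\<eta> k) t \<omega> - I t \<omega>)\<^sup>2) \<partial>M) \<longlonglongrightarrow> 0))"

definition ito_integral_matrix ::
    "'w measure \<Rightarrow> (real \<Rightarrow> 'w measure) \<Rightarrow> (real \<Rightarrow> 'w \<Rightarrow> real ^ 'd) \<Rightarrow> real \<Rightarrow> real \<Rightarrow>
     (real \<Rightarrow> 'w \<Rightarrow> real ^ 'd ^ 'e) \<Rightarrow> (real \<Rightarrow> 'w \<Rightarrow> real ^ 'e) \<Rightarrow> bool" where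
  "ito_integral_matrix M F W a b H I \<longleftrightarrow>
     (\<forall>i. ito_integral M F W a b (\<lambda>s \<omega>. H s \<omega> $ i) (\<lambda>s \<omega>. I s \<omega> $ i))"

text \<open>\<open>Cb S k h\<close>: for every \<open>t \<in> S\<close> the function \<open>h t\<close> is k times continuously differentiable,
  and \<open>h\<close> together with all its partial derivatives in x up to order k is bounded, uniformly
  in \<open>t \<in> S\<close>.\<close>

primrec Cb :: "real set \<Rightarrow> nat \<Rightarrow> (real \<Rightarrow> real ^ 'd \<Rightarrow> 'b::real_normed_vector) \<Rightarrow> bool" where
  "Cb S 0 h \<longleftrightarrow>
     (\<exists>B. \<forall>t\<in>S. \<forall>x. norm (h t x) \<le> B) \<and> (\<forall>t\<in>S. continuous_on UNIV (h t))"
| "Cb S (Suc k) h \<longleftrightarrow>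
     (\<exists>B. \<forall>t\<in>S. \<forall>x. norm (h t x) \<le> B) \<and>
     (\<exists>D :: 'd \<Rightarrow> real \<Rightarrow> real ^ 'd \<Rightarrow> 'b.
        (\<forall>t\<in>S. \<forall>x. (h t has_derivative (\<lambda>v. \<Sum>i\<in>UNIV. (v $ i) *\<^sub>R D i t x)) (at x)) \<and>
        (\<forall>i. Cb S k (D i)))"

definition standing_assumptions ::
    "real \<Rightarrow> (real \<Rightarrow> real ^ 'd \<Rightarrow> real ^ 'd) \<Rightarrow> (real \<Rightarrow> real ^ 'd \<Rightarrow> real ^ 'd ^ 'd) \<Rightarrow>
     (real \<Rightarrow> real ^ 'd \<Rightarrow> real \<Rightarrow> real ^ 'd \<Rightarrow> real) \<Rightarrow> (real ^ 'd \<Rightarrow> real) \<Rightarrow> bool" where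
  "standing_assumptions T \<mu> \<sigma> f g \<longleftrightarrow>
     (\<forall>k. Cb {0..T} k \<mu>) \<and>
     (\<forall>k. Cb {0..T} k \<sigma>) \<and>
     (\<exists>L. \<forall>t\<in>{0..T}. \<forall>x x' y y' z z'.
        \<bar>f t x y z - f t x' y' z'\<bar> \<le> L * (norm (x - x') + \<bar>y - y'\<bar> + norm (z - z'))) \<and>
     (\<exists>L. \<forall>t\<in>{0..T}. \<forall>x y z. \<bar>f t x y z\<bar> \<le> L * (1 + norm x + \<bar>y\<bar> + norm z)) \<and>
     Cb UNIV 2 (\<lambda>_. g) \<and>
     (\<exists>K. \<forall>s\<in>{0..T}. \<forall>t\<in>{0..T}. \<forall>x. norm (\<mu> t x - \<mu> s x) \<le> K * sqrt \<bar>t - s\<bar>) \<and>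
     (\<exists>K. \<forall>s\<in>{0..T}. \<forall>t\<in>{0..T}. \<forall>x. norm (\<sigma> t x - \<sigma> s x) \<le> K * sqrt \<bar>t - s\<bar>) \<and>
     (\<exists>K. \<forall>s\<in>{0..T}. \<forall>t\<in>{0..T}. \<forall>x y z. \<bar>f t x y z - f s x y z\<bar> \<le> K * sqrt \<bar>t - s\<bar>) \<and>
     (\<exists>\<epsilon>\<^sub>0>0. \<forall>t\<in>{0..T}. \<forall>x v.
        v \<bullet> ((\<sigma> t x ** transpose (\<sigma> t x)) *v v) \<ge> v \<bullet> (\<epsilon>\<^sub>0 *\<^sub>R v))"

definition sde_solution ::
    "'w measure \<Rightarrow> (real \<Rightarrow> 'w measure) \<Rightarrow> (real \<Rightarrow> 'w \<Rightarrow> real ^ 'd) \<Rightarrow> real \<Rightarrow>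
     (real \<Rightarrow> real ^ 'd \<Rightarrow> real ^ 'd) \<Rightarrow> (real \<Rightarrow> real ^ 'd \<Rightarrow> real ^ 'd ^ 'd) \<Rightarrow>
     real \<Rightarrow> real \<Rightarrow> ('w \<Rightarrow> real ^ 'd) \<Rightarrow> (real \<Rightarrow> 'w \<Rightarrow> real ^ 'd) \<Rightarrow> bool" where
  "sde_solution M F W T \<mu> \<sigma> \<epsilon> a \<zeta> X \<longleftrightarrow>
     progressive F a T X \<and>
     (\<exists>I. ito_integral_matrix M F W a T (\<lambda>s \<omega>. \<epsilon> *\<^sub>R \<sigma> s (X s \<omega>)) I \<and>
        (AE \<omega> in M. \<forall>t\<in>{a..T}.
           X t \<omega> = \<zeta> \<omega> + (LBINT s:{a..t}. \<mu> s (X s \<omega>)) + I t \<omega>))"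

text \<open>Here \<open>I T - I t\<close> is the stochastic integral of \<open>Z\<close> over \<open>{t..T}\<close>.\<close>

definition fbsde_solution ::
    "'w measure \<Rightarrow> (real \<Rightarrow> 'w measure) \<Rightarrow> (real \<Rightarrow> 'w \<Rightarrow> real ^ 'd) \<Rightarrow> real \<Rightarrow>
     (real \<Rightarrow> real ^ 'd \<Rightarrow> real ^ 'd) \<Rightarrow> (real \<Rightarrow> real ^ 'd \<Rightarrow> real ^ 'd ^ 'd) \<Rightarrow>
     (real \<Rightarrow> real ^ 'd \<Rightarrow> real \<Rightarrow> real ^ 'd \<Rightarrow> real) \<Rightarrow> (real ^ 'd \<Rightarrow> real) \<Rightarrow>
     ('w \<Rightarrow> real ^ 'd) \<Rightarrow> real \<Rightarrow> real \<Rightarrow>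
     (real \<Rightarrow> 'w \<Rightarrow> real ^ 'd) \<Rightarrow> (real \<Rightarrow> 'w \<Rightarrow> real) \<Rightarrow> (real \<Rightarrow> 'w \<Rightarrow> real ^ 'd) \<Rightarrow> bool" where
  "fbsde_solution M F W T \<mu> \<sigma> f g \<xi> \<epsilon> \<alpha> X Y Z \<longleftrightarrow>
     sde_solution M F W T \<mu> \<sigma> \<epsilon> 0 \<xi> X \<and>
     square_integrable_process M F 0 T Y \<and>
     square_integrable_process M F 0 T Z \<and>
     (\<exists>I. ito_integral M F W 0 T Z I \<and>
        (AE \<omega> in M. \<forall>t\<in>{0..T}.
           Y t \<omega> = g (X T \<omega>) + (LBINT s:{t..T}. \<alpha> * f s (X s \<omega>) (Y s \<omega>) (Z s \<omega>))
                    - (I T \<omega> - I t \<omega>)))"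

definition unique_fbsde_solution ::
    "'w measure \<Rightarrow> (real \<Rightarrow> 'w measure) \<Rightarrow> (real \<Rightarrow> 'w \<Rightarrow> real ^ 'd) \<Rightarrow> real \<Rightarrow>
     (real \<Rightarrow> real ^ 'd \<Rightarrow> real ^ 'd) \<Rightarrow> (real \<Rightarrow> real ^ 'd \<Rightarrow> real ^ 'd ^ 'd) \<Rightarrow>
     (real \<Rightarrow> real ^ 'd \<Rightarrow> real \<Rightarrow> real ^ 'd \<Rightarrow> real) \<Rightarrow> (real ^ 'd \<Rightarrow> real) \<Rightarrow>
     ('w \<Rightarrow> real ^ 'd) \<Rightarrow> real \<Rightarrow> real \<Rightarrow>
     (real \<Rightarrow> 'w \<Rightarrow> real ^ 'd) \<Rightarrow> (real \<Rightarrow> 'w \<Rightarrow> real) \<Rightarrow> (real \<Rightarrow> 'w \<Rightarrow> real ^ 'd) \<Rightarrow> bool" where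
  "unique_fbsde_solution M F W T \<mu> \<sigma> f g \<xi> \<epsilon> \<alpha> X Y Z \<longleftrightarrow>
     fbsde_solution M F W T \<mu> \<sigma> f g \<xi> \<epsilon> \<alpha> X Y Z \<and>
     (\<forall>X' Y' Z'. fbsde_solution M F W T \<mu> \<sigma> f g \<xi> \<epsilon> \<alpha> X' Y' Z' \<longrightarrow>
        (AE \<omega> in M. \<forall>t\<in>{0..T}. X' t \<omega> = X t \<omega> \<and> Y' t \<omega> = Y t \<omega>) \<and>
        (AE (t, \<omega>) in restrict_space lborel {0..T} \<Otimes>\<^sub>M M. Z' t \<omega> = Z t \<omega>))"

definition gradient :: "(real ^ 'd \<Rightarrow> real) \<Rightarrow> real ^ 'd \<Rightarrow> real ^ 'd" where
  "gradient h x = (\<chi> i. frechet_derivative h (at x) (axis i 1))"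

definition hessian :: "(real ^ 'd \<Rightarrow> real) \<Rightarrow> real ^ 'd \<Rightarrow> real ^ 'd ^ 'd" where
  "hessian h x = (\<chi> i j. frechet_derivative (gradient h) (at x) (axis i 1) $ j)"

definition generator ::
    "(real \<Rightarrow> real ^ 'd \<Rightarrow> real ^ 'd) \<Rightarrow> (real \<Rightarrow> real ^ 'd \<Rightarrow> real ^ 'd ^ 'd) \<Rightarrow> real \<Rightarrow>
     real \<Rightarrow> (real ^ 'd \<Rightarrow> real) \<Rightarrow> real ^ 'd \<Rightarrow> real" where
  "generator \<mu> \<sigma> \<epsilon> t h x =
     (\<Sum>i\<in>UNIV. \<mu> t x $ i * gradient h x $ i) +
     1 / 2 * (\<Sum>i\<in>UNIV. \<Sum>j\<in>UNIV.
        ((\<epsilon> *\<^sub>R \<sigma> t x) ** transpose (\<epsilon> *\<^sub>R \<sigma> t x)) $ i $ j * hessian h x $ i $ j)"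

text \<open>At \<open>t = 0\<close> the time derivative is the one-sided one.\<close>

definition backward_pde_solution ::
    "real \<Rightarrow> (real \<Rightarrow> real ^ 'd \<Rightarrow> real ^ 'd) \<Rightarrow> (real \<Rightarrow> real ^ 'd \<Rightarrow> real ^ 'd ^ 'd) \<Rightarrow>
     (real ^ 'd \<Rightarrow> real) \<Rightarrow> real \<Rightarrow> (real \<Rightarrow> real ^ 'd \<Rightarrow> real) \<Rightarrow> bool" where
  "backward_pde_solution T \<mu> \<sigma> g \<epsilon> u \<longleftrightarrow>
     continuous_on ({0..T} \<times> UNIV) (\<lambda>(t, x). u t x) \<and>
     (\<forall>t\<in>{0..<T}. \<forall>x. u t differentiable (at x) \<and> gradient (u t) differentiable (at x)) \<and>
     continuous_on ({0..<T} \<times> UNIV) (\<lambda>(t, x). gradient (u t) x) \<and>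
     continuous_on ({0..<T} \<times> UNIV) (\<lambda>(t, x). hessian (u t) x) \<and>
     (\<exists>u'. continuous_on ({0..<T} \<times> UNIV) (\<lambda>(t, x). u' t x) \<and>
        (\<forall>t\<in>{0..<T}. \<forall>x.
           ((\<lambda>s. u s x) has_real_derivative u' t x) (at t within {0..T}) \<and>
           u' t x + generator \<mu> \<sigma> \<epsilon> t (u t) x = 0)) \<and>
     (\<forall>x. u T x = g x)"

text \<open>A classical solution of the backward equation need not be unique without a growth
  condition; the Feynman-Kac representation singles out the intended one.\<close>

definition linear_part ::
    "'w measure \<Rightarrow> (real \<Rightarrow> 'w measure) \<Rightarrow> (real \<Rightarrow> 'w \<Rightarrow> real ^ 'd) \<Rightarrow> real \<Rightarrow>
     (real \<Rightarrow> real ^ 'd \<Rightarrow> real ^ 'd) \<Rightarrow> (real \<Rightarrow> real ^ 'd \<Rightarrow> real ^ 'd ^ 'd) \<Rightarrow>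
     (real ^ 'd \<Rightarrow> real) \<Rightarrow> real \<Rightarrow> (real \<Rightarrow> real ^ 'd \<Rightarrow> real) \<Rightarrow> bool" where
  "linear_part M F W T \<mu> \<sigma> g \<epsilon> u \<longleftrightarrow>
     backward_pde_solution T \<mu> \<sigma> g \<epsilon> u \<and>
     (\<forall>t\<in>{0..T}. \<forall>x. \<exists>X. sde_solution M F W T \<mu> \<sigma> \<epsilon> t (\<lambda>_. x) X \<and>
        u t x = (\<integral>\<omega>. g (X T \<omega>) \<partial>M))"

definition linear_Z ::
    "(real \<Rightarrow> real ^ 'd \<Rightarrow> real ^ 'd ^ 'd) \<Rightarrow> real \<Rightarrow> (real \<Rightarrow> real ^ 'd \<Rightarrow> real) \<Rightarrow>
     real \<Rightarrow> real ^ 'd \<Rightarrow> real ^ 'd" where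
  "linear_Z \<sigma> \<epsilon> u t x = gradient (u t) x v* (\<epsilon> *\<^sub>R \<sigma> t x)"

definition grid_floor :: "real \<Rightarrow> nat \<Rightarrow> real \<Rightarrow> real" where
  "grid_floor T n s = Max {real k * T / real n | k. s \<ge> real k * T / real n}"

definition euler_maruyama ::
    "'w measure \<Rightarrow> (real \<Rightarrow> 'w measure) \<Rightarrow> (real \<Rightarrow> 'w \<Rightarrow> real ^ 'd) \<Rightarrow> real \<Rightarrow>
     (real \<Rightarrow> real ^ 'd \<Rightarrow> real ^ 'd) \<Rightarrow> (real \<Rightarrow> real ^ 'd \<Rightarrow> real ^ 'd ^ 'd) \<Rightarrow>
     ('w \<Rightarrow> real ^ 'd) \<Rightarrow> real \<Rightarrow> nat \<Rightarrow> (real \<Rightarrow> 'w \<Rightarrow> real ^ 'd) \<Rightarrow> bool" where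
  "euler_maruyama M F W T \<mu> \<sigma> \<xi> \<epsilon> n X \<longleftrightarrow>
     progressive F 0 T X \<and>
     (\<exists>I. ito_integral_matrix M F W 0 T
            (\<lambda>s \<omega>. \<epsilon> *\<^sub>R \<sigma> (grid_floor T n s) (X (grid_floor T n s) \<omega>)) I \<and>
        (AE \<omega> in M. \<forall>t\<in>{0..T}.
           X t \<omega> = \<xi> \<omega> +
             (LBINT s:{0..t}. \<mu> (grid_floor T n s) (X (grid_floor T n s) \<omega>)) + I t \<omega>))"

definition admissible ::
    "'w measure \<Rightarrow> (real \<Rightarrow> 'w measure) \<Rightarrow> real \<Rightarrow>
     ('w \<Rightarrow> real) \<Rightarrow> (real \<Rightarrow> 'w \<Rightarrow> real ^ 'd) \<Rightarrow> bool" where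
  "admissible M F T y\<^sub>0 Z \<longleftrightarrow>
     y\<^sub>0 \<in> borel_measurable (F 0) \<and> integrable M (\<lambda>\<omega>. (y\<^sub>0 \<omega>)\<^sup>2) \<and>
     square_integrable_process M F 0 T Z"

definition controlled_process ::
    "'w measure \<Rightarrow> (real \<Rightarrow> 'w measure) \<Rightarrow> (real \<Rightarrow> 'w \<Rightarrow> real ^ 'd) \<Rightarrow> real \<Rightarrow>
     (real \<Rightarrow> real ^ 'd \<Rightarrow> real ^ 'd ^ 'd) \<Rightarrow>
     (real \<Rightarrow> real ^ 'd \<Rightarrow> real \<Rightarrow> real ^ 'd \<Rightarrow> real) \<Rightarrow> real \<Rightarrow> real \<Rightarrow>
     (real \<Rightarrow> real ^ 'd \<Rightarrow> real) \<Rightarrow> (real \<Rightarrow> 'w \<Rightarrow> real ^ 'd) \<Rightarrow>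
     ('w \<Rightarrow> real) \<Rightarrow> (real \<Rightarrow> 'w \<Rightarrow> real ^ 'd) \<Rightarrow> (real \<Rightarrow> 'w \<Rightarrow> real) \<Rightarrow> bool" where
  "controlled_process M F W T \<sigma> f \<epsilon> \<alpha> u X y\<^sub>0 Z Y \<longleftrightarrow>
     progressive F 0 T Y \<and>
     (\<exists>I. ito_integral M F W 0 T Z I \<and>
        (AE \<omega> in M. \<forall>t\<in>{0..T}.
           Y t \<omega> = y\<^sub>0 \<omega>
             - (LBINT s:{0..t}. f s (X s \<omega>) (u s (X s \<omega>) + \<alpha> * Y s \<omega>)
                                  (linear_Z \<sigma> \<epsilon> u s (X s \<omega>) + \<alpha> *\<^sub>R Z s \<omega>))
             + I t \<omega>))"

end

theory Submission
  imports Defs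
begin

text \<open>
  Comparing several copies of the backward equation, driven by the same noise, with a polynomial
  penalty (doubling and quadrupling of variables) bounds the gradient of \<open>u\<close> and its Lipschitz
  constant uniformly in \<open>\<epsilon>\<close>. With these bounds a first order expansion of \<open>u\<close> along \<open>X\<close> has
  remainders of square norm \<open>O(h\<^sup>2)\<close> over steps of length \<open>h\<close>; since \<open>u(t, X t)\<close> is a martingale, remainders
  of different steps are orthogonal, so their sum vanishes in the limit and the increments of \<open>u(t, X t)\<close> are the
  stochastic integral of \<open>linear_Z\<close>.

  Consequently \<open>D = (Y - u(\<cdot>, X)) / \<alpha> - Y2\<close> and \<open>\<zeta> = (Z - linear_Z) / \<alpha> - Z2\<close> solve a backward equation with
  terminal value \<open>- Y2 T\<close> and a driver bounded by a multiple of \<open>|X - Xbar| + |D| + |\<zeta>|\<close>, where the factor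
  \<open>\<alpha> < 1\<close> has been cancelled. The isometry turns this into an energy estimate on short time intervals, whose
  length depends only on the Lipschitz constant of \<open>f\<close>; iterating it over \<open>[0, T]\<close> and inserting the
  \<open>O(1 / n)\<close> mean square error of the Euler scheme gives the claim.
\<close>

section \<open>Functions with bounded derivatives\<close>

text \<open>The constant must serve all \<epsilon> at once, while smoothing estimates based on
  nondegenerate noise deteriorate as \<epsilon> tends to 0. The derivative bounds of
  \<open>u\<close> are therefore carried over from \<open>g\<close>, and on the level of
  differences: copies that share the noise separate slowly because \<mu> and \<sigma> are Lipschitz.
  A bounded gradient alone is not enough, since \<open>linear_Z\<close> has to be compared at
  \<open>X\<close> and at \<open>Xbar\<close>; the Lipschitz constant of the gradient is a second
  difference of \<open>u\<close>, hence the four copies. Conditional expectations are replaced by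
  testing against \<open>F s\<close>-measurable variables: the martingale property means that the
  mean of \<open>G * u(t, X t)\<close> has arbitrarily small right slopes in time, and the energy
  estimate is Pythagoras for a variable known at time \<open>s\<close> and a stochastic integral
  after \<open>s\<close>. Nothing is given about the derivatives of \<open>u\<close> at time
  \<open>T\<close>, nor about integrability of the driver along the controlled process. The former
  is met by changing integrands on a null set, the latter by a pathwise Gronwall argument.\<close>

lemma Cb_bounded: "Cb S k h \<Longrightarrow> \<exists>B\<ge>0. \<forall>t\<in>S. \<forall>x. norm (h t x) \<le> B"
proof -
  assume "Cb S k h"
  then obtain B where B: "\<forall>t\<in>S. \<forall>x. norm (h t x) \<le> B" by (cases k) auto
  then have "\<forall>t\<in>S. \<forall>x. norm (h t x) \<le> max B 0" by (auto simp: le_max_iff_disj)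
  then show ?thesis by (intro exI[of _ "max B 0"]) auto
qed

lemma norm_sum_components_le:
  fixes v :: "real ^ 'd" and D :: "'d \<Rightarrow> 'b::real_normed_vector"
  assumes "\<And>i. norm (D i) \<le> B i"
  shows "norm (\<Sum>i\<in>UNIV. v $ i *\<^sub>R D i) \<le> (\<Sum>i\<in>UNIV. B i) * norm v"
proof -
  have "norm (\<Sum>i\<in>UNIV. v $ i *\<^sub>R D i) \<le> (\<Sum>i\<in>UNIV. norm v * B i)"
    by (rule sum_norm_le) (auto intro!: mult_mono component_le_norm_cart assms)
  then show ?thesis by (simp only: sum_distrib_right mult.commute[of "norm v"])
qed

lemma Cb_Suc_lipschitz:
  fixes h :: "real \<Rightarrow> real ^ 'd \<Rightarrow> 'b::real_normed_vector"
  assumes "Cb S (Suc k) h"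
  shows "\<exists>L\<ge>0. \<forall>t\<in>S. \<forall>x y. norm (h t x - h t y) \<le> L * norm (x - y)"
proof -
  obtain D where D: "\<forall>t\<in>S. \<forall>x. (h t has_derivative (\<lambda>v. \<Sum>i\<in>UNIV. (v $ i) *\<^sub>R D i t x)) (at x)"
    and CD: "\<forall>i. Cb S k (D i)" using assms by auto
  from CD Cb_bounded have "\<forall>i. \<exists>B\<ge>0. \<forall>t\<in>S. \<forall>x. norm (D i t x) \<le> B" by blast
  then obtain B where B: "\<And>i. B i \<ge> 0" "\<And>i t x. t \<in> S \<Longrightarrow> norm (D i t x) \<le> B i" by metis
  have "norm (h t x - h t y) \<le> (\<Sum>i\<in>UNIV. B i) * norm (x - y)" if t: "t \<in> S" for t x y
  proof (rule differentiable_bound[where S=UNIV and f'="\<lambda>x v. \<Sum>i\<in>UNIV. (v $ i) *\<^sub>R D i t x"])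
    fix x show "(h t has_derivative (\<lambda>v. \<Sum>i\<in>UNIV. (v $ i) *\<^sub>R D i t x)) (at x within UNIV)"
      using D t by simp
    show "onorm (\<lambda>v. \<Sum>i\<in>UNIV. v $ i *\<^sub>R D i t x) \<le> sum B UNIV"
      by (rule onorm_le) (rule norm_sum_components_le, rule B(2)[OF t])
  qed auto
  then show ?thesis by (intro exI[of _ "\<Sum>i\<in>UNIV. B i"]) (auto simp: sum_nonneg B)
qed

text \<open>For an exact parallelogram the mean value inequality applies to
  \<open>h t x - h t (x - a)\<close>, whose derivative is of size \<open>norm a\<close> because the
  first derivatives are Lipschitz; the missing closure \<open>x1 - x2 - x3 + x4\<close> is paid for
  by the Lipschitz bound of \<open>h\<close>. In this form second order regularity can be passed on
  to \<open>u\<close> without differentiating it.\<close>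

lemma Cb2_mixed_difference:
  fixes h :: "real \<Rightarrow> real ^ 'd \<Rightarrow> 'b::real_normed_vector"
  assumes "Cb S 2 h"
  shows "\<exists>L\<ge>0. \<forall>t\<in>S. \<forall>x1 x2 x3 x4. norm (h t x1 - h t x2 - h t x3 + h t x4)
           \<le> L * (norm (x1 - x2 - x3 + x4) + norm (x1 - x2) * norm (x1 - x3))"
proof -
  have C2: "Cb S (Suc (Suc 0)) h" using assms by (simp add: numeral_2_eq_2)
  obtain L where L: "L \<ge> 0" "\<And>t x y. t \<in> S \<Longrightarrow> norm (h t x - h t y) \<le> L * norm (x - y)"
    using Cb_Suc_lipschitz[OF C2] by blast
  obtain D where D: "\<forall>t\<in>S. \<forall>x. (h t has_derivative (\<lambda>v. \<Sum>i\<in>UNIV. (v $ i) *\<^sub>R D i t x)) (at x)"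
    and CD: "\<And>i. Cb S (Suc 0) (D i)" using C2 Cb.simps(2)[of S "Suc 0" h] by blast
  from Cb_Suc_lipschitz[OF CD] have "\<forall>i. \<exists>L\<ge>0. \<forall>t\<in>S. \<forall>x y. norm (D i t x - D i t y) \<le> L * norm (x - y)" by blast
  then obtain B where B: "\<And>i. B i \<ge> 0"
     "\<And>i t x y. t \<in> S \<Longrightarrow> norm (D i t x - D i t y) \<le> B i * norm (x - y)" by metis
  define B' where "B' = (\<Sum>i\<in>UNIV. B i)"
  have B'0: "B' \<ge> 0" unfolding B'_def by (simp add: sum_nonneg B)
  have main: "norm (h t x1 - h t x2 - h t x3 + h t x4)
           \<le> (L + B') * (norm (x1 - x2 - x3 + x4) + norm (x1 - x2) * norm (x1 - x3))"
    if t: "t \<in> S" for t x1 x2 x3 x4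
  proof -
    \<comment> \<open>With this shift \<open>x1 - a = x2\<close>, and \<open>x3 - a\<close> is the
      fourth vertex of the exact parallelogram, which \<open>x4\<close> misses by
      \<open>x1 - x2 - x3 + x4\<close>.\<close>
    define a where "a = x1 - x2"
    have der: "((\<lambda>x. h t x - h t (x - a)) has_derivative
        (\<lambda>v. \<Sum>i\<in>UNIV. v $ i *\<^sub>R (D i t x - D i t (x - a)))) (at x)" for x
    proof -
      have 1: "(h t has_derivative (\<lambda>v. \<Sum>i\<in>UNIV. (v $ i) *\<^sub>R D i t x)) (at x)" using D t by auto
      have 2: "((h t \<circ> (\<lambda>x. x - a)) has_derivative ((\<lambda>v. \<Sum>i\<in>UNIV. (v $ i) *\<^sub>R D i t (x - a)) \<circ> (\<lambda>v. v - 0))) (at x)"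
        by (rule diff_chain_at) (use D t in \<open>auto intro!: derivative_eq_intros\<close>)
      show ?thesis
        using has_derivative_diff[OF 1 2] by (simp add: o_def sum_subtractf[symmetric] scaleR_diff_right)
    qed
    have "norm ((h t x1 - h t (x1 - a)) - (h t x3 - h t (x3 - a))) \<le> (B' * norm a) * norm (x1 - x3)"
    proof (rule differentiable_bound[where S=UNIV and f'="\<lambda>x v. \<Sum>i\<in>UNIV. v $ i *\<^sub>R (D i t x - D i t (x - a))"])
      fix x
      have "norm (D i t x - D i t (x - a)) \<le> B i * norm a" for i using B(2)[OF t, of i x "x - a"] by simp
      then have "norm (\<Sum>i\<in>UNIV. v $ i *\<^sub>R (D i t x - D i t (x - a))) \<le> (\<Sum>i\<in>UNIV. B i * norm a) * norm v" for v
        by (rule norm_sum_components_le)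
      then show "onorm (\<lambda>v. \<Sum>i\<in>UNIV. v $ i *\<^sub>R (D i t x - D i t (x - a))) \<le> B' * norm a"
        by (intro onorm_le) (simp add: B'_def sum_distrib_right)
    qed (auto simp: der)
    moreover have "norm (h t x4 - h t (x3 - a)) \<le> L * norm (x1 - x2 - x3 + x4)"
      using L(2)[OF t, of x4 "x3 - a"] by (simp add: a_def algebra_simps)
    moreover have "h t x1 - h t x2 - h t x3 + h t x4 =
        ((h t x1 - h t (x1 - a)) - (h t x3 - h t (x3 - a))) + (h t x4 - h t (x3 - a))"
      by (simp add: a_def)
    ultimately have "norm (h t x1 - h t x2 - h t x3 + h t x4)
        \<le> (B' * norm a) * norm (x1 - x3) + L * norm (x1 - x2 - x3 + x4)"
      by (metis (no_types, lifting) add_mono norm_triangle_le)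
    also have "... \<le> (L + B') * (norm (x1 - x2 - x3 + x4) + norm (x1 - x2) * norm (x1 - x3))"
      using L(1) B'0 by (simp add: a_def algebra_simps)
    finally show ?thesis .
  qed
  show ?thesis using main L(1) B'0 by (intro exI[of _ "L + B'"]) auto
qed

section \<open>Second order expansions\<close>

text \<open>A Peano expansion at 0: \<open>q\<close> is half a second derivative, and nothing is
  asked of \<phi> away from 0. This is what a gradient differentiable at a single point provides,
  and it is enough for the conditions at a maximum.\<close>

definition expands2 :: "(real \<Rightarrow> real) \<Rightarrow> real \<Rightarrow> real \<Rightarrow> bool" where
  "expands2 \<phi> p q \<longleftrightarrow> ((\<lambda>s. (\<phi> s - \<phi> 0 - s * p - s\<^sup>2 * q) / s\<^sup>2) \<longlongrightarrow> 0) (at 0)"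

lemma expands2_add:
  assumes "expands2 \<phi> p q" "expands2 \<psi> p' q'"
  shows "expands2 (\<lambda>s. \<phi> s + \<psi> s) (p + p') (q + q')"
  using tendsto_add[OF assms[unfolded expands2_def]] unfolding expands2_def
  by (simp add: add_divide_distrib[symmetric] algebra_simps)

lemma expands2_cmult:
  assumes "expands2 \<phi> p q"
  shows "expands2 (\<lambda>s. c * \<phi> s) (c * p) (c * q)"
  using tendsto_mult_left[OF assms[unfolded expands2_def], of c] unfolding expands2_def
  by (simp add: algebra_simps)

lemma expands2_sum:
  assumes "\<And>i. i \<in> I \<Longrightarrow> expands2 (\<phi> i) (p i) (q i)"
  shows "expands2 (\<lambda>s. \<Sum>i\<in>I. \<phi> i s) (\<Sum>i\<in>I. p i) (\<Sum>i\<in>I. q i)"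
proof (cases "finite I")
  case True
  then show ?thesis using assms
    by (induction I) (auto intro!: expands2_add simp: expands2_def[of "\<lambda>_. 0"])
qed (simp add: expands2_def)

lemma expands2_poly:
  "expands2 (\<lambda>s. c0 + c1 * s + c2 * s\<^sup>2 + c3 * s ^ 3 + c4 * s ^ 4) c1 c2"
proof -
  have "((\<lambda>s. c3 * s + c4 * s\<^sup>2) \<longlongrightarrow> c3 * 0 + c4 * 0\<^sup>2) (at (0::real))" by (intro tendsto_intros)
  then show ?thesis unfolding expands2_def
    by (simp, elim Lim_transform_eventually)
      (auto simp: eventually_at field_simps power2_eq_square power3_eq_cube power4_eq_xxxx intro!: exI[of _ 1])
qed

text \<open>Multiplying the remainder by \<open>s\<close> shows that \<open>p\<close> is a
  derivative at an interior maximum; once \<open>p = 0\<close>, the nonpositive quotients of second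
  order tend to \<open>q\<close>.\<close>

lemma expands2_max:
  assumes e: "expands2 \<phi> p q" and m: "\<And>s. \<phi> s \<le> \<phi> 0"
  shows "p = 0" "q \<le> 0"
proof -
  have "((\<lambda>s. s * ((\<phi> s - \<phi> 0 - s * p - s\<^sup>2 * q) / s\<^sup>2) + p + s * q) \<longlongrightarrow> 0 * 0 + p + 0 * q) (at 0)"
    by (intro tendsto_intros e[unfolded expands2_def])
  then have "((\<lambda>s. (\<phi> s - \<phi> 0) / s) \<longlongrightarrow> p) (at 0)"
    by (simp, elim Lim_transform_eventually)
       (auto simp: eventually_at field_simps power2_eq_square intro!: exI[of _ 1])
  then have "DERIV \<phi> 0 :> p" by (simp add: DERIV_def)
  then show p: "p = 0" by (rule DERIV_local_max[of _ _ _ 1]) (auto simp: m)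
  have "((\<lambda>s. ((\<phi> s - \<phi> 0 - s * p - s\<^sup>2 * q) / s\<^sup>2) + q) \<longlongrightarrow> 0 + q) (at 0)"
    by (intro tendsto_intros e[unfolded expands2_def])
  then have "((\<lambda>s. (\<phi> s - \<phi> 0) / s\<^sup>2) \<longlongrightarrow> q) (at 0)"
    by (simp add: p, elim Lim_transform_eventually)
       (auto simp: eventually_at p field_simps power2_eq_square intro!: exI[of _ 1])
  then show "q \<le> 0"
    by (rule tendsto_upperbound) (auto simp: m divide_nonpos_nonneg intro!: always_eventually)
qed

lemma frechet_gradient:
  fixes f :: "real ^ 'd \<Rightarrow> real"
  assumes "f differentiable (at x)"
  shows "(f has_derivative (\<lambda>v. gradient f x \<bullet> v)) (at x)"
proof -
  have d: "(f has_derivative frechet_derivative f (at x)) (at x)"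
    using assms by (simp add: frechet_derivative_works)
  then have lin: "linear (frechet_derivative f (at x))" by (rule has_derivative_linear)
  have "frechet_derivative f (at x) v = gradient f x \<bullet> v" for v
  proof -
    have "frechet_derivative f (at x) v = frechet_derivative f (at x) (\<Sum>i\<in>UNIV. v $ i *s axis i 1)"
      by (simp add: basis_expansion)
    also have "... = (\<Sum>i\<in>UNIV. v $ i * frechet_derivative f (at x) (axis i 1))"
      by (simp add: linear_sum[OF lin] linear_cmul[OF lin] scalar_mult_eq_scaleR)
    finally show ?thesis by (simp add: gradient_def inner_vec_def mult.commute)
  qed
  then have "frechet_derivative f (at x) = (\<lambda>v. gradient f x \<bullet> v)" by auto
  with d show ?thesis by simp
qed

lemma frechet_hessian:
  fixes f :: "real ^ 'd \<Rightarrow> real"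
  assumes "gradient f differentiable (at x)"
  shows "(gradient f has_derivative (\<lambda>v. v v* hessian f x)) (at x)"
proof -
  have d: "(gradient f has_derivative frechet_derivative (gradient f) (at x)) (at x)"
    using assms by (simp add: frechet_derivative_works)
  then have lin: "linear (frechet_derivative (gradient f) (at x))" by (rule has_derivative_linear)
  have "frechet_derivative (gradient f) (at x) v = v v* hessian f x" for v
  proof -
    have "frechet_derivative (gradient f) (at x) v = frechet_derivative (gradient f) (at x) (\<Sum>i\<in>UNIV. v $ i *s axis i 1)"
      by (simp add: basis_expansion)
    also have "... = (\<Sum>i\<in>UNIV. v $ i *\<^sub>R frechet_derivative (gradient f) (at x) (axis i 1))"
      by (simp add: linear_sum[OF lin] linear_cmul[OF lin] scalar_mult_eq_scaleR)
    finally show ?thesis by (simp add: vec_eq_iff hessian_def vector_matrix_mult_def mult.commute)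
  qed
  then have "frechet_derivative (gradient f) (at x) = (\<lambda>v. v v* hessian f x)" by auto
  with d show ?thesis by simp
qed

lemma scaleR_vector_matrix: "(s *\<^sub>R v) v* A = s *\<^sub>R (v v* A)" for v :: "real ^ 'd"
  by (simp add: vec_eq_iff vector_matrix_mult_def sum_distrib_left algebra_simps)

lemma taylor2_peano:
  fixes f :: "real ^ 'd \<Rightarrow> real"
  assumes f: "\<And>y. f differentiable (at y)" and g: "gradient f differentiable (at x)" and e: "e > 0"
  shows "\<exists>\<delta>>0. \<forall>v. norm v < \<delta> \<longrightarrow>
    \<bar>f (x + v) - f x - gradient f x \<bullet> v - 1/2 * ((v v* hessian f x) \<bullet> v)\<bar> \<le> e * (norm v)\<^sup>2"
proof -
  let ?H = "\<lambda>v. v v* hessian f x"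
  obtain \<delta> where \<delta>: "\<delta> > 0" "\<And>y. norm (y - x) < \<delta> \<Longrightarrow>
     norm (gradient f y - gradient f x - ?H (y - x)) \<le> e * norm (y - x)"
    using frechet_hessian[OF g, unfolded has_derivative_at_alt] e by blast
  have "\<bar>f (x + v) - f x - gradient f x \<bullet> v - 1/2 * (?H v \<bullet> v)\<bar> \<le> e * (norm v)\<^sup>2" if v: "norm v < \<delta>" for v
  proof -
    \<comment> \<open>\<open>q\<close> is \<open>f\<close> on the segment minus the linear and
      quadratic terms of its model. Its derivative is the linearisation error of the gradient at
      \<open>x\<close>, paired with \<open>v\<close>, so the mean value inequality finishes the
      proof.\<close>
    define q where "q s = f (x + s *\<^sub>R v) - s * (gradient f x \<bullet> v) - 1/2 * s\<^sup>2 * (?H v \<bullet> v)" for s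
    have dq: "(q has_derivative (\<lambda>h. h * ((gradient f (x + s *\<^sub>R v) - gradient f x - ?H (s *\<^sub>R v)) \<bullet> v))) (at s)" for s
    proof -
      have "(f \<circ> (\<lambda>s. x + s *\<^sub>R v) has_derivative (\<lambda>w. gradient f (x + s *\<^sub>R v) \<bullet> w) \<circ> (\<lambda>h. h *\<^sub>R v)) (at s)"
        by (rule diff_chain_at) (auto intro!: derivative_eq_intros frechet_gradient f)
      then show ?thesis unfolding q_def o_def
        by (auto intro!: derivative_eq_intros simp: algebra_simps inner_diff_left inner_diff_right scaleR_vector_matrix)
    qed
    have "norm (q 1 - q 0) \<le> (e * (norm v)\<^sup>2) * norm (1 - 0 :: real)"
    proof (rule differentiable_bound[where S="{0..1}" and f'="\<lambda>s h. h * ((gradient f (x + s *\<^sub>R v) - gradient f x - ?H (s *\<^sub>R v)) \<bullet> v)"])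
      fix s :: real assume s: "s \<in> {0..1}"
      show "(q has_derivative (\<lambda>h. h * ((gradient f (x + s *\<^sub>R v) - gradient f x - ?H (s *\<^sub>R v)) \<bullet> v))) (at s within {0..1})"
        using dq has_derivative_at_withinI by blast
      let ?w = "gradient f (x + s *\<^sub>R v) - gradient f x - ?H (s *\<^sub>R v)"
      have sv: "norm (s *\<^sub>R v) \<le> norm v" using s by (simp add: mult_left_le_one_le)
      then have "norm ?w \<le> e * norm (s *\<^sub>R v)" using \<delta>(2)[of "x + s *\<^sub>R v"] v by auto
      also have "... \<le> e * norm v" using e sv by simp
      finally have "norm ?w \<le> e * norm v" .
      then have "\<bar>?w \<bullet> v\<bar> \<le> e * norm v * norm v"
        by (meson Cauchy_Schwarz_ineq2 mult_right_mono norm_ge_zero order_trans)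
      then have "\<bar>h * (?w \<bullet> v)\<bar> \<le> \<bar>h\<bar> * (e * norm v * norm v)" for h
        unfolding abs_mult by (rule mult_left_mono) simp
      then have "\<bar>h * (?w \<bullet> v)\<bar> \<le> e * (norm v)\<^sup>2 * norm h" for h
        by (simp add: power2_eq_square mult.commute mult.left_commute)
      then show "onorm (\<lambda>h. h * (?w \<bullet> v)) \<le> e * (norm v)\<^sup>2"
        by (intro onorm_le) simp
    qed auto
    then show ?thesis by (simp add: q_def algebra_simps)
  qed
  with \<delta>(1) show ?thesis by blast
qed

lemma expands2_line:
  fixes f :: "real ^ 'd \<Rightarrow> real"
  assumes f: "\<And>y. f differentiable (at y)" and g: "gradient f differentiable (at x)"
  shows "expands2 (\<lambda>s. f (x + s *\<^sub>R v)) (gradient f x \<bullet> v) (1/2 * ((v v* hessian f x) \<bullet> v))"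
  unfolding expands2_def
proof (rule LIM_I)
  fix r :: real assume r: "r > 0"
  define e where "e = r / (1 + (norm v)\<^sup>2)"
  have pos: "1 + (norm v)\<^sup>2 > 0" by (simp add: add_pos_nonneg)
  have e: "e > 0" "e * (norm v)\<^sup>2 < r" using r pos unfolding e_def by (auto simp: field_simps)
  obtain \<delta> where \<delta>: "\<delta> > 0" "\<And>v. norm v < \<delta> \<Longrightarrow>
    \<bar>f (x + v) - f x - gradient f x \<bullet> v - 1/2 * ((v v* hessian f x) \<bullet> v)\<bar> \<le> e * (norm v)\<^sup>2"
    using taylor2_peano[OF f g e(1)] by blast
  define s0 where "s0 = \<delta> / (1 + norm v)"
  have s0: "s0 > 0" unfolding s0_def using \<delta>(1) by (simp add: add_pos_nonneg)
  have "norm ((f (x + s *\<^sub>R v) - f (x + 0 *\<^sub>R v) - s * (gradient f x \<bullet> v) - s\<^sup>2 * (1 / 2 * ((v v* hessian f x) \<bullet> v))) / s\<^sup>2 - 0) < r"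
    if s: "s \<noteq> 0 \<and> norm (s - 0) < s0" for s
  proof -
    have "\<bar>s\<bar> * norm v \<le> \<bar>s\<bar> * (1 + norm v)" by (simp add: mult_left_mono)
    also have "... < \<delta>" using s by (simp add: s0_def field_simps add_pos_nonneg)
    finally have "norm (s *\<^sub>R v) < \<delta>" by simp
    from \<delta>(2)[OF this] have "\<bar>f (x + s *\<^sub>R v) - f x - s * (gradient f x \<bullet> v) - s\<^sup>2 * (1/2 * ((v v* hessian f x) \<bullet> v))\<bar> \<le> (e * (norm v)\<^sup>2) * s\<^sup>2"
      by (simp add: scaleR_vector_matrix power2_eq_square algebra_simps)
    also have "... < r * s\<^sup>2" using e(2) s by simp
    finally show ?thesis using s by (simp add: abs_divide field_simps)
  qed
  then show "\<exists>s>0. \<forall>xa. xa \<noteq> 0 \<and> norm (xa - 0) < s \<longrightarrow>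
    norm ((f (x + xa *\<^sub>R v) - f (x + 0 *\<^sub>R v) - xa * (gradient f x \<bullet> v) - xa\<^sup>2 * (1 / 2 * ((v v* hessian f x) \<bullet> v))) / xa\<^sup>2 - 0) < r"
    using s0 by blast
qed

section \<open>A comparison principle for the backward equation\<close>

text \<open>With second derivatives taken only in the directions of the columns, the generator of
  several copies driven by the same noise is a sum of expansions along single lines: the line for
  noise component \<open>k\<close> moves every copy along its own column \<open>k\<close>.\<close>

lemma generator_columns:
  fixes \<mu> :: "real \<Rightarrow> real ^ 'd \<Rightarrow> real ^ 'd"
  shows "generator \<mu> \<sigma> \<epsilon> t h x = gradient h x \<bullet> \<mu> t x +
    \<epsilon>\<^sup>2 * (\<Sum>k\<in>UNIV. 1/2 * ((column k (\<sigma> t x) v* hessian h x) \<bullet> column k (\<sigma> t x)))"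
proof -
  have "(\<Sum>i\<in>UNIV. \<Sum>j\<in>UNIV. ((\<epsilon> *\<^sub>R \<sigma> t x) ** transpose (\<epsilon> *\<^sub>R \<sigma> t x)) $ i $ j * hessian h x $ i $ j)
    = (\<Sum>i\<in>UNIV. \<Sum>j\<in>UNIV. \<Sum>k\<in>UNIV. \<epsilon>\<^sup>2 * (\<sigma> t x $ i $ k * \<sigma> t x $ j $ k * hessian h x $ i $ j))"
    by (simp add: matrix_matrix_mult_def transpose_def sum_distrib_left sum_distrib_right power2_eq_square algebra_simps)
  also have "... = (\<Sum>i\<in>UNIV. \<Sum>k\<in>UNIV. \<Sum>j\<in>UNIV. \<epsilon>\<^sup>2 * (\<sigma> t x $ i $ k * \<sigma> t x $ j $ k * hessian h x $ i $ j))"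
    by (intro sum.cong refl sum.swap)
  also have "... = (\<Sum>k\<in>UNIV. \<Sum>i\<in>UNIV. \<Sum>j\<in>UNIV. \<epsilon>\<^sup>2 * (\<sigma> t x $ i $ k * \<sigma> t x $ j $ k * hessian h x $ i $ j))"
    by (rule sum.swap)
  also have "... = (\<Sum>k\<in>UNIV. \<Sum>j\<in>UNIV. \<Sum>i\<in>UNIV. \<epsilon>\<^sup>2 * (\<sigma> t x $ i $ k * \<sigma> t x $ j $ k * hessian h x $ i $ j))"
    by (intro sum.cong refl sum.swap)
  also have "... = (\<Sum>k\<in>UNIV. \<epsilon>\<^sup>2 * ((column k (\<sigma> t x) v* hessian h x) \<bullet> column k (\<sigma> t x)))"
    by (simp add: inner_vec_def vector_matrix_mult_def column_def sum_distrib_left sum_distrib_right algebra_simps)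
  finally show ?thesis
    unfolding generator_def by (simp add: inner_vec_def sum_distrib_left mult.commute)
qed

lemma norm_vec_le:
  fixes v :: "'b::real_normed_vector ^ 'i"
  assumes "\<And>i. norm (v $ i) \<le> B"
  shows "norm v \<le> real CARD('i) * B"
proof -
  have "norm v \<le> (\<Sum>i\<in>UNIV. norm (v $ i))" unfolding norm_vec_def by (rule L2_set_le_sum) auto
  also have "... \<le> (\<Sum>i\<in>(UNIV::'i set). B)" by (intro sum_mono assms)
  finally show ?thesis by simp
qed

lemma power2_norm_line:
  "(norm (a + s *\<^sub>R b))\<^sup>2 = (norm a)\<^sup>2 + (2 * (a \<bullet> b)) * s + (norm b)\<^sup>2 * s\<^sup>2"
  for a b :: "'b::real_inner"
  by (simp only: power2_norm_eq_inner)
    (simp add: inner_add_left inner_add_right inner_commute algebra_simps power2_eq_square)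

text \<open>\<open>gen\<close> makes \<open>Q\<close>, up to the rate \<open>K\<close>, a
  supersolution for the system in which each point of \<open>P\<close> follows its own drift and all
  share the noise, and \<open>tcond\<close> orders the terminal values. The weighted sum of copies
  of \<open>u\<close> solves the equation of that system, so a positive maximum of the difference
  contradicts the expansions of both sides in the drift and column directions. The term with \<eta>
  in the proof forces the maximum to be attained and is removed at the end.\<close>

lemma comparison:
  fixes u :: "real \<Rightarrow> real ^ 'd \<Rightarrow> real" and c :: "'i::finite \<Rightarrow> real" and Q :: "real ^ 'd ^ 'i \<Rightarrow> real"
  assumes pde: "backward_pde_solution T \<mu> \<sigma> g \<epsilon> u"
    and eps: "\<epsilon> \<in> {0<..<1}"
    and uB: "\<And>t x. t \<in> {0..T} \<Longrightarrow> \<bar>u t x\<bar> \<le> B"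
    and muB: "\<And>t x. t \<in> {0..T} \<Longrightarrow> norm (\<mu> t x) \<le> B1"
    and sigB: "\<And>t x k. t \<in> {0..T} \<Longrightarrow> norm (column k (\<sigma> t x)) \<le> B1"
    and Qcont: "continuous_on UNIV Q" and Q0: "\<And>P. Q P \<ge> 0"
    and tcond: "\<And>P. (\<Sum>i\<in>UNIV. c i * g (P $ i)) \<le> Q P"
    and qexp: "\<And>P v. expands2 (\<lambda>s. Q (P + s *\<^sub>R v)) (q1 P v) (q2 P v)"
    and gen: "\<And>t P. t \<in> {0..<T} \<Longrightarrow> q1 P (\<chi> i. \<mu> t (P $ i)) +
        \<epsilon>\<^sup>2 * (\<Sum>k\<in>UNIV. q2 P (\<chi> i. column k (\<sigma> t (P $ i)))) \<le> K * Q P"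
    and t: "t \<in> {0..T}"
    and n: "n = (real CARD('i) * B1)\<^sup>2"
  shows "(\<Sum>i\<in>UNIV. c i * u t (P $ i)) \<le> exp ((max K (1 + n + real CARD('d) * n) + 1) * (T - t)) * Q P"
proof -
  \<comment> \<open>The second entry is the rate for \<open>1 + (norm P)\<^sup>2\<close>, which the
    generator of the coupled system maps to at most
    \<open>(norm P)\<^sup>2 + n + real CARD('d) * n\<close>.\<close>
  define K1 where "K1 = max K (1 + n + real CARD('d) * n)"
  define w where "w t P = (\<Sum>i\<in>UNIV. c i * u t (P $ i))" for t and P :: "real ^ 'd ^ 'i"
  have n0: "n \<ge> 0" using n by simp
  have cu: "continuous_on ({0..T} \<times> UNIV) (\<lambda>(t, x). u t x)"
    and du: "\<And>t x. t \<in> {0..<T} \<Longrightarrow> u t differentiable (at x)"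
    and dg: "\<And>t x. t \<in> {0..<T} \<Longrightarrow> gradient (u t) differentiable (at x)"
    and uT: "\<And>x. u T x = g x"
    using pde unfolding backward_pde_solution_def by auto
  obtain u' where u': "\<And>t x. t \<in> {0..<T} \<Longrightarrow> ((\<lambda>s. u s x) has_real_derivative u' t x) (at t within {0..T})"
    "\<And>t x. t \<in> {0..<T} \<Longrightarrow> u' t x + generator \<mu> \<sigma> \<epsilon> t (u t) x = 0"
    using pde unfolding backward_pde_solution_def by blast
  have pen: "w t P \<le> exp ((K1 + 1) * (T - t)) * (Q P + \<eta> * (1 + (norm P)\<^sup>2))"
    if eta: "\<eta> > 0" and tt: "t \<in> {0..T}" for \<eta> t P
  proof (rule ccontr)
    define R where "R P = Q P + \<eta> * (1 + (norm P)\<^sup>2)" for P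
    have Rpos: "R P > 0" for P
      using Q0[of P] mult_pos_pos[OF eta, of "1 + (norm P)\<^sup>2"] unfolding R_def
      by (smt (verit) zero_le_power2)
    define \<Psi> where "\<Psi> = (\<lambda>(t, P). w t P - exp ((K1 + 1) * (T - t)) * R P)"
    assume "\<not> ?thesis"
    then have pos0: "\<Psi> (t, P) > 0" by (simp add: \<Psi>_def R_def)
    define C where "C = (\<Sum>i\<in>UNIV. \<bar>c i\<bar> * B)"
    have wC: "w s P' \<le> C" if "s \<in> {0..T}" for s P'
      unfolding w_def C_def using uB[OF that]
      by (intro sum_mono) (metis abs_ge_self abs_mult abs_ge_zero mult_left_mono order_trans)
    have K10: "K1 \<ge> 0" unfolding K1_def using n0 by (simp add: le_max_iff_disj)
    have \<Psi>C: "\<Psi> (s, P') \<le> C - \<eta> * (norm P')\<^sup>2" if s: "s \<in> {0..T}" for s P'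
    proof -
      have "1 \<le> exp ((K1 + 1) * (T - s))" using K10 s by simp
      then have "R P' \<le> exp ((K1 + 1) * (T - s)) * R P'" using Rpos[of P'] by simp
      moreover have "\<eta> * (norm P')\<^sup>2 \<le> R P'" unfolding R_def using Q0[of P'] eta by (simp add: algebra_simps)
      ultimately show ?thesis using wC[OF s, of P'] unfolding \<Psi>_def by simp
    qed
    \<comment> \<open>\<open>w\<close> is bounded by \<open>C\<close> and the penalty grows
      quadratically, so \<Psi> is positive only within this radius and its maximum over the compact
      set is global.\<close>
    define r where "r = sqrt (\<bar>C\<bar> / \<eta>)"
    have out: "norm P' \<le> r" if s: "s \<in> {0..T}" and p: "\<Psi> (s, P') > 0" for s P'
    proof -
      have "\<eta> * (norm P')\<^sup>2 \<le> \<bar>C\<bar>" using \<Psi>C[OF s, of P'] p by linarith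
      then have "(norm P')\<^sup>2 \<le> \<bar>C\<bar> / \<eta>" using eta by (simp add: field_simps)
      then show ?thesis unfolding r_def by (rule real_le_rsqrt)
    qed
    have contw: "continuous_on ({0..T} \<times> UNIV) (\<lambda>z. w (fst z) (snd z))"
    proof -
      have "continuous_on ({0..T} \<times> UNIV) ((\<lambda>(t, x). u t x) \<circ> (\<lambda>z. (fst z, snd z $ i)))" for i :: 'i
        by (rule continuous_on_compose) (auto intro!: continuous_intros continuous_on_subset[OF cu])
      then show ?thesis unfolding w_def by (auto intro!: continuous_intros simp: o_def)
    qed
    have contR: "continuous_on UNIV R" unfolding R_def by (intro continuous_intros Qcont)
    have "continuous_on ({0..T} \<times> UNIV) (R \<circ> snd)"
      by (rule continuous_on_compose) (auto intro!: continuous_intros continuous_on_subset[OF contR])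
    then have cont\<Psi>: "continuous_on ({0..T} \<times> UNIV) \<Psi>"
      unfolding \<Psi>_def case_prod_beta by (intro continuous_intros contw) (simp add: o_def)
    have "compact ({0..T} \<times> cball (0 :: real ^ 'd ^ 'i) r)" by (intro compact_Times) auto
    moreover have "{0..T} \<times> cball (0 :: real ^ 'd ^ 'i) r \<noteq> {}"
      using tt out[OF tt pos0] norm_ge_zero[of P] by (auto simp: dist_norm simp del: norm_ge_zero)
    moreover have "continuous_on ({0..T} \<times> cball 0 r) \<Psi>"
      by (rule continuous_on_subset[OF cont\<Psi>]) auto
    ultimately obtain z where z: "z \<in> {0..T} \<times> cball 0 r" "\<forall>y\<in>{0..T} \<times> cball 0 r. \<Psi> y \<le> \<Psi> z"
      using continuous_attains_sup by blast
    obtain \<tau> P\<^sub>0 where z_eq: "z = (\<tau>, P\<^sub>0)" by fastforce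
    have \<tau>: "\<tau> \<in> {0..T}" using z z_eq by auto
    have "\<Psi> (t, P) \<le> \<Psi> z" using z(2) tt out[OF tt pos0] by auto
    then have zpos: "\<Psi> (\<tau>, P\<^sub>0) > 0" using pos0 z_eq by simp
    have max: "\<Psi> (s, P') \<le> \<Psi> (\<tau>, P\<^sub>0)" if "s \<in> {0..T}" for s P'
      using z(2) z_eq that out[OF that, of P'] zpos by (cases "\<Psi> (s, P') > 0") (auto simp: not_less)
    have "\<tau> \<noteq> T"
    proof
      assume "\<tau> = T"
      then have "\<Psi> (\<tau>, P\<^sub>0) \<le> Q P\<^sub>0 - R P\<^sub>0"
        using tcond[of P\<^sub>0] by (simp add: \<Psi>_def w_def uT)
      also have "... \<le> 0" using eta by (simp add: R_def)
      finally show False using zpos by simp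
    qed
    then have \<tau>': "\<tau> \<in> {0..<T}" using \<tau> by auto
    define E where "E = exp ((K1 + 1) * (T - \<tau>))"
    have E0: "E > 0" by (simp add: E_def)
    have exp\<Psi>: "expands2 (\<lambda>s. \<Psi> (\<tau>, P\<^sub>0 + s *\<^sub>R v))
        ((\<Sum>i\<in>UNIV. c i * (gradient (u \<tau>) (P\<^sub>0 $ i) \<bullet> v $ i)) + (- E) * (q1 P\<^sub>0 v + \<eta> * (2 * (P\<^sub>0 \<bullet> v))))
        ((\<Sum>i\<in>UNIV. c i * (1/2 * ((v $ i v* hessian (u \<tau>) (P\<^sub>0 $ i)) \<bullet> v $ i))) + (- E) * (q2 P\<^sub>0 v + \<eta> * (norm v)\<^sup>2))" for v
    proof -
      have "expands2 (\<lambda>s. \<Sum>i\<in>UNIV. c i * u \<tau> (P\<^sub>0 $ i + s *\<^sub>R v $ i))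
        (\<Sum>i\<in>UNIV. c i * (gradient (u \<tau>) (P\<^sub>0 $ i) \<bullet> v $ i))
        (\<Sum>i\<in>UNIV. c i * (1/2 * ((v $ i v* hessian (u \<tau>) (P\<^sub>0 $ i)) \<bullet> v $ i)))"
        by (intro expands2_sum expands2_cmult expands2_line du dg \<tau>')
      moreover have "expands2 (\<lambda>s. 1 + (norm (P\<^sub>0 + s *\<^sub>R v))\<^sup>2) (2 * (P\<^sub>0 \<bullet> v)) ((norm v)\<^sup>2)"
        using expands2_poly[of "1 + (norm P\<^sub>0)\<^sup>2" "2 * (P\<^sub>0 \<bullet> v)" "(norm v)\<^sup>2" 0 0]
        by (simp add: power2_norm_line add.assoc)
      then have "expands2 (\<lambda>s. Q (P\<^sub>0 + s *\<^sub>R v) + \<eta> * (1 + (norm (P\<^sub>0 + s *\<^sub>R v))\<^sup>2)) (q1 P\<^sub>0 v + \<eta> * (2 * (P\<^sub>0 \<bullet> v))) (q2 P\<^sub>0 v + \<eta> * (norm v)\<^sup>2)"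
        by (intro expands2_add expands2_cmult qexp)
      ultimately have "expands2 (\<lambda>s. (\<Sum>i\<in>UNIV. c i * u \<tau> (P\<^sub>0 $ i + s *\<^sub>R v $ i)) + (- E) * (Q (P\<^sub>0 + s *\<^sub>R v) + \<eta> * (1 + (norm (P\<^sub>0 + s *\<^sub>R v))\<^sup>2)))
         ((\<Sum>i\<in>UNIV. c i * (gradient (u \<tau>) (P\<^sub>0 $ i) \<bullet> v $ i)) + (- E) * (q1 P\<^sub>0 v + \<eta> * (2 * (P\<^sub>0 \<bullet> v))))
        ((\<Sum>i\<in>UNIV. c i * (1/2 * ((v $ i v* hessian (u \<tau>) (P\<^sub>0 $ i)) \<bullet> v $ i))) + (- E) * (q2 P\<^sub>0 v + \<eta> * (norm v)\<^sup>2))"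
        by (rule expands2_add[OF _ expands2_cmult])
      then show ?thesis by (simp add: \<Psi>_def w_def R_def E_def)
    qed
    have first: "(\<Sum>i\<in>UNIV. c i * (gradient (u \<tau>) (P\<^sub>0 $ i) \<bullet> v $ i)) = E * (q1 P\<^sub>0 v + \<eta> * (2 * (P\<^sub>0 \<bullet> v)))" for v
      using expands2_max(1)[OF exp\<Psi>[of v]] max[OF \<tau>] by simp
    have second: "(\<Sum>i\<in>UNIV. c i * (1/2 * ((v $ i v* hessian (u \<tau>) (P\<^sub>0 $ i)) \<bullet> v $ i))) \<le> E * (q2 P\<^sub>0 v + \<eta> * (norm v)\<^sup>2)" for v
      using expands2_max(2)[OF exp\<Psi>[of v]] max[OF \<tau>] by simp
    define m :: "real ^ 'd ^ 'i" where "m = (\<chi> i. \<mu> \<tau> (P\<^sub>0 $ i))"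
    define s :: "'d \<Rightarrow> real ^ 'd ^ 'i" where "s k = (\<chi> i. column k (\<sigma> \<tau> (P\<^sub>0 $ i)))" for k
    have nm: "(norm m)\<^sup>2 \<le> n" "\<And>k. (norm (s k))\<^sup>2 \<le> n"
      unfolding n m_def s_def using \<tau> by (auto intro!: power_mono norm_vec_le muB sigB)
    have "- (\<Sum>i\<in>UNIV. c i * u' \<tau> (P\<^sub>0 $ i)) = (\<Sum>i\<in>UNIV. c i * generator \<mu> \<sigma> \<epsilon> \<tau> (u \<tau>) (P\<^sub>0 $ i))"
      using u'(2)[OF \<tau>'] by (simp add: sum_negf[symmetric] add_eq_0_iff)
    also have "... = (\<Sum>i\<in>UNIV. c i * (gradient (u \<tau>) (P\<^sub>0 $ i) \<bullet> m $ i)) +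
        \<epsilon>\<^sup>2 * (\<Sum>k\<in>UNIV. \<Sum>i\<in>UNIV. c i * (1/2 * ((s k $ i v* hessian (u \<tau>) (P\<^sub>0 $ i)) \<bullet> s k $ i)))"
      unfolding generator_columns m_def s_def
      by (subst sum.swap) (simp add: sum.distrib sum_distrib_left algebra_simps)
    also have "... \<le> E * (q1 P\<^sub>0 m + \<eta> * (2 * (P\<^sub>0 \<bullet> m))) + \<epsilon>\<^sup>2 * (\<Sum>k\<in>UNIV. E * (q2 P\<^sub>0 (s k) + \<eta> * (norm (s k))\<^sup>2))"
      unfolding first by (intro add_left_mono mult_left_mono sum_mono second) auto
    also have "... = E * (q1 P\<^sub>0 m + \<epsilon>\<^sup>2 * (\<Sum>k\<in>UNIV. q2 P\<^sub>0 (s k))) + E * \<eta> * (2 * (P\<^sub>0 \<bullet> m) + \<epsilon>\<^sup>2 * (\<Sum>k\<in>UNIV. (norm (s k))\<^sup>2))"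
      by (simp add: sum.distrib sum_distrib_left algebra_simps)
    also have "... \<le> E * (K1 * Q P\<^sub>0) + E * \<eta> * (K1 * (1 + (norm P\<^sub>0)\<^sup>2))"
    proof (intro add_mono mult_left_mono)
      have "K * Q P\<^sub>0 \<le> K1 * Q P\<^sub>0" unfolding K1_def by (intro mult_right_mono Q0) simp
      then show "q1 P\<^sub>0 m + \<epsilon>\<^sup>2 * (\<Sum>k\<in>UNIV. q2 P\<^sub>0 (s k)) \<le> K1 * Q P\<^sub>0"
        using gen[OF \<tau>', of P\<^sub>0] unfolding m_def s_def by linarith
      have "2 * (P\<^sub>0 \<bullet> m) \<le> (norm P\<^sub>0)\<^sup>2 + (norm m)\<^sup>2"
        using Cauchy_Schwarz_ineq2[of P\<^sub>0 m] sum_squares_bound[of "norm P\<^sub>0" "norm m"] by linarith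
      moreover have "\<epsilon>\<^sup>2 * (\<Sum>k\<in>UNIV. (norm (s k))\<^sup>2) \<le> 1 * (real CARD('d) * n)"
      proof (intro mult_mono)
        show "\<epsilon>\<^sup>2 \<le> 1" using eps by (simp add: power_le_one)
        show "(\<Sum>k\<in>UNIV. (norm (s k))\<^sup>2) \<le> real CARD('d) * n"
          using sum_mono[of UNIV "\<lambda>k. (norm (s k))\<^sup>2" "\<lambda>_. n"] nm(2) by simp
      qed (auto simp: sum_nonneg)
      moreover have "(1 + n + real CARD('d) * n) * 1 \<le> (1 + n + real CARD('d) * n) * (1 + (norm P\<^sub>0)\<^sup>2)"
        using n0 by (intro mult_left_mono) auto
      moreover have "(norm P\<^sub>0)\<^sup>2 + n + real CARD('d) * n \<le> (1 + n + real CARD('d) * n) * (1 + (norm P\<^sub>0)\<^sup>2)"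
      proof -
        have "0 \<le> (n + real CARD('d) * n) * (norm P\<^sub>0)\<^sup>2" using n0 by simp
        then show ?thesis by (simp add: algebra_simps)
      qed
      moreover have "(1 + n + real CARD('d) * n) * (1 + (norm P\<^sub>0)\<^sup>2) \<le> K1 * (1 + (norm P\<^sub>0)\<^sup>2)"
        unfolding K1_def by (intro mult_right_mono) auto
      ultimately show "2 * (P\<^sub>0 \<bullet> m) + \<epsilon>\<^sup>2 * (\<Sum>k\<in>UNIV. (norm (s k))\<^sup>2) \<le> K1 * (1 + (norm P\<^sub>0)\<^sup>2)"
        using nm(1) by linarith
    qed (use E0 eta in auto)
    also have "... = K1 * (E * R P\<^sub>0)" by (simp add: R_def algebra_simps)
    finally have upper: "- (\<Sum>i\<in>UNIV. c i * u' \<tau> (P\<^sub>0 $ i)) \<le> K1 * (E * R P\<^sub>0)" .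
    \<comment> \<open>The spatial conditions let \<open>w\<close> decrease by at most
      \<open>K1 * (E * R P\<^sub>0)\<close>, while the exponential weight decreases at rate
      \<open>K1 + 1\<close>; hence \<Psi> would still increase to the right of its maximum. The step
      goes to the right because \<tau> may be 0.\<close>
    have der: "((\<lambda>s. \<Psi> (s, P\<^sub>0)) has_real_derivative
        (\<Sum>i\<in>UNIV. c i * u' \<tau> (P\<^sub>0 $ i)) + (K1 + 1) * (E * R P\<^sub>0)) (at \<tau> within {0..T})"
      unfolding \<Psi>_def w_def E_def
      by (auto intro!: derivative_eq_intros u'(1)[OF \<tau>'] simp: algebra_simps)
    have "(\<Sum>i\<in>UNIV. c i * u' \<tau> (P\<^sub>0 $ i)) + (K1 + 1) * (E * R P\<^sub>0) > 0"
      using upper mult_pos_pos[OF E0 Rpos[of P\<^sub>0]] by (simp add: algebra_simps)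
    from has_real_derivative_pos_inc_right[OF der this] obtain d where d: "d > 0"
      "\<And>h. 0 < h \<Longrightarrow> \<tau> + h \<in> {0..T} \<Longrightarrow> h < d \<Longrightarrow> \<Psi> (\<tau>, P\<^sub>0) < \<Psi> (\<tau> + h, P\<^sub>0)" by blast
    define h where "h = min (d / 2) (T - \<tau>)"
    have "0 < h" "\<tau> + h \<in> {0..T}" "h < d" using d(1) \<tau>' by (auto simp: h_def)
    then show False using d(2)[of h] max[of "\<tau> + h" P\<^sub>0] by fastforce
  qed
  have "((\<lambda>\<eta>. exp ((K1 + 1) * (T - t)) * (Q P + \<eta> * (1 + (norm P)\<^sup>2)))
      \<longlongrightarrow> exp ((K1 + 1) * (T - t)) * (Q P + 0 * (1 + (norm P)\<^sup>2))) (at_right 0)"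
    by (intro tendsto_intros)
  then have "w t P \<le> exp ((K1 + 1) * (T - t)) * (Q P + 0 * (1 + (norm P)\<^sup>2))"
    by (rule tendsto_lowerbound) (auto simp: eventually_at intro!: exI[of _ 1] pen t)
  then show ?thesis by (simp add: w_def K1_def)
qed

section \<open>Uniform derivative bounds for the linear part\<close>

lemma norm_column_le: "norm (column k A) \<le> norm A" for A :: "real ^ 'n ^ 'm"
  unfolding norm_vec_def[of "column k A"] norm_vec_def[of A]
  by (rule L2_set_mono) (auto simp: column_def intro: component_le_norm_cart)

lemma column_diff: "column k (A - B) = column k A - column k B" for A :: "real ^ 'n ^ 'm"
  by (simp add: column_def vec_eq_iff)

lemma column_add: "column k (A + B) = column k A + column k B" for A :: "real ^ 'n ^ 'm"
  by (simp add: column_def vec_eq_iff)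

text \<open>One constant \<open>L\<close> for all bounds. The mixed differences stand for bounded
  second derivatives in x: this is the form in which coupled copies reproduce them.\<close>

locale regular_coefficients =
  fixes T :: real and \<mu> :: "real \<Rightarrow> real ^ 'd \<Rightarrow> real ^ 'd" and \<sigma> :: "real \<Rightarrow> real ^ 'd \<Rightarrow> real ^ 'd ^ 'd"
    and g :: "real ^ 'd \<Rightarrow> real" and L :: real
  assumes L0: "L \<ge> 0"
    and mu_bound: "\<And>t x. t \<in> {0..T} \<Longrightarrow> norm (\<mu> t x) \<le> L"
    and sigma_bound: "\<And>t x. t \<in> {0..T} \<Longrightarrow> norm (\<sigma> t x) \<le> L"
    and g_bound: "\<And>x. \<bar>g x\<bar> \<le> L"
    and mu_lip: "\<And>t x y. t \<in> {0..T} \<Longrightarrow> norm (\<mu> t x - \<mu> t y) \<le> L * norm (x - y)"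
    and sigma_lip: "\<And>t x y. t \<in> {0..T} \<Longrightarrow> norm (\<sigma> t x - \<sigma> t y) \<le> L * norm (x - y)"
    and g_lip: "\<And>x y. \<bar>g x - g y\<bar> \<le> L * norm (x - y)"
    and mu_mixed: "\<And>t x1 x2 x3 x4. t \<in> {0..T} \<Longrightarrow> norm (\<mu> t x1 - \<mu> t x2 - \<mu> t x3 + \<mu> t x4)
           \<le> L * (norm (x1 - x2 - x3 + x4) + norm (x1 - x2) * norm (x1 - x3))"
    and sigma_mixed: "\<And>t x1 x2 x3 x4. t \<in> {0..T} \<Longrightarrow> norm (\<sigma> t x1 - \<sigma> t x2 - \<sigma> t x3 + \<sigma> t x4)
           \<le> L * (norm (x1 - x2 - x3 + x4) + norm (x1 - x2) * norm (x1 - x3))"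
    and g_mixed: "\<And>x1 x2 x3 x4. \<bar>g x1 - g x2 - g x3 + g x4\<bar>
           \<le> L * (norm (x1 - x2 - x3 + x4) + norm (x1 - x2) * norm (x1 - x3))"
    and mu_hoelder: "\<And>s t x. s \<in> {0..T} \<Longrightarrow> t \<in> {0..T} \<Longrightarrow> norm (\<mu> t x - \<mu> s x) \<le> L * sqrt \<bar>t - s\<bar>"
    and sigma_hoelder: "\<And>s t x. s \<in> {0..T} \<Longrightarrow> t \<in> {0..T} \<Longrightarrow> norm (\<sigma> t x - \<sigma> s x) \<le> L * sqrt \<bar>t - s\<bar>"
begin

lemma column_bound: "t \<in> {0..T} \<Longrightarrow> norm (column k (\<sigma> t x)) \<le> L"
  using sigma_bound[of t x] norm_column_le[of k "\<sigma> t x"] by linarith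

lemma column_lip: "t \<in> {0..T} \<Longrightarrow> norm (column k (\<sigma> t x) - column k (\<sigma> t y)) \<le> L * norm (x - y)"
  using sigma_lip[of t x y] norm_column_le[of k "\<sigma> t x - \<sigma> t y"] by (simp add: column_diff)

lemma column_mixed: "t \<in> {0..T} \<Longrightarrow>
    norm (column k (\<sigma> t x1) - column k (\<sigma> t x2) - column k (\<sigma> t x3) + column k (\<sigma> t x4))
           \<le> L * (norm (x1 - x2 - x3 + x4) + norm (x1 - x2) * norm (x1 - x3))"
  using sigma_mixed[of t x1 x2 x3 x4] norm_column_le[of k "\<sigma> t x1 - \<sigma> t x2 - \<sigma> t x3 + \<sigma> t x4"]
  by (simp add: column_diff column_add)

text \<open>The exponent delivered by \<open>comparison\<close> for \<open>N\<close> copies with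
  coefficients bounded by \<open>L\<close>; \<open>K\<close> is the rate of the penalty.\<close>

definition comparison_rate :: "real \<Rightarrow> real \<Rightarrow> real" where
  "comparison_rate N K = max K (1 + (N * L)\<^sup>2 + real CARD('d) * (N * L)\<^sup>2) + 1"

lemma exp_rate_le:
  assumes "t \<in> {0..T}"
  shows "exp (comparison_rate N K * (T - t)) \<le> exp (comparison_rate N K * T)"
proof -
  have "comparison_rate N K \<ge> 0" unfolding comparison_rate_def
    by (simp add: le_max_iff_disj add_nonneg_nonneg)
  then show ?thesis using assms by (simp add: mult_left_mono)
qed

text \<open>For two copies the squared distance grows at rate \<open>2 * L\<close> through the drift
  and \<open>L\<^sup>2\<close> through each column. For four copies 7 and 8 are the numbers of
  \<open>first\<close> and \<open>second\<close> in \<open>solution_mixed_aux\<close>. In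
  \<open>deriv_bound\<close> a common bound is formed from the penalties \<open>2 * L\<close> and
  \<open>3 * L\<close> at their minimising parameters.\<close>

definition "lip_rate = comparison_rate 2 (2 * L + real CARD('d) * L\<^sup>2)"
definition "mixed_rate = comparison_rate 4 (7 * L + real CARD('d) * (8 * L\<^sup>2))"
definition "deriv_bound = 3 * L * exp (lip_rate * T) + 3 * L * exp (mixed_rate * T)"

lemma
  shows lip_const_le: "2 * L * exp (lip_rate * T) \<le> deriv_bound"
    and mixed_const_le: "3 * L * exp (mixed_rate * T) \<le> deriv_bound"
    and deriv_bound_nonneg: "deriv_bound \<ge> 0"
  using L0 by (auto simp: deriv_bound_def intro!: add_nonneg_nonneg add_increasing mult_right_mono)

context
  fixes \<epsilon> B :: real and u :: "real \<Rightarrow> real ^ 'd \<Rightarrow> real"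
  assumes pde: "backward_pde_solution T \<mu> \<sigma> g \<epsilon> u" and eps: "\<epsilon> \<in> {0<..<1}"
    and uB: "\<And>t x. t \<in> {0..T} \<Longrightarrow> \<bar>u t x\<bar> \<le> B"
begin

text \<open>The right hand sides below, minimised over \<open>\<rho>\<close> and \<open>\<kappa>\<close>, are a multiple of \<open>norm (x - y)\<close>
  and, on parallelograms, of the product of the side lengths.\<close>

lemma solution_lipschitz_aux:
  assumes t: "t \<in> {0..T}"
    and rho: "\<rho> > 0"
  shows "u t x - u t y \<le> exp (lip_rate * T) * (L * ((norm (x - y))\<^sup>2 / \<rho> + \<rho>))"
proof -
  define c :: "2 \<Rightarrow> real" where "c i = (if i = 1 then 1 else - 1)" for i
  define Q where "Q P = L * ((norm (P $ 1 - P $ 2))\<^sup>2 / \<rho> + \<rho>)" for P :: "real ^ 'd ^ 2"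
  define q1 where "q1 P v = L * (2 * ((P $ 1 - P $ 2) \<bullet> (v $ 1 - v $ 2)) / \<rho>)" for P v :: "real ^ 'd ^ 2"
  define q2 where "q2 P v = L * ((norm (v $ 1 - v $ 2))\<^sup>2 / \<rho>)" for P v :: "real ^ 'd ^ 2"
  have Q0: "Q P \<ge> 0" for P unfolding Q_def using rho L0 by simp
  have "(\<Sum>i\<in>UNIV. c i * u t (vector [x, y] $ i)) \<le> exp (lip_rate * (T - t)) * Q (vector [x, y])"
    unfolding lip_rate_def comparison_rate_def
  proof (rule comparison[OF pde eps uB mu_bound column_bound _ Q0, where ?q1.0 = q1 and ?q2.0 = q2])
    show "continuous_on UNIV Q" unfolding Q_def by (intro continuous_intros) (use rho in auto)
    show "(\<Sum>i\<in>UNIV. c i * g (P $ i)) \<le> Q P" for P :: "real ^ 'd ^ 2"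
    proof -
      define a where "a = norm (P $ 1 - P $ 2)"
      have "0 \<le> (a - \<rho>)\<^sup>2 / \<rho> + a" using rho by (simp add: a_def)
      also have "... = a\<^sup>2 / \<rho> + \<rho> - a" using rho by (simp add: power2_eq_square field_simps)
      finally have "L * a \<le> L * (a\<^sup>2 / \<rho> + \<rho>)" using L0 by (intro mult_left_mono) auto
      then show ?thesis using g_lip[of "P $ 1" "P $ 2"] by (simp add: c_def sum_2 Q_def a_def)
    qed
    show "expands2 (\<lambda>s. Q (P + s *\<^sub>R v)) (q1 P v) (q2 P v)" for P v :: "real ^ 'd ^ 2"
    proof -
      define a where "a = P $ 1 - P $ 2"
      define p where "p = v $ 1 - v $ 2"
      have e: "(P + s *\<^sub>R v) $ 1 - (P + s *\<^sub>R v) $ 2 = a + s *\<^sub>R p" for s by (simp add: a_def p_def algebra_simps)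
      show ?thesis unfolding Q_def e q1_def q2_def a_def[symmetric] p_def[symmetric] power2_norm_line
        using expands2_poly[of "L * ((norm a)\<^sup>2 / \<rho> + \<rho>)" "L * (2 * (a \<bullet> p) / \<rho>)" "L * ((norm p)\<^sup>2 / \<rho>)" 0 0]
        by (simp add: algebra_simps add_divide_distrib)
    qed
    fix t and P :: "real ^ 'd ^ 2" assume "t \<in> {0..<T}"
    then have t: "t \<in> {0..T}" by auto
    define a where "a = P $ 1 - P $ 2"
    define N where "N = (norm a)\<^sup>2 / \<rho>"
    have "a \<bullet> (\<mu> t (P $ 1) - \<mu> t (P $ 2)) \<le> norm a * (L * norm a)"
      unfolding a_def using mu_lip[OF t] by (meson norm_cauchy_schwarz mult_left_mono norm_ge_zero order_trans)
    then have "2 * (a \<bullet> (\<mu> t (P $ 1) - \<mu> t (P $ 2))) / \<rho> \<le> 2 * (norm a * (L * norm a)) / \<rho>"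
      using rho by (simp add: divide_right_mono)
    also have "... = 2 * L * N" by (simp add: N_def power2_eq_square)
    finally have 1: "q1 P (\<chi> i. \<mu> t (P $ i)) \<le> L * (2 * L * N)"
      unfolding q1_def a_def[symmetric] vec_lambda_beta by (rule mult_left_mono[OF _ L0])
    have "q2 P (\<chi> i. column k (\<sigma> t (P $ i))) \<le> L * (L\<^sup>2 * N)" for k
    proof -
      have "(norm (column k (\<sigma> t (P $ 1)) - column k (\<sigma> t (P $ 2))))\<^sup>2 \<le> (L * norm a)\<^sup>2"
        unfolding a_def by (intro power_mono column_lip t) auto
      then have "(norm (column k (\<sigma> t (P $ 1)) - column k (\<sigma> t (P $ 2))))\<^sup>2 / \<rho> \<le> L\<^sup>2 * N"
        using rho by (simp add: N_def power_mult_distrib divide_right_mono)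
      then show ?thesis unfolding q2_def vec_lambda_beta by (rule mult_left_mono[OF _ L0])
    qed
    then have "(\<Sum>k\<in>UNIV. q2 P (\<chi> i. column k (\<sigma> t (P $ i)))) \<le> (\<Sum>k\<in>(UNIV::'d set). L * (L\<^sup>2 * N))"
      by (intro sum_mono)
    then have "(\<Sum>k\<in>UNIV. q2 P (\<chi> i. column k (\<sigma> t (P $ i)))) \<le> real CARD('d) * (L * (L\<^sup>2 * N))" by simp
    moreover have "(\<Sum>k\<in>UNIV. q2 P (\<chi> i. column k (\<sigma> t (P $ i)))) \<ge> 0"
      unfolding q2_def using L0 rho by (intro sum_nonneg) auto
    moreover have "\<epsilon>\<^sup>2 \<le> 1" using eps by (simp add: power_le_one)
    ultimately have "\<epsilon>\<^sup>2 * (\<Sum>k\<in>UNIV. q2 P (\<chi> i. column k (\<sigma> t (P $ i)))) \<le> 1 * (real CARD('d) * (L * (L\<^sup>2 * N)))"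
      by (intro mult_mono) auto
    with 1 have "q1 P (\<chi> i. \<mu> t (P $ i)) + \<epsilon>\<^sup>2 * (\<Sum>k\<in>UNIV. q2 P (\<chi> i. column k (\<sigma> t (P $ i))))
      \<le> (2 * L + real CARD('d) * L\<^sup>2) * (L * N)" by (simp add: algebra_simps)
    also have "... \<le> (2 * L + real CARD('d) * L\<^sup>2) * Q P"
      unfolding Q_def N_def a_def using L0 rho by (intro mult_left_mono) auto
    finally show "q1 P (\<chi> i. \<mu> t (P $ i)) + \<epsilon>\<^sup>2 * (\<Sum>k\<in>UNIV. q2 P (\<chi> i. column k (\<sigma> t (P $ i))))
      \<le> (2 * L + real CARD('d) * L\<^sup>2) * Q P" .
  qed (use t in auto)
  moreover have "exp (lip_rate * (T - t)) * Q (vector [x, y]) \<le> exp (lip_rate * T) * Q (vector [x, y])"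
    unfolding lip_rate_def by (intro mult_right_mono exp_rate_le t Q0)
  ultimately show ?thesis by (simp add: sum_2 c_def Q_def)
qed

lemma solution_lipschitz:
  assumes t: "t \<in> {0..T}"
  shows "\<bar>u t x - u t y\<bar> \<le> deriv_bound * norm (x - y)"
proof -
  have "u t x - u t y \<le> deriv_bound * norm (x - y)" if "x \<noteq> y" for x y
  proof -
    \<comment> \<open>At \<open>\<rho> = norm (x - y)\<close> the two terms of the penalty coincide,
      which gives the factor 2.\<close>
    have "u t x - u t y \<le> exp (lip_rate * T) * (L * ((norm (x - y))\<^sup>2 / norm (x - y) + norm (x - y)))"
      using that by (intro solution_lipschitz_aux[OF t]) auto
    also have "... = 2 * L * exp (lip_rate * T) * norm (x - y)" using that by (simp add: power2_eq_square)
    also have "... \<le> deriv_bound * norm (x - y)" by (intro mult_right_mono lip_const_le) auto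
    finally show ?thesis .
  qed
  from this[of x y] this[of y x] show ?thesis by (cases "x = y") (auto simp: abs_le_iff norm_minus_commute)
qed

text \<open>\<open>D\<close> measures how far four points are from a parallelogram with sides
  \<open>a\<close> and \<open>b\<close>. The bound for \<open>g\<close> is
  \<open>norm (D P) + norm (a P) * norm (b P)\<close>, which is not smooth; it is dominated by
  squares divided by \<rho>, and the squared product of the sides by two separate fourth powers
  balanced by \<kappa>, so that under the generator each side interacts only with itself.\<close>

lemma solution_mixed_aux:
  assumes t: "t \<in> {0..T}"
    and rho: "\<rho> > 0" and kap: "\<kappa> > 0"
  shows "u t x1 - u t x2 - u t x3 + u t x4 \<le> exp (mixed_rate * T) *
    (L * ((norm (x1 - x2 - x3 + x4))\<^sup>2 / \<rho> + \<rho> + (\<kappa> * (norm (x1 - x2)) ^ 4 + (norm (x1 - x3)) ^ 4 / \<kappa>) / \<rho>))"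
proof -
  define c :: "4 \<Rightarrow> real" where "c i = (if i = 1 \<or> i = 4 then 1 else - 1)" for i
  define D where "D P = P $ 1 - P $ 2 - P $ 3 + P $ 4" for P :: "real ^ 'd ^ 4"
  define a where "a P = P $ 1 - P $ 2" for P :: "real ^ 'd ^ 4"
  define b where "b P = P $ 1 - P $ 3" for P :: "real ^ 'd ^ 4"
  define Q where "Q P = L * ((norm (D P))\<^sup>2 / \<rho> + \<rho> + (\<kappa> * (norm (a P)) ^ 4 + (norm (b P)) ^ 4 / \<kappa>) / \<rho>)" for P
  define q1 where "q1 P v = L * (2 * (D P \<bullet> D v) / \<rho> +
     (\<kappa> * (4 * (norm (a P))\<^sup>2 * (a P \<bullet> a v)) + (4 * (norm (b P))\<^sup>2 * (b P \<bullet> b v)) / \<kappa>) / \<rho>)" for P v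
  define q2 where "q2 P v = L * ((norm (D v))\<^sup>2 / \<rho> +
     (\<kappa> * (4 * (a P \<bullet> a v)\<^sup>2 + 2 * (norm (a P))\<^sup>2 * (norm (a v))\<^sup>2)
      + (4 * (b P \<bullet> b v)\<^sup>2 + 2 * (norm (b P))\<^sup>2 * (norm (b v))\<^sup>2) / \<kappa>) / \<rho>)" for P v
  have Q0: "Q P \<ge> 0" for P unfolding Q_def using rho L0 kap by simp
  have ab: "(norm v)\<^sup>2 * (norm w)\<^sup>2 \<le> \<kappa> * norm v ^ 4 + norm w ^ 4 / \<kappa>" for v w :: "real ^ 'd"
  proof -
    have "0 \<le> (\<kappa> * (norm v)\<^sup>2 - (norm w)\<^sup>2)\<^sup>2 / \<kappa> + (norm v)\<^sup>2 * (norm w)\<^sup>2" using kap by simp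
    also have "... = \<kappa> * norm v ^ 4 + norm w ^ 4 / \<kappa> - (norm v)\<^sup>2 * (norm w)\<^sup>2"
      using kap by (simp add: power2_eq_square power4_eq_xxxx field_simps)
    finally show ?thesis by simp
  qed
  define P0 :: "real ^ 'd ^ 4" where "P0 = (\<chi> i. if i = 1 then x1 else if i = 2 then x2 else if i = 3 then x3 else x4)"
  have "(\<Sum>i\<in>UNIV. c i * u t (P0 $ i)) \<le> exp (mixed_rate * (T - t)) * Q P0"
    unfolding mixed_rate_def comparison_rate_def
  proof (rule comparison[OF pde eps uB mu_bound column_bound _ Q0, where ?q1.0 = q1 and ?q2.0 = q2])
    show "continuous_on UNIV Q" unfolding Q_def D_def a_def b_def by (intro continuous_intros) (use rho kap in auto)
    show "(\<Sum>i\<in>UNIV. c i * g (P $ i)) \<le> Q P" for P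
    proof -
      define d where "d = norm (D P)"
      define e where "e = norm (a P) * norm (b P)"
      \<comment> \<open>Applied to both \<open>d\<close> and \<open>e\<close>, each taking half of
        the single summand \<rho>.\<close>
      have le: "x \<le> x\<^sup>2 / \<rho> / 2 + \<rho> / 2" if "x \<ge> 0" for x
      proof -
        have "0 \<le> (x - \<rho>)\<^sup>2 / (2 * \<rho>)" using rho by simp
        also have "... = x\<^sup>2 / \<rho> / 2 + \<rho> / 2 - x" using rho by (simp add: power2_eq_square field_simps)
        finally show ?thesis by simp
      qed
      have "e\<^sup>2 / \<rho> \<le> (\<kappa> * (norm (a P)) ^ 4 + (norm (b P)) ^ 4 / \<kappa>) / \<rho>"
        using ab[of "a P" "b P"] rho by (simp add: e_def power_mult_distrib divide_right_mono)
      moreover have "0 \<le> d\<^sup>2 / \<rho>" "0 \<le> e\<^sup>2 / \<rho>" using rho by auto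
      ultimately have "d + e \<le> d\<^sup>2 / \<rho> + \<rho> + (\<kappa> * (norm (a P)) ^ 4 + (norm (b P)) ^ 4 / \<kappa>) / \<rho>"
        using le[of d] le[of e] by (simp add: d_def e_def)
      then have "L * (d + e) \<le> Q P" unfolding Q_def d_def using L0 by (rule mult_left_mono)
      then show ?thesis using g_mixed[of "P $ 1" "P $ 2" "P $ 3" "P $ 4"]
        by (simp add: c_def sum_4 d_def e_def D_def a_def b_def)
    qed
    show "expands2 (\<lambda>s. Q (P + s *\<^sub>R v)) (q1 P v) (q2 P v)" for P v
    proof -
      have e: "D (P + s *\<^sub>R v) = D P + s *\<^sub>R D v" "a (P + s *\<^sub>R v) = a P + s *\<^sub>R a v"
        "b (P + s *\<^sub>R v) = b P + s *\<^sub>R b v" for s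
        by (simp_all add: a_def b_def D_def algebra_simps)
      have n4: "expands2 (\<lambda>s. norm (x + s *\<^sub>R y) ^ 4) (4 * (norm x)\<^sup>2 * (x \<bullet> y)) (4 * (x \<bullet> y)\<^sup>2 + 2 * (norm x)\<^sup>2 * (norm y)\<^sup>2)"
        for x y :: "real ^ 'd"
      proof -
        have "norm (x + s *\<^sub>R y) ^ 4 = ((norm x)\<^sup>2 + (2 * (x \<bullet> y)) * s + (norm y)\<^sup>2 * s\<^sup>2)\<^sup>2" for s
          by (simp add: power2_norm_line[symmetric])
        also have "... s = (norm x)^4 + (4 * (norm x)\<^sup>2 * (x \<bullet> y)) * s + (4 * (x \<bullet> y)\<^sup>2 + 2 * (norm x)\<^sup>2 * (norm y)\<^sup>2) * s\<^sup>2
          + (4 * (x \<bullet> y) * (norm y)\<^sup>2) * s ^ 3 + (norm y)^4 * s ^ 4" for s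
          by (simp add: power2_eq_square power3_eq_cube power4_eq_xxxx algebra_simps)
        finally show ?thesis by (simp only: expands2_poly)
      qed
      have n2: "expands2 (\<lambda>s. (norm (x + s *\<^sub>R y))\<^sup>2) (2 * (x \<bullet> y)) ((norm y)\<^sup>2)" for x y :: "real ^ 'd"
        using expands2_poly[of "(norm x)\<^sup>2" "2 * (x \<bullet> y)" "(norm y)\<^sup>2" 0 0] by (simp add: power2_norm_line)
      have cst: "expands2 (\<lambda>s. r) 0 0" for r :: real using expands2_poly[of r 0 0 0 0] by simp
      have "expands2 (\<lambda>s. L * ((1/\<rho>) * (norm (D P + s *\<^sub>R D v))\<^sup>2 + \<rho> + ((\<kappa>/\<rho>) * (norm (a P + s *\<^sub>R a v)) ^ 4
           + (1/(\<kappa> * \<rho>)) * (norm (b P + s *\<^sub>R b v)) ^ 4)))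
         (L * ((1/\<rho>) * (2 * (D P \<bullet> D v)) + 0 + ((\<kappa>/\<rho>) * (4 * (norm (a P))\<^sup>2 * (a P \<bullet> a v))
            + (1/(\<kappa> * \<rho>)) * (4 * (norm (b P))\<^sup>2 * (b P \<bullet> b v)))))
         (L * ((1/\<rho>) * (norm (D v))\<^sup>2 + 0 + ((\<kappa>/\<rho>) * (4 * (a P \<bullet> a v)\<^sup>2 + 2 * (norm (a P))\<^sup>2 * (norm (a v))\<^sup>2)
            + (1/(\<kappa> * \<rho>)) * (4 * (b P \<bullet> b v)\<^sup>2 + 2 * (norm (b P))\<^sup>2 * (norm (b v))\<^sup>2))))"
        by (intro expands2_cmult expands2_add n2 n4 cst)
      then show ?thesis unfolding Q_def e q1_def q2_def
        by (simp add: add_divide_distrib)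
    qed
    fix t and P :: "real ^ 'd ^ 4" assume "t \<in> {0..<T}"
    then have t: "t \<in> {0..T}" by auto
    let ?q = "\<Sum>k\<in>UNIV. q2 P (\<chi> i. column k (\<sigma> t (P $ i)))"
    define d where "d = norm (D P)"
    define x where "x = norm (a P)"
    define y where "y = norm (b P)"
    define R where "R = \<kappa> * x ^ 4 + y ^ 4 / \<kappa>"
    have R: "(x * y)\<^sup>2 \<le> R" unfolding R_def x_def y_def using ab[of "a P" "b P"] by (simp add: power_mult_distrib)
    have R0: "R \<ge> 0" using R by (rule order_trans[rotated]) simp
    define S where "S = (d\<^sup>2 + R) / \<rho>"
    \<comment> \<open>7 = 3 + 4: the defect moves by at most \<open>L * (d + x * y)\<close>, where
      \<open>(x * y)\<^sup>2 \<le> R\<close> turns the mixed term into a total of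
      \<open>3 * L\<close>; each fourth power grows at rate \<open>4 * L\<close>.\<close>
    have first: "q1 P v \<le> L * (7 * L * S)"
      if v: "norm (D v) \<le> L * (d + x * y)" "norm (a v) \<le> L * x" "norm (b v) \<le> L * y" for v
    proof -
      have "D P \<bullet> D v \<le> d * (L * (d + x * y))"
        unfolding d_def using v(1) unfolding d_def by (meson norm_cauchy_schwarz mult_left_mono norm_ge_zero order_trans)
      also have "... = L * (d\<^sup>2 + d * (x * y))" by (simp add: power2_eq_square algebra_simps)
      also have "... \<le> L * (d\<^sup>2 + (d\<^sup>2 + (x * y)\<^sup>2) / 2)"
        using sum_squares_bound[of d "x * y"] by (intro mult_left_mono L0) (simp add: power_mult_distrib)
      also have "... \<le> L * (3 / 2 * (d\<^sup>2 + R))"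
        using R R0 by (intro mult_left_mono L0) auto
      finally have 1: "2 * (D P \<bullet> D v) \<le> 3 * L * (d\<^sup>2 + R)" by (simp add: algebra_simps)
      have "a P \<bullet> a v \<le> x * (L * x)"
        unfolding x_def using v(2) unfolding x_def by (meson norm_cauchy_schwarz mult_left_mono norm_ge_zero order_trans)
      then have "\<kappa> * (4 * x\<^sup>2 * (a P \<bullet> a v)) \<le> \<kappa> * (4 * x\<^sup>2 * (x * (L * x)))"
        using kap by (intro mult_left_mono) auto
      moreover have "b P \<bullet> b v \<le> y * (L * y)"
        unfolding y_def using v(3) unfolding y_def by (meson norm_cauchy_schwarz mult_left_mono norm_ge_zero order_trans)
      then have "(4 * y\<^sup>2 * (b P \<bullet> b v)) / \<kappa> \<le> (4 * y\<^sup>2 * (y * (L * y))) / \<kappa>"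
        using kap by (intro divide_right_mono mult_left_mono) auto
      ultimately have "\<kappa> * (4 * x\<^sup>2 * (a P \<bullet> a v)) + (4 * y\<^sup>2 * (b P \<bullet> b v)) / \<kappa> \<le> 4 * L * R"
        unfolding R_def by (simp add: power2_eq_square power4_eq_xxxx algebra_simps)
      also have "... \<le> 4 * L * (d\<^sup>2 + R)" using L0 by (intro mult_left_mono) auto
      finally have "2 * (D P \<bullet> D v) + (\<kappa> * (4 * x\<^sup>2 * (a P \<bullet> a v)) + (4 * y\<^sup>2 * (b P \<bullet> b v)) / \<kappa>) \<le> 7 * L * (d\<^sup>2 + R)"
        using 1 by simp
      then have "(2 * (D P \<bullet> D v) + (\<kappa> * (4 * x\<^sup>2 * (a P \<bullet> a v)) + (4 * y\<^sup>2 * (b P \<bullet> b v)) / \<kappa>)) / \<rho> \<le> 7 * L * (d\<^sup>2 + R) / \<rho>"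
        using rho by (intro divide_right_mono) auto
      then have "2 * (D P \<bullet> D v) / \<rho> + (\<kappa> * (4 * x\<^sup>2 * (a P \<bullet> a v)) + (4 * y\<^sup>2 * (b P \<bullet> b v)) / \<kappa>) / \<rho> \<le> 7 * L * S"
        unfolding S_def by (simp only: add_divide_distrib[symmetric] times_divide_eq_right)
      then show ?thesis unfolding q1_def x_def y_def by (rule mult_left_mono) (rule L0)
    qed
    \<comment> \<open>8 = 2 + 6: the squared norm of \<open>D v\<close> contributes 2, and the
      second order coefficient of a fourth power, with its terms 4 and 2, contributes 6.\<close>
    have second: "q2 P v \<le> L * (8 * L\<^sup>2 * S)"
      if v: "norm (D v) \<le> L * (d + x * y)" "norm (a v) \<le> L * x" "norm (b v) \<le> L * y" for v
    proof -
      have "(norm (D v))\<^sup>2 \<le> (L * (d + x * y))\<^sup>2" using v by (intro power_mono) auto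
      also have "... \<le> L\<^sup>2 * (2 * (d\<^sup>2 + (x * y)\<^sup>2))"
        unfolding power_mult_distrib[of L] using sum_squares_bound[of d "x * y"]
        by (intro mult_left_mono) (auto simp: power2_sum power_mult_distrib)
      also have "... \<le> L\<^sup>2 * (2 * (d\<^sup>2 + R))" using R by (intro mult_left_mono) auto
      finally have 1: "(norm (D v))\<^sup>2 \<le> 2 * L\<^sup>2 * (d\<^sup>2 + R)" by (simp add: algebra_simps)
      have sq: "4 * (p \<bullet> q)\<^sup>2 + 2 * (norm p)\<^sup>2 * (norm q)\<^sup>2 \<le> 6 * L\<^sup>2 * norm p ^ 4"
        if "norm q \<le> L * norm p" for p q :: "real ^ 'd"
      proof -
        have "(p \<bullet> q)\<^sup>2 \<le> (norm p)\<^sup>2 * (norm q)\<^sup>2"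
          using Cauchy_Schwarz_ineq[of p q] by (simp add: power2_norm_eq_inner)
        moreover have "(norm q)\<^sup>2 \<le> (L * norm p)\<^sup>2" using that by (intro power_mono) auto
        then have "(norm p)\<^sup>2 * (norm q)\<^sup>2 \<le> (norm p)\<^sup>2 * (L * norm p)\<^sup>2" by (intro mult_left_mono) auto
        moreover have "(norm p)\<^sup>2 * (L * norm p)\<^sup>2 = L\<^sup>2 * norm p ^ 4"
          by (simp add: power2_eq_square power4_eq_xxxx)
        ultimately show ?thesis by simp
      qed
      have "\<kappa> * (4 * (a P \<bullet> a v)\<^sup>2 + 2 * (norm (a P))\<^sup>2 * (norm (a v))\<^sup>2) \<le> \<kappa> * (6 * L\<^sup>2 * x ^ 4)"
        using kap v(2) unfolding x_def by (intro mult_left_mono sq) auto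
      moreover have "(4 * (b P \<bullet> b v)\<^sup>2 + 2 * (norm (b P))\<^sup>2 * (norm (b v))\<^sup>2) / \<kappa> \<le> (6 * L\<^sup>2 * y ^ 4) / \<kappa>"
        using kap v(3) unfolding y_def by (intro divide_right_mono sq) auto
      ultimately have "\<kappa> * (4 * (a P \<bullet> a v)\<^sup>2 + 2 * (norm (a P))\<^sup>2 * (norm (a v))\<^sup>2)
        + (4 * (b P \<bullet> b v)\<^sup>2 + 2 * (norm (b P))\<^sup>2 * (norm (b v))\<^sup>2) / \<kappa> \<le> 6 * L\<^sup>2 * R"
        unfolding R_def by (simp add: algebra_simps)
      also have "... \<le> 6 * L\<^sup>2 * (d\<^sup>2 + R)" by (intro mult_left_mono) auto
      finally have "((norm (D v))\<^sup>2 + (\<kappa> * (4 * (a P \<bullet> a v)\<^sup>2 + 2 * (norm (a P))\<^sup>2 * (norm (a v))\<^sup>2)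
        + (4 * (b P \<bullet> b v)\<^sup>2 + 2 * (norm (b P))\<^sup>2 * (norm (b v))\<^sup>2) / \<kappa>)) / \<rho> \<le> 8 * L\<^sup>2 * (d\<^sup>2 + R) / \<rho>"
        using 1 rho by (intro divide_right_mono) auto
      then have "(norm (D v))\<^sup>2 / \<rho> + (\<kappa> * (4 * (a P \<bullet> a v)\<^sup>2 + 2 * (norm (a P))\<^sup>2 * (norm (a v))\<^sup>2)
        + (4 * (b P \<bullet> b v)\<^sup>2 + 2 * (norm (b P))\<^sup>2 * (norm (b v))\<^sup>2) / \<kappa>) / \<rho> \<le> 8 * L\<^sup>2 * S"
        unfolding S_def by (simp only: add_divide_distrib[symmetric] times_divide_eq_right)
      then show ?thesis unfolding q2_def by (rule mult_left_mono) (rule L0)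
    qed
    have m1: "q1 P (\<chi> i. \<mu> t (P $ i)) \<le> L * (7 * L * S)"
      by (rule first) (auto simp: D_def a_def b_def d_def x_def y_def intro!: mu_mixed mu_lip t)
    have "q2 P (\<chi> i. column k (\<sigma> t (P $ i))) \<le> L * (8 * L\<^sup>2 * S)" for k
      by (rule second) (auto simp: D_def a_def b_def d_def x_def y_def intro!: column_mixed column_lip t)
    then have "?q \<le> (\<Sum>k\<in>(UNIV::'d set). L * (8 * L\<^sup>2 * S))"
      by (intro sum_mono)
    then have "?q \<le> real CARD('d) * (L * (8 * L\<^sup>2 * S))" by simp
    moreover have "?q \<ge> 0"
      unfolding q2_def using L0 rho kap by (intro sum_nonneg) auto
    moreover have "\<epsilon>\<^sup>2 \<le> 1" using eps by (simp add: power_le_one)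
    ultimately have "\<epsilon>\<^sup>2 * ?q \<le> 1 * (real CARD('d) * (L * (8 * L\<^sup>2 * S)))"
      by (intro mult_mono) auto
    with m1 have "q1 P (\<chi> i. \<mu> t (P $ i)) + \<epsilon>\<^sup>2 * ?q
      \<le> (7 * L + real CARD('d) * (8 * L\<^sup>2)) * (L * S)" by (simp add: algebra_simps)
    also have "... \<le> (7 * L + real CARD('d) * (8 * L\<^sup>2)) * Q P"
      unfolding Q_def S_def R_def d_def x_def y_def using L0 rho by (intro mult_left_mono) (auto simp: add_divide_distrib)
    finally show "q1 P (\<chi> i. \<mu> t (P $ i)) + \<epsilon>\<^sup>2 * ?q
      \<le> (7 * L + real CARD('d) * (8 * L\<^sup>2)) * Q P" .
  qed (use t in auto)
  moreover have "exp (mixed_rate * (T - t)) * Q P0 \<le> exp (mixed_rate * T) * Q P0"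
    unfolding mixed_rate_def by (intro mult_right_mono exp_rate_le t Q0)
  ultimately show ?thesis by (simp add: sum_4 c_def Q_def D_def a_def b_def P0_def)
qed

lemma solution_mixed:
  assumes t: "t \<in> {0..T}"
  shows "\<bar>u t (x + h + k) - u t (x + h) - u t (x + k) + u t x\<bar> \<le> deriv_bound * norm h * norm k"
proof -
  have main: "u t x1 - u t x2 - u t x3 + u t x4 \<le> deriv_bound * norm h * norm k"
    if "x1 - x2 - x3 + x4 = 0" "norm (x1 - x2) = norm k" "norm (x1 - x3) = norm h" "h \<noteq> 0" "k \<noteq> 0" for x1 x2 x3 x4
  proof -
    \<comment> \<open>\<rho> is the product and \<kappa> the squared quotient of the side lengths.
      The defect is 0 and the three other terms all equal \<open>norm h * norm k\<close>.\<close>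
    have "u t x1 - u t x2 - u t x3 + u t x4 \<le> exp (mixed_rate * T) *
      (L * ((norm (x1 - x2 - x3 + x4))\<^sup>2 / (norm h * norm k) + (norm h * norm k)
       + ((norm h / norm k)\<^sup>2 * (norm (x1 - x2)) ^ 4 + (norm (x1 - x3)) ^ 4 / (norm h / norm k)\<^sup>2) / (norm h * norm k)))"
      using that by (intro solution_mixed_aux[OF t]) auto
    also have "... = 3 * L * exp (mixed_rate * T) * (norm h * norm k)"
      using that by (simp add: power2_eq_square power4_eq_xxxx field_simps)
    also have "... \<le> deriv_bound * (norm h * norm k)" by (intro mult_right_mono mixed_const_le) auto
    finally show ?thesis by simp
  qed
  show ?thesis
  proof (cases "h = 0 \<or> k = 0")
    case False
    \<comment> \<open>The second instance lists the vertices in another order, which reverses the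
      sign of the mixed difference.\<close>
    then show ?thesis
      using main[of "x + h + k" "x + h" "x + k" x] main[of "x + h" "x + h + k" x "x + k"]
      by (simp add: abs_le_iff norm_minus_commute)
  qed auto
qed

text \<open>The gradient is tested in its own direction, and a difference of gradients in the
  direction \<open>v\<close> of that difference; \<open>self\<close> then cancels one factor of the
  norm. The second bound is the parallelogram estimate with the side \<open>s *\<^sub>R v\<close>
  shrinking to 0.\<close>

lemma
  assumes t: "t \<in> {0..<T}"
  shows solution_gradient_bound: "norm (gradient (u t) x) \<le> deriv_bound"
    and solution_gradient_lipschitz: "norm (gradient (u t) x - gradient (u t) y) \<le> deriv_bound * norm (x - y)"
proof -
  have tT: "t \<in> {0..T}" using t by auto
  have line: "((\<lambda>s. u t (z + s *\<^sub>R v)) has_real_derivative gradient (u t) z \<bullet> v) (at 0)" for z v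
  proof -
    have "u t differentiable (at (z + 0 *\<^sub>R v))" using pde t unfolding backward_pde_solution_def by auto
    from frechet_gradient[OF this]
    have "(u t \<circ> (\<lambda>s. z + s *\<^sub>R v) has_derivative (\<lambda>w. gradient (u t) (z + 0 *\<^sub>R v) \<bullet> w) \<circ> (\<lambda>h. h *\<^sub>R v)) (at 0)"
      by (intro diff_chain_at) (auto intro!: derivative_eq_intros)
    then have "((\<lambda>s. u t (z + s *\<^sub>R v)) has_derivative (\<lambda>h. h * (gradient (u t) z \<bullet> v))) (at 0)"
      by (simp add: o_def)
    then show ?thesis by (simp add: has_field_derivative_def mult_commute_abs)
  qed
  have dom: "d \<le> C" if "(\<phi> has_real_derivative d) (at 0)" "\<And>s. s > 0 \<Longrightarrow> \<phi> s - \<phi> 0 \<le> C * s" for \<phi> d C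
  proof -
    have "((\<lambda>s. (\<phi> s - \<phi> 0) / s) \<longlongrightarrow> d) (at_right 0)"
      using that(1) unfolding DERIV_def by (simp add: filterlim_at_split)
    then show ?thesis
      by (rule tendsto_upperbound)
        (use that(2) in \<open>auto simp: eventually_at pos_divide_le_eq intro!: exI[of _ 1]\<close>)
  qed
  have self: "norm v \<le> C" if "v \<bullet> v \<le> C * norm v" "C \<ge> 0" for v :: "real ^ 'd" and C
    using that by (cases "v = 0") (auto simp: power2_norm_eq_inner[symmetric] power2_eq_square)
  show "norm (gradient (u t) x) \<le> deriv_bound"
  proof (rule self[OF dom[OF line] deriv_bound_nonneg])
    fix s :: real assume "s > 0"
    then show "u t (x + s *\<^sub>R gradient (u t) x) - u t (x + 0 *\<^sub>R gradient (u t) x)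
      \<le> deriv_bound * norm (gradient (u t) x) * s"
      using solution_lipschitz[OF tT, of "x + s *\<^sub>R gradient (u t) x" x] by (simp add: algebra_simps)
  qed
  define v where "v = gradient (u t) x - gradient (u t) y"
  show "norm (gradient (u t) x - gradient (u t) y) \<le> deriv_bound * norm (x - y)"
    unfolding v_def[symmetric]
  proof (rule self[OF dom])
    show "((\<lambda>s. u t (x + s *\<^sub>R v) - u t (y + s *\<^sub>R v)) has_real_derivative v \<bullet> v) (at 0)"
      using DERIV_diff[OF line[of x v] line[of y v]] by (simp add: v_def inner_diff_left)
    fix s :: real assume "s > 0"
    then show "u t (x + s *\<^sub>R v) - u t (y + s *\<^sub>R v) - (u t (x + 0 *\<^sub>R v) - u t (y + 0 *\<^sub>R v))
       \<le> deriv_bound * norm (x - y) * norm v * s"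
      using solution_mixed[OF tT, of y "x - y" "s *\<^sub>R v"] by (simp add: algebra_simps)
  qed (auto simp: deriv_bound_nonneg)
qed

end

end

section \<open>Square norms\<close>

text \<open>Valued in \<open>ennreal\<close>, so that estimates can be stated before any
  integrability is known and finiteness is read off afterwards.\<close>

definition sqn :: "'a measure \<Rightarrow> ('a \<Rightarrow> 'b::real_normed_vector) \<Rightarrow> ennreal" where
  "sqn N f = (\<integral>\<^sup>+x. ennreal ((norm (f x))\<^sup>2) \<partial>N)"

lemma sqn_cong_AE: "AE x in N. f x = g x \<Longrightarrow> sqn N f = sqn N g"
  unfolding sqn_def by (rule nn_integral_cong_AE) auto

lemma sqn_cong: "(\<And>x. x \<in> space N \<Longrightarrow> f x = g x) \<Longrightarrow> sqn N f = sqn N g"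
  unfolding sqn_def by (rule nn_integral_cong) auto

lemma sqn_mono_AE: "AE x in N. norm (f x) \<le> norm (g x) \<Longrightarrow> sqn N f \<le> sqn N g"
  unfolding sqn_def by (rule nn_integral_mono_AE) (auto intro!: ennreal_leI power_mono)

lemma sqn_mono: "(\<And>x. x \<in> space N \<Longrightarrow> norm (f x) \<le> norm (g x)) \<Longrightarrow> sqn N f \<le> sqn N g"
  by (rule sqn_mono_AE) auto

lemma sqn_zero [simp]: "sqn N (\<lambda>_. 0) = 0"
  by (simp add: sqn_def)

lemma sqn_minus: "sqn N (\<lambda>x. - f x) = sqn N f"
  by (simp add: sqn_def)

lemma sqn_minus_commute: "sqn N (\<lambda>x. f x - g x) = sqn N (\<lambda>x. g x - f x)"
  by (simp add: sqn_def norm_minus_commute)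

lemma sqn_norm [simp]: "sqn N (\<lambda>x. norm (f x)) = sqn N f"
  by (simp add: sqn_def)

lemma sqn_scale:
  assumes [measurable]: "f \<in> borel_measurable N"
  shows "sqn N (\<lambda>x. c *\<^sub>R f x) = ennreal (c\<^sup>2) * sqn N f"
proof -
  have "sqn N (\<lambda>x. c *\<^sub>R f x) = (\<integral>\<^sup>+x. ennreal (c\<^sup>2) * ennreal ((norm (f x))\<^sup>2) \<partial>N)"
    unfolding sqn_def by (intro nn_integral_cong) (simp add: power_mult_distrib ennreal_mult)
  then show ?thesis unfolding sqn_def by (subst (asm) nn_integral_cmult) auto
qed

lemma sqn_const: "sqn N (\<lambda>_. c) = ennreal ((norm c)\<^sup>2) * emeasure N (space N)"
  by (simp add: sqn_def)

lemma norm_add_square_le: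
  fixes a b :: "'b::real_normed_vector"
  assumes "\<theta> > 0"
  shows "(norm (a + b))\<^sup>2 \<le> (1 + \<theta>) * (norm a)\<^sup>2 + (1 + 1 / \<theta>) * (norm b)\<^sup>2"
proof -
  have "(norm (a + b))\<^sup>2 \<le> (norm a + norm b)\<^sup>2" by (intro power_mono norm_triangle_ineq) auto
  also have "... = (norm a)\<^sup>2 + (norm b)\<^sup>2 + 2 * norm a * norm b" by (simp add: power2_sum)
  also have "2 * norm a * norm b \<le> \<theta> * (norm a)\<^sup>2 + (norm b)\<^sup>2 / \<theta>"
  proof -
    have "0 \<le> (\<theta> * norm a - norm b)\<^sup>2 / \<theta>" using assms by simp
    also have "... = \<theta> * (norm a)\<^sup>2 + (norm b)\<^sup>2 / \<theta> - 2 * norm a * norm b"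
      using assms by (simp add: power2_eq_square field_simps)
    finally show ?thesis by simp
  qed
  finally show ?thesis by (simp add: algebra_simps)
qed

text \<open>The weight is kept free: for \<theta> near 0 the first factor approaches 1, which is
  what makes the norm continuous under convergence.\<close>

lemma sqn_add_le_weighted:
  fixes f g :: "'a \<Rightarrow> 'b::real_normed_vector"
  assumes [measurable]: "f \<in> borel_measurable N" "g \<in> borel_measurable N" and \<theta>: "\<theta> > 0"
  shows "sqn N (\<lambda>x. f x + g x) \<le> ennreal (1 + \<theta>) * sqn N f + ennreal (1 + 1 / \<theta>) * sqn N g"
proof -
  have "sqn N (\<lambda>x. f x + g x) \<le>
      (\<integral>\<^sup>+x. ennreal (1 + \<theta>) * ennreal ((norm (f x))\<^sup>2) + ennreal (1 + 1 / \<theta>) * ennreal ((norm (g x))\<^sup>2) \<partial>N)"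
    unfolding sqn_def using norm_add_square_le[OF \<theta>] \<theta>
    by (intro nn_integral_mono) (simp flip: ennreal_mult ennreal_plus add: ennreal_leI)
  also have "... = ennreal (1 + \<theta>) * sqn N f + ennreal (1 + 1 / \<theta>) * sqn N g"
    unfolding sqn_def by (subst nn_integral_add) (auto simp: nn_integral_cmult)
  finally show ?thesis .
qed

lemma sqn_add_le:
  fixes f g :: "'a \<Rightarrow> 'b::real_normed_vector"
  assumes "f \<in> borel_measurable N" "g \<in> borel_measurable N"
  shows "sqn N (\<lambda>x. f x + g x) \<le> 2 * sqn N f + 2 * sqn N g"
  using sqn_add_le_weighted[OF assms, of 1] by simp

lemma sqn_diff_le:
  fixes f g :: "'a \<Rightarrow> 'b::{real_normed_vector, second_countable_topology}"
  assumes "f \<in> borel_measurable N" "g \<in> borel_measurable N"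
  shows "sqn N (\<lambda>x. f x - g x) \<le> 2 * sqn N f + 2 * sqn N g"
  using sqn_add_le[OF assms(1) borel_measurable_uminus[OF assms(2)]] by (simp add: sqn_minus)

lemma sqn_add3_le:
  fixes f g h :: "'a \<Rightarrow> 'b::{real_normed_vector, second_countable_topology}"
  assumes [measurable]: "f \<in> borel_measurable N" "g \<in> borel_measurable N" "h \<in> borel_measurable N"
  shows "sqn N (\<lambda>x. f x + g x + h x) \<le> 4 * sqn N f + 4 * sqn N g + 4 * sqn N h"
proof -
  have "sqn N (\<lambda>x. (f x + g x) + h x) \<le> 2 * sqn N (\<lambda>x. f x + g x) + 2 * sqn N h" by (rule sqn_add_le) auto
  also have "... \<le> 2 * (2 * sqn N f + 2 * sqn N g) + 2 * sqn N h"
    by (intro add_right_mono mult_left_mono sqn_add_le) auto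
  also have "... \<le> 2 * (2 * sqn N f + 2 * sqn N g) + 4 * sqn N h" by (intro add_left_mono mult_right_mono) auto
  finally show ?thesis by (simp add: distrib_left mult.assoc[symmetric])
qed

text \<open>The two sequences may live on different measures, so that an isometry between \<Omega>
  and the product of time and \<Omega> passes to the limit. Replacing \<open>f k\<close> and
  \<open>g k\<close> by their limits costs the factor \<open>(1 + \<theta>)\<^sup>2\<close>, and
  \<theta> tends to 0.\<close>

lemma sqn_limit_le:
  fixes f :: "nat \<Rightarrow> 'a \<Rightarrow> 'b::{real_normed_vector, second_countable_topology}"
    and g :: "nat \<Rightarrow> 'c \<Rightarrow> 'e::{real_normed_vector, second_countable_topology}"
  assumes [measurable]: "\<And>k. f k \<in> borel_measurable N" "f0 \<in> borel_measurable N"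
    "\<And>k. g k \<in> borel_measurable N'" "g0 \<in> borel_measurable N'"
    and le: "\<And>k. sqn N (f k) \<le> sqn N' (g k)"
    and f: "(\<lambda>k. sqn N (\<lambda>x. f k x - f0 x)) \<longlonglongrightarrow> 0"
    and g: "(\<lambda>k. sqn N' (\<lambda>x. g k x - g0 x)) \<longlonglongrightarrow> 0"
  shows "sqn N f0 \<le> sqn N' g0"
proof -
  have 1: "sqn N f0 \<le> ennreal ((1 + \<theta>)\<^sup>2) * sqn N' g0" if \<theta>: "\<theta> > 0" for \<theta> :: real
  proof -
    let ?R = "\<lambda>k. ennreal (1 + \<theta>) * (ennreal (1 + \<theta>) * sqn N' g0 + ennreal (1 + 1 / \<theta>) * sqn N' (\<lambda>x. g k x - g0 x))
       + ennreal (1 + 1 / \<theta>) * sqn N (\<lambda>x. f k x - f0 x)"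
    have "sqn N f0 \<le> ?R k" for k
    proof -
      have "sqn N (\<lambda>x. f k x + (f0 x - f k x)) \<le> ennreal (1 + \<theta>) * sqn N (f k) + ennreal (1 + 1 / \<theta>) * sqn N (\<lambda>x. f0 x - f k x)"
        by (rule sqn_add_le_weighted) (auto simp: \<theta>)
      also have "sqn N (f k) \<le> sqn N' (\<lambda>x. g0 x + (g k x - g0 x))" using le by simp
      also have "... \<le> ennreal (1 + \<theta>) * sqn N' g0 + ennreal (1 + 1 / \<theta>) * sqn N' (\<lambda>x. g k x - g0 x)"
        by (rule sqn_add_le_weighted) (auto simp: \<theta>)
      finally show ?thesis by (simp add: sqn_minus_commute[of N f0] mult_left_mono)
    qed
    moreover have "?R \<longlonglongrightarrow> ennreal (1 + \<theta>) * (ennreal (1 + \<theta>) * sqn N' g0 + ennreal (1 + 1 / \<theta>) * 0) + ennreal (1 + 1 / \<theta>) * 0"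
      by (intro tendsto_add ennreal_tendsto_cmult tendsto_const f g) auto
    ultimately have "sqn N f0 \<le> ennreal (1 + \<theta>) * (ennreal (1 + \<theta>) * sqn N' g0)"
      by (intro tendsto_lowerbound[OF _ always_eventually]) auto
    then show ?thesis using \<theta> by (simp add: power2_eq_square ennreal_mult mult.assoc)
  qed
  show ?thesis
  proof (cases "sqn N' g0 = top")
    case False
    have "(\<lambda>n. ennreal ((1 + 1 / real (Suc n))\<^sup>2)) \<longlonglongrightarrow> ennreal ((1 + 0)\<^sup>2)"
      using LIMSEQ_inverse_real_of_nat by (intro tendsto_ennrealI tendsto_intros) (simp add: inverse_eq_divide)
    then have "(\<lambda>n. sqn N' g0 * ennreal ((1 + 1 / real (Suc n))\<^sup>2)) \<longlonglongrightarrow> sqn N' g0 * ennreal ((1 + 0)\<^sup>2)"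
      using False by (intro ennreal_tendsto_cmult) (auto simp: less_top)
    then have "sqn N f0 \<le> sqn N' g0 * ennreal ((1 + 0)\<^sup>2)"
      using 1[of "1 / real (Suc n)" for n]
      by (intro tendsto_lowerbound[OF _ always_eventually]) (auto simp: mult.commute)
    then show ?thesis by simp
  qed simp
qed

lemma sqn_finite_iff_integrable:
  assumes [measurable]: "f \<in> borel_measurable N"
  shows "sqn N f < top \<longleftrightarrow> integrable N (\<lambda>x. (norm (f x))\<^sup>2)"
  by (simp add: integrable_iff_bounded sqn_def)

lemma sqn_eq_integral:
  assumes [measurable]: "f \<in> borel_measurable N" and "sqn N f < top"
  shows "sqn N f = ennreal (\<integral>x. (norm (f x))\<^sup>2 \<partial>N)"
  unfolding sqn_def using assms by (intro nn_integral_eq_integral) (auto simp: sqn_finite_iff_integrable)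

lemma integrable_inner_sqn:
  fixes f g :: "'a \<Rightarrow> 'b::{real_inner, second_countable_topology}"
  assumes [measurable]: "f \<in> borel_measurable N" "g \<in> borel_measurable N"
    and "sqn N f < top" "sqn N g < top"
  shows "integrable N (\<lambda>x. f x \<bullet> g x)"
proof (rule Bochner_Integration.integrable_bound)
  show "integrable N (\<lambda>x. (norm (f x))\<^sup>2 + (norm (g x))\<^sup>2)"
    using assms by (simp add: sqn_finite_iff_integrable)
  show "AE x in N. norm (f x \<bullet> g x) \<le> norm ((norm (f x))\<^sup>2 + (norm (g x))\<^sup>2)"
  proof (rule AE_I2)
    fix x
    have "\<bar>f x \<bullet> g x\<bar> \<le> norm (f x) * norm (g x)" by (rule Cauchy_Schwarz_ineq2)
    also have "... \<le> (norm (f x))\<^sup>2 + (norm (g x))\<^sup>2"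
      using sum_squares_bound[of "norm (f x)" "norm (g x)"] mult_nonneg_nonneg[OF norm_ge_zero norm_ge_zero, of "f x" "g x"]
      by linarith
    finally show "norm (f x \<bullet> g x) \<le> norm ((norm (f x))\<^sup>2 + (norm (g x))\<^sup>2)" by simp
  qed
qed auto

lemma integrable_mult_sqn:
  fixes f g :: "'a \<Rightarrow> real"
  assumes "f \<in> borel_measurable N" "g \<in> borel_measurable N"
    and "sqn N f < top" "sqn N g < top"
  shows "integrable N (\<lambda>x. f x * g x)"
  using integrable_inner_sqn[OF assms] by (simp add: mult.commute)

lemma sqn_pythagoras:
  fixes f g :: "'a \<Rightarrow> real"
  assumes [measurable]: "f \<in> borel_measurable N" "g \<in> borel_measurable N"
    and "sqn N f < top" "sqn N g < top" and o: "(\<integral>x. f x * g x \<partial>N) = 0"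
  shows "sqn N (\<lambda>x. f x + g x) = sqn N f + sqn N g"
proof -
  have i: "integrable N (\<lambda>x. (f x)\<^sup>2)" "integrable N (\<lambda>x. (g x)\<^sup>2)" "integrable N (\<lambda>x. f x * g x)"
    using assms integrable_mult_sqn[OF assms(1-4)] by (auto simp: sqn_finite_iff_integrable)
  have fin: "sqn N (\<lambda>x. f x + g x) < top"
    using assms sqn_add_le[OF assms(1,2)] by (auto simp: ennreal_mult_less_top intro: order_le_less_trans)
  have "(\<integral>x. (f x + g x)\<^sup>2 \<partial>N) = (\<integral>x. (f x)\<^sup>2 + (g x)\<^sup>2 + 2 * (f x * g x) \<partial>N)"
    by (simp add: power2_sum mult.assoc)
  also have "... = (\<integral>x. (f x)\<^sup>2 \<partial>N) + (\<integral>x. (g x)\<^sup>2 \<partial>N)" using i o by simp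
  finally have eq: "(\<integral>x. (f x + g x)\<^sup>2 \<partial>N) = (\<integral>x. (f x)\<^sup>2 \<partial>N) + (\<integral>x. (g x)\<^sup>2 \<partial>N)" .
  have "sqn N (\<lambda>x. f x + g x) = ennreal (\<integral>x. (f x + g x)\<^sup>2 \<partial>N)"
    using sqn_eq_integral[OF _ fin] by simp
  also have "... = ennreal (\<integral>x. (f x)\<^sup>2 \<partial>N) + ennreal (\<integral>x. (g x)\<^sup>2 \<partial>N)"
    unfolding eq by (rule ennreal_plus) auto
  also have "... = sqn N f + sqn N g"
    using sqn_eq_integral[OF assms(1,3)] sqn_eq_integral[OF assms(2,4)] by simp
  finally show ?thesis .
qed

text \<open>Cauchy-Schwarz in Young's form; the free weight \<theta> takes the place of square
  roots.\<close>

lemma abs_integral_mult_le_sqn: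
  fixes f g :: "'a \<Rightarrow> real"
  assumes [measurable]: "f \<in> borel_measurable N" "g \<in> borel_measurable N"
    and "sqn N f < top" "sqn N g < top" and \<theta>: "\<theta> > 0"
  shows "ennreal \<bar>\<integral>x. f x * g x \<partial>N\<bar> \<le> ennreal \<theta> * sqn N f + ennreal (1 / \<theta>) * sqn N g"
proof -
  have i: "integrable N (\<lambda>x. (f x)\<^sup>2)" "integrable N (\<lambda>x. (g x)\<^sup>2)" "integrable N (\<lambda>x. f x * g x)"
    using assms integrable_mult_sqn[OF assms(1-4)] by (auto simp: sqn_finite_iff_integrable)
  have pt0: "x * y \<le> \<theta> * x\<^sup>2 + 1 / \<theta> * y\<^sup>2" if "x \<ge> 0" "y \<ge> 0" for x y :: real
  proof -
    have "0 \<le> (\<theta> * x - y)\<^sup>2 / \<theta> + x * y" using \<theta> that by simp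
    also have "... = \<theta> * x\<^sup>2 + 1 / \<theta> * y\<^sup>2 - x * y"
      using \<theta> by (simp add: power2_eq_square field_simps)
    finally show ?thesis by simp
  qed
  have pt: "\<bar>a * b\<bar> \<le> \<theta> * a\<^sup>2 + 1 / \<theta> * b\<^sup>2" for a b :: real
    using pt0[of "\<bar>a\<bar>" "\<bar>b\<bar>"] by (simp add: abs_mult)
  have "\<bar>\<integral>x. f x * g x \<partial>N\<bar> \<le> (\<integral>x. \<bar>f x * g x\<bar> \<partial>N)" by (rule integral_abs_bound)
  also have "... \<le> (\<integral>x. \<theta> * (f x)\<^sup>2 + 1 / \<theta> * (g x)\<^sup>2 \<partial>N)"
    by (intro integral_mono Bochner_Integration.integrable_add integrable_mult_right integrable_abs i pt)
  also have "... = \<theta> * (\<integral>x. (f x)\<^sup>2 \<partial>N) + 1 / \<theta> * (\<integral>x. (g x)\<^sup>2 \<partial>N)"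
    using i by (subst Bochner_Integration.integral_add) auto
  finally have le: "\<bar>\<integral>x. f x * g x \<partial>N\<bar> \<le> \<theta> * (\<integral>x. (f x)\<^sup>2 \<partial>N) + 1 / \<theta> * (\<integral>x. (g x)\<^sup>2 \<partial>N)" .
  have "ennreal \<bar>\<integral>x. f x * g x \<partial>N\<bar> \<le> ennreal (\<theta> * (\<integral>x. (f x)\<^sup>2 \<partial>N) + 1 / \<theta> * (\<integral>x. (g x)\<^sup>2 \<partial>N))"
    by (rule ennreal_leI[OF le])
  also have "... = ennreal \<theta> * ennreal (\<integral>x. (f x)\<^sup>2 \<partial>N) + ennreal (1 / \<theta>) * ennreal (\<integral>x. (g x)\<^sup>2 \<partial>N)"
    using \<theta> by (simp only: ennreal_plus ennreal_mult mult_nonneg_nonneg zero_le_divide_1_iff less_imp_le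
        Bochner_Integration.integral_nonneg zero_le_power2)
  also have "... = ennreal \<theta> * sqn N f + ennreal (1 / \<theta>) * sqn N g"
    using sqn_eq_integral[OF assms(1,3)] sqn_eq_integral[OF assms(2,4)] by simp
  finally show ?thesis .
qed

lemma tendsto_integral_mult_sqn:
  fixes f :: "'a \<Rightarrow> real"
  assumes [measurable]: "f \<in> borel_measurable N" "\<And>k. g k \<in> borel_measurable N"
    and ff: "sqn N f < top" and g: "(\<lambda>k. sqn N (g k)) \<longlonglongrightarrow> 0"
  shows "(\<lambda>k. \<integral>x. f x * g k x \<partial>N) \<longlonglongrightarrow> 0"
proof (rule LIMSEQ_I)
  fix r :: real assume r: "r > 0"
  obtain A where A: "sqn N f = ennreal A" "A \<ge> 0" using ff by (cases "sqn N f") auto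
  \<comment> \<open>This leaves less than \<open>r / 2\<close> for the fixed factor; the other half
    is for \<open>g k\<close> with \<open>k\<close> large. The summand 1 covers
    \<open>A = 0\<close>.\<close>
  define \<theta> where "\<theta> = r / (2 * (A + 1))"
  have \<theta>: "\<theta> > 0" "\<theta> * A < r / 2" using r A by (auto simp: \<theta>_def field_simps)
  have "\<forall>\<^sub>F k in sequentially. sqn N (g k) < ennreal (\<theta> * (r / 2))"
    using \<theta> r by (intro order_tendstoD(2)[OF g]) simp
  then obtain n where n: "\<And>k. k \<ge> n \<Longrightarrow> sqn N (g k) < ennreal (\<theta> * (r / 2))"
    unfolding eventually_sequentially by auto
  have "norm ((\<integral>x. f x * g k x \<partial>N) - 0) < r" if "k \<ge> n" for k
  proof -
    have fg: "sqn N (g k) < top" using n[OF that] by (metis ennreal_less_top infinity_ennreal_def order_less_trans)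
    then obtain B where B: "sqn N (g k) = ennreal B" "B \<ge> 0" by (cases "sqn N (g k)") auto
    have "B < \<theta> * (r / 2)" using n[OF that] B by (simp add: ennreal_less_iff)
    then have "1 / \<theta> * B < r / 2" using \<theta> by (simp add: field_simps)
    moreover have "ennreal \<bar>\<integral>x. f x * g k x \<partial>N\<bar> \<le> ennreal (\<theta> * A + 1 / \<theta> * B)"
      using abs_integral_mult_le_sqn[OF assms(1,2) ff fg \<theta>(1)] A B \<theta>(1)
      by (simp add: ennreal_mult'[symmetric])
    then have "\<bar>\<integral>x. f x * g k x \<partial>N\<bar> \<le> \<theta> * A + 1 / \<theta> * B"
      using A B \<theta> by (subst (asm) ennreal_le_iff) auto
    ultimately have "\<bar>\<integral>x. f x * g k x \<partial>N\<bar> < r" using \<theta>(2) by linarith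
    then show ?thesis by simp
  qed
  then show "\<exists>no. \<forall>n\<ge>no. norm ((\<integral>x. f x * g n x \<partial>N) - 0) < r" by blast
qed

text \<open>Integrate \<open>2 * m * f x \<le> (f x)\<^sup>2 + m\<^sup>2\<close>: first with
  \<open>m = 1\<close>, to see that the integral \<open>A\<close> of \<open>f\<close> is finite,
  then with the optimal \<open>m = A / c\<close>.\<close>

lemma nn_integral_square_le:
  fixes f :: "'a \<Rightarrow> real"
  assumes [measurable]: "f \<in> borel_measurable N" and f0: "\<And>x. f x \<ge> 0"
    and c: "emeasure N (space N) = ennreal c" "c \<ge> 0"
  shows "(\<integral>\<^sup>+x. ennreal (f x) \<partial>N)\<^sup>2 \<le> ennreal c * (\<integral>\<^sup>+x. ennreal ((f x)\<^sup>2) \<partial>N)"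
proof (cases "c = 0")
  case True
  then have "AE x in N. False" using c by (intro AE_I[where N="space N"]) auto
  then have "(\<integral>\<^sup>+x. ennreal (f x) \<partial>N) = (\<integral>\<^sup>+x. 0 \<partial>N)" by (intro nn_integral_cong_AE) auto
  then show ?thesis by simp
next
  case False
  then have c0: "c > 0" using c by simp
  show ?thesis
  proof (cases "(\<integral>\<^sup>+x. ennreal ((f x)\<^sup>2) \<partial>N)")
    case (real B)
    have key: "ennreal (2 * m) * (\<integral>\<^sup>+x. ennreal (f x) \<partial>N) \<le> ennreal (B + m\<^sup>2 * c)" if m: "m \<ge> 0" for m
    proof -
      have "ennreal (2 * m) * (\<integral>\<^sup>+x. ennreal (f x) \<partial>N) = (\<integral>\<^sup>+x. ennreal (2 * m * f x) \<partial>N)"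
        using m f0 by (subst nn_integral_cmult[symmetric]) (auto simp: ennreal_mult)
      also have "... \<le> (\<integral>\<^sup>+x. ennreal ((f x)\<^sup>2 + m\<^sup>2) \<partial>N)"
        using sum_squares_bound[of m "f x" for x]
        by (intro nn_integral_mono ennreal_leI) (simp add: add.commute)
      also have "... = (\<integral>\<^sup>+x. ennreal ((f x)\<^sup>2) \<partial>N) + ennreal (m\<^sup>2) * ennreal c"
        by (subst c(1)[symmetric]) (simp add: nn_integral_add)
      also have "... = ennreal (B + m\<^sup>2 * c)" using real c by (simp add: ennreal_mult)
      finally show ?thesis .
    qed
    have "(\<integral>\<^sup>+x. ennreal (f x) \<partial>N) < top"
    proof (rule ccontr)
      assume "\<not> ?thesis"
      then have "(\<integral>\<^sup>+x. ennreal (f x) \<partial>N) = top" by (simp add: less_top[symmetric])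
      then show False using key[of 1] by (simp add: ennreal_mult_top top_unique)
    qed
    then obtain A where A: "(\<integral>\<^sup>+x. ennreal (f x) \<partial>N) = ennreal A" "A \<ge> 0"
      by (cases "(\<integral>\<^sup>+x. ennreal (f x) \<partial>N)") auto
    have "ennreal (2 * (A / c) * A) \<le> ennreal (B + (A / c)\<^sup>2 * c)"
      using key[of "A / c"] A c0 by (simp add: ennreal_mult'[symmetric])
    then have "2 * (A / c) * A \<le> B + (A / c)\<^sup>2 * c" using real A c0 by (subst (asm) ennreal_le_iff) auto
    then have "A\<^sup>2 \<le> c * B" using c0 by (simp add: power2_eq_square field_simps)
    then show ?thesis using A real c by (simp add: ennreal_power ennreal_mult[symmetric] ennreal_leI)
  qed (use c0 in \<open>simp add: ennreal_mult_top\<close>)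
qed

lemma norm_set_integral_square_le:
  fixes m :: "real \<Rightarrow> 'b::{banach, second_countable_topology}"
  assumes st: "s \<le> t" and m: "m \<in> borel_measurable (restrict_space lborel {s..t})"
  shows "ennreal ((norm (LBINT r:{s..t}. m r))\<^sup>2) \<le> ennreal (t - s) * sqn (restrict_space lborel {s..t}) m"
proof -
  let ?N = "restrict_space lborel {s..t}"
  have "ennreal (norm (LBINT r:{s..t}. m r)) \<le> (\<integral>\<^sup>+r. ennreal (norm (m r)) \<partial>?N)"
  proof -
    have eq: "(LBINT r:{s..t}. m r) = (\<integral>r. m r \<partial>?N)"
      by (simp add: set_lebesgue_integral_def integral_restrict_space)
    \<comment> \<open>If \<open>m\<close> is not integrable, its Bochner integral is 0 by convention
      and the bound is trivial.\<close>
    show ?thesis unfolding eq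
      by (cases "integrable ?N m") (auto intro: integral_norm_bound_ennreal simp: not_integrable_integral_eq)
  qed
  then have "(ennreal (norm (LBINT r:{s..t}. m r)))\<^sup>2 \<le> (\<integral>\<^sup>+r. ennreal (norm (m r)) \<partial>?N)\<^sup>2"
    by (rule power_mono) simp
  also have "... \<le> ennreal (t - s) * (\<integral>\<^sup>+r. ennreal ((norm (m r))\<^sup>2) \<partial>?N)"
    using st m by (intro nn_integral_square_le) (auto simp: emeasure_restrict_space)
  finally show ?thesis by (simp add: sqn_def ennreal_power)
qed

section \<open>Processes on a time interval\<close>

context prob_space
begin

abbreviation TM :: "real \<Rightarrow> real \<Rightarrow> real measure" where
  "TM s t \<equiv> restrict_space lborel {s..t}"

abbreviation PM :: "real \<Rightarrow> real \<Rightarrow> (real \<times> 'a) measure" where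
  "PM s t \<equiv> TM s t \<Otimes>\<^sub>M M"

text \<open>Joint measurability in time and \<omega> for the full \<sigma>-algebra of
  \<open>M\<close>; adaptedness is tracked separately through \<open>F\<close>. The companion
  \<open>psq\<close> is the squared L2 norm for dt times P.\<close>

definition jm :: "real \<Rightarrow> real \<Rightarrow> (real \<Rightarrow> 'a \<Rightarrow> 'b::topological_space) \<Rightarrow> bool" where
  "jm s t H \<longleftrightarrow> (\<lambda>z. H (fst z) (snd z)) \<in> borel_measurable (PM s t)"

definition psq :: "real \<Rightarrow> real \<Rightarrow> (real \<Rightarrow> 'a \<Rightarrow> 'b::real_normed_vector) \<Rightarrow> ennreal" where
  "psq s t H = sqn (PM s t) (\<lambda>z. H (fst z) (snd z))"

lemma sigma_finite_TM: "sigma_finite_measure (TM s t)"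
  by (rule sigma_finite_measure_restrict_space) (auto intro: sigma_finite_lborel)

lemma jmD: "jm s t H \<Longrightarrow> (\<lambda>z. H (fst z) (snd z)) \<in> borel_measurable (PM s t)"
  by (simp add: jm_def)

lemma space_PM: "space (PM s t) = {s..t} \<times> space M"
  by (simp add: space_pair_measure space_restrict_space)

lemma jm_sub:
  assumes "jm s t H" "s \<le> s'" "t' \<le> t"
  shows "jm s' t' H"
proof -
  have "(\<lambda>r. r) \<in> measurable (TM s' t') (TM s t)"
    using assms(2,3) by (intro measurable_restrict_space3) auto
  then have "(\<lambda>z. (fst z, snd z)) \<in> measurable (PM s' t') (PM s t)"
    by (intro measurable_Pair measurable_compose[OF measurable_fst]) auto
  from measurable_compose[OF this assms(1)[unfolded jm_def]] show ?thesis by (simp add: jm_def)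
qed

lemma jm_section:
  assumes "jm s t H" "r \<in> {s..t}"
  shows "H r \<in> borel_measurable M"
proof -
  have "(\<lambda>w. (r, w)) \<in> measurable M (PM s t)" using assms(2) by (intro measurable_Pair1') simp
  from measurable_compose[OF this assms(1)[unfolded jm_def]] show ?thesis by simp
qed

lemma jm_path:
  assumes "jm s t H" "w \<in> space M"
  shows "(\<lambda>r. H r w) \<in> borel_measurable (TM s t)"
proof -
  have "(\<lambda>r. (r, w)) \<in> measurable (TM s t) (PM s t)" using assms(2) by (intro measurable_Pair2') simp
  from measurable_compose[OF this assms(1)[unfolded jm_def]] show ?thesis by simp
qed

lemma jm_const: "h \<in> borel_measurable M \<Longrightarrow> jm s t (\<lambda>_. h)"
  unfolding jm_def by (rule measurable_compose[OF measurable_snd])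

lemma jm_time: "h \<in> borel_measurable borel \<Longrightarrow> jm s t (\<lambda>r _. h r)"
  unfolding jm_def
  by (rule measurable_compose[OF measurable_fst]) (simp add: measurable_restrict_space1)

lemma jm_comp:
  assumes "jm s t H" "h \<in> borel_measurable borel"
  shows "jm s t (\<lambda>r w. h (H r w))"
  using measurable_compose[OF assms(1)[unfolded jm_def] assms(2)] by (simp add: jm_def)

lemma jm_comp_pair:
  fixes X :: "real \<Rightarrow> 'a \<Rightarrow> 'b::second_countable_topology" and Y :: "real \<Rightarrow> 'a \<Rightarrow> 'c::second_countable_topology"
  assumes "jm s t X" "jm s t Y" "h \<in> borel_measurable borel"
  shows "jm s t (\<lambda>r w. h (X r w, Y r w))"
proof -
  have "(\<lambda>z. (X (fst z) (snd z), Y (fst z) (snd z))) \<in> borel_measurable (PM s t)"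
    using assms(1,2) unfolding jm_def by (rule borel_measurable_Pair)
  from measurable_compose[OF this assms(3)] show ?thesis by (simp add: jm_def)
qed

lemma jm_add:
  fixes H G :: "real \<Rightarrow> 'a \<Rightarrow> 'b::{real_normed_vector, second_countable_topology}"
  shows "jm s t H \<Longrightarrow> jm s t G \<Longrightarrow> jm s t (\<lambda>r w. H r w + G r w)"
  unfolding jm_def by (rule borel_measurable_add)

lemma jm_diff:
  fixes H G :: "real \<Rightarrow> 'a \<Rightarrow> 'b::{real_normed_vector, second_countable_topology}"
  shows "jm s t H \<Longrightarrow> jm s t G \<Longrightarrow> jm s t (\<lambda>r w. H r w - G r w)"
  unfolding jm_def by (rule borel_measurable_diff)

lemma jm_scaleR:
  fixes H :: "real \<Rightarrow> 'a \<Rightarrow> 'b::{real_normed_vector, second_countable_topology}"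
  shows "jm s t H \<Longrightarrow> jm s t (\<lambda>r w. c *\<^sub>R H r w)"
  unfolding jm_def by (intro borel_measurable_scaleR borel_measurable_const)

lemma jm_cong:
  assumes "\<And>r w. r \<in> {s..t} \<Longrightarrow> w \<in> space M \<Longrightarrow> H r w = G r w"
  shows "jm s t H \<longleftrightarrow> jm s t G"
  unfolding jm_def by (rule measurable_cong) (auto simp: space_PM assms)

lemma psq_fst:
  assumes "jm s t H"
  shows "psq s t H = (\<integral>\<^sup>+r\<in>{s..t}. sqn M (H r) \<partial>lborel)"
proof -
  have "psq s t H = (\<integral>\<^sup>+r. (\<integral>\<^sup>+w. ennreal ((norm (H r w))\<^sup>2) \<partial>M) \<partial>TM s t)"
    unfolding psq_def sqn_def using jmD[OF assms]
    by (subst nn_integral_fst[symmetric]) (auto intro!: measurable_compose[OF _ measurable_ennreal])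
  then show ?thesis by (simp add: nn_integral_restrict_space sqn_def)
qed

lemma psq_snd:
  assumes "jm s t H"
  shows "psq s t H = (\<integral>\<^sup>+w. sqn (TM s t) (\<lambda>r. H r w) \<partial>M)"
proof -
  interpret T: sigma_finite_measure "TM s t" by (rule sigma_finite_TM)
  interpret P: pair_sigma_finite "TM s t" M ..
  have "(\<lambda>z. ennreal ((norm (H (fst z) (snd z)))\<^sup>2)) \<in> borel_measurable (PM s t)"
    using jmD[OF assms] by (auto intro!: measurable_compose[OF _ measurable_ennreal])
  then show ?thesis
    unfolding psq_def sqn_def by (subst P.nn_integral_snd[symmetric]) (auto simp: case_prod_beta)
qed

lemma psq_eq_iterated:
  assumes "jm s t H"
  shows "psq s t H = (\<integral>\<^sup>+w. (\<integral>\<^sup>+r\<in>{s..t}. ennreal ((norm (H r w))\<^sup>2) \<partial>lborel) \<partial>M)"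
  unfolding psq_snd[OF assms] by (simp add: sqn_def nn_integral_restrict_space)

lemma sqn_section_measurable:
  assumes "jm s t H"
  shows "(\<lambda>r. sqn M (H r)) \<in> borel_measurable (TM s t)"
proof -
  have "(\<lambda>z. ennreal ((norm (H (fst z) (snd z)))\<^sup>2)) \<in> borel_measurable (PM s t)"
    using jmD[OF assms] by (auto intro!: measurable_compose[OF _ measurable_ennreal])
  from borel_measurable_nn_integral_fst[OF this] show ?thesis by (simp add: sqn_def)
qed

lemma psq_cong:
  assumes "\<And>r w. r \<in> {s..t} \<Longrightarrow> w \<in> space M \<Longrightarrow> H r w = G r w"
  shows "psq s t H = psq s t G"
  unfolding psq_def by (rule sqn_cong) (auto simp: space_PM assms)

lemma psq_mono:
  assumes "\<And>r w. r \<in> {s..t} \<Longrightarrow> w \<in> space M \<Longrightarrow> norm (H r w) \<le> norm (G r w)"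
  shows "psq s t H \<le> psq s t G"
  unfolding psq_def by (rule sqn_mono) (auto simp: space_PM assms)

lemma psq_interval_mono:
  assumes "jm s t H" "s \<le> s'" "t' \<le> t"
  shows "psq s' t' H \<le> psq s t H"
  unfolding psq_fst[OF assms(1)] psq_fst[OF jm_sub[OF assms]]
  using assms(2,3) by (intro nn_integral_mono) (auto split: split_indicator)

lemma psq_le:
  assumes "jm s t H" "s \<le> t" "\<And>r. r \<in> {s..t} \<Longrightarrow> sqn M (H r) \<le> C"
  shows "psq s t H \<le> ennreal (t - s) * C"
proof -
  have "psq s t H \<le> (\<integral>\<^sup>+r\<in>{s..t}. C \<partial>lborel)"
    unfolding psq_fst[OF assms(1)] by (intro nn_integral_mono) (auto split: split_indicator simp: assms(3))
  also have "... = ennreal (t - s) * C"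
    using assms(2) by (simp add: nn_integral_cmult_indicator mult.commute)
  finally show ?thesis .
qed

lemma measurable_time_integral:
  fixes H :: "real \<Rightarrow> 'a \<Rightarrow> 'b::{banach, second_countable_topology}"
  assumes "jm s t H"
  shows "(\<lambda>w. LBINT r:{s..t}. H r w) \<in> borel_measurable M"
proof -
  interpret T: sigma_finite_measure "TM s t" by (rule sigma_finite_TM)
  have "(\<lambda>z. H (snd z) (fst z)) \<in> borel_measurable (M \<Otimes>\<^sub>M TM s t)"
    using measurable_compose[OF measurable_pair_swap' jmD[OF assms]] by (simp add: case_prod_beta)
  then have "(\<lambda>w. \<integral>r. H r w \<partial>TM s t) \<in> borel_measurable M"
    by (intro T.borel_measurable_lebesgue_integral) (simp add: case_prod_beta)
  then show ?thesis by (simp add: set_lebesgue_integral_def integral_restrict_space)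
qed

lemma sqn_time_integral_le:
  fixes H :: "real \<Rightarrow> 'a \<Rightarrow> 'b::{banach, second_countable_topology}"
  assumes "jm s t H" "s \<le> t"
  shows "sqn M (\<lambda>w. LBINT r:{s..t}. H r w) \<le> ennreal (t - s) * psq s t H"
proof -
  interpret T: sigma_finite_measure "TM s t" by (rule sigma_finite_TM)
  have m: "(\<lambda>w. sqn (TM s t) (\<lambda>r. H r w)) \<in> borel_measurable M"
  proof -
    have "(\<lambda>z. H (snd z) (fst z)) \<in> borel_measurable (M \<Otimes>\<^sub>M TM s t)"
      using measurable_compose[OF measurable_pair_swap' jmD[OF assms(1)]] by (simp add: case_prod_beta)
    then have "(\<lambda>z. ennreal ((norm (H (snd z) (fst z)))\<^sup>2)) \<in> borel_measurable (M \<Otimes>\<^sub>M TM s t)"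
      by (auto intro!: measurable_compose[OF _ measurable_ennreal])
    from T.borel_measurable_nn_integral_fst[OF this] show ?thesis by (simp add: sqn_def)
  qed
  have "sqn M (\<lambda>w. LBINT r:{s..t}. H r w) \<le> (\<integral>\<^sup>+w. ennreal (t - s) * sqn (TM s t) (\<lambda>r. H r w) \<partial>M)"
    unfolding sqn_def[of M] by (intro nn_integral_mono norm_set_integral_square_le assms jm_path[OF assms(1)])
  also have "... = ennreal (t - s) * psq s t H"
    unfolding psq_snd[OF assms(1)] by (rule nn_integral_cmult[OF m])
  finally show ?thesis .
qed

end

section \<open>Brownian increments\<close>

lemma space_generated_filtration [simp]: "space (generated_filtration M V t) = space M"
  by (simp add: generated_filtration_def space_measure_of_conv)

lemma sets_generated_filtration:
  "sets (generated_filtration M V t) =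
     sigma_sets (space M) {V s -` A \<inter> space M | s A. s \<in> {0..t} \<and> A \<in> sets borel}"
  unfolding generated_filtration_def by (rule sets_measure_of) auto

lemma generated_filtration_measurable:
  "s \<in> {0..t} \<Longrightarrow> V s \<in> borel_measurable (generated_filtration M V t)"
  by (rule measurableI) (auto simp: sets_generated_filtration intro!: sigma_sets.Basic)

lemma sets_generated_filtration_mono:
  "s \<le> t \<Longrightarrow> sets (generated_filtration M V s) \<subseteq> sets (generated_filtration M V t)"
  unfolding sets_generated_filtration by (rule sigma_sets_mono') fastforce

lemma sets_generated_filtration_subset:
  assumes "\<And>s. s \<in> {0..t} \<Longrightarrow> V s \<in> borel_measurable N" "space N = space M"
  shows "sets (generated_filtration M V t) \<subseteq> sets N"
  unfolding sets_generated_filtration assms(2)[symmetric]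
  by (rule sets.sigma_sets_subset) (use assms(1) in \<open>auto intro: measurable_sets\<close>)

locale brownian_setting = prob_space M for M :: "'w measure" +
  fixes T :: real and W :: "real \<Rightarrow> 'w \<Rightarrow> real ^ 'd" and \<xi> :: "'w \<Rightarrow> real ^ 'd" and F :: "real \<Rightarrow> 'w measure"
  assumes T_pos: "T > 0" and BM: "brownian_motion M T W" and xi_measurable: "\<xi> \<in> borel_measurable M"
    and xi_indep: "indep_of_path M \<xi> T W" and F_def: "F = generated_filtration M (\<lambda>t w. W t w + \<xi> w)"
begin

lemma W_measurable: "t \<in> {0..T} \<Longrightarrow> W t \<in> borel_measurable M"
  using BM by (auto simp: brownian_motion_def)

lemma space_F [simp]: "space (F t) = space M"
  by (simp add: F_def)

lemma F_mono: "s \<le> t \<Longrightarrow> sets (F s) \<subseteq> sets (F t)"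
  unfolding F_def by (rule sets_generated_filtration_mono)

lemma F_subset: "t \<le> T \<Longrightarrow> sets (F t) \<subseteq> sets M"
  unfolding F_def using W_measurable xi_measurable
  by (intro sets_generated_filtration_subset borel_measurable_add) auto

lemma measurable_F_mono: "f \<in> measurable (F s) N \<Longrightarrow> s \<le> t \<Longrightarrow> f \<in> measurable (F t) N"
  using F_mono[of s t] by (auto simp: measurable_def)

lemma measurable_F: "f \<in> measurable (F t) N \<Longrightarrow> t \<le> T \<Longrightarrow> f \<in> measurable M N"
  using F_subset[of t] by (auto simp: measurable_def)

lemma increment_F_measurable:
  assumes "0 \<le> s" "s \<le> t"
  shows "(\<lambda>w. W t w - W s w) \<in> borel_measurable (F t)"
proof -
  have "(\<lambda>w. (W t w + \<xi> w) - (W s w + \<xi> w)) \<in> borel_measurable (F t)"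
    unfolding F_def using assms by (intro borel_measurable_diff generated_filtration_measurable) auto
  then show ?thesis by simp
qed

lemma increment_measurable:
  "0 \<le> s \<Longrightarrow> s \<le> t \<Longrightarrow> t \<le> T \<Longrightarrow> (\<lambda>w. W t w - W s w) \<in> borel_measurable M"
  by (intro borel_measurable_diff W_measurable) auto

lemma increment_indep_filtration:
  assumes st: "0 \<le> s" "s < t" "t \<le> T"
  shows "indep_set (sets (F s)) (sigma_sets (space M) {(\<lambda>w. W t w - W s w) -` A \<inter> space M | A. A \<in> sets borel})"
proof -
  let ?D = "\<lambda>w. W t w - W s w"
  let ?FW = "generated_filtration M W"
  let ?\<D> = "{?D -` A \<inter> space M | A. A \<in> sets borel}"
  let ?X = "{\<xi> -` A \<inter> space M | A. A \<in> sets borel}"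
  define \<G> where "\<G> = {(\<xi> -` A \<inter> space M) \<inter> B | A B. A \<in> sets borel \<and> B \<in> sets (?FW s)}"
  have FWM: "sets (?FW r) \<subseteq> sets M" if "r \<le> T" for r
    using that W_measurable by (intro sets_generated_filtration_subset) auto
  have xiM: "\<xi> -` A \<inter> space M \<in> sets M" if "A \<in> sets borel" for A
    using xi_measurable that by (rule measurable_sets)
  have DFW: "?D -` A \<inter> space M \<in> sets (?FW T)" if "A \<in> sets borel" for A
  proof -
    have "?D \<in> borel_measurable (?FW T)"
      using st by (intro borel_measurable_diff generated_filtration_measurable) auto
    from measurable_sets[OF this that] show ?thesis by simp
  qed
  have i1: "indep_set ?X (sets (?FW T))" using xi_indep by (simp add: indep_of_path_def)
  have i2: "indep_set ?\<D> (sets (?FW s))" using BM st by (simp add: brownian_motion_def indep_of_path_def)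
  have "indep_set \<G> ?\<D>"
  proof (rule indep_setI)
    show "\<G> \<subseteq> events" using xiM FWM[of s] st by (auto simp: \<G>_def)
    show "?\<D> \<subseteq> events" using DFW FWM[of T] by auto
    fix a b assume "a \<in> \<G>" "b \<in> ?\<D>"
    then obtain A B C where AB: "a = (\<xi> -` A \<inter> space M) \<inter> B" "A \<in> sets borel" "B \<in> sets (?FW s)"
      and C: "b = ?D -` C \<inter> space M" "C \<in> sets borel" by (auto simp: \<G>_def)
    have B: "B \<in> sets (?FW T)" using AB(3) sets_generated_filtration_mono[of s T M W] st by auto
    \<comment> \<open>Both \<open>B\<close> and \<open>b\<close> are events of the path of
      \<open>W\<close> up to \<open>T\<close>, so \<xi> splits off first; only then is
      \<open>b\<close> separated from \<open>B\<close>, and finally \<open>B\<close> is joined with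
      \<xi> again.\<close>
    have "prob (a \<inter> b) = prob ((\<xi> -` A \<inter> space M) \<inter> (B \<inter> b))" by (simp add: AB Int_assoc)
    also have "... = prob (\<xi> -` A \<inter> space M) * prob (B \<inter> b)"
      using B DFW[OF C(2)] C AB by (intro indep_setD[OF i1]) auto
    also have "prob (B \<inter> b) = prob b * prob B"
      using indep_setD[OF i2, of b B] C AB by (auto simp: Int_commute)
    also have "prob (\<xi> -` A \<inter> space M) * (prob b * prob B) = prob a * prob b"
    proof -
      have "\<xi> -` A \<inter> space M \<in> ?X" using AB(2) by blast
      from indep_setD[OF i1 this B] show ?thesis by (simp add: AB(1))
    qed
    finally show "prob (a \<inter> b) = prob a * prob b" .
  qed
  moreover have "Int_stable \<G>"
  proof (rule Int_stableI)
    fix a b assume "a \<in> \<G>" "b \<in> \<G>"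
    then obtain A B A' B' where *: "a = (\<xi> -` A \<inter> space M) \<inter> B" "A \<in> sets borel" "B \<in> sets (?FW s)"
      "b = (\<xi> -` A' \<inter> space M) \<inter> B'" "A' \<in> sets borel" "B' \<in> sets (?FW s)" by (auto simp: \<G>_def)
    then have "a \<inter> b = (\<xi> -` (A \<inter> A') \<inter> space M) \<inter> (B \<inter> B')" by auto
    then show "a \<inter> b \<in> \<G>" using * unfolding \<G>_def by blast
  qed
  moreover have "Int_stable ?\<D>"
  proof (rule Int_stableI)
    fix a b assume "a \<in> ?\<D>" "b \<in> ?\<D>"
    then obtain A B where *: "a = ?D -` A \<inter> space M" "A \<in> sets borel" "b = ?D -` B \<inter> space M" "B \<in> sets borel" by auto
    then have "a \<inter> b = ?D -` (A \<inter> B) \<inter> space M" by auto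
    then show "a \<inter> b \<in> ?\<D>" using * by blast
  qed
  ultimately have ind: "indep_set (sigma_sets (space M) \<G>) (sigma_sets (space M) ?\<D>)"
    by (rule indep_set_sigma_sets)
  have "sets (F s) \<subseteq> sigma_sets (space M) \<G>"
  proof -
    have sub: "\<G> \<subseteq> Pow (space M)" by (auto simp: \<G>_def)
    let ?N = "sigma (space M) \<G>"
    have sN: "sets ?N = sigma_sets (space M) \<G>" using sub by (rule sets_measure_of)
    have spN: "space ?N = space M" using sub by (rule space_measure_of)
    have GI: "(\<xi> -` A \<inter> space M) \<inter> B \<in> sets ?N" if "A \<in> sets borel" "B \<in> sets (?FW s)" for A B
      unfolding sN by (rule sigma_sets.Basic) (use that in \<open>auto simp: \<G>_def\<close>)
    have "W r \<in> borel_measurable ?N" if "r \<in> {0..s}" for r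
    proof (rule measurableI)
      fix A :: "(real ^ 'd) set" assume A: "A \<in> sets borel"
      have "W r -` A \<inter> space M \<in> sets (?FW s)"
        using measurable_sets[OF generated_filtration_measurable[OF that, of W M] A] by simp
      from GI[OF _ this, of UNIV] show "W r -` A \<inter> space ?N \<in> sets ?N" by (simp add: spN Int_left_absorb Int_commute)
    qed (simp add: spN)
    moreover have "\<xi> \<in> borel_measurable ?N"
    proof (rule measurableI)
      fix A :: "(real ^ 'd) set" assume A: "A \<in> sets borel"
      from GI[OF this sets.top[of "?FW s"]] show "\<xi> -` A \<inter> space ?N \<in> sets ?N" by (simp add: spN)
    qed (simp add: spN)
    ultimately have "sets (F s) \<subseteq> sets ?N"
      unfolding F_def by (intro sets_generated_filtration_subset borel_measurable_add) (auto simp: spN)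
    then show ?thesis by (simp add: sN)
  qed
  then show ?thesis using ind unfolding indep_set_def
    by (elim indep_sets_mono_sets) (auto split: bool.split)
qed

lemma increment_indep_var:
  assumes st: "0 \<le> s" "s < t" "t \<le> T" and G: "G \<in> borel_measurable (F s)" and h: "h \<in> borel_measurable borel"
  shows "indep_var borel (G :: 'w \<Rightarrow> real) borel (\<lambda>w. h (W t w - W s w))"
proof -
  let ?D = "\<lambda>w. W t w - W s w"
  have D: "?D \<in> borel_measurable M" using st by (intro increment_measurable) auto
  show ?thesis
    unfolding indep_var_eq
  proof (intro conjI)
    show "random_variable borel G" using measurable_F[OF G] st by simp
    show "random_variable borel (\<lambda>w. h (?D w))" by (rule measurable_compose[OF D h])
    have 1: "sigma_sets (space M) {G -` A \<inter> space M |A. A \<in> sets borel} \<subseteq> sets (F s)"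
      using measurable_sets[OF G] sets.sigma_sets_subset[of "{G -` A \<inter> space M |A. A \<in> sets borel}" "F s"] by auto
    have "(\<lambda>w. h (?D w)) -` A \<inter> space M = ?D -` (h -` A) \<inter> space M" "h -` A \<in> sets borel"
      if "A \<in> sets borel" for A
      using measurable_sets[OF h that] by auto
    then have 2: "sigma_sets (space M) {(\<lambda>w. h (?D w)) -` A \<inter> space M |A. A \<in> sets borel}
      \<subseteq> sigma_sets (space M) {?D -` A \<inter> space M |A. A \<in> sets borel}"
      by (intro sigma_sets_mono') blast
    show "indep_set (sigma_sets (space M) {G -` A \<inter> space M |A. A \<in> sets borel})
       (sigma_sets (space M) {(\<lambda>w. h (?D w)) -` A \<inter> space M |A. A \<in> sets borel})"
      using increment_indep_filtration[OF st] unfolding indep_set_def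
      by (rule indep_sets_mono_sets) (use 1 2 in \<open>auto split: bool.split\<close>)
  qed
qed

lemma increment_moments:
  assumes st: "0 \<le> s" "s \<le> t" "t \<le> T"
  shows "integrable M (\<lambda>w. (W t w - W s w) $ i)"
    and "(\<integral>w. (W t w - W s w) $ i \<partial>M) = 0"
    and "integrable M (\<lambda>w. ((W t w - W s w) $ i)\<^sup>2)"
    and "(\<integral>w. ((W t w - W s w) $ i)\<^sup>2 \<partial>M) = t - s"
    and "integrable M (\<lambda>w. ((W t w - W s w) $ i) ^ 4)"
    and "(\<integral>w. ((W t w - W s w) $ i) ^ 4 \<partial>M) = 3 * (t - s)\<^sup>2"
proof -
  have "integrable M (\<lambda>w. (W t w - W s w) $ i) \<and> (\<integral>w. (W t w - W s w) $ i \<partial>M) = 0 \<and>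
    integrable M (\<lambda>w. ((W t w - W s w) $ i)\<^sup>2) \<and> (\<integral>w. ((W t w - W s w) $ i)\<^sup>2 \<partial>M) = t - s \<and>
    integrable M (\<lambda>w. ((W t w - W s w) $ i) ^ 4) \<and> (\<integral>w. ((W t w - W s w) $ i) ^ 4 \<partial>M) = 3 * (t - s)\<^sup>2"
  proof (cases "s = t")
    case False
    then have st': "s < t" using st by simp
    then have pos: "0 < sqrt (t - s)" by simp
    have D: "distributed M lborel (\<lambda>w. (W t w - W s w) $ i) (\<lambda>x. ennreal (normal_density 0 (sqrt (t - s)) x))"
      using BM st st' by (simp add: brownian_motion_def)
    have int: "integrable M (\<lambda>w. ((W t w - W s w) $ i) ^ k)" for k
      using distributed_integrable[OF D, of "\<lambda>x. x ^ k"] integrable_normal_moment[OF pos, of 0 k] by simp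
    have val: "(\<integral>w. ((W t w - W s w) $ i) ^ k \<partial>M) = (\<integral>x. normal_density 0 (sqrt (t - s)) x * (x - 0) ^ k \<partial>lborel)" for k
      using distributed_integral[OF D, of "\<lambda>x. x ^ k"] by simp
    have sq: "(sqrt (t - s))\<^sup>2 = t - s" using st by simp
    have "(\<integral>w. ((W t w - W s w) $ i) ^ (2 * 1) \<partial>M) = t - s"
      unfolding val integral_normal_moment_even[OF pos] sq by (simp add: fact_numeral)
    moreover have "(\<integral>w. ((W t w - W s w) $ i) ^ (2 * 2) \<partial>M) = 3 * (t - s)\<^sup>2"
      unfolding val integral_normal_moment_even[OF pos] sq by (simp add: fact_numeral power2_eq_square)
    moreover have "(\<integral>w. ((W t w - W s w) $ i) ^ (2 * 0 + 1) \<partial>M) = 0"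
      unfolding val integral_normal_moment_odd[OF pos] by simp
    ultimately show ?thesis using int[of 1] int[of 2] int[of 4] by simp
  qed simp
  then show "integrable M (\<lambda>w. (W t w - W s w) $ i)"
    and "(\<integral>w. (W t w - W s w) $ i \<partial>M) = 0"
    and "integrable M (\<lambda>w. ((W t w - W s w) $ i)\<^sup>2)"
    and "(\<integral>w. ((W t w - W s w) $ i)\<^sup>2 \<partial>M) = t - s"
    and "integrable M (\<lambda>w. ((W t w - W s w) $ i) ^ 4)"
    and "(\<integral>w. ((W t w - W s w) $ i) ^ 4 \<partial>M) = 3 * (t - s)\<^sup>2" by auto
qed

lemma borel_measurable_vec_nth' [measurable]: "(\<lambda>x :: 'b::euclidean_space ^ 'n. x $ i) \<in> borel_measurable borel"
  by (intro borel_measurable_continuous_onI continuous_intros)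

lemma increment_nth_measurable:
  "0 \<le> s \<Longrightarrow> s \<le> t \<Longrightarrow> t \<le> T \<Longrightarrow> (\<lambda>w. (W t w - W s w) $ i) \<in> borel_measurable M"
  by (rule measurable_compose[OF increment_measurable borel_measurable_vec_nth'])

lemma increment_covariance:
  assumes st: "0 \<le> s" "s \<le> t" "t \<le> T"
  shows "integrable M (\<lambda>w. (W t w - W s w) $ i * (W t w - W s w) $ j)"
    and "(\<integral>w. (W t w - W s w) $ i * (W t w - W s w) $ j \<partial>M) = (if i = j then t - s else 0)"
proof -
  have sq: "sqn M (\<lambda>w. (W t w - W s w) $ i) < top" for i
    using increment_moments(3)[OF st] increment_nth_measurable[OF st] by (simp add: sqn_finite_iff_integrable)
  show "integrable M (\<lambda>w. (W t w - W s w) $ i * (W t w - W s w) $ j)"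
    by (rule integrable_mult_sqn[OF increment_nth_measurable[OF st] increment_nth_measurable[OF st] sq sq])
  show "(\<integral>w. (W t w - W s w) $ i * (W t w - W s w) $ j \<partial>M) = (if i = j then t - s else 0)"
  proof (cases "i = j")
    case True
    then show ?thesis using increment_moments(4)[OF st, of i] by (simp add: power2_eq_square)
  next
    case False
    show ?thesis
    proof (cases "s = t")
      case ne: False
      then have "indep_vars (\<lambda>_. borel) (\<lambda>i w. (W t w - W s w) $ i) UNIV"
        using BM st by (auto simp: brownian_motion_def)
      then have "indep_vars (\<lambda>_. borel) (\<lambda>i w. (W t w - W s w) $ i) {i, j}"
        by (rule indep_vars_subset) simp
      from indep_vars_lebesgue_integral[OF _ this] increment_moments(1,2)[OF st] False
      show ?thesis by simp
    qed (simp add: False)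
  qed
qed

text \<open>Testing against all integrable \<open>F s\<close>-measurable \<open>G\<close> expresses
  that the conditional mean given \<open>F s\<close> is 0, without conditional expectations.\<close>

lemma increment_cond_mean:
  assumes st: "0 \<le> s" "s \<le> t" "t \<le> T" and G: "G \<in> borel_measurable (F s)" "integrable M G"
  shows "integrable M (\<lambda>w. G w * (W t w - W s w) $ i)"
    and "(\<integral>w. G w * (W t w - W s w) $ i \<partial>M) = 0"
proof -
  have "integrable M (\<lambda>w. G w * (W t w - W s w) $ i) \<and> (\<integral>w. G w * (W t w - W s w) $ i \<partial>M) = 0"
  proof (cases "s = t")
    case False
    then have "indep_var borel G borel (\<lambda>w. (W t w - W s w) $ i)"
      using st by (intro increment_indep_var G) auto
    from indep_var_integrable[OF this] indep_var_lebesgue_integral[OF this] increment_moments(1,2)[OF st, of i] G(2)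
    show ?thesis by simp
  qed simp
  then show "integrable M (\<lambda>w. G w * (W t w - W s w) $ i)"
    and "(\<integral>w. G w * (W t w - W s w) $ i \<partial>M) = 0" by auto
qed

lemma increment_cond_covariance:
  assumes st: "0 \<le> s" "s \<le> t" "t \<le> T" and G: "G \<in> borel_measurable (F s)" "integrable M G"
  shows "integrable M (\<lambda>w. G w * ((W t w - W s w) $ i * (W t w - W s w) $ j))"
    and "(\<integral>w. G w * ((W t w - W s w) $ i * (W t w - W s w) $ j) \<partial>M) = (if i = j then (t - s) * (\<integral>w. G w \<partial>M) else 0)"
proof -
  have "integrable M (\<lambda>w. G w * ((W t w - W s w) $ i * (W t w - W s w) $ j)) \<and>
    (\<integral>w. G w * ((W t w - W s w) $ i * (W t w - W s w) $ j) \<partial>M) = (if i = j then (t - s) * (\<integral>w. G w \<partial>M) else 0)"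
  proof (cases "s = t")
    case False
    then have "indep_var borel G borel (\<lambda>w. (\<lambda>v. v $ i * v $ j) (W t w - W s w))"
      using st by (intro increment_indep_var G) auto
    from indep_var_integrable[OF this] indep_var_lebesgue_integral[OF this] increment_covariance[OF st, of i j] G(2)
    show ?thesis by simp
  qed simp
  then show "integrable M (\<lambda>w. G w * ((W t w - W s w) $ i * (W t w - W s w) $ j))"
    and "(\<integral>w. G w * ((W t w - W s w) $ i * (W t w - W s w) $ j) \<partial>M) = (if i = j then (t - s) * (\<integral>w. G w \<partial>M) else 0)" by auto
qed

lemma increment_fourth_moment:
  assumes st: "0 \<le> s" "s \<le> t" "t \<le> T"
  shows "sqn M (\<lambda>w. (norm (W t w - W s w))\<^sup>2) \<le> ennreal (3 * real CARD('d) ^ 2 * (t - s)\<^sup>2)"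
proof -
  let ?D = "\<lambda>w. W t w - W s w"
  \<comment> \<open>Cauchy-Schwarz over the components; summing the fourth moments
    \<open>3 * (t - s)\<^sup>2\<close> of all components then produces the square of the
    dimension.\<close>
  have pt: "((norm v)\<^sup>2)\<^sup>2 \<le> real CARD('d) * (\<Sum>i\<in>UNIV. (v $ i) ^ 4)" for v :: "real ^ 'd"
  proof -
    have "(norm v)\<^sup>2 = (\<Sum>i\<in>UNIV. (v $ i)\<^sup>2)"
      by (simp add: norm_vec_def L2_set_def sum_nonneg)
    also have "(...)\<^sup>2 \<le> real CARD('d) * (\<Sum>i\<in>UNIV. ((v $ i)\<^sup>2)\<^sup>2)"
      using sum_squared_le_sum_of_squares[of "\<lambda>i. (v $ i)\<^sup>2" UNIV] by (simp only: mult.commute)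
    finally show ?thesis by simp
  qed
  have "sqn M (\<lambda>w. (norm (?D w))\<^sup>2) \<le> (\<integral>\<^sup>+w. ennreal (real CARD('d) * (\<Sum>i\<in>UNIV. (?D w $ i) ^ 4)) \<partial>M)"
    unfolding sqn_def using pt
    by (intro nn_integral_mono ennreal_leI) (simp del: vector_minus_component)
  also have "... = ennreal (\<integral>w. real CARD('d) * (\<Sum>i\<in>UNIV. (?D w $ i) ^ 4) \<partial>M)"
    using increment_moments(5)[OF st] by (intro nn_integral_eq_integral AE_I2 mult_nonneg_nonneg sum_nonneg) auto
  also have "(\<integral>w. real CARD('d) * (\<Sum>i\<in>UNIV. (?D w $ i) ^ 4) \<partial>M) = real CARD('d) * (\<Sum>i\<in>(UNIV :: 'd set). 3 * (t - s)\<^sup>2)"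
    using increment_moments(5,6)[OF st] by (simp add: Bochner_Integration.integral_sum)
  finally show ?thesis by (simp add: power2_eq_square mult_ac)
qed

end

section \<open>Elementary stochastic integrals\<close>

context brownian_setting
begin

type_synonym ('v, 'n) elementary = "real \<times> real \<times> ('v \<Rightarrow> real ^ 'n)"

text \<open>A triple is one step with value \<eta> on the left-open interval from \<open>a\<close>
  to \<open>b\<close>. Elementary integrands are arbitrary lists of such steps, possibly
  overlapping, so that sums are concatenations and no common refinement has to be formed.\<close>

definition elem :: "real \<Rightarrow> real \<Rightarrow> ('w, 'd) elementary \<Rightarrow> bool" where
  "elem s t x \<longleftrightarrow> (case x of (a, b, \<eta>) \<Rightarrow> s \<le> a \<and> a \<le> b \<and> b \<le> t \<and>
     \<eta> \<in> borel_measurable (F a) \<and> (\<exists>B. \<forall>w\<in>space M. norm (\<eta> w) \<le> B))"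

definition eint :: "('w, 'd) elementary \<Rightarrow> 'w \<Rightarrow> real" where
  "eint x w = (case x of (a, b, \<eta>) \<Rightarrow> \<eta> w \<bullet> (W b w - W a w))"

definition eproc :: "('w, 'd) elementary \<Rightarrow> real \<Rightarrow> 'w \<Rightarrow> real ^ 'd" where
  "eproc x r w = (case x of (a, b, \<eta>) \<Rightarrow> indicat_real {a<..b} r *\<^sub>R \<eta> w)"

definition lint :: "('w, 'd) elementary list \<Rightarrow> 'w \<Rightarrow> real" where
  "lint xs w = (\<Sum>x\<leftarrow>xs. eint x w)"

definition lproc :: "('w, 'd) elementary list \<Rightarrow> real \<Rightarrow> 'w \<Rightarrow> real ^ 'd" where
  "lproc xs r w = (\<Sum>x\<leftarrow>xs. eproc x r w)"

lemma integrable_if_sqn_finite: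
  fixes G :: "'w \<Rightarrow> real"
  assumes "G \<in> borel_measurable M" "sqn M G < top"
  shows "integrable M G"
  using integrable_mult_sqn[OF assms(1) borel_measurable_const[of 1] assms(2)] by (simp add: sqn_const emeasure_space_1)

lemma sqn_bounded:
  assumes "\<And>w. w \<in> space M \<Longrightarrow> norm (h w) \<le> B"
  shows "sqn M h \<le> ennreal (B\<^sup>2)"
proof -
  have "sqn M h \<le> sqn M (\<lambda>_. B)" using assms by (intro sqn_mono) force
  then show ?thesis by (simp add: sqn_const emeasure_space_1)
qed

lemma elem_measurable:
  assumes "elem s t (a, b, \<eta>)" "t \<le> T"
  shows "\<eta> \<in> borel_measurable M"
  using assms by (auto simp: elem_def intro: measurable_F)

lemma increment_sqn:
  assumes st: "0 \<le> s" "s \<le> t" "t \<le> T"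
  shows "sqn M (\<lambda>w. W t w - W s w) = ennreal (real CARD('d) * (t - s))"
proof -
  have n: "(norm v)\<^sup>2 = (\<Sum>i\<in>UNIV. (v $ i)\<^sup>2)" for v :: "real ^ 'd"
    by (simp add: norm_vec_def L2_set_def sum_nonneg)
  have "sqn M (\<lambda>w. W t w - W s w) = ennreal (\<integral>w. (\<Sum>i\<in>UNIV. ((W t w - W s w) $ i)\<^sup>2) \<partial>M)"
    unfolding sqn_def n using increment_moments(3)[OF st]
    by (intro nn_integral_eq_integral AE_I2 sum_nonneg) auto
  also have "(\<integral>w. (\<Sum>i\<in>UNIV. ((W t w - W s w) $ i)\<^sup>2) \<partial>M) = real CARD('d) * (t - s)"
    using increment_moments(3,4)[OF st] by (simp add: Bochner_Integration.integral_sum)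
  finally show ?thesis .
qed

lemma eint_measurable:
  assumes "elem s t x" "0 \<le> s" "t \<le> T"
  shows "eint x \<in> borel_measurable M"
proof (cases x)
  case (fields a b \<eta>)
  have "\<eta> \<in> borel_measurable M" using elem_measurable assms fields by blast
  moreover have "(\<lambda>w. W b w - W a w) \<in> borel_measurable M"
    using assms fields by (intro increment_measurable) (auto simp: elem_def)
  ultimately show ?thesis unfolding fields eint_def[abs_def] by simp
qed

lemma eint_F_measurable:
  assumes "elem s t x" "0 \<le> s"
  shows "eint x \<in> borel_measurable (F t)"
proof (cases x)
  case (fields a b \<eta>)
  have "\<eta> \<in> borel_measurable (F t)" using assms fields by (auto simp: elem_def intro: measurable_F_mono[of _ a])
  moreover have "(\<lambda>w. W b w - W a w) \<in> borel_measurable (F t)"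
    using assms fields by (intro measurable_F_mono[OF increment_F_measurable, of a b]) (auto simp: elem_def)
  ultimately show ?thesis unfolding fields eint_def[abs_def] by simp
qed

lemma eint_sqn_finite:
  assumes "elem s t x" "0 \<le> s" "t \<le> T"
  shows "sqn M (eint x) < top"
proof (cases x)
  case (fields a b \<eta>)
  obtain B where B: "\<And>w. w \<in> space M \<Longrightarrow> norm (\<eta> w) \<le> B" using assms fields by (auto simp: elem_def)
  have ab: "0 \<le> a" "a \<le> b" "b \<le> T" using assms fields by (auto simp: elem_def)
  have "sqn M (eint x) \<le> sqn M (\<lambda>w. B *\<^sub>R (W b w - W a w))"
  proof (rule sqn_mono)
    fix w assume "w \<in> space M"
    have "\<bar>\<eta> w \<bullet> (W b w - W a w)\<bar> \<le> norm (\<eta> w) * norm (W b w - W a w)" by (rule Cauchy_Schwarz_ineq2)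
    also have "... \<le> \<bar>B\<bar> * norm (W b w - W a w)" using B[OF \<open>w \<in> space M\<close>] by (intro mult_right_mono) auto
    finally show "norm (eint x w) \<le> norm (B *\<^sub>R (W b w - W a w))" by (simp add: fields eint_def)
  qed
  also have "... = ennreal (B\<^sup>2) * ennreal (real CARD('d) * (b - a))"
    using increment_measurable[OF ab] by (simp only: sqn_scale increment_sqn[OF ab])
  also have "... < top" by (simp add: ennreal_mult_less_top)
  finally show ?thesis .
qed

lemma eint_orthogonal:
  assumes G: "G \<in> borel_measurable (F s)" "integrable M G"
    and x: "elem s t x" and st: "0 \<le> s" "t \<le> T"
  shows "integrable M (\<lambda>w. G w * eint x w)" and "(\<integral>w. G w * eint x w \<partial>M) = 0"
proof -
  obtain a b \<eta> where xe: "x = (a, b, \<eta>)" by (cases x)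
  obtain B where B: "\<And>w. w \<in> space M \<Longrightarrow> norm (\<eta> w) \<le> B" using x xe by (auto simp: elem_def)
  have ab: "0 \<le> a" "a \<le> b" "b \<le> T" "s \<le> a" and eta: "\<eta> \<in> borel_measurable (F a)" using x xe st by (auto simp: elem_def)
  have Ga: "(\<lambda>w. G w * \<eta> w $ i) \<in> borel_measurable (F a)" for i
    using measurable_F_mono[OF G(1) ab(4)] measurable_compose[OF eta borel_measurable_vec_nth'] by simp
  have Gi: "integrable M (\<lambda>w. G w * \<eta> w $ i)" for i
  proof (rule Bochner_Integration.integrable_bound)
    show "integrable M (\<lambda>w. B * G w)" using G(2) by simp
    show "(\<lambda>w. G w * \<eta> w $ i) \<in> borel_measurable M" using measurable_F[OF Ga] ab by auto
    show "AE w in M. norm (G w * \<eta> w $ i) \<le> norm (B * G w)"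
    proof (rule AE_I2)
      fix w assume "w \<in> space M"
      then have "\<bar>\<eta> w $ i\<bar> \<le> \<bar>B\<bar>" using B[of w] component_le_norm_cart[of "\<eta> w" i] by linarith
      then show "norm (G w * \<eta> w $ i) \<le> norm (B * G w)"
        using mult_right_mono[of "\<bar>\<eta> w $ i\<bar>" "\<bar>B\<bar>" "\<bar>G w\<bar>"] by (simp add: abs_mult mult.commute)
    qed
  qed
  have eq: "G w * eint x w = (\<Sum>i\<in>UNIV. (G w * \<eta> w $ i) * (W b w - W a w) $ i)" for w
    by (simp add: xe eint_def inner_vec_def sum_distrib_left mult.assoc)
  note c = increment_cond_mean[OF ab(1-3) Ga Gi]
  show "integrable M (\<lambda>w. G w * eint x w)" unfolding eq by (intro Bochner_Integration.integrable_sum c)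
  show "(\<integral>w. G w * eint x w \<partial>M) = 0" unfolding eq
    by (subst Bochner_Integration.integral_sum) (auto simp del: vector_minus_component intro: c simp: c)
qed

lemma elem_subinterval:
  assumes "elem s t (a, b, \<eta>)" "a \<le> a'" "a' \<le> b'" "b' \<le> b"
  shows "elem a' b' (a', b', \<eta>)"
  using assms by (auto simp: elem_def intro: measurable_F_mono)

lemma elem_weaken: "elem s t x \<Longrightarrow> s' \<le> s \<Longrightarrow> t \<le> t' \<Longrightarrow> elem s' t' x"
  by (auto simp: elem_def)

lemma eint_product_disjoint:
  assumes x: "elem 0 T (a, b, \<eta>)" and y: "elem 0 T (c, d, \<eta>')" and bc: "b \<le> c"
  shows "(\<integral>w. eint (a, b, \<eta>) w * eint (c, d, \<eta>') w \<partial>M) = 0"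
proof -
  have "elem 0 c (a, b, \<eta>)" using x bc by (auto simp: elem_def)
  then have 1: "eint (a, b, \<eta>) \<in> borel_measurable (F c)" by (rule eint_F_measurable) simp
  have 2: "integrable M (eint (a, b, \<eta>))"
    by (intro integrable_if_sqn_finite eint_measurable[OF x] eint_sqn_finite[OF x]) auto
  have "elem c d (c, d, \<eta>')" "0 \<le> c" "d \<le> T" using y by (auto simp: elem_def)
  from eint_orthogonal(2)[OF 1 2 this] show ?thesis .
qed

lemma bounded_product_integrable:
  fixes \<eta> \<eta>' :: "'w \<Rightarrow> 'b::{real_inner, second_countable_topology}"
  assumes "\<eta> \<in> borel_measurable M" "\<eta>' \<in> borel_measurable M"
    and "\<exists>B. \<forall>w\<in>space M. norm (\<eta> w) \<le> B" "\<exists>B. \<forall>w\<in>space M. norm (\<eta>' w) \<le> B"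
  shows "integrable M (\<lambda>w. \<eta> w \<bullet> \<eta>' w)"
proof (rule integrable_inner_sqn[OF assms(1,2)])
  from assms(3) obtain B where "\<And>w. w \<in> space M \<Longrightarrow> norm (\<eta> w) \<le> B" by auto
  from sqn_bounded[of \<eta>, OF this] show "sqn M \<eta> < top" by (rule order_le_less_trans) auto
  from assms(4) obtain B where "\<And>w. w \<in> space M \<Longrightarrow> norm (\<eta>' w) \<le> B" by auto
  from sqn_bounded[of \<eta>', OF this] show "sqn M \<eta>' < top" by (rule order_le_less_trans) auto
qed

lemma eint_product_same:
  assumes x: "elem 0 T (a, b, \<eta>)" and y: "elem 0 T (a, b, \<eta>')"
  shows "(\<integral>w. eint (a, b, \<eta>) w * eint (a, b, \<eta>') w \<partial>M) = (b - a) * (\<integral>w. \<eta> w \<bullet> \<eta>' w \<partial>M)"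
proof -
  have ab: "0 \<le> a" "a \<le> b" "b \<le> T" and e: "\<eta> \<in> borel_measurable (F a)" and e': "\<eta>' \<in> borel_measurable (F a)"
    using x y by (auto simp: elem_def)
  obtain B where B: "\<And>w. w \<in> space M \<Longrightarrow> norm (\<eta> w) \<le> B" using x by (auto simp: elem_def)
  obtain B' where B': "\<And>w. w \<in> space M \<Longrightarrow> norm (\<eta>' w) \<le> B'" using y by (auto simp: elem_def)
  let ?D = "\<lambda>w. W b w - W a w"
  have G: "(\<lambda>w. \<eta> w $ i * \<eta>' w $ j) \<in> borel_measurable (F a)" for i j
    using measurable_compose[OF e borel_measurable_vec_nth'] measurable_compose[OF e' borel_measurable_vec_nth'] by simp
  have nth: "\<exists>B. \<forall>w\<in>space M. norm (h w $ i) \<le> B" if "\<And>w. w \<in> space M \<Longrightarrow> norm (h w) \<le> C" for h :: "'w \<Rightarrow> real ^ 'd" and C i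
  proof -
    have "norm (h w $ i) \<le> C" if "w \<in> space M" for w
      using \<open>\<And>w. w \<in> space M \<Longrightarrow> norm (h w) \<le> C\<close>[OF that] component_le_norm_cart[of "h w" i] by simp
    then show ?thesis by auto
  qed
  have "integrable M (\<lambda>w. \<eta> w $ i \<bullet> \<eta>' w $ j)" for i j
    using ab measurable_compose[OF measurable_F[OF e] borel_measurable_vec_nth'] measurable_compose[OF measurable_F[OF e'] borel_measurable_vec_nth']
    by (intro bounded_product_integrable nth[of \<eta> B] nth[of \<eta>' B'] B B') auto
  then have Gi: "integrable M (\<lambda>w. \<eta> w $ i * \<eta>' w $ j)" for i j by (simp add: mult.commute)
  note c = increment_cond_covariance[OF ab G Gi]
  have "eint (a, b, \<eta>) w * eint (a, b, \<eta>') w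
      = (\<Sum>i\<in>UNIV. \<Sum>j\<in>UNIV. (\<eta> w $ i * \<eta>' w $ j) * (?D w $ i * ?D w $ j))" for w
    unfolding eint_def inner_vec_def prod.case by (simp only: sum_product) (simp add: mult_ac)
  then have "(\<integral>w. eint (a, b, \<eta>) w * eint (a, b, \<eta>') w \<partial>M)
      = (\<integral>w. (\<Sum>i\<in>UNIV. \<Sum>j\<in>UNIV. (\<eta> w $ i * \<eta>' w $ j) * (?D w $ i * ?D w $ j)) \<partial>M)" by simp
  also have "... = (\<Sum>i\<in>UNIV. \<Sum>j\<in>UNIV. \<integral>w. (\<eta> w $ i * \<eta>' w $ j) * (?D w $ i * ?D w $ j) \<partial>M)"
    by (subst Bochner_Integration.integral_sum, intro Bochner_Integration.integrable_sum c(1))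
      (intro sum.cong refl Bochner_Integration.integral_sum c(1))
  also have "... = (\<Sum>i\<in>UNIV. \<Sum>j\<in>UNIV. (if i = j then (b - a) * (\<integral>w. \<eta> w $ i * \<eta>' w $ j \<partial>M) else 0))"
    by (simp only: c(2))
  also have "... = (\<Sum>i\<in>UNIV. (b - a) * (\<integral>w. \<eta> w $ i * \<eta>' w $ i \<partial>M))" by simp
  also have "... = (b - a) * (\<integral>w. \<eta> w \<bullet> \<eta>' w \<partial>M)"
    unfolding inner_vec_def using Gi by (simp add: sum_distrib_left Bochner_Integration.integral_sum)
  finally show ?thesis .
qed

lemma eint_mult_integrable:
  assumes x: "elem 0 T x" and y: "elem 0 T y"
  shows "integrable M (\<lambda>w. eint x w * eint y w)"
  using x y by (intro integrable_mult_sqn eint_measurable eint_sqn_finite) auto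

text \<open>Both steps are cut at \<open>c\<close> and at \<open>e = min b d\<close>. The common
  piece from \<open>c\<close> to \<open>e\<close> gives the isometry; in all other pairs the
  intervals do not overlap, so their products have mean 0.\<close>

lemma eint_product_ordered:
  assumes x: "elem 0 T (a, b, \<eta>)" and y: "elem 0 T (c, d, \<eta>')" and ac: "a \<le> c"
  shows "(\<integral>w. eint (a, b, \<eta>) w * eint (c, d, \<eta>') w \<partial>M) = max 0 (min b d - max a c) * (\<integral>w. \<eta> w \<bullet> \<eta>' w \<partial>M)"
proof (cases "b \<le> c")
  case True
  then show ?thesis using eint_product_disjoint[OF x y True] ac y by (simp add: max_def elem_def)
next
  case False
  define e where "e = min b d"
  have 0: "0 \<le> a" "c \<le> e" "e \<le> b" "e \<le> d" "c \<le> b" "c \<le> d" "b \<le> T" "d \<le> T" using False x y by (auto simp: elem_def e_def)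
  have sub: "elem 0 T (a', b', \<eta>)" if "a \<le> a'" "a' \<le> b'" "b' \<le> b" for a' b'
    using elem_weaken[OF elem_subinterval[OF x that], of 0 T] that 0 by auto
  have sub': "elem 0 T (a', b', \<eta>')" if "c \<le> a'" "a' \<le> b'" "b' \<le> d" for a' b'
    using elem_weaken[OF elem_subinterval[OF y that], of 0 T] that 0 ac by auto
  have ac_e: "elem 0 T (a, c, \<eta>)" and ce: "elem 0 T (c, e, \<eta>)" and eb: "elem 0 T (e, b, \<eta>)"
    and ce': "elem 0 T (c, e, \<eta>')" and ed': "elem 0 T (e, d, \<eta>')"
    using 0 ac by (auto intro!: sub sub')
  \<comment> \<open>As \<open>e\<close> is the smaller of \<open>b\<close> and \<open>d\<close>, one
    of these two end pieces is empty.\<close>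
  have zero: "(\<integral>w. eint (e, b, \<eta>) w * eint (e, d, \<eta>') w \<partial>M) = 0"
    by (cases "e = b") (auto simp: e_def min_def eint_def)
  have d3: "(\<integral>w. eint (e, b, \<eta>) w * eint (c, e, \<eta>') w \<partial>M) = 0"
    using eint_product_disjoint[OF ce' eb] by (simp add: mult.commute)
  have split: "eint (a, b, \<eta>) w = eint (a, c, \<eta>) w + (eint (c, e, \<eta>) w + eint (e, b, \<eta>) w)"
    "eint (c, d, \<eta>') w = eint (c, e, \<eta>') w + eint (e, d, \<eta>') w" for w
    using 0 ac by (simp_all add: eint_def inner_diff_right)
  have "(\<integral>w. eint (a, b, \<eta>) w * eint (c, d, \<eta>') w \<partial>M) =
    (\<integral>w. eint (a, c, \<eta>) w * eint (c, d, \<eta>') w + (eint (c, e, \<eta>) w * eint (c, e, \<eta>') w + eint (c, e, \<eta>) w * eint (e, d, \<eta>') w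
      + (eint (e, b, \<eta>) w * eint (c, e, \<eta>') w + eint (e, b, \<eta>) w * eint (e, d, \<eta>') w)) \<partial>M)"
    unfolding split(1) by (subst distrib_right) (simp only: split(2) distrib_left distrib_right add_ac)
  also have "... = (\<integral>w. eint (a, c, \<eta>) w * eint (c, d, \<eta>') w \<partial>M) + ((\<integral>w. eint (c, e, \<eta>) w * eint (c, e, \<eta>') w \<partial>M)
      + (\<integral>w. eint (c, e, \<eta>) w * eint (e, d, \<eta>') w \<partial>M)
      + ((\<integral>w. eint (e, b, \<eta>) w * eint (c, e, \<eta>') w \<partial>M) + (\<integral>w. eint (e, b, \<eta>) w * eint (e, d, \<eta>') w \<partial>M)))"
    by (simp add: eint_mult_integrable ac_e ce eb ce' ed' y)
  also have "... = (e - c) * (\<integral>w. \<eta> w \<bullet> \<eta>' w \<partial>M)"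
    using eint_product_disjoint[OF ac_e y] eint_product_same[OF ce ce'] eint_product_disjoint[OF ce ed'] d3 zero by simp
  finally show ?thesis using 0 ac by (simp add: e_def max_def)
qed

lemma eint_product:
  assumes x: "elem 0 T (a, b, \<eta>)" and y: "elem 0 T (c, d, \<eta>')"
  shows "(\<integral>w. eint (a, b, \<eta>) w * eint (c, d, \<eta>') w \<partial>M) = max 0 (min b d - max a c) * (\<integral>w. \<eta> w \<bullet> \<eta>' w \<partial>M)"
proof (cases "a \<le> c")
  case False
  then show ?thesis using eint_product_ordered[OF y x]
    by (simp add: mult.commute min.commute max.commute inner_commute)
qed (rule eint_product_ordered[OF x y])

text \<open>The polarised isometry in a form that is additive in both arguments, so that it has to be
  checked on single elements only.\<close>

definition covers :: "('w \<Rightarrow> real) \<Rightarrow> (real \<Rightarrow> 'w \<Rightarrow> real ^ 'd) \<Rightarrow> ('w \<Rightarrow> real) \<Rightarrow> (real \<Rightarrow> 'w \<Rightarrow> real ^ 'd) \<Rightarrow> bool" where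
  "covers f p g q \<longleftrightarrow> integrable M (\<lambda>w. f w * g w) \<and> (\<forall>r. integrable M (\<lambda>w. p r w \<bullet> q r w)) \<and>
     integrable lborel (\<lambda>r. \<integral>w. p r w \<bullet> q r w \<partial>M) \<and>
     (\<integral>w. f w * g w \<partial>M) = (\<integral>r. (\<integral>w. p r w \<bullet> q r w \<partial>M) \<partial>lborel)"

lemma covers_zero: "covers (\<lambda>_. 0) (\<lambda>_ _. 0) g q"
  by (simp add: covers_def)

lemma covers_commute: "covers f p g q \<Longrightarrow> covers g q f p"
  by (simp add: covers_def mult.commute inner_commute)

lemma covers_add:
  "covers f p g q \<Longrightarrow> covers f' p' g q \<Longrightarrow> covers (\<lambda>w. f w + f' w) (\<lambda>r w. p r w + p' r w) g q"
  by (simp add: covers_def distrib_right inner_add_left)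

lemma covers_elem:
  assumes x: "elem 0 T x" and y: "elem 0 T y"
  shows "covers (eint x) (eproc x) (eint y) (eproc y)"
proof -
  obtain a b \<eta> where xe: "x = (a, b, \<eta>)" by (cases x)
  obtain c d \<eta>' where ye: "y = (c, d, \<eta>')" by (cases y)
  have int: "integrable M (\<lambda>w. \<eta> w \<bullet> \<eta>' w)"
    using elem_measurable[OF x[unfolded xe]] elem_measurable[OF y[unfolded ye]] x y
    by (intro bounded_product_integrable) (auto simp: xe ye elem_def)
  have eq: "eproc x r w \<bullet> eproc y r w = indicat_real ({a<..b} \<inter> {c<..d}) r * (\<eta> w \<bullet> \<eta>' w)" for r w
    by (auto simp: xe ye eproc_def indicator_def)
  have I: "{a<..b} \<inter> {c<..d} = {max a c<..min b d}" by auto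
  have m: "measure lborel {max a c<..min b d} = max 0 (min b d - max a c)"
    by (cases "max a c \<le> min b d") auto
  have "integrable lborel (\<lambda>r. indicat_real {max a c<..min b d} r * (\<integral>w. \<eta> w \<bullet> \<eta>' w \<partial>M))"
    by (cases "max a c \<le> min b d") (auto intro!: integrable_mult_left integrable_real_indicator)
  then show ?thesis unfolding covers_def eq I
    using eint_mult_integrable[OF x y] eint_product[OF x[unfolded xe] y[unfolded ye]] int m
    by (simp add: xe ye)
qed

lemma covers_list:
  assumes "\<forall>x\<in>set xs. elem 0 T x" "\<forall>y\<in>set ys. elem 0 T y"
  shows "covers (lint xs) (lproc xs) (lint ys) (lproc ys)"
proof -
  have 1: "covers (lint xs) (lproc xs) (eint y) (eproc y)" if y: "elem 0 T y" for y
    using assms(1)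
  proof (induction xs)
    case Nil
    then show ?case using covers_zero by (simp add: lint_def[abs_def] lproc_def[abs_def])
  next
    case (Cons x xs)
    then show ?case using covers_add[OF covers_elem[of x, OF _ y] Cons.IH] by (simp add: lint_def[abs_def] lproc_def[abs_def])
  qed
  have "covers (lint ys) (lproc ys) (lint xs) (lproc xs)"
    using assms(2)
  proof (induction ys)
    case Nil
    then show ?case using covers_zero by (simp add: lint_def[abs_def] lproc_def[abs_def])
  next
    case (Cons y ys)
    then show ?case using covers_add[OF covers_commute[OF 1[of y]] Cons.IH] by (simp add: lint_def[abs_def] lproc_def[abs_def])
  qed
  then show ?thesis by (rule covers_commute)
qed

lemma lint_measurable:
  assumes "\<forall>x\<in>set xs. elem s t x" "0 \<le> s" "t \<le> T"
  shows "lint xs \<in> borel_measurable M"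
  using assms(1)
proof (induction xs)
  case (Cons x xs)
  then show ?case using eint_measurable[OF _ assms(2,3), of x] by (simp add: lint_def[abs_def])
qed (simp add: lint_def[abs_def])

lemma eproc_jm:
  assumes "elem s t x" "t \<le> T"
  shows "jm s' t' (eproc x)"
proof (cases x)
  case (fields a b \<eta>)
  have eta: "\<eta> \<in> borel_measurable M" using elem_measurable assms fields by blast
  have "jm s' t' (\<lambda>r w. (\<lambda>(c, v). c *\<^sub>R v) (indicat_real {a<..b} r, \<eta> w))"
    by (rule jm_comp_pair[OF jm_time jm_const[OF eta]])
      (auto intro!: borel_measurable_continuous_onI continuous_intros simp: case_prod_beta)
  then show ?thesis by (simp add: fields eproc_def[abs_def])
qed

lemma lproc_jm:
  assumes "\<forall>x\<in>set xs. elem s t x" "t \<le> T"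
  shows "jm s' t' (lproc xs)"
  using assms(1)
proof (induction xs)
  case (Cons x xs)
  then show ?case using jm_add[OF eproc_jm[OF _ assms(2), of s x] Cons.IH] by (simp add: lproc_def[abs_def])
qed (simp add: lproc_def[abs_def] jm_const)

lemma lproc_outside:
  assumes "\<forall>x\<in>set xs. elem s t x" "r \<notin> {s..t}"
  shows "lproc xs r w = 0"
  using assms(1)
proof (induction xs)
  case (Cons x xs)
  moreover have "eproc x r w = 0" using Cons.prems assms(2) by (cases x) (auto simp: eproc_def elem_def indicator_def)
  ultimately show ?case by (simp add: lproc_def)
qed (simp add: lproc_def)

lemma lint_isometry:
  assumes xs: "\<forall>x\<in>set xs. elem s t x" and st: "0 \<le> s" "t \<le> T"
  shows "sqn M (lint xs) = psq s t (lproc xs)" and "sqn M (lint xs) < top"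
proof -
  have xs': "\<forall>x\<in>set xs. elem 0 T x" using xs st by (auto intro: elem_weaken)
  note c = covers_list[OF xs' xs', unfolded covers_def]
  have m: "lint xs \<in> borel_measurable M" by (rule lint_measurable[OF xs st])
  have int: "integrable M (\<lambda>w. (norm (lint xs w))\<^sup>2)" using c by (simp add: power2_eq_square)
  have mr: "lproc xs r \<in> borel_measurable M" for r using jm_section[OF lproc_jm[OF xs st(2), of r r]] by simp
  have intr: "sqn M (lproc xs r) = ennreal (\<integral>w. lproc xs r w \<bullet> lproc xs r w \<partial>M)" for r
    using c by (subst sqn_eq_integral[OF mr]) (auto simp: sqn_finite_iff_integrable[OF mr] power2_norm_eq_inner)
  have "psq s t (lproc xs) = (\<integral>\<^sup>+r. sqn M (lproc xs r) \<partial>lborel)"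
    unfolding psq_fst[OF lproc_jm[OF xs st(2)]]
    by (intro nn_integral_cong) (auto split: split_indicator simp: lproc_outside[OF xs] sqn_def)
  also have "... = ennreal (\<integral>r. (\<integral>w. lproc xs r w \<bullet> lproc xs r w \<partial>M) \<partial>lborel)"
    unfolding intr using c by (intro nn_integral_eq_integral) auto
  also have "... = ennreal (\<integral>w. (norm (lint xs w))\<^sup>2 \<partial>M)"
    using c by (simp add: power2_eq_square)
  also have "... = sqn M (lint xs)"
    using int by (subst sqn_eq_integral[OF m]) (auto simp: sqn_finite_iff_integrable[OF m])
  finally show "sqn M (lint xs) = psq s t (lproc xs)" ..
  show "sqn M (lint xs) < top" using int by (simp add: sqn_finite_iff_integrable[OF m])
qed

lemma lint_orthogonal:
  assumes G: "G \<in> borel_measurable (F s)" "integrable M G"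
    and xs: "\<forall>x\<in>set xs. elem s t x" and st: "0 \<le> s" "t \<le> T"
  shows "integrable M (\<lambda>w. G w * lint xs w) \<and> (\<integral>w. G w * lint xs w \<partial>M) = 0"
  using xs
proof (induction xs)
  case (Cons x xs)
  then show ?case using eint_orthogonal[OF G _ st, of x] by (simp add: lint_def distrib_left)
qed (simp add: lint_def)

end

section \<open>The stochastic integral as a closed relation\<close>

lemma tendsto_zero_ennreal_bound:
  fixes f g :: "nat \<Rightarrow> ennreal"
  assumes "\<And>k. f k \<le> g k" "g \<longlonglongrightarrow> 0"
  shows "f \<longlonglongrightarrow> 0"
  by (rule tendsto_sandwich[OF _ _ tendsto_const assms(2)]) (auto simp: assms(1))

lemma tendsto_zero_ennreal_lin:
  fixes f g :: "nat \<Rightarrow> ennreal"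
  assumes "f \<longlonglongrightarrow> 0" "g \<longlonglongrightarrow> 0"
  shows "(\<lambda>k. ennreal a * f k + ennreal b * g k) \<longlonglongrightarrow> 0"
proof -
  have "(\<lambda>k. ennreal a * f k + ennreal b * g k) \<longlonglongrightarrow> ennreal a * 0 + ennreal b * 0"
    by (intro tendsto_add ennreal_tendsto_cmult assms) auto
  then show ?thesis by simp
qed

context brownian_setting
begin

text \<open>Closing the graph of the elementary integral in \<open>L\<^sup>2\<close> gives a relation that is linear and needs
  no path regularity.\<close>

definition ito_pair :: "real \<Rightarrow> real \<Rightarrow> (real \<Rightarrow> 'w \<Rightarrow> real ^ 'd) \<Rightarrow> ('w \<Rightarrow> real) \<Rightarrow> bool" where
  "ito_pair s t H J \<longleftrightarrow> jm s t H \<and> J \<in> borel_measurable M \<and>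
     (\<exists>xs. (\<forall>k. \<forall>x\<in>set (xs k). elem s t x) \<and>
        (\<lambda>k. psq s t (\<lambda>r w. lproc (xs k) r w - H r w)) \<longlonglongrightarrow> 0 \<and>
        (\<lambda>k. sqn M (\<lambda>w. lint (xs k) w - J w)) \<longlonglongrightarrow> 0)"

lemma ito_pair_measurable: "ito_pair s t H J \<Longrightarrow> J \<in> borel_measurable M"
  and ito_pair_jm: "ito_pair s t H J \<Longrightarrow> jm s t H"
  by (auto simp: ito_pair_def)

lemma ito_pair_cases:
  assumes "ito_pair s t H J" "0 \<le> s" "t \<le> T"
  obtains (approx) xs where "\<And>k. \<forall>x\<in>set (xs k). elem s t x"
    "(\<lambda>k. psq s t (\<lambda>r w. lproc (xs k) r w - H r w)) \<longlonglongrightarrow> 0"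
    "(\<lambda>k. sqn M (\<lambda>w. lint (xs k) w - J w)) \<longlonglongrightarrow> 0"
    "\<And>k. jm s t (lproc (xs k))" "\<And>k. lint (xs k) \<in> borel_measurable M" "jm s t H" "J \<in> borel_measurable M"
proof -
  obtain xs where xs: "\<forall>k. \<forall>x\<in>set (xs k). elem s t x"
    "(\<lambda>k. psq s t (\<lambda>r w. lproc (xs k) r w - H r w)) \<longlonglongrightarrow> 0"
    "(\<lambda>k. sqn M (\<lambda>w. lint (xs k) w - J w)) \<longlonglongrightarrow> 0"
    using assms(1) unfolding ito_pair_def by blast
  show ?thesis
    by (rule that[OF spec[OF xs(1)] xs(2,3) lproc_jm[OF spec[OF xs(1)] assms(3)] lint_measurable[OF spec[OF xs(1)] assms(2,3)]])
      (use assms(1) in \<open>simp_all add: ito_pair_def\<close>)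
qed

lemma lint_append: "lint (xs @ ys) w = lint xs w + lint ys w"
  and lproc_append: "lproc (xs @ ys) r w = lproc xs r w + lproc ys r w"
  by (simp_all add: lint_def lproc_def)

definition scale_elem :: "real \<Rightarrow> ('w, 'd) elementary \<Rightarrow> ('w, 'd) elementary" where
  "scale_elem c x = (case x of (a, b, \<eta>) \<Rightarrow> (a, b, \<lambda>w. c *\<^sub>R \<eta> w))"

lemma elem_scale: "elem s t x \<Longrightarrow> elem s t (scale_elem c x)"
proof (cases x)
  case (fields a b \<eta>)
  assume x: "elem s t x"
  then obtain B where B: "\<And>w. w \<in> space M \<Longrightarrow> norm (\<eta> w) \<le> B" by (auto simp: elem_def fields)
  have "norm (c *\<^sub>R \<eta> w) \<le> \<bar>c\<bar> * B" if "w \<in> space M" for w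
    using B[OF that] by (simp add: mult_left_mono)
  with x show ?thesis unfolding fields elem_def scale_elem_def by auto
qed

lemma lint_scale: "lint (map (scale_elem c) xs) w = c * lint xs w"
  by (induction xs) (auto simp: lint_def eint_def scale_elem_def algebra_simps split: prod.splits)

lemma lproc_scale: "lproc (map (scale_elem c) xs) r w = c *\<^sub>R lproc xs r w"
  by (induction xs) (auto simp: lproc_def eproc_def scale_elem_def algebra_simps split: prod.splits)

lemma ito_pair_add:
  assumes "ito_pair s t H J" "ito_pair s t H' J'" and st: "0 \<le> s" "t \<le> T"
  shows "ito_pair s t (\<lambda>r w. H r w + H' r w) (\<lambda>w. J w + J' w)"
proof -
  obtain xs ys where xs: "\<forall>k. \<forall>x\<in>set (xs k). elem s t x"
    "(\<lambda>k. psq s t (\<lambda>r w. lproc (xs k) r w - H r w)) \<longlonglongrightarrow> 0"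
    "(\<lambda>k. sqn M (\<lambda>w. lint (xs k) w - J w)) \<longlonglongrightarrow> 0"
    and ys: "\<forall>k. \<forall>x\<in>set (ys k). elem s t x"
    "(\<lambda>k. psq s t (\<lambda>r w. lproc (ys k) r w - H' r w)) \<longlonglongrightarrow> 0"
    "(\<lambda>k. sqn M (\<lambda>w. lint (ys k) w - J' w)) \<longlonglongrightarrow> 0"
    using assms(1,2) unfolding ito_pair_def by blast
  have jH: "jm s t H" "jm s t H'" and mJ: "J \<in> borel_measurable M" "J' \<in> borel_measurable M"
    using assms(1,2) by (auto simp: ito_pair_def)
  have jl: "jm s t (lproc (xs k))" "jm s t (lproc (ys k))" for k using lproc_jm xs(1) ys(1) st by blast+
  have ml: "lint (xs k) \<in> borel_measurable M" "lint (ys k) \<in> borel_measurable M" for k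
    using lint_measurable xs(1) ys(1) st by blast+
  have "(\<lambda>k. psq s t (\<lambda>r w. lproc (xs k @ ys k) r w - (H r w + H' r w))) \<longlonglongrightarrow> 0"
  proof (rule tendsto_zero_ennreal_bound[OF _ tendsto_zero_ennreal_lin[OF xs(2) ys(2), of 2 2]])
    fix k
    show "psq s t (\<lambda>r w. lproc (xs k @ ys k) r w - (H r w + H' r w))
      \<le> ennreal 2 * psq s t (\<lambda>r w. lproc (xs k) r w - H r w) + ennreal 2 * psq s t (\<lambda>r w. lproc (ys k) r w - H' r w)"
      unfolding psq_def lproc_append
      using sqn_add_le[OF jmD[OF jm_diff[OF jl(1) jH(1)]] jmD[OF jm_diff[OF jl(2) jH(2)]], of k k]
      by (simp add: algebra_simps)
  qed
  moreover have "(\<lambda>k. sqn M (\<lambda>w. lint (xs k @ ys k) w - (J w + J' w))) \<longlonglongrightarrow> 0"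
  proof (rule tendsto_zero_ennreal_bound[OF _ tendsto_zero_ennreal_lin[OF xs(3) ys(3), of 2 2]])
    fix k
    show "sqn M (\<lambda>w. lint (xs k @ ys k) w - (J w + J' w))
      \<le> ennreal 2 * sqn M (\<lambda>w. lint (xs k) w - J w) + ennreal 2 * sqn M (\<lambda>w. lint (ys k) w - J' w)"
      unfolding lint_append
      using sqn_add_le[OF borel_measurable_diff[OF ml(1) mJ(1)] borel_measurable_diff[OF ml(2) mJ(2)], of k k]
      by (simp add: algebra_simps)
  qed
  ultimately show ?thesis unfolding ito_pair_def using jm_add[OF jH] mJ xs(1) ys(1)
    by (intro conjI exI[of _ "\<lambda>k. xs k @ ys k"] borel_measurable_add) auto
qed

lemma ito_pair_scale:
  assumes "ito_pair s t H J" and st: "0 \<le> s" "t \<le> T"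
  shows "ito_pair s t (\<lambda>r w. c *\<^sub>R H r w) (\<lambda>w. c * J w)"
  using assms(1) st
proof (cases rule: ito_pair_cases)
  case xs: (approx xs)
  note jl = xs(4) and ml = xs(5) and jH = xs(6) and mJ = xs(7)
  have "psq s t (\<lambda>r w. lproc (map (scale_elem c) (xs k)) r w - c *\<^sub>R H r w) = ennreal (c\<^sup>2) * psq s t (\<lambda>r w. lproc (xs k) r w - H r w)" for k
    unfolding psq_def lproc_scale using sqn_scale[OF jmD[OF jm_diff[OF jl jH]], of c k]
    by (simp add: scaleR_diff_right)
  moreover have "sqn M (\<lambda>w. lint (map (scale_elem c) (xs k)) w - c * J w) = ennreal (c\<^sup>2) * sqn M (\<lambda>w. lint (xs k) w - J w)" for k
    unfolding lint_scale using sqn_scale[OF borel_measurable_diff[OF ml mJ], of c k] by (simp add: right_diff_distrib)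
  moreover have "\<forall>k. \<forall>x\<in>set (map (scale_elem c) (xs k)). elem s t x" using xs(1) elem_scale by auto
  moreover have "(\<lambda>k. ennreal (c\<^sup>2) * psq s t (\<lambda>r w. lproc (xs k) r w - H r w)) \<longlonglongrightarrow> 0"
    using tendsto_zero_ennreal_lin[OF xs(2) tendsto_const, of "c\<^sup>2" 0] by simp
  moreover have "(\<lambda>k. ennreal (c\<^sup>2) * sqn M (\<lambda>w. lint (xs k) w - J w)) \<longlonglongrightarrow> 0"
    using tendsto_zero_ennreal_lin[OF xs(3) tendsto_const, of "c\<^sup>2" 0] by simp
  ultimately show ?thesis unfolding ito_pair_def using jm_scaleR[OF jH] mJ
    by (intro conjI exI[of _ "\<lambda>k. map (scale_elem c) (xs k)"]) auto
qed

lemma ito_pair_diff: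
  assumes "ito_pair s t H J" "ito_pair s t H' J'" and st: "0 \<le> s" "t \<le> T"
  shows "ito_pair s t (\<lambda>r w. H r w - H' r w) (\<lambda>w. J w - J' w)"
  using ito_pair_add[OF assms(1) ito_pair_scale[OF assms(2) st, of "-1"] st] by simp

lemma ito_pair_isometry:
  assumes "ito_pair s t H J" and st: "0 \<le> s" "t \<le> T"
  shows "sqn M J = psq s t H"
  using assms(1) st
proof (cases rule: ito_pair_cases)
  case xs: (approx xs)
  note jl = xs(4) and ml = xs(5) and jH = xs(6) and mJ = xs(7)
  have iso: "sqn M (lint (xs k)) = psq s t (lproc (xs k))" for k using lint_isometry(1) xs(1) st by blast
  show ?thesis
  proof (rule antisym)
    show "sqn M J \<le> psq s t H" unfolding psq_def
      by (rule sqn_limit_le[OF ml mJ jmD[OF jl] jmD[OF jH] _ xs(3) xs(2)[unfolded psq_def]])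
        (simp add: iso psq_def)
    show "psq s t H \<le> sqn M J" unfolding psq_def
      by (rule sqn_limit_le[OF jmD[OF jl] jmD[OF jH] ml mJ _ xs(2)[unfolded psq_def] xs(3)])
        (simp add: iso psq_def)
  qed
qed

lemma ito_pair_finite:
  assumes "ito_pair s t H J" and st: "0 \<le> s" "t \<le> T"
  shows "sqn M J < top"
  using assms(1) st
proof (cases rule: ito_pair_cases)
  case xs: (approx xs)
  note ml = xs(5) and mJ = xs(7)
  have "\<forall>\<^sub>F k in sequentially. sqn M (\<lambda>w. lint (xs k) w - J w) < 1"
    using order_tendstoD(2)[OF xs(3), of 1] by simp
  then obtain k where k: "sqn M (\<lambda>w. lint (xs k) w - J w) < 1" by (auto simp: eventually_sequentially)
  have "sqn M (\<lambda>w. lint (xs k) w - (lint (xs k) w - J w)) \<le> 2 * sqn M (lint (xs k)) + 2 * sqn M (\<lambda>w. lint (xs k) w - J w)"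
    using ml mJ by (intro sqn_diff_le) auto
  also have "... < top"
    using lint_isometry(2)[of "xs k" s t] xs(1) st k
    by (auto simp: ennreal_mult_less_top intro: order_less_trans)
  finally show ?thesis by simp
qed

text \<open>Orthogonality holds for the approximating lists and survives the limit because
  \<open>G\<close> is fixed in L2 while the lists converge in L2.\<close>

lemma ito_pair_orthogonal:
  assumes "ito_pair s t H J" and st: "0 \<le> s" "s \<le> t" "t \<le> T" and G: "G \<in> borel_measurable (F s)" "sqn M G < top"
  shows "(\<integral>w. G w * J w \<partial>M) = 0"
  using assms(1) st(1,3)
proof (cases rule: ito_pair_cases)
  case xs: (approx xs)
  note ml = xs(5) and mJ = xs(7)
  have mG: "G \<in> borel_measurable M" using measurable_F[OF G(1)] st by auto
  have iG: "integrable M G" by (rule integrable_if_sqn_finite[OF mG G(2)])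
  have iJ: "integrable M (\<lambda>w. G w * J w)"
    by (rule integrable_mult_sqn[OF mG mJ G(2) ito_pair_finite[OF assms(1)]]) (use st in auto)
  have "(\<integral>w. G w * (lint (xs k) w - J w) \<partial>M) = - (\<integral>w. G w * J w \<partial>M)" for k
    using lint_orthogonal[OF G(1) iG, of "xs k" t] xs(1) st iJ by (simp add: right_diff_distrib)
  moreover have "(\<lambda>k. \<integral>w. G w * (lint (xs k) w - J w) \<partial>M) \<longlonglongrightarrow> 0"
    by (rule tendsto_integral_mult_sqn[OF mG _ G(2) xs(3)]) (use ml mJ in auto)
  ultimately have "(\<lambda>k::nat. - (\<integral>w. G w * J w \<partial>M)) \<longlonglongrightarrow> 0" by simp
  then show ?thesis by (simp add: LIMSEQ_const_iff)
qed

lemma ito_pair_elem: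
  assumes "elem s t x" "0 \<le> s" "t \<le> T"
  shows "ito_pair s t (eproc x) (eint x)"
  unfolding ito_pair_def using assms
  by (intro conjI exI[of _ "\<lambda>_. [x]"])
    (auto intro: eproc_jm eint_measurable simp: lint_def lproc_def psq_def)

text \<open>Steps live on left-open intervals, so elementary processes vanish at the left endpoint;
  that single time is a null set.\<close>

lemma psq_mono_except_left:
  assumes "jm s t H" "jm s t G" "\<And>r w. r \<in> {s<..t} \<Longrightarrow> w \<in> space M \<Longrightarrow> norm (H r w) \<le> norm (G r w)"
  shows "psq s t H \<le> psq s t G"
  unfolding psq_fst[OF assms(1)] psq_fst[OF assms(2)]
proof (rule nn_integral_mono_AE)
  show "AE r in lborel. sqn M (H r) * indicator {s..t} r \<le> sqn M (G r) * indicator {s..t} r"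
    using AE_lborel_singleton[of s]
  proof eventually_elim
    case (elim r)
    then show ?case using assms(3) by (cases "r \<in> {s..t}") (auto intro!: sqn_mono)
  qed
qed

lemma progressive_jm:
  assumes "progressive F a b H" "b \<le> T" "a \<le> b"
  shows "jm a b H"
proof -
  have "(\<lambda>(s, w). H s w) \<in> borel_measurable (restrict_space borel {a..b} \<Otimes>\<^sub>M F b)"
    using assms by (auto simp: progressive_def)
  moreover have "(\<lambda>z. (fst z, snd z)) \<in> measurable (PM a b) (restrict_space borel {a..b} \<Otimes>\<^sub>M F b)"
  proof (rule measurable_Pair)
    show "(\<lambda>z. fst z) \<in> measurable (PM a b) (restrict_space borel {a..b})"
      using measurable_fst[of "TM a b" M] measurable_cong_sets[OF refl sets_restrict_space_cong[OF sets_lborel]] by blast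
    have "(\<lambda>w. w) \<in> measurable M (F b)" using F_subset[OF assms(2)] by (auto simp: measurable_def)
    from measurable_compose[OF measurable_snd this]
    show "(\<lambda>z. snd z) \<in> measurable (PM a b) (F b)" .
  qed
  ultimately show ?thesis unfolding jm_def using measurable_compose by fastforce
qed

lemma progressive_section:
  assumes "progressive F a b H" "t \<in> {a..b}"
  shows "H t \<in> borel_measurable (F t)"
proof -
  have "(\<lambda>(s, w). H s w) \<in> borel_measurable (restrict_space borel {a..t} \<Otimes>\<^sub>M F t)"
    using assms by (auto simp: progressive_def)
  moreover have "(\<lambda>w. (t, w)) \<in> measurable (F t) (restrict_space borel {a..t} \<Otimes>\<^sub>M F t)"
    using assms(2) by (intro measurable_Pair1') simp
  ultimately have "(\<lambda>w. (\<lambda>(s, w). H s w) (t, w)) \<in> borel_measurable (F t)"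
    by (rule measurable_compose[rotated])
  then show ?thesis by simp
qed

text \<open>The integral over \<open>{s..t}\<close> has to be recovered from integrals started at
  \<open>a\<close>. The approximating steps are clamped to \<open>{s..t}\<close>: inside, the
  integrand is unchanged, and the clamped sum is the difference of the simple integrals at
  \<open>t\<close> and at \<open>s\<close>.\<close>

lemma ito_integral_imp_ito_pair:
  assumes I: "ito_integral M F W a b H I" and ab: "0 \<le> a" "b \<le> T" and st: "a \<le> s" "s \<le> t" "t \<le> b"
  shows "ito_pair s t H (\<lambda>w. I t w - I s w)"
proof -
  obtain m \<tau> \<eta> where simple: "\<And>k. simple_integrand F a b (m k) (\<tau> k) (\<eta> k)"
    and conv: "(\<lambda>k. \<integral>\<^sup>+w. (\<integral>\<^sup>+r\<in>{a..b}.
            ennreal ((norm (simple_process (m k) (\<tau> k) (\<eta> k) r w - H r w))\<^sup>2) \<partial>lborel) \<partial>M) \<longlonglongrightarrow> 0"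
    and lim: "\<And>t. t \<in> {a..b} \<Longrightarrow> (\<lambda>k. \<integral>\<^sup>+w.
            ennreal ((simple_integral W (m k) (\<tau> k) (\<eta> k) t w - I t w)\<^sup>2) \<partial>M) \<longlonglongrightarrow> 0"
    using I unfolding ito_integral_def by blast
  have progH: "progressive F a b H" using I by (auto simp: ito_integral_def square_integrable_process_def)
  have jH0: "jm a b H" using progressive_jm[OF progH] ab st by auto
  have jH: "jm s t H" using jm_sub[OF jH0] st by auto
  have mI: "I t \<in> borel_measurable M" "I s \<in> borel_measurable M" using I st by (auto simp: ito_integral_def)
  define cl where "cl x = max s (min t x)" for x
  \<comment> \<open>A step that starts after \<open>t\<close> is clamped to the empty step at
    \<open>t\<close>. Its coefficient is measurable only at the later time
    \<open>\<tau> k i\<close>, hence the replacement by 0.\<close>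
  define tr where "tr k i = (cl (\<tau> k i), cl (\<tau> k (Suc i)), if \<tau> k i > t then (\<lambda>_. 0) else \<eta> k i)" for k i
  define xs where "xs k = map (tr k) [0..<m k]" for k
  have tau: "a \<le> \<tau> k i" "\<tau> k i \<le> \<tau> k (Suc i)" "\<tau> k (Suc i) \<le> b" "\<eta> k i \<in> borel_measurable (F (\<tau> k i))"
    "\<exists>B. \<forall>w\<in>space M. norm (\<eta> k i w) \<le> B" if "i < m k" for k i
    using simple[of k] that by (auto simp: simple_integrand_def)
  have elem_tr: "elem s t (tr k i)" if "i < m k" for k i
  proof -
    have "\<eta> k i \<in> borel_measurable (F (cl (\<tau> k i)))" if "\<tau> k i \<le> t"
      by (rule measurable_F_mono[OF tau(4)[OF \<open>i < m k\<close>]]) (use that st in \<open>auto simp: cl_def\<close>)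
    moreover have "s \<le> cl (\<tau> k i)" "cl (\<tau> k i) \<le> cl (\<tau> k (Suc i))" "cl (\<tau> k (Suc i)) \<le> t"
      using tau(2)[OF that] st by (auto simp: cl_def)
    moreover have "\<exists>B. \<forall>w\<in>space M. norm ((\<lambda>_. 0 :: real ^ 'd) w) \<le> B" by auto
    ultimately show ?thesis using tau(5)[OF that] unfolding elem_def tr_def prod.case
      by (cases "\<tau> k i > t") auto
  qed
  have xs: "\<forall>k. \<forall>x\<in>set (xs k). elem s t x" unfolding xs_def using elem_tr by auto
  have 0: "0 \<le> s" "t \<le> T" using ab st by auto
  have jl: "jm a b (lproc (xs k))" "jm s t (lproc (xs k))" for k using lproc_jm xs 0 by blast+
  have jS: "jm a b (simple_process (m k) (\<tau> k) (\<eta> k))" for k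
  proof -
    have "elem a b (\<tau> k i, \<tau> k (Suc i), \<eta> k i)" if "i < m k" for i
      using tau[OF that] by (auto simp: elem_def)
    then have "jm a b (lproc (map (\<lambda>i. (\<tau> k i, \<tau> k (Suc i), \<eta> k i)) [0..<m k]))"
      using ab by (intro lproc_jm[of _ a b]) auto
    moreover have "lproc (map (\<lambda>i. (\<tau> k i, \<tau> k (Suc i), \<eta> k i)) [0..<m k]) = simple_process (m k) (\<tau> k) (\<eta> k)"
      by (intro ext) (simp add: lproc_def simple_process_def eproc_def sum_list_distinct_conv_sum_set o_def atLeast0LessThan)
    ultimately show ?thesis by simp
  qed
  have lproc_eq: "lproc (xs k) r w = simple_process (m k) (\<tau> k) (\<eta> k) r w" if "r \<in> {s<..t}" for k r w
  proof -
    have "eproc (tr k i) r w = indicat_real {\<tau> k i<..\<tau> k (Suc i)} r *\<^sub>R \<eta> k i w" for i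
      using that by (auto simp: eproc_def tr_def cl_def indicator_def)
    then show ?thesis
      by (simp add: lproc_def xs_def simple_process_def sum_list_distinct_conv_sum_set o_def atLeast0LessThan)
  qed
  have lint_eq: "lint (xs k) w = simple_integral W (m k) (\<tau> k) (\<eta> k) t w - simple_integral W (m k) (\<tau> k) (\<eta> k) s w" for k w
  proof -
    have "eint (tr k i) w = \<eta> k i w \<bullet> (W (min t (\<tau> k (Suc i))) w - W (min t (\<tau> k i)) w)
       - \<eta> k i w \<bullet> (W (min s (\<tau> k (Suc i))) w - W (min s (\<tau> k i)) w)" if i: "i < m k" for i
    proof -
      have cl: "W (cl x) w = W (min t x) w - W (min s x) w + W s w" for x
        using st by (auto simp: cl_def min_def max_def)
      show ?thesis
      proof (cases "\<tau> k i > t")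
        case True
        then have "\<tau> k (Suc i) > t" using tau(2)[OF i] by linarith
        then show ?thesis using True st by (simp add: tr_def eint_def min_def)
      next
        case False
        then show ?thesis by (simp add: tr_def eint_def cl inner_diff_right inner_add_right)
      qed
    qed
    then have "lint (xs k) w = (\<Sum>i<m k. \<eta> k i w \<bullet> (W (min t (\<tau> k (Suc i))) w - W (min t (\<tau> k i)) w)
       - \<eta> k i w \<bullet> (W (min s (\<tau> k (Suc i))) w - W (min s (\<tau> k i)) w))"
      by (simp add: lint_def xs_def sum_list_distinct_conv_sum_set o_def atLeast0LessThan)
    then show ?thesis by (simp add: simple_integral_def sum_subtractf)
  qed
  have mS: "simple_integral W (m k) (\<tau> k) (\<eta> k) r \<in> borel_measurable M" if r: "r \<in> {a..b}" for k r
  proof -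
    have "(\<lambda>w. \<eta> k i w \<bullet> (W (min r (\<tau> k (Suc i))) w - W (min r (\<tau> k i)) w)) \<in> borel_measurable M" if "i < m k" for i
      using tau[OF that] r ab st
      by (intro borel_measurable_inner borel_measurable_diff W_measurable measurable_F[OF tau(4)[OF that]]) auto
    then show ?thesis unfolding simple_integral_def[abs_def] by (intro borel_measurable_sum) auto
  qed
  have "(\<lambda>k. psq s t (\<lambda>r w. lproc (xs k) r w - H r w)) \<longlonglongrightarrow> 0"
  proof (rule tendsto_zero_ennreal_bound[OF _ conv])
    fix k
    have "psq s t (\<lambda>r w. lproc (xs k) r w - H r w) \<le> psq s t (\<lambda>r w. simple_process (m k) (\<tau> k) (\<eta> k) r w - H r w)"
      using jl(2) jH jm_sub[OF jS, of s t] st by (intro psq_mono_except_left jm_diff) (auto simp: lproc_eq)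
    also have "... \<le> psq a b (\<lambda>r w. simple_process (m k) (\<tau> k) (\<eta> k) r w - H r w)"
      using st by (intro psq_interval_mono jm_diff jS jH0) auto
    also have "... = (\<integral>\<^sup>+w. (\<integral>\<^sup>+r\<in>{a..b}. ennreal ((norm (simple_process (m k) (\<tau> k) (\<eta> k) r w - H r w))\<^sup>2) \<partial>lborel) \<partial>M)"
      by (rule psq_eq_iterated) (intro jm_diff jS jH0)
    finally show "psq s t (\<lambda>r w. lproc (xs k) r w - H r w) \<le> ..." .
  qed
  moreover have "(\<lambda>k. sqn M (\<lambda>w. lint (xs k) w - (I t w - I s w))) \<longlonglongrightarrow> 0"
  proof (rule tendsto_zero_ennreal_bound[OF _ tendsto_zero_ennreal_lin[OF lim lim, of t s 2 2]])
    fix k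
    have "sqn M (\<lambda>w. (simple_integral W (m k) (\<tau> k) (\<eta> k) t w - I t w) - (simple_integral W (m k) (\<tau> k) (\<eta> k) s w - I s w))
       \<le> 2 * sqn M (\<lambda>w. simple_integral W (m k) (\<tau> k) (\<eta> k) t w - I t w) + 2 * sqn M (\<lambda>w. simple_integral W (m k) (\<tau> k) (\<eta> k) s w - I s w)"
      using st by (intro sqn_diff_le borel_measurable_diff mS mI) auto
    moreover have "lint (xs k) w - (I t w - I s w) = (simple_integral W (m k) (\<tau> k) (\<eta> k) t w - I t w) - (simple_integral W (m k) (\<tau> k) (\<eta> k) s w - I s w)" for w
      by (simp add: lint_eq)
    ultimately show "sqn M (\<lambda>w. lint (xs k) w - (I t w - I s w))
      \<le> ennreal 2 * (\<integral>\<^sup>+w. ennreal ((simple_integral W (m k) (\<tau> k) (\<eta> k) t w - I t w)\<^sup>2) \<partial>M)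
       + ennreal 2 * (\<integral>\<^sup>+w. ennreal ((simple_integral W (m k) (\<tau> k) (\<eta> k) s w - I s w)\<^sup>2) \<partial>M)"
      by (simp only: sqn_def real_norm_def power2_abs ennreal_numeral)
  qed (use st in auto)
  moreover have "(\<lambda>w. I t w - I s w) \<in> borel_measurable M" using mI by simp
  ultimately show ?thesis unfolding ito_pair_def using jH xs by blast
qed

end

section \<open>Gronwall estimates\<close>

text \<open>The crude bound \<open>M0\<close> is improved repeatedly. Against the weight
  \<open>exp (2 * K * t)\<close> the time integral times \<open>K\<close> contributes at most one
  half, so a bound with constant \<open>c\<close> becomes one with \<open>B + c / 2\<close>; the
  fixed point is \<open>2 * B\<close>, and the influence of \<open>M0\<close> is halved each
  time.\<close>

lemma gronwall_ennreal:
  fixes e :: "real \<Rightarrow> ennreal"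
  assumes le: "\<And>t. t \<in> {0..T} \<Longrightarrow> e t \<le> ennreal B + ennreal K * (\<integral>\<^sup>+r\<in>{0..t}. e r \<partial>lborel)"
    and bounded: "\<And>t. t \<in> {0..T} \<Longrightarrow> e t \<le> ennreal M0"
    and B: "B \<ge> 0" and K: "K > 0" and M0: "M0 \<ge> 0" and t: "t \<in> {0..T}"
  shows "e t \<le> ennreal (2 * B * exp (2 * K * t))"
proof -
  have step: "e t \<le> ennreal ((2 * B + M0 / 2 ^ k) * exp (2 * K * t))" if "t \<in> {0..T}" for k t
    using that
  proof (induction k arbitrary: t)
    case 0
    have "M0 \<le> (2 * B + M0) * exp (2 * K * t)"
      using mult_mono[of M0 "2 * B + M0" 1 "exp (2 * K * t)"] B K M0 0 by auto
    then show ?case using bounded[OF 0] by (auto intro: order_trans ennreal_leI)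
  next
    case (Suc k)
    define c where "c = 2 * B + M0 / 2 ^ k"
    have c: "c \<ge> 0" using B M0 by (simp add: c_def)
    have t: "0 \<le> t" "t \<le> T" using Suc.prems by auto
    have "(\<integral>\<^sup>+r\<in>{0..t}. e r \<partial>lborel) \<le> (\<integral>\<^sup>+r\<in>{0..t}. ennreal (c * exp (2 * K * r)) \<partial>lborel)"
      using Suc.IH t by (intro nn_integral_mono) (auto split: split_indicator simp: c_def)
    also have "... = ennreal (c * exp (2 * K * t) / (2 * K) - c * exp (2 * K * 0) / (2 * K))"
    proof (rule nn_integral_FTC_Icc[where F = "\<lambda>r. c * exp (2 * K * r) / (2 * K)"])
      fix x
      show "((\<lambda>r. c * exp (2 * K * r) / (2 * K)) has_real_derivative c * exp (2 * K * x)) (at x)"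
        using K by (auto intro!: derivative_eq_intros)
    qed (use c t in auto)
    finally have I: "ennreal K * (\<integral>\<^sup>+r\<in>{0..t}. e r \<partial>lborel) \<le> ennreal (K * (c * exp (2 * K * t) / (2 * K) - c * exp (2 * K * 0) / (2 * K)))"
      using K by (simp add: ennreal_mult' mult_left_mono)
    have "e t \<le> ennreal B + ennreal (K * (c * exp (2 * K * t) / (2 * K) - c * exp (2 * K * 0) / (2 * K)))"
      using le[OF Suc.prems] add_left_mono[OF I, of "ennreal B"] by (rule order_trans)
    also have "K * (c * exp (2 * K * t) / (2 * K) - c * exp (2 * K * 0) / (2 * K)) = c / 2 * exp (2 * K * t) - c / 2"
      using K by (simp add: field_simps)
    also have "ennreal B + ennreal (c / 2 * exp (2 * K * t) - c / 2) = ennreal (B + (c / 2 * exp (2 * K * t) - c / 2))"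
      using B c K t by (intro ennreal_plus[symmetric]) (auto simp: mult_le_cancel_left1)
    also have "... \<le> ennreal ((B + c / 2) * exp (2 * K * t))"
    proof (rule ennreal_leI)
      have "B * 1 \<le> B * exp (2 * K * t)" using B K t by (intro mult_left_mono) auto
      then show "B + (c / 2 * exp (2 * K * t) - c / 2) \<le> (B + c / 2) * exp (2 * K * t)"
        using c by (simp add: distrib_right)
    qed
    also have "B + c / 2 = 2 * B + M0 / 2 ^ Suc k" by (simp add: c_def field_simps)
    finally show ?case .
  qed
  have "(\<lambda>k. (2 * B + M0 * (1 / 2) ^ k) * exp (2 * K * t)) \<longlonglongrightarrow> (2 * B + M0 * 0) * exp (2 * K * t)"
    by (intro tendsto_intros LIMSEQ_power_zero) auto
  then have "(\<lambda>k. ennreal ((2 * B + M0 / 2 ^ k) * exp (2 * K * t))) \<longlonglongrightarrow> ennreal (2 * B * exp (2 * K * t))"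
    by (intro tendsto_ennrealI) (simp add: power_one_over)
  then show ?thesis by (rule tendsto_lowerbound) (auto intro!: always_eventually step t)
qed

lemma set_integral_split_interval:
  fixes f :: "real \<Rightarrow> 'b::{banach, second_countable_topology}"
  assumes "set_integrable lborel {a..c} f" "a \<le> b" "b \<le> c"
  shows "(LBINT r:{a..c}. f r) = (LBINT r:{a..b}. f r) + (LBINT r:{b..c}. f r)"
proof -
  have u: "{a..c} = {a..b} \<union> {b..c}" using assms by auto
  have "(LBINT r:{a..b} \<union> {b..c}. f r) = (LBINT r:{a..b}. f r) + (LBINT r:{b..c}. f r)"
  proof (rule set_integral_Un_AE)
    show "AE r in lborel. \<not> (r \<in> {a..b} \<and> r \<in> {b..c})"
      using AE_lborel_singleton[of b] by eventually_elim auto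
  qed (use assms in \<open>auto intro: set_integrable_subset\<close>)
  then show ?thesis by (simp add: u)
qed

section \<open>Vector valued stochastic integrals\<close>

lemma borel_measurable_vecI:
  fixes f :: "'a \<Rightarrow> 'b::euclidean_space ^ 'n"
  assumes "\<And>i. (\<lambda>x. f x $ i) \<in> borel_measurable N"
  shows "f \<in> borel_measurable N"
  using assms by (intro borel_measurable_euclidean_space[THEN iffD2]) (auto simp: Basis_vec_def inner_axis)

lemma sqn_vec:
  fixes f :: "'a \<Rightarrow> 'b::real_normed_vector ^ 'n"
  assumes "\<And>i. (\<lambda>x. f x $ i) \<in> borel_measurable N"
  shows "sqn N f = (\<Sum>i\<in>UNIV. sqn N (\<lambda>x. f x $ i))"
proof -
  have "(norm (f x))\<^sup>2 = (\<Sum>i\<in>UNIV. (norm (f x $ i))\<^sup>2)" for x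
    by (simp add: norm_vec_def L2_set_def sum_nonneg)
  then show ?thesis unfolding sqn_def
    by (simp add: sum_ennreal[symmetric] del: sum_ennreal)
      (rule nn_integral_sum, use assms in \<open>auto intro!: measurable_compose[OF _ measurable_ennreal]\<close>)
qed

context brownian_setting
begin

definition ito_vec :: "real \<Rightarrow> real \<Rightarrow> (real \<Rightarrow> 'w \<Rightarrow> real ^ 'd ^ 'e) \<Rightarrow> ('w \<Rightarrow> real ^ 'e) \<Rightarrow> bool" where
  "ito_vec s t H J \<longleftrightarrow> (\<forall>i. ito_pair s t (\<lambda>r w. H r w $ i) (\<lambda>w. J w $ i))"

lemma ito_vec_nth: "ito_vec s t H J \<Longrightarrow> ito_pair s t (\<lambda>r w. H r w $ i) (\<lambda>w. J w $ i)"
  by (simp add: ito_vec_def)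

lemma ito_vec_isometry:
  assumes "ito_vec s t H J" "0 \<le> s" "t \<le> T"
  shows "sqn M J = psq s t H"
proof -
  have "sqn M J = (\<Sum>i\<in>UNIV. sqn M (\<lambda>w. J w $ i))"
    by (intro sqn_vec ito_pair_measurable[OF ito_vec_nth[OF assms(1)]])
  also have "... = (\<Sum>i\<in>UNIV. psq s t (\<lambda>r w. H r w $ i))"
    using assms by (intro sum.cong refl ito_pair_isometry) (auto simp: ito_vec_def)
  also have "... = psq s t H" unfolding psq_def
    by (intro sqn_vec[symmetric] jmD[OF ito_pair_jm[OF ito_vec_nth[OF assms(1)]]])
  finally show ?thesis .
qed

lemma ito_vec_diff:
  assumes "ito_vec s t H J" "ito_vec s t H' J'" "0 \<le> s" "t \<le> T"
  shows "ito_vec s t (\<lambda>r w. H r w - H' r w) (\<lambda>w. J w - J' w)"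
  using assms ito_pair_diff unfolding ito_vec_def by simp

lemma ito_vec_measurable: "ito_vec s t H J \<Longrightarrow> J \<in> borel_measurable M"
  by (rule borel_measurable_vecI) (rule ito_pair_measurable[OF ito_vec_nth])

lemma ito_integral_matrix_imp_ito_vec:
  assumes "ito_integral_matrix M F W a b H I" "0 \<le> a" "b \<le> T" "a \<le> s" "s \<le> t" "t \<le> b"
  shows "ito_vec s t H (\<lambda>w. I t w - I s w)"
  using assms ito_integral_imp_ito_pair[of a b "\<lambda>r w. H r w $ i" "\<lambda>r w. I r w $ i" s t for i]
  unfolding ito_integral_matrix_def ito_vec_def by auto

lemma sqn_eq_0_imp_AE:
  assumes "f \<in> borel_measurable N" "sqn N f = 0"
  shows "AE x in N. f x = 0"
  using assms unfolding sqn_def by (subst (asm) nn_integral_0_iff_AE) (auto intro!: measurable_compose[OF _ measurable_ennreal])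

text \<open>The defining limits fix \<open>I\<close> at each time separately, so the initial value
  has to be read off: every simple integral vanishes at \<open>a\<close>, as no grid point precedes
  \<open>a\<close>.\<close>

lemma ito_integral_start:
  assumes "ito_integral M F W a b H I" "a \<le> b"
  shows "AE w in M. I a w = 0"
proof -
  obtain m \<tau> \<eta> where simple: "\<And>k. simple_integrand F a b (m k) (\<tau> k) (\<eta> k)"
    and lim: "\<And>t. t \<in> {a..b} \<Longrightarrow> (\<lambda>k. \<integral>\<^sup>+w.
            ennreal ((simple_integral W (m k) (\<tau> k) (\<eta> k) t w - I t w)\<^sup>2) \<partial>M) \<longlonglongrightarrow> 0"
    using assms(1) unfolding ito_integral_def by blast
  have "simple_integral W (m k) (\<tau> k) (\<eta> k) a w = 0" for k w
    using simple[of k] unfolding simple_integrand_def simple_integral_def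
    by (intro sum.neutral) (auto simp: min_def)
  then have "(\<lambda>k::nat. sqn M (I a)) \<longlonglongrightarrow> 0" using lim[of a] assms(2) by (simp add: sqn_def)
  then have "sqn M (I a) = 0" by (simp add: LIMSEQ_const_iff)
  moreover have "I a \<in> borel_measurable M" using assms by (auto simp: ito_integral_def)
  ultimately show ?thesis by (intro sqn_eq_0_imp_AE)
qed

lemma ito_integral_matrix_start:
  assumes "ito_integral_matrix M F W a b H I" "a \<le> b"
  shows "AE w in M. I a w = 0"
proof -
  have "AE w in M. \<forall>i\<in>UNIV. I a w $ i = 0"
    using assms ito_integral_start[of a b "\<lambda>s w. H s w $ i" "\<lambda>s w. I s w $ i" for i]
    by (intro AE_finite_allI) (auto simp: ito_integral_matrix_def)
  then show ?thesis by (simp add: vec_eq_iff)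
qed

text \<open>\<open>c\<close> is continuous only for times in \<open>A\<close>, so it is extended by
  0 before composing. The inner time \<tau> admits the grid times of the Euler scheme.\<close>

lemma jm_coefficient:
  fixes c :: "real \<Rightarrow> 'x::{second_countable_topology, topological_space} \<Rightarrow> 'b::{real_normed_vector, second_countable_topology}"
  assumes c: "continuous_on (A \<times> UNIV) (\<lambda>(r, x). c r x)" and A: "A \<in> sets borel"
    and \<tau>: "jm s t (\<lambda>r _. \<tau> r)" "\<And>r. r \<in> {s..t} \<Longrightarrow> \<tau> r \<in> A" and X: "jm s t X"
  shows "jm s t (\<lambda>r w. c (\<tau> r) (X r w))"
proof -
  have "A \<times> (UNIV :: 'x set) \<in> sets borel"
    using A unfolding borel_prod[symmetric] by auto
  then have "(\<lambda>z. indicator (A \<times> UNIV) z *\<^sub>R (\<lambda>(r, x). c r x) z) \<in> borel_measurable borel"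
    by (intro borel_measurable_continuous_on_indicator c) auto
  from jm_comp_pair[OF \<tau>(1) X this]
  show ?thesis by (rule jm_cong[THEN iffD1, rotated]) (use \<tau>(2) in auto)
qed

lemma jm_reparam:
  assumes X: "jm 0 T X" and \<tau>: "\<tau> \<in> borel_measurable borel" "\<And>r. r \<in> {s..t} \<Longrightarrow> \<tau> r \<in> {0..T}"
  shows "jm s t (\<lambda>r. X (\<tau> r))"
proof -
  have "\<tau> \<in> measurable (TM s t) (TM 0 T)"
    using \<tau> by (intro measurable_restrict_space3) auto
  then have "(\<lambda>z. (\<tau> (fst z), snd z)) \<in> measurable (PM s t) (PM 0 T)"
    by (intro measurable_Pair measurable_compose[OF measurable_fst]) auto
  from measurable_compose[OF this jmD[OF X]] show ?thesis by (simp add: jm_def)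
qed

end

section \<open>Diffusions and the Euler scheme\<close>

lemma
  fixes T s :: real
  assumes T: "T > 0" and n: "n \<ge> 1" and s: "s \<ge> 0"
  shows grid_floor_le: "grid_floor T n s \<le> s"
    and grid_floor_close: "s - grid_floor T n s \<le> T / real n"
    and grid_floor_nonneg: "0 \<le> grid_floor T n s"
    and grid_floor_eq: "grid_floor T n s = real_of_int \<lfloor>s * real n / T\<rfloor> * T / real n"
proof -
  define k where "k = nat \<lfloor>s * real n / T\<rfloor>"
  have k: "real k = real_of_int \<lfloor>s * real n / T\<rfloor>" using s T by (simp add: k_def)
  have "real k \<le> s * real n / T" unfolding k by simp
  then have k_le: "real k * T / real n \<le> s" using T n by (simp add: field_simps)
  have eq: "grid_floor T n s = real k * T / real n" unfolding grid_floor_def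
  proof (rule Max_eqI)
    have le: "j \<le> k" if "s \<ge> real j * T / real n" for j
    proof -
      have "real j \<le> s * real n / T" using that T n by (simp add: field_simps)
      then show ?thesis unfolding k_def by (simp add: le_nat_floor)
    qed
    then have "{real k * T / real n |k. real k * T / real n \<le> s} \<subseteq> (\<lambda>k. real k * T / real n) ` {..k}" by auto
    then show "finite {real k * T / real n |k. real k * T / real n \<le> s}" by (rule finite_subset) simp
    fix y assume "y \<in> {real k * T / real n |k. real k * T / real n \<le> s}"
    then show "y \<le> real k * T / real n" using le T by (auto intro!: divide_right_mono mult_right_mono)
  next
    show "real k * T / real n \<in> {real k * T / real n |k. real k * T / real n \<le> s}" using k_le by blast
  qed
  then show "grid_floor T n s = real_of_int \<lfloor>s * real n / T\<rfloor> * T / real n" by (simp add: k)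
  show "grid_floor T n s \<le> s" unfolding eq by (rule k_le)
  have "s * real n / T < real k + 1" unfolding k by linarith
  then have "s < (real k + 1) * (T / real n)" using T n by (simp add: field_simps)
  then show "s - grid_floor T n s \<le> T / real n" unfolding eq by (simp add: field_simps add_divide_distrib)
  show "0 \<le> grid_floor T n s" unfolding eq using T by simp
qed

lemma numeral_mult_ennreal': "numeral n * ennreal x = ennreal (numeral n * x)"
  using ennreal_mult'[of "numeral n" x] by simp

lemma continuous_coefficient:
  fixes c :: "real \<Rightarrow> 'x::real_normed_vector \<Rightarrow> 'b::real_normed_vector"
  assumes lip: "\<And>t x y. t \<in> {0..T} \<Longrightarrow> norm (c t x - c t y) \<le> K * norm (x - y)"
    and hoelder: "\<And>s t x. s \<in> {0..T} \<Longrightarrow> t \<in> {0..T} \<Longrightarrow> norm (c t x - c s x) \<le> K * sqrt \<bar>t - s\<bar>"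
  shows "continuous_on ({0..T} \<times> UNIV) (\<lambda>(t, x). c t x)"
  unfolding continuous_on_def
proof (rule ballI)
  fix z :: "real \<times> 'x" assume "z \<in> {0..T} \<times> UNIV"
  then obtain t x where z: "z = (t, x)" "t \<in> {0..T}" by auto
  have "((\<lambda>w. K * norm (snd w - x) + K * sqrt \<bar>fst w - t\<bar>) \<longlongrightarrow> K * norm (snd z - x) + K * sqrt \<bar>fst z - t\<bar>) (at z within {0..T} \<times> UNIV)"
    by (intro tendsto_intros)
  then have lim: "((\<lambda>w. K * norm (snd w - x) + K * sqrt \<bar>fst w - t\<bar>) \<longlongrightarrow> 0) (at z within {0..T} \<times> UNIV)"
    by (simp add: z)
  have "norm (c (fst w) (snd w) - c t x) \<le> K * norm (snd w - x) + K * sqrt \<bar>fst w - t\<bar>" if "w \<in> {0..T} \<times> UNIV" for w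
  proof -
    have "norm (c (fst w) (snd w) - c t x) \<le> norm (c (fst w) (snd w) - c (fst w) x) + norm (c (fst w) x - c t x)"
      by (metis diff_add_cancel add_diff_eq norm_triangle_ineq)
    also have "... \<le> K * norm (snd w - x) + K * sqrt \<bar>fst w - t\<bar>"
      using that z by (intro add_mono lip hoelder) auto
    finally show ?thesis .
  qed
  then have "((\<lambda>w. norm (c (fst w) (snd w) - c t x)) \<longlongrightarrow> 0) (at z within {0..T} \<times> UNIV)"
    by (intro Lim_null_comparison[OF _ lim]) (auto simp: eventually_at_filter)
  then show "((\<lambda>(t, x). c t x) \<longlongrightarrow> (case z of (t, x) \<Rightarrow> c t x)) (at z within {0..T} \<times> UNIV)"
    by (subst Lim_null) (simp add: tendsto_norm_zero_iff z case_prod_beta)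
qed

locale diffusion_setting = brownian_setting M T W \<xi> F + regular_coefficients T \<mu> \<sigma> g L
  for M :: "'w measure" and T :: real and W :: "real \<Rightarrow> 'w \<Rightarrow> real ^ 'd" and \<xi> F
    and \<mu> :: "real \<Rightarrow> real ^ 'd \<Rightarrow> real ^ 'd" and \<sigma> g L +
  assumes xi_square: "integrable M (\<lambda>w. (norm (\<xi> w))\<^sup>2)"
begin

text \<open>Covers the forward equation and its Euler scheme at once: both start at \<xi>, are
  driven by the same noise and have coefficients bounded by \<open>L\<close>, for all \<epsilon> and
  all step numbers.\<close>

definition has_drift_diffusion ::
    "(real \<Rightarrow> 'w \<Rightarrow> real ^ 'd) \<Rightarrow> (real \<Rightarrow> 'w \<Rightarrow> real ^ 'd) \<Rightarrow> (real \<Rightarrow> 'w \<Rightarrow> real ^ 'd ^ 'd) \<Rightarrow> bool" where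
  "has_drift_diffusion X m H \<longleftrightarrow> progressive F 0 T X \<and> jm 0 T m \<and>
     (\<forall>r\<in>{0..T}. \<forall>w\<in>space M. norm (m r w) \<le> L \<and> norm (H r w) \<le> L) \<and>
     (\<exists>I. ito_integral_matrix M F W 0 T H I \<and>
        (AE w in M. \<forall>t\<in>{0..T}. X t w = \<xi> w + (LBINT r:{0..t}. m r w) + I t w))"

lemma mu_continuous: "continuous_on ({0..T} \<times> UNIV) (\<lambda>(t, x). \<mu> t x)"
  by (rule continuous_coefficient) (auto intro: mu_lip mu_hoelder)

lemma sigma_continuous: "continuous_on ({0..T} \<times> UNIV) (\<lambda>(t, x). \<sigma> t x)"
  by (rule continuous_coefficient) (auto intro: sigma_lip sigma_hoelder)

lemma sde_has_drift_diffusion: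
  assumes "sde_solution M F W T \<mu> \<sigma> \<epsilon> 0 \<xi> X" "\<epsilon> \<in> {0<..<1}"
  shows "has_drift_diffusion X (\<lambda>r w. \<mu> r (X r w)) (\<lambda>r w. \<epsilon> *\<^sub>R \<sigma> r (X r w))"
proof -
  have X: "jm 0 T X" using assms(1) T_pos by (intro progressive_jm) (auto simp: sde_solution_def)
  have "jm 0 T (\<lambda>r w. \<mu> r (X r w))"
    by (rule jm_coefficient[where A = "{0..T}" and \<tau> = "\<lambda>r. r", OF mu_continuous _ _ _ X]) (auto intro: jm_time)
  moreover have "norm (\<epsilon> *\<^sub>R \<sigma> r x) \<le> L" if "r \<in> {0..T}" for r x
    using mult_mono[of \<epsilon> 1 "norm (\<sigma> r x)" L] sigma_bound[OF that, of x] assms(2) L0 by simp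
  ultimately show ?thesis using assms(1) unfolding has_drift_diffusion_def sde_solution_def
    by (auto simp: mu_bound)
qed

text \<open>For negative times the set in \<open>grid_floor\<close> is empty and its maximum
  unspecified; \<open>max 0\<close> keeps to the range of the floor formula.\<close>

lemma grid_floor_measurable:
  assumes "n \<ge> 1"
  shows "(\<lambda>s. grid_floor T n (max 0 s)) \<in> borel_measurable borel"
proof -
  have "(\<lambda>s. real_of_int \<lfloor>max 0 s * real n / T\<rfloor> * T / real n) \<in> borel_measurable borel" by measurable
  then show ?thesis using grid_floor_eq[OF T_pos assms] by simp
qed

lemma jm_grid:
  assumes "jm 0 T X" "n \<ge> 1"
  shows "jm 0 T (\<lambda>r. X (grid_floor T n r))"
proof -
  have "jm 0 T (\<lambda>r. X (grid_floor T n (max 0 r)))"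
  proof (rule jm_reparam[OF assms(1) grid_floor_measurable[OF assms(2)]])
    fix r assume "r \<in> {0..T}"
    then show "grid_floor T n (max 0 r) \<in> {0..T}"
      using grid_floor_nonneg[OF T_pos assms(2), of r] grid_floor_le[OF T_pos assms(2), of r] by auto
  qed
  then show ?thesis by (rule jm_cong[THEN iffD1, rotated]) auto
qed

lemma grid_floor_mem: "r \<in> {0..T} \<Longrightarrow> n \<ge> 1 \<Longrightarrow> grid_floor T n r \<in> {0..T}"
  using grid_floor_nonneg[OF T_pos, of n r] grid_floor_le[OF T_pos, of n r] by auto

lemma euler_has_drift_diffusion:
  assumes "euler_maruyama M F W T \<mu> \<sigma> \<xi> \<epsilon> n X" "\<epsilon> \<in> {0<..<1}" "n \<ge> 1"
  shows "has_drift_diffusion X (\<lambda>r w. \<mu> (grid_floor T n r) (X (grid_floor T n r) w))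
    (\<lambda>r w. \<epsilon> *\<^sub>R \<sigma> (grid_floor T n r) (X (grid_floor T n r) w))"
proof -
  have X: "jm 0 T X" using assms(1) T_pos by (intro progressive_jm) (auto simp: euler_maruyama_def)
  have "jm 0 T (\<lambda>r _. grid_floor T n (max 0 r))" by (rule jm_time[OF grid_floor_measurable[OF assms(3)]])
  then have "jm 0 T (\<lambda>r _. grid_floor T n r)" by (rule jm_cong[THEN iffD1, rotated]) auto
  then have "jm 0 T (\<lambda>r w. \<mu> (grid_floor T n r) (X (grid_floor T n r) w))"
    by (intro jm_coefficient[where A = "{0..T}", OF mu_continuous _ _ _ jm_grid[OF X assms(3)]])
      (auto simp del: atLeastAtMost_iff intro: grid_floor_mem[OF _ assms(3)])
  moreover have "norm (\<epsilon> *\<^sub>R \<sigma> (grid_floor T n r) x) \<le> L" if "r \<in> {0..T}" for r x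
    using mult_mono[of \<epsilon> 1 "norm (\<sigma> (grid_floor T n r) x)" L] sigma_bound[OF grid_floor_mem[OF that assms(3)], of x] assms(2) L0 by simp
  ultimately show ?thesis using assms(1) unfolding has_drift_diffusion_def euler_maruyama_def
    using mu_bound grid_floor_mem[OF _ assms(3)] by auto
qed

lemma bounded_path_integrable:
  fixes m :: "real \<Rightarrow> 'w \<Rightarrow> real ^ 'd"
  assumes "jm 0 T m" "w \<in> space M" "\<And>r. r \<in> {0..T} \<Longrightarrow> norm (m r w) \<le> B" "{a..b} \<subseteq> {0..T}"
  shows "set_integrable lborel {a..b} (\<lambda>r. m r w)"
proof -
  have "set_integrable lborel {0..T} (\<lambda>r. m r w)"
    unfolding set_integrable_def
  proof (rule Bochner_Integration.integrable_bound)
    show "integrable lborel (\<lambda>r. indicat_real {0..T} r * B)" by (intro integrable_mult_left integrable_real_indicator) (auto simp: emeasure_lborel_Icc_eq)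
    show "(\<lambda>r. indicat_real {0..T} r *\<^sub>R m r w) \<in> borel_measurable lborel"
      using jm_path[OF assms(1,2)] by (simp add: borel_measurable_restrict_space_iff)
    show "AE r in lborel. norm (indicat_real {0..T} r *\<^sub>R m r w) \<le> norm (indicat_real {0..T} r * B)"
      using assms(3) by (intro AE_I2) (force simp: indicator_def)
  qed
  then show ?thesis by (rule set_integrable_subset) (use assms(4) in auto)
qed

context
  fixes X m H I
  assumes X: "has_drift_diffusion X m H"
    and I: "ito_integral_matrix M F W 0 T H I"
    and eq: "AE w in M. \<forall>t\<in>{0..T}. X t w = \<xi> w + (LBINT r:{0..t}. m r w) + I t w"
begin

lemma dd_progressive: "progressive F 0 T X"
  and dd_jm_drift: "jm 0 T m"
  and dd_bound_drift: "r \<in> {0..T} \<Longrightarrow> w \<in> space M \<Longrightarrow> norm (m r w) \<le> L"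
  and dd_bound_diffusion: "r \<in> {0..T} \<Longrightarrow> w \<in> space M \<Longrightarrow> norm (H r w) \<le> L"
  using X by (auto simp: has_drift_diffusion_def)

lemma dd_jm: "jm 0 T X"
  using progressive_jm[OF dd_progressive] T_pos by simp

lemma dd_F_measurable: "t \<in> {0..T} \<Longrightarrow> X t \<in> borel_measurable (F t)"
  using progressive_section[OF dd_progressive] .

lemma dd_measurable: "t \<in> {0..T} \<Longrightarrow> X t \<in> borel_measurable M"
  using measurable_F[OF dd_F_measurable] by auto

lemma dd_ito_vec: "0 \<le> s \<Longrightarrow> s \<le> t \<Longrightarrow> t \<le> T \<Longrightarrow> ito_vec s t H (\<lambda>w. I t w - I s w)"
  by (rule ito_integral_matrix_imp_ito_vec[OF I]) auto

lemma dd_increment: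
  assumes "0 \<le> s" "s \<le> t" "t \<le> T"
  shows "AE w in M. X t w - X s w = (LBINT r:{s..t}. m r w) + (I t w - I s w)"
  using eq AE_space
proof eventually_elim
  case (elim w)
  have "set_integrable lborel {0..t} (\<lambda>r. m r w)"
    using bounded_path_integrable[OF dd_jm_drift elim(2) dd_bound_drift[OF _ elim(2)]] assms by auto
  from set_integral_split_interval[OF this, of s] elim(1) assms show ?case by simp
qed

lemma dd_jm_diffusion: "jm 0 T H"
  unfolding jm_def
  by (rule borel_measurable_vecI) (rule jmD[OF ito_pair_jm[OF ito_vec_nth[OF dd_ito_vec]]], use T_pos in auto)

lemma dd_drift_sqn:
  assumes "0 \<le> s" "s \<le> t" "t \<le> T"
  shows "sqn M (\<lambda>w. LBINT r:{s..t}. m r w) \<le> ennreal (L\<^sup>2 * (t - s)\<^sup>2)"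
proof -
  have j: "jm s t m" using jm_sub[OF dd_jm_drift] assms by auto
  have "psq s t m \<le> ennreal (t - s) * ennreal (L\<^sup>2)"
    using assms dd_bound_drift by (intro psq_le j sqn_bounded) auto
  from order_trans[OF sqn_time_integral_le[OF j assms(2)] mult_left_mono[OF this]]
  have "sqn M (\<lambda>w. LBINT r:{s..t}. m r w) \<le> ennreal (t - s) * (ennreal (t - s) * ennreal (L\<^sup>2))" by simp
  also have "... = ennreal (L\<^sup>2 * (t - s)\<^sup>2)"
    using assms by (simp add: ennreal_mult'[symmetric] power2_eq_square mult_ac)
  finally show ?thesis .
qed

lemma dd_increment_sqn:
  assumes "0 \<le> s" "s \<le> t" "t \<le> T"
  shows "sqn M (\<lambda>w. X t w - X s w) \<le> ennreal (2 * L\<^sup>2 * (T + 1) * (t - s))"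
proof -
  have "jm s t H" using jm_sub[OF dd_jm_diffusion] assms by auto
  then have "psq s t H \<le> ennreal (t - s) * ennreal (L\<^sup>2)"
    using assms dd_bound_diffusion by (intro psq_le sqn_bounded) auto
  then have J: "sqn M (\<lambda>w. I t w - I s w) \<le> ennreal (L\<^sup>2 * (t - s))"
    using ito_vec_isometry[OF dd_ito_vec[OF assms]] assms by (simp add: ennreal_mult[symmetric] mult.commute)
  have "sqn M (\<lambda>w. X t w - X s w) = sqn M (\<lambda>w. (LBINT r:{s..t}. m r w) + (I t w - I s w))"
    by (rule sqn_cong_AE[OF dd_increment[OF assms]])
  also have "... \<le> 2 * sqn M (\<lambda>w. LBINT r:{s..t}. m r w) + 2 * sqn M (\<lambda>w. I t w - I s w)"
    using jm_sub[OF dd_jm_drift, of s t] assms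
    by (intro sqn_add_le measurable_time_integral ito_vec_measurable[OF dd_ito_vec[OF assms]]) auto
  also have "... \<le> 2 * ennreal (L\<^sup>2 * (t - s)\<^sup>2) + 2 * ennreal (L\<^sup>2 * (t - s))"
    by (intro add_mono mult_left_mono dd_drift_sqn assms J) auto
  also have "... = ennreal (2 * (L\<^sup>2 * (t - s)\<^sup>2) + 2 * (L\<^sup>2 * (t - s)))"
    using assms by (simp add: numeral_mult_ennreal')
  also have "... \<le> ennreal (2 * L\<^sup>2 * (T + 1) * (t - s))"
  proof (rule ennreal_leI)
    have "(t - s)\<^sup>2 \<le> T * (t - s)" using assms by (auto simp: power2_eq_square intro!: mult_right_mono)
    then have "L\<^sup>2 * (t - s)\<^sup>2 \<le> L\<^sup>2 * (T * (t - s))" by (rule mult_left_mono) simp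
    then show "2 * (L\<^sup>2 * (t - s)\<^sup>2) + 2 * (L\<^sup>2 * (t - s)) \<le> 2 * L\<^sup>2 * (T + 1) * (t - s)" by (simp add: algebra_simps)
  qed
  finally show ?thesis .
qed

lemma dd_start: "AE w in M. X 0 w = \<xi> w"
proof -
  have "(LBINT r:{0..0}. m r w) = 0" for w
    unfolding set_lebesgue_integral_def
  proof (rule integral_eq_zero_AE)
    show "AE r in lborel. indicat_real {0..0} r *\<^sub>R m r w = 0"
      using AE_lborel_singleton[of 0] by eventually_elim auto
  qed
  moreover have "AE w in M. I 0 w = 0" using ito_integral_matrix_start[OF I] T_pos by simp
  ultimately show ?thesis using eq T_pos by (auto elim: eventually_elim2)
qed

lemma dd_sqn_bounded:
  assumes "t \<in> {0..T}"
  shows "sqn M (X t) \<le> 2 * sqn M \<xi> + ennreal (4 * L\<^sup>2 * (T + 1) * T)"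
proof -
  have "sqn M (\<lambda>w. X 0 w + (X t w - X 0 w)) \<le> 2 * sqn M (X 0) + 2 * sqn M (\<lambda>w. X t w - X 0 w)"
    using assms T_pos by (intro sqn_add_le borel_measurable_diff dd_measurable) auto
  also have "sqn M (X 0) = sqn M \<xi>" by (rule sqn_cong_AE[OF dd_start])
  also have "2 * sqn M (\<lambda>w. X t w - X 0 w) \<le> 2 * ennreal (2 * L\<^sup>2 * (T + 1) * (t - 0))"
    using assms by (intro mult_left_mono dd_increment_sqn) auto
  also have "2 * ennreal (2 * L\<^sup>2 * (T + 1) * (t - 0)) = ennreal (4 * L\<^sup>2 * (T + 1) * t)"
    by (simp add: numeral_mult_ennreal' mult.assoc)
  also have "... \<le> ennreal (4 * L\<^sup>2 * (T + 1) * T)"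
    using assms by (intro ennreal_leI mult_left_mono) auto
  finally show ?thesis by (simp add: add_left_mono)
qed

lemma dd_continuous: "AE w in M. continuous_on {0..T} (\<lambda>t. X t w)"
proof -
  have "AE w in M. \<forall>i\<in>UNIV. continuous_on {0..T} (\<lambda>t. I t w $ i)"
    using I by (intro AE_finite_allI) (auto simp: ito_integral_matrix_def ito_integral_def)
  with eq AE_space show ?thesis
  proof eventually_elim
    case (elim w)
    have int: "set_integrable lborel {a..b} (\<lambda>r. m r w)" if "{a..b} \<subseteq> {0..T}" for a b
      by (rule bounded_path_integrable[OF dd_jm_drift elim(2) dd_bound_drift[OF _ elim(2)] that])
    have le: "norm ((LBINT r:{0..t}. m r w) - (LBINT r:{0..s}. m r w)) \<le> L * (t - s)"
      if "0 \<le> s" "s \<le> t" "t \<le> T" for s t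
    proof -
      have "(LBINT r:{0..t}. m r w) - (LBINT r:{0..s}. m r w) = (LBINT r:{s..t}. m r w)"
        using set_integral_split_interval[OF int, of 0 t s] that by simp
      also have "norm ... \<le> (LBINT r:{s..t}. norm (m r w))"
        using int[of s t] that by (intro set_integral_norm_bound) auto
      also have "... \<le> (LBINT r:{s..t}. L)"
        using that int[of s t] dd_bound_drift[OF _ elim(2)]
        by (intro set_integral_mono set_integrable_norm) (auto simp: set_integrable_def)
      also have "... = L * (t - s)" using that by (simp add: set_lebesgue_integral_def)
      finally show ?thesis .
    qed
    have "continuous_on {0..T} (\<lambda>t. LBINT r:{0..t}. m r w)"
    proof (rule continuous_on_iff[THEN iffD2], intro ballI allI impI)
      fix t e :: real assume t: "t \<in> {0..T}" and e: "e > 0"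
      have "dist (LBINT r:{0..t'}. m r w) (LBINT r:{0..t}. m r w) < e" if t': "t' \<in> {0..T}" "dist t' t < e / (L + 1)" for t'
      proof -
        have "dist (LBINT r:{0..t'}. m r w) (LBINT r:{0..t}. m r w) \<le> L * dist t' t"
          using le[of t t'] le[of t' t] t t' by (cases "t \<le> t'") (auto simp: dist_norm norm_minus_commute)
        also have "... \<le> (L + 1) * dist t' t" by (intro mult_right_mono) auto
        also have "... < e" using t' L0 by (simp add: field_simps)
        finally show ?thesis .
      qed
      then show "\<exists>d>0. \<forall>t'\<in>{0..T}. dist t' t < d \<longrightarrow> dist (LBINT r:{0..t'}. m r w) (LBINT r:{0..t}. m r w) < e"
        using e L0 by (intro exI[of _ "e / (L + 1)"]) auto
    qed
    moreover have "continuous_on {0..T} (\<lambda>t. I t w)"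
      using continuous_on_vec_lambda[of "{0..T}" "\<lambda>i t. I t w $ i"] elim(3) by (simp add: vec_nth_inverse)
    ultimately have "continuous_on {0..T} (\<lambda>t. \<xi> w + (LBINT r:{0..t}. m r w) + I t w)"
      by (intro continuous_intros)
    then show ?case by (rule continuous_on_cong[THEN iffD1, rotated 2]) (use elim(1) in auto)
  qed
qed

end

lemma dd_difference_sqn:
  assumes X: "has_drift_diffusion X m H" and X': "has_drift_diffusion X' m' H'" and t: "t \<in> {0..T}"
  shows "sqn M (\<lambda>w. X t w - X' t w) \<le> ennreal (2 * T) * psq 0 t (\<lambda>r w. m r w - m' r w) + 2 * psq 0 t (\<lambda>r w. H r w - H' r w)"
proof -
  obtain I where I: "ito_integral_matrix M F W 0 T H I"
    "AE w in M. \<forall>t\<in>{0..T}. X t w = \<xi> w + (LBINT r:{0..t}. m r w) + I t w"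
    using X unfolding has_drift_diffusion_def by blast
  obtain I' where I': "ito_integral_matrix M F W 0 T H' I'"
    "AE w in M. \<forall>t\<in>{0..T}. X' t w = \<xi> w + (LBINT r:{0..t}. m' r w) + I' t w"
    using X' unfolding has_drift_diffusion_def by blast
  have t': "0 \<le> t" "t \<le> T" using t by auto
  have jm: "jm 0 t (\<lambda>r w. m r w - m' r w)"
    by (rule jm_sub[OF jm_diff[OF dd_jm_drift[OF X I] dd_jm_drift[OF X' I']]]) (use t in auto)
  have J: "ito_vec 0 t (\<lambda>r w. H r w - H' r w) (\<lambda>w. (I t w - I 0 w) - (I' t w - I' 0 w))"
    using t by (intro ito_vec_diff dd_ito_vec[OF X I] dd_ito_vec[OF X' I']) auto
  have "AE w in M. X t w - X' t w = (LBINT r:{0..t}. m r w - m' r w) + ((I t w - I 0 w) - (I' t w - I' 0 w))"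
    using dd_increment[OF X I order_refl t'] dd_increment[OF X' I' order_refl t'] dd_start[OF X I] dd_start[OF X' I'] AE_space
  proof eventually_elim
    case (elim w)
    have "set_integrable lborel {0..t} (\<lambda>r. m r w)" "set_integrable lborel {0..t} (\<lambda>r. m' r w)"
      using bounded_path_integrable[OF dd_jm_drift[OF X I] elim(5) dd_bound_drift[OF X I _ elim(5)]]
        bounded_path_integrable[OF dd_jm_drift[OF X' I'] elim(5) dd_bound_drift[OF X' I' _ elim(5)]] t by auto
    note sd = set_integral_diff(2)[OF this]
    have "X t w = (LBINT r:{0..t}. m r w) + (I t w - I 0 w) + \<xi> w" using elim(1,3) by (simp add: diff_eq_eq)
    moreover have "X' t w = (LBINT r:{0..t}. m' r w) + (I' t w - I' 0 w) + \<xi> w" using elim(2,4) by (simp add: diff_eq_eq)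
    ultimately show ?case by (simp only: sd) (simp only: algebra_simps)
  qed
  then have "sqn M (\<lambda>w. X t w - X' t w) = sqn M (\<lambda>w. (LBINT r:{0..t}. m r w - m' r w) + ((I t w - I 0 w) - (I' t w - I' 0 w)))"
    by (rule sqn_cong_AE)
  also have "... \<le> 2 * sqn M (\<lambda>w. LBINT r:{0..t}. m r w - m' r w) + 2 * sqn M (\<lambda>w. (I t w - I 0 w) - (I' t w - I' 0 w))"
    by (intro sqn_add_le measurable_time_integral jm ito_vec_measurable[OF J])
  also have "... = 2 * sqn M (\<lambda>w. LBINT r:{0..t}. m r w - m' r w) + 2 * psq 0 t (\<lambda>r w. H r w - H' r w)"
    using ito_vec_isometry[OF J] t by simp
  also have "sqn M (\<lambda>w. LBINT r:{0..t}. m r w - m' r w) \<le> ennreal T * psq 0 t (\<lambda>r w. m r w - m' r w)"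
    by (rule order_trans[OF sqn_time_integral_le[OF jm t'(1)]]) (use t' in \<open>auto intro!: mult_right_mono ennreal_leI\<close>)
  also have "2 * (ennreal T * psq 0 t (\<lambda>r w. m r w - m' r w)) = ennreal (2 * T) * psq 0 t (\<lambda>r w. m r w - m' r w)"
    by (simp add: numeral_mult_ennreal' mult.assoc[symmetric])
  finally show ?thesis by (simp add: add_right_mono mult_left_mono)
qed

text \<open>The difference of the coefficients is split into the error \<open>X - X'\<close>, the
  movement \<open>N\<close> of the scheme since its last grid time, and the modulus of continuity of
  the coefficients in time over one cell. The last two have square norm of order 1/n; Gronwall takes
  care of the first. The factor \<epsilon> only shrinks the diffusion, which gives
  uniformity.\<close>

lemma euler_error:
  "\<exists>C\<ge>0. \<forall>\<epsilon>\<in>{0<..<1}. \<forall>n\<ge>1. \<forall>X X'. sde_solution M F W T \<mu> \<sigma> \<epsilon> 0 \<xi> X \<longrightarrow>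
     euler_maruyama M F W T \<mu> \<sigma> \<xi> \<epsilon> n X' \<longrightarrow>
     (\<forall>t\<in>{0..T}. sqn M (\<lambda>w. X t w - X' t w) \<le> ennreal (C / real n))"
proof -
  \<comment> \<open>\<open>C1\<close> bounds the mean square modulus of the scheme,
    \<open>c0 / real n\<close> collects the two contributions of a grid cell, and \<open>K\<close>
    is the Gronwall rate, with 1 added to make it positive.\<close>
  define C1 where "C1 = 2 * L\<^sup>2 * (T + 1)"
  define c0 where "c0 = 4 * (L\<^sup>2 * (T * (C1 * T))) + 4 * (T * (L\<^sup>2 * T))"
  define K where "K = (2 * T + 2) * (4 * L\<^sup>2) + 1"
  define B where "B n = (2 * T + 2) * (c0 / real n)" for n
  define C where "C = 2 * ((2 * T + 2) * c0) * exp (2 * K * T)"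
  have C1: "C1 \<ge> 0" and K: "K > 0" using T_pos by (auto simp: C1_def K_def intro!: add_nonneg_pos)
  have c0: "c0 \<ge> 0" unfolding c0_def using C1 T_pos by (intro add_nonneg_nonneg mult_nonneg_nonneg) auto
  have C: "C \<ge> 0" unfolding C_def using c0 T_pos by simp
  have main: "sqn M (\<lambda>w. X t w - X' t w) \<le> ennreal (C / real n)"
    if \<epsilon>: "\<epsilon> \<in> {0<..<1}" and n: "n \<ge> 1" and sol: "sde_solution M F W T \<mu> \<sigma> \<epsilon> 0 \<xi> X"
      and eul: "euler_maruyama M F W T \<mu> \<sigma> \<xi> \<epsilon> n X'" and t: "t \<in> {0..T}" for \<epsilon> n X X' t
  proof -
    let ?\<phi> = "grid_floor T n"
    let ?m = "\<lambda>r w. \<mu> r (X r w)" and ?H = "\<lambda>r w. \<epsilon> *\<^sub>R \<sigma> r (X r w)"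
    let ?m' = "\<lambda>r w. \<mu> (?\<phi> r) (X' (?\<phi> r) w)" and ?H' = "\<lambda>r w. \<epsilon> *\<^sub>R \<sigma> (?\<phi> r) (X' (?\<phi> r) w)"
    note X = sde_has_drift_diffusion[OF sol \<epsilon>]
    note X' = euler_has_drift_diffusion[OF eul \<epsilon> n]
    obtain I where I: "ito_integral_matrix M F W 0 T ?H I"
      "AE w in M. \<forall>t\<in>{0..T}. X t w = \<xi> w + (LBINT r:{0..t}. ?m r w) + I t w"
      using X unfolding has_drift_diffusion_def by blast
    obtain I' where I': "ito_integral_matrix M F W 0 T ?H' I'"
      "AE w in M. \<forall>t\<in>{0..T}. X' t w = \<xi> w + (LBINT r:{0..t}. ?m' r w) + I' t w"
      using X' unfolding has_drift_diffusion_def by blast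
    define D where "D r w = X r w - X' r w" for r w
    define N where "N r w = X' r w - X' (?\<phi> r) w" for r w
    define c where "c = L * sqrt (T / real n)"
    have jD: "jm 0 T D" and jN: "jm 0 T N"
      unfolding D_def[abs_def] N_def[abs_def] using dd_jm[OF X I] dd_jm[OF X' I'] jm_grid[OF dd_jm[OF X' I'] n]
      by (auto intro: jm_diff)
    have N_le: "sqn M (N r) \<le> ennreal (C1 * (T / real n))" if r: "r \<in> {0..T}" for r
    proof -
      have "sqn M (N r) \<le> ennreal (2 * L\<^sup>2 * (T + 1) * (r - ?\<phi> r))"
        unfolding N_def[abs_def] using grid_floor_mem[OF r n] grid_floor_le[OF T_pos n, of r] r
        by (intro dd_increment_sqn[OF X' I']) auto
      also have "... \<le> ennreal (C1 * (T / real n))"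
        unfolding C1_def using grid_floor_close[OF T_pos n, of r] r T_pos by (intro ennreal_leI mult_left_mono) auto
      finally show ?thesis .
    qed
    have coef: "psq 0 t G \<le> ennreal (4 * L\<^sup>2) * psq 0 t D + ennreal (c0 / real n)"
      if le: "\<And>r w. r \<in> {0..T} \<Longrightarrow> norm (G r w) \<le> L * norm (D r w) + L * norm (N r w) + c" and t: "t \<in> {0..T}"
      for G :: "real \<Rightarrow> 'w \<Rightarrow> 'b::real_normed_vector" and t
    proof -
      have jD': "jm 0 t D" and jN': "jm 0 t N" using jm_sub[OF jD] jm_sub[OF jN] t by auto
      have m: "(\<lambda>z. L *\<^sub>R norm (D (fst z) (snd z))) \<in> borel_measurable (PM 0 t)"
        "(\<lambda>z. L *\<^sub>R norm (N (fst z) (snd z))) \<in> borel_measurable (PM 0 t)"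
        using jmD[OF jD'] jmD[OF jN'] by (auto intro!: borel_measurable_times borel_measurable_norm)
      have mn: "(\<lambda>z. norm (D (fst z) (snd z))) \<in> borel_measurable (PM 0 t)"
        "(\<lambda>z. norm (N (fst z) (snd z))) \<in> borel_measurable (PM 0 t)"
        using jmD[OF jD'] jmD[OF jN'] by (auto intro!: borel_measurable_norm)
      have "psq 0 t G \<le> sqn (PM 0 t) (\<lambda>z. L *\<^sub>R norm (D (fst z) (snd z)) + L *\<^sub>R norm (N (fst z) (snd z)) + c)"
        unfolding psq_def
      proof (rule sqn_mono)
        fix z assume "z \<in> space (PM 0 t)"
        then have "norm (G (fst z) (snd z)) \<le> L * norm (D (fst z) (snd z)) + L * norm (N (fst z) (snd z)) + c"
          using t by (intro le) (auto simp: space_PM)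
        then show "norm (G (fst z) (snd z)) \<le> norm (L *\<^sub>R norm (D (fst z) (snd z)) + L *\<^sub>R norm (N (fst z) (snd z)) + c)"
          by simp
      qed
      also have "... \<le> 4 * sqn (PM 0 t) (\<lambda>z. L *\<^sub>R norm (D (fst z) (snd z))) + 4 * sqn (PM 0 t) (\<lambda>z. L *\<^sub>R norm (N (fst z) (snd z))) + 4 * sqn (PM 0 t) (\<lambda>z. c)"
        by (rule sqn_add3_le[OF m]) auto
      also have "... = 4 * (ennreal (L\<^sup>2) * psq 0 t D) + 4 * (ennreal (L\<^sup>2) * psq 0 t N) + 4 * psq 0 t (\<lambda>_ _. c)"
        unfolding psq_def sqn_scale[OF mn(1)] sqn_scale[OF mn(2)] by simp
      also have "... \<le> 4 * (ennreal (L\<^sup>2) * psq 0 t D) + 4 * (ennreal (L\<^sup>2) * (ennreal T * ennreal (C1 * (T / real n)))) + 4 * (ennreal T * ennreal (c\<^sup>2))"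
      proof (intro add_mono mult_left_mono order_refl)
        have "psq 0 t N \<le> ennreal (t - 0) * ennreal (C1 * (T / real n))"
          using t by (intro psq_le jN' N_le) auto
        also have "... \<le> ennreal T * ennreal (C1 * (T / real n))" using t by (intro mult_right_mono ennreal_leI) auto
        finally show "psq 0 t N \<le> ennreal T * ennreal (C1 * (T / real n))" .
        have "psq 0 t (\<lambda>_ _. c) \<le> ennreal (t - 0) * ennreal (c\<^sup>2)"
          using t by (intro psq_le jm_const sqn_bounded) (auto simp: c_def L0 T_pos less_imp_le)
        also have "... \<le> ennreal T * ennreal (c\<^sup>2)" using t by (intro mult_right_mono ennreal_leI) auto
        finally show "psq 0 t (\<lambda>_ _. c) \<le> ennreal T * ennreal (c\<^sup>2)" .
      qed auto
      also have "... = ennreal (4 * L\<^sup>2) * psq 0 t D + ennreal (c0 / real n)"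
      proof -
        have "c\<^sup>2 = L\<^sup>2 * (T / real n)" using T_pos by (simp add: c_def power_mult_distrib)
        then have "4 * (ennreal (L\<^sup>2) * (ennreal T * ennreal (C1 * (T / real n)))) + 4 * (ennreal T * ennreal (c\<^sup>2))
          = ennreal (4 * (L\<^sup>2 * (T * (C1 * (T / real n))))) + ennreal (4 * (T * (L\<^sup>2 * (T / real n))))"
          using T_pos by (simp add: ennreal_mult'[symmetric] numeral_mult_ennreal')
        also have "... = ennreal (4 * (L\<^sup>2 * (T * (C1 * (T / real n)))) + 4 * (T * (L\<^sup>2 * (T / real n))))"
          using T_pos C1 by (intro ennreal_plus[symmetric]) auto
        also have "4 * (L\<^sup>2 * (T * (C1 * (T / real n)))) + 4 * (T * (L\<^sup>2 * (T / real n))) = c0 / real n"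
          by (simp add: c0_def add_divide_distrib)
        finally show ?thesis by (simp add: add.assoc numeral_mult_ennreal' mult.assoc[symmetric])
      qed
      finally show ?thesis .
    qed
    have lip: "norm (a r (X r w) - a (?\<phi> r) (X' (?\<phi> r) w)) \<le> L * norm (D r w) + L * norm (N r w) + c"
      if r: "r \<in> {0..T}" and a1: "\<And>t x y. t \<in> {0..T} \<Longrightarrow> norm (a t x - a t y) \<le> L * norm (x - y)"
        and a2: "\<And>s t x. s \<in> {0..T} \<Longrightarrow> t \<in> {0..T} \<Longrightarrow> norm (a t x - a s x) \<le> L * sqrt \<bar>t - s\<bar>"
      for a :: "real \<Rightarrow> real ^ 'd \<Rightarrow> 'b::real_normed_vector" and r w
    proof -
      have p: "?\<phi> r \<in> {0..T}" by (rule grid_floor_mem[OF r n])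
      have split: "a r (X r w) - a (?\<phi> r) (X' (?\<phi> r) w) = (a r (X r w) - a r (X' r w)) + (a r (X' r w) - a r (X' (?\<phi> r) w))
        + (a r (X' (?\<phi> r) w) - a (?\<phi> r) (X' (?\<phi> r) w))" by simp
      have "norm (a r (X r w) - a (?\<phi> r) (X' (?\<phi> r) w)) \<le> norm (a r (X r w) - a r (X' r w)) + norm (a r (X' r w) - a r (X' (?\<phi> r) w))
        + norm (a r (X' (?\<phi> r) w) - a (?\<phi> r) (X' (?\<phi> r) w))"
        unfolding split by (intro norm_triangle_le add_mono norm_triangle_ineq order_refl)
      also have "... \<le> L * norm (D r w) + L * norm (N r w) + L * sqrt \<bar>r - ?\<phi> r\<bar>"
        unfolding D_def N_def by (rule add_mono[OF add_mono[OF a1[OF r] a1[OF r]] a2[OF p r]])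
      also have "... \<le> L * norm (D r w) + L * norm (N r w) + c"
        unfolding c_def using grid_floor_close[OF T_pos n, of r] grid_floor_le[OF T_pos n, of r] r L0
        by (intro add_left_mono mult_left_mono real_sqrt_le_mono) auto
      finally show ?thesis .
    qed
    have mle: "psq 0 t (\<lambda>r w. ?m r w - ?m' r w) \<le> ennreal (4 * L\<^sup>2) * psq 0 t D + ennreal (c0 / real n)" if "t \<in> {0..T}" for t
      by (rule coef[OF lip that]) (auto intro: mu_lip mu_hoelder)
    have Hle: "psq 0 t (\<lambda>r w. ?H r w - ?H' r w) \<le> ennreal (4 * L\<^sup>2) * psq 0 t D + ennreal (c0 / real n)" if "t \<in> {0..T}" for t
    proof (rule coef[OF _ that])
      fix r w assume r: "r \<in> {0..T}"
      let ?d = "\<sigma> r (X r w) - \<sigma> (?\<phi> r) (X' (?\<phi> r) w)"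
      have "norm (?H r w - ?H' r w) = \<epsilon> * norm ?d"
        using \<epsilon> by (simp add: scaleR_diff_right[symmetric] del: scaleR_diff_right)
      also have "... \<le> 1 * norm ?d" using \<epsilon> by (intro mult_right_mono) auto
      also have "1 * norm ?d \<le> L * norm (D r w) + L * norm (N r w) + c"
        unfolding mult_1 by (rule lip[OF r]) (auto intro: sigma_lip sigma_hoelder)
      finally show "norm (?H r w - ?H' r w) \<le> L * norm (D r w) + L * norm (N r w) + c" .
    qed
    define e where "e r = sqn M (D r)" for r
    have step: "e t \<le> ennreal (B n) + ennreal K * (\<integral>\<^sup>+r\<in>{0..t}. e r \<partial>lborel)" if t: "t \<in> {0..T}" for t
    proof -
      have p: "psq 0 t D = (\<integral>\<^sup>+r\<in>{0..t}. e r \<partial>lborel)"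
        unfolding e_def using jm_sub[OF jD, of 0 t] t by (intro psq_fst) auto
      have "e t \<le> ennreal (2 * T) * psq 0 t (\<lambda>r w. ?m r w - ?m' r w) + 2 * psq 0 t (\<lambda>r w. ?H r w - ?H' r w)"
        unfolding e_def D_def[abs_def] by (rule dd_difference_sqn[OF X X' t])
      also have "... \<le> ennreal (2 * T) * (ennreal (4 * L\<^sup>2) * psq 0 t D + ennreal (c0 / real n)) + 2 * (ennreal (4 * L\<^sup>2) * psq 0 t D + ennreal (c0 / real n))"
        by (intro add_mono mult_left_mono mle Hle t) auto
      also have "... = ennreal (2 * T + 2) * (ennreal (4 * L\<^sup>2) * psq 0 t D + ennreal (c0 / real n))"
        using T_pos by (simp add: distrib_right)
      also have "... = ennreal ((2 * T + 2) * (4 * L\<^sup>2)) * psq 0 t D + ennreal (B n)"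
      proof -
        have "ennreal ((2 * T + 2) * (4 * L\<^sup>2)) = ennreal (2 * T + 2) * ennreal (4 * L\<^sup>2)"
          "ennreal (B n) = ennreal (2 * T + 2) * ennreal (c0 / real n)"
          using T_pos unfolding B_def by (rule_tac [!] ennreal_mult') auto
        then show ?thesis by (simp only: distrib_left mult.assoc)
      qed
      also have "... \<le> ennreal K * psq 0 t D + ennreal (B n)"
        unfolding K_def by (intro add_right_mono mult_right_mono ennreal_leI) auto
      finally show ?thesis by (simp add: p add.commute)
    qed
    have "L\<^sup>2 \<ge> 0" by simp
    \<comment> \<open>A crude bound from the boundedness of the coefficients, to start the Gronwall
      iteration.\<close>
    have bounded: "e t \<le> ennreal (2 * T * (T * (2 * L)\<^sup>2) + 2 * (T * (2 * L)\<^sup>2))" if t: "t \<in> {0..T}" for t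
    proof -
      have gen: "psq 0 t (\<lambda>r w. a r w - b r w) \<le> ennreal (T * (2 * L)\<^sup>2)"
        if "jm 0 T a" "jm 0 T b" "\<And>r w. r \<in> {0..T} \<Longrightarrow> w \<in> space M \<Longrightarrow> norm (a r w) \<le> L"
          "\<And>r w. r \<in> {0..T} \<Longrightarrow> w \<in> space M \<Longrightarrow> norm (b r w) \<le> L"
        for a b :: "real \<Rightarrow> 'w \<Rightarrow> 'c::{real_normed_vector, second_countable_topology}"
      proof -
        have "psq 0 t (\<lambda>r w. a r w - b r w) \<le> ennreal (t - 0) * ennreal ((2 * L)\<^sup>2)"
        proof (intro psq_le sqn_bounded jm_sub[OF jm_diff[OF that(1,2)]])
          fix r w assume "r \<in> {0..t}" "w \<in> space M"
          then show "norm (a r w - b r w) \<le> 2 * L"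
            using that(3)[of r w] that(4)[of r w] t norm_triangle_ineq4[of "a r w" "b r w"] by auto
        qed (use t in auto)
        also have "... \<le> ennreal (T * (2 * L)\<^sup>2)"
          using t by (simp add: ennreal_mult'[symmetric] ennreal_leI mult_right_mono)
        finally show ?thesis .
      qed
      have "e t \<le> ennreal (2 * T) * psq 0 t (\<lambda>r w. ?m r w - ?m' r w) + 2 * psq 0 t (\<lambda>r w. ?H r w - ?H' r w)"
        unfolding e_def D_def[abs_def] by (rule dd_difference_sqn[OF X X' t])
      also have "... \<le> ennreal (2 * T) * ennreal (T * (2 * L)\<^sup>2) + 2 * ennreal (T * (2 * L)\<^sup>2)"
        by (intro add_mono mult_left_mono gen dd_jm_drift[OF X I] dd_jm_drift[OF X' I'] dd_jm_diffusion[OF X I]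
            dd_jm_diffusion[OF X' I'] dd_bound_drift[OF X I] dd_bound_drift[OF X' I'] dd_bound_diffusion[OF X I] dd_bound_diffusion[OF X' I']) auto
      also have "... = ennreal (2 * T * (T * (2 * L)\<^sup>2) + 2 * (T * (2 * L)\<^sup>2))"
        using T_pos by (simp add: ennreal_mult'[symmetric] numeral_mult_ennreal')
      finally show ?thesis .
    qed
    have "e t \<le> ennreal (2 * B n * exp (2 * K * t))"
      by (rule gronwall_ennreal[OF step bounded _ K _ t]) (use c0 T_pos n in \<open>auto simp: B_def\<close>)
    also have "... \<le> ennreal (C / real n)"
    proof (rule ennreal_leI)
      have "2 * B n * exp (2 * K * t) \<le> 2 * B n * exp (2 * K * T)"
        using t K c0 T_pos by (intro mult_left_mono) (auto simp: B_def)
      also have "... = C / real n" by (simp add: B_def C_def)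
      finally show "2 * B n * exp (2 * K * t) \<le> C / real n" .
    qed
    finally show ?thesis by (simp add: e_def D_def[abs_def])
  qed
  show ?thesis using main C by blast
qed

end

section \<open>The linear part along the forward process\<close>

lemma norm_matrix_vector_le: "norm (A *v x) \<le> norm A * norm x" for A :: "real ^ 'n ^ 'm"
proof -
  have "norm (A *v x) = L2_set (\<lambda>i. norm ((A *v x) $ i)) UNIV" by (rule norm_vec_def)
  also have "... \<le> L2_set (\<lambda>i. norm (A $ i) * norm x) UNIV"
    by (rule L2_set_mono) (auto simp: matrix_vector_mul_component Cauchy_Schwarz_ineq2)
  also have "... = norm A * norm x"
    by (simp add: L2_set_left_distrib norm_vec_def[of A])
  finally show ?thesis .
qed

text \<open>For given \<open>e\<close>, the times \<open>r\<close> with increment from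
  \<open>s\<close> at most \<open>e * (r - s)\<close> form a closed set, and a step with slope at
  most \<open>e\<close> from its supremum stays in the set; so the supremum is \<open>T\<close>. One
  point \<open>r'\<close> for each \<open>e\<close> suffices, so slopes need to be examined along a
  sequence only.\<close>

lemma constant_if_right_slopes_vanish:
  fixes \<phi> :: "real \<Rightarrow> real"
  assumes cont: "continuous_on {s..T} \<phi>"
    and slope: "\<And>r e. s \<le> r \<Longrightarrow> r < T \<Longrightarrow> e > 0 \<Longrightarrow> \<exists>r'. r < r' \<and> r' \<le> T \<and> \<bar>\<phi> r' - \<phi> r\<bar> \<le> e * (r' - r)"
    and s: "s \<le> T"
  shows "\<phi> T = \<phi> s"
proof -
  have "\<bar>\<phi> T - \<phi> s\<bar> \<le> e * (T - s)" if e: "e > 0" for e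
  proof -
    define S where "S = {s..T} \<inter> (\<lambda>r. \<bar>\<phi> r - \<phi> s\<bar> - e * (r - s)) -` {..0}"
    have "closed S" unfolding S_def
      by (intro continuous_closed_preimage continuous_intros cont)
    moreover have "s \<in> S" using s by (simp add: S_def)
    moreover have bdd: "bdd_above S" by (rule bdd_aboveI[of _ T]) (auto simp: S_def)
    ultimately have m: "Sup S \<in> S" using closed_contains_Sup by blast
    have "Sup S = T"
    proof (rule ccontr)
      assume "Sup S \<noteq> T"
      then have lt: "s \<le> Sup S" "Sup S < T" using m by (auto simp: S_def)
      from slope[OF lt e] obtain r' where r': "Sup S < r'" "r' \<le> T" "\<bar>\<phi> r' - \<phi> (Sup S)\<bar> \<le> e * (r' - Sup S)" by blast
      have "\<bar>\<phi> r' - \<phi> s\<bar> \<le> e * (r' - Sup S) + e * (Sup S - s)" using r'(3) m by (auto simp: S_def)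
      then have "r' \<in> S" using r' lt by (auto simp: S_def algebra_simps)
      then show False using cSup_upper[OF _ bdd] r'(1) by fastforce
    qed
    then show ?thesis using m by (auto simp: S_def)
  qed
  note slope_le = this
  have "\<bar>\<phi> T - \<phi> s\<bar> \<le> 0 + d" if d: "d > 0" for d
  proof -
    have "\<bar>\<phi> T - \<phi> s\<bar> \<le> d / (T - s + 1) * (T - s)" using d s by (intro slope_le) simp
    also have "... \<le> d" using d s by (simp add: field_simps)
    finally show ?thesis by simp
  qed
  then have "\<bar>\<phi> T - \<phi> s\<bar> \<le> 0" by (rule field_le_epsilon)
  then show ?thesis by simp
qed

lemma has_derivative_norm_le_lipschitz:
  fixes f :: "'a::real_normed_vector \<Rightarrow> 'b::real_normed_vector"
  assumes d: "(f has_derivative f') (at x)" and lip: "\<And>y. norm (f y - f x) \<le> C * norm (y - x)"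
  shows "norm (f' v) \<le> C * norm v"
proof (cases "v = 0")
  case True
  then show ?thesis using has_derivative_linear[OF d] by (simp add: linear_0)
next
  case False
  have "norm (f' v) \<le> C * norm v + d" if "d > 0" for d
  proof -
    define e where "e = d / norm v"
    have e: "e > 0" using that False by (simp add: e_def)
    obtain \<delta> where \<delta>: "\<delta> > 0" "\<And>y. norm (y - x) < \<delta> \<Longrightarrow> norm (f y - f x - f' (y - x)) \<le> e * norm (y - x)"
      using d[unfolded has_derivative_at_alt] e by blast
    define s where "s = \<delta> / (2 * norm v)"
    have s: "s > 0" using \<delta>(1) False by (simp add: s_def)
    have "norm ((x + s *\<^sub>R v) - x) < \<delta>" using \<delta>(1) False by (simp add: s_def)
    from \<delta>(2)[OF this] have "norm (f (x + s *\<^sub>R v) - f x - f' (s *\<^sub>R v)) \<le> e * (s * norm v)" using s by simp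
    moreover have "norm (f (x + s *\<^sub>R v) - f x) \<le> C * (s * norm v)" using lip[of "x + s *\<^sub>R v"] s by simp
    ultimately have "norm (f' (s *\<^sub>R v)) \<le> C * (s * norm v) + e * (s * norm v)"
      by (smt (verit) norm_triangle_ineq4 add_diff_cancel_left' diff_add_cancel norm_minus_commute norm_triangle_sub)
    then have "s * norm (f' v) \<le> s * (C * norm v + e * norm v)"
      using s by (simp add: linear_cmul[OF has_derivative_linear[OF d]] algebra_simps)
    then show ?thesis using s False by (simp add: e_def)
  qed
  then show ?thesis by (rule field_le_epsilon)
qed

lemma tendsto_integral_mult_sqn_bounded:
  fixes f g :: "nat \<Rightarrow> 'a \<Rightarrow> real"
  assumes [measurable]: "\<And>k. f k \<in> borel_measurable N" "\<And>k. g k \<in> borel_measurable N"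
    and ff: "\<And>k. sqn N (f k) \<le> ennreal A" and g: "(\<lambda>k. sqn N (g k)) \<longlonglongrightarrow> 0"
  shows "(\<lambda>k. \<integral>x. f k x * g k x \<partial>N) \<longlonglongrightarrow> 0"
proof (rule LIMSEQ_I)
  fix r :: real assume r: "r > 0"
  define \<theta> where "\<theta> = r / (2 * (\<bar>A\<bar> + 1))"
  have \<theta>: "\<theta> > 0" "\<theta> * \<bar>A\<bar> < r / 2" using r by (auto simp: \<theta>_def field_simps)
  have "\<forall>\<^sub>F k in sequentially. sqn N (g k) < ennreal (\<theta> * (r / 2))"
    using \<theta> r by (intro order_tendstoD(2)[OF g]) simp
  then obtain n where n: "\<And>k. k \<ge> n \<Longrightarrow> sqn N (g k) < ennreal (\<theta> * (r / 2))"
    unfolding eventually_sequentially by auto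
  have "norm ((\<integral>x. f k x * g k x \<partial>N) - 0) < r" if "k \<ge> n" for k
  proof -
    have fg: "sqn N (g k) < top" using n[OF that] by (metis ennreal_less_top infinity_ennreal_def order_less_trans)
    then obtain B where B: "sqn N (g k) = ennreal B" "B \<ge> 0" by (cases "sqn N (g k)") auto
    have fk: "sqn N (f k) < top" using ff[of k] ennreal_less_top by (rule order_le_less_trans)
    have "B < \<theta> * (r / 2)" using n[OF that] B by (simp add: ennreal_less_iff)
    then have b: "1 / \<theta> * B < r / 2" using \<theta> by (simp add: field_simps)
    have "ennreal \<bar>\<integral>x. f k x * g k x \<partial>N\<bar> \<le> ennreal \<theta> * sqn N (f k) + ennreal (1 / \<theta>) * sqn N (g k)"
      by (rule abs_integral_mult_le_sqn[OF assms(1,2) fk fg \<theta>(1)])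
    also have "... \<le> ennreal \<theta> * ennreal \<bar>A\<bar> + ennreal (1 / \<theta>) * ennreal B"
      unfolding B(1) by (intro add_right_mono mult_left_mono order_trans[OF ff] ennreal_leI) auto
    also have "... = ennreal (\<theta> * \<bar>A\<bar> + 1 / \<theta> * B)"
      using B(2) \<theta>(1) by (simp only: ennreal_plus ennreal_mult mult_nonneg_nonneg less_imp_le abs_ge_zero zero_le_divide_1_iff)
    finally have "\<bar>\<integral>x. f k x * g k x \<partial>N\<bar> \<le> \<theta> * \<bar>A\<bar> + 1 / \<theta> * B"
      using B \<theta> by (subst (asm) ennreal_le_iff) auto
    then have "\<bar>\<integral>x. f k x * g k x \<partial>N\<bar> < r" using \<theta>(2) b by linarith
    then show ?thesis by simp
  qed
  then show "\<exists>no. \<forall>n\<ge>no. norm ((\<integral>x. f n x * g n x \<partial>N) - 0) < r" by blast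
qed

text \<open>The bound \<open>L\<close> for \<open>u\<close> comes from the representation of
  \<open>u\<close> as a mean of \<open>g\<close>.\<close>

locale linear_setting = diffusion_setting M T W \<xi> F \<mu> \<sigma> g L
  for M :: "'w measure" and T :: real and W :: "real \<Rightarrow> 'w \<Rightarrow> real ^ 'd" and \<xi> F
    and \<mu> :: "real \<Rightarrow> real ^ 'd \<Rightarrow> real ^ 'd" and \<sigma> g L +
  fixes \<epsilon> :: real and X :: "real \<Rightarrow> 'w \<Rightarrow> real ^ 'd" and u :: "real \<Rightarrow> real ^ 'd \<Rightarrow> real"
  assumes eps: "\<epsilon> \<in> {0<..<1}"
    and sol: "sde_solution M F W T \<mu> \<sigma> \<epsilon> 0 \<xi> X"
    and pde: "backward_pde_solution T \<mu> \<sigma> g \<epsilon> u"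
    and u_bound: "\<And>t x. t \<in> {0..T} \<Longrightarrow> \<bar>u t x\<bar> \<le> L"
begin

section \<open>Pointwise bounds for the linear part\<close>

lemma u_lipschitz: "t \<in> {0..T} \<Longrightarrow> \<bar>u t x - u t y\<bar> \<le> deriv_bound * norm (x - y)"
  by (rule solution_lipschitz[OF pde eps u_bound])

lemma gradient_bound: "t \<in> {0..<T} \<Longrightarrow> norm (gradient (u t) x) \<le> deriv_bound"
  by (rule solution_gradient_bound[OF pde eps u_bound])

lemma gradient_lipschitz: "t \<in> {0..<T} \<Longrightarrow> norm (gradient (u t) x - gradient (u t) y) \<le> deriv_bound * norm (x - y)"
  by (rule solution_gradient_lipschitz[OF pde eps u_bound])

lemma u_differentiable: "t \<in> {0..<T} \<Longrightarrow> u t differentiable (at x)"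
  and gradient_differentiable: "t \<in> {0..<T} \<Longrightarrow> gradient (u t) differentiable (at x)"
  and u_continuous: "continuous_on ({0..T} \<times> UNIV) (\<lambda>(t, x). u t x)"
  and gradient_continuous: "continuous_on ({0..<T} \<times> UNIV) (\<lambda>(t, x). gradient (u t) x)"
  and hessian_continuous: "continuous_on ({0..<T} \<times> UNIV) (\<lambda>(t, x). hessian (u t) x)"
  using pde by (auto simp: backward_pde_solution_def)

lemma hessian_bound: "t \<in> {0..<T} \<Longrightarrow> norm (v v* hessian (u t) x) \<le> deriv_bound * norm v"
  by (rule has_derivative_norm_le_lipschitz[OF frechet_hessian[OF gradient_differentiable]]) (auto intro: gradient_lipschitz)

text \<open>A fixed choice of the time derivative, taken within \<open>{0..T}\<close> so that it is
  one-sided at 0.\<close>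

definition "ut = (SOME u'. continuous_on ({0..<T} \<times> UNIV) (\<lambda>(t, x). u' t x) \<and>
        (\<forall>t\<in>{0..<T}. \<forall>x.
           ((\<lambda>s. u s x) has_real_derivative u' t x) (at t within {0..T}) \<and>
           u' t x + generator \<mu> \<sigma> \<epsilon> t (u t) x = 0))"

lemma
  shows ut_continuous: "continuous_on ({0..<T} \<times> UNIV) (\<lambda>(t, x). ut t x)"
    and ut_derivative: "t \<in> {0..<T} \<Longrightarrow> ((\<lambda>s. u s x) has_real_derivative ut t x) (at t within {0..T})"
    and ut_equation: "t \<in> {0..<T} \<Longrightarrow> ut t x + generator \<mu> \<sigma> \<epsilon> t (u t) x = 0"
proof -
  have "\<exists>u'. continuous_on ({0..<T} \<times> UNIV) (\<lambda>(t, x). u' t x) \<and>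
        (\<forall>t\<in>{0..<T}. \<forall>x.
           ((\<lambda>s. u s x) has_real_derivative u' t x) (at t within {0..T}) \<and>
           u' t x + generator \<mu> \<sigma> \<epsilon> t (u t) x = 0)"
    using pde by (simp add: backward_pde_solution_def)
  from someI_ex[OF this, folded ut_def]
  show "continuous_on ({0..<T} \<times> UNIV) (\<lambda>(t, x). ut t x)"
    and "t \<in> {0..<T} \<Longrightarrow> ((\<lambda>s. u s x) has_real_derivative ut t x) (at t within {0..T})"
    and "t \<in> {0..<T} \<Longrightarrow> ut t x + generator \<mu> \<sigma> \<epsilon> t (u t) x = 0" by auto
qed

definition "time_bound = deriv_bound * L + real CARD('d) * (deriv_bound * L\<^sup>2)"

text \<open>The equation expresses \<open>ut\<close> through the gradient and the Hessian, and the
  Hessian is bounded by the Lipschitz constant of the gradient.\<close>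

lemma ut_bound:
  assumes t: "t \<in> {0..<T}"
  shows "\<bar>ut t x\<bar> \<le> time_bound"
proof -
  have t': "t \<in> {0..T}" using t by auto
  have "\<bar>gradient (u t) x \<bullet> \<mu> t x\<bar> \<le> norm (gradient (u t) x) * norm (\<mu> t x)" by (rule Cauchy_Schwarz_ineq2)
  also have "... \<le> deriv_bound * L" by (intro mult_mono gradient_bound mu_bound t t' deriv_bound_nonneg) auto
  finally have 1: "\<bar>gradient (u t) x \<bullet> \<mu> t x\<bar> \<le> deriv_bound * L" .
  have k: "\<bar>1/2 * ((column k (\<sigma> t x) v* hessian (u t) x) \<bullet> column k (\<sigma> t x))\<bar> \<le> deriv_bound * L\<^sup>2" for k
  proof -
    have "\<bar>(column k (\<sigma> t x) v* hessian (u t) x) \<bullet> column k (\<sigma> t x)\<bar> \<le> norm (column k (\<sigma> t x) v* hessian (u t) x) * norm (column k (\<sigma> t x))"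
      by (rule Cauchy_Schwarz_ineq2)
    also have "... \<le> (deriv_bound * norm (column k (\<sigma> t x))) * norm (column k (\<sigma> t x))"
      by (intro mult_right_mono hessian_bound t) auto
    also have "... \<le> (deriv_bound * L) * L"
      by (intro mult_mono mult_left_mono column_bound t' deriv_bound_nonneg mult_nonneg_nonneg L0) auto
    finally show ?thesis by (simp add: power2_eq_square)
  qed
  have "\<bar>\<Sum>k\<in>UNIV. 1/2 * ((column k (\<sigma> t x) v* hessian (u t) x) \<bullet> column k (\<sigma> t x))\<bar> \<le> (\<Sum>k\<in>(UNIV::'d set). deriv_bound * L\<^sup>2)"
    by (rule order_trans[OF sum_abs sum_mono]) (rule k)
  then have s: "\<bar>\<Sum>k\<in>UNIV. 1/2 * ((column k (\<sigma> t x) v* hessian (u t) x) \<bullet> column k (\<sigma> t x))\<bar> \<le> real CARD('d) * (deriv_bound * L\<^sup>2)"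
    by simp
  have "\<epsilon>\<^sup>2 \<le> 1" using eps by (simp add: power_le_one)
  then have 2: "\<bar>\<epsilon>\<^sup>2 * (\<Sum>k\<in>UNIV. 1/2 * ((column k (\<sigma> t x) v* hessian (u t) x) \<bullet> column k (\<sigma> t x)))\<bar> \<le> 1 * (real CARD('d) * (deriv_bound * L\<^sup>2))"
    unfolding abs_mult using s by (intro mult_mono) auto
  have "ut t x = - (gradient (u t) x \<bullet> \<mu> t x + \<epsilon>\<^sup>2 * (\<Sum>k\<in>UNIV. 1/2 * ((column k (\<sigma> t x) v* hessian (u t) x) \<bullet> column k (\<sigma> t x))))"
    using ut_equation[OF t, of x] unfolding generator_columns by linarith
  then show ?thesis using 1 2 unfolding time_bound_def by linarith
qed

lemma u_mean_value:
  assumes "s \<in> {0..T}" "t \<in> {0..T}" "s < t"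
  shows "\<exists>r. s < r \<and> r < t \<and> u t x - u s x = (t - s) * ut r x"
proof -
  have "continuous_on {s..t} ((\<lambda>(t, x). u t x) \<circ> (\<lambda>r. (r, x)))"
    by (rule continuous_on_compose) (use assms in \<open>auto intro!: continuous_intros continuous_on_subset[OF u_continuous]\<close>)
  then have c: "continuous_on {s..t} (\<lambda>r. u r x)" by (simp add: o_def)
  have d: "((\<lambda>r. u r x) has_derivative (\<lambda>h. h * ut r x)) (at r)" if r: "s < r" "r < t" for r
  proof -
    have "((\<lambda>r. u r x) has_real_derivative ut r x) (at r within {0..T})" using r assms by (intro ut_derivative) auto
    moreover have "at r within {0..T} = at r" using r assms by (intro at_within_Icc_at) auto
    ultimately show ?thesis by (simp add: has_field_derivative_def mult_commute_abs)
  qed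
  obtain r where "s < r" "r < t" "u t x - u s x = (t - s) * ut r x"
    by (rule mvt[OF assms(3) c d])
  then show ?thesis by blast
qed

lemma u_time_lipschitz:
  assumes "s \<in> {0..T}" "t \<in> {0..T}"
  shows "\<bar>u t x - u s x\<bar> \<le> time_bound * \<bar>t - s\<bar>"
proof -
  have main: "\<bar>u t x - u s x\<bar> \<le> time_bound * \<bar>t - s\<bar>" if st: "s \<in> {0..T}" "t \<in> {0..T}" "s < t" for s t
  proof -
    obtain r where r: "s < r" "r < t" "u t x - u s x = (t - s) * ut r x" using u_mean_value[OF st] by blast
    have "\<bar>ut r x\<bar> \<le> time_bound" using r st by (intro ut_bound) auto
    then show ?thesis unfolding r(3) abs_mult using mult_left_mono[of "\<bar>ut r x\<bar>" time_bound "\<bar>t - s\<bar>"] by (simp add: mult.commute)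
  qed
  from main[of s t] main[of t s] assms show ?thesis by (cases s t rule: linorder_cases) (auto simp: abs_minus_commute)
qed

lemma taylor1_bound:
  assumes t: "t \<in> {0..<T}"
  shows "\<bar>u t (x + v) - u t x - gradient (u t) x \<bullet> v\<bar> \<le> deriv_bound * (norm v)\<^sup>2"
    and "\<bar>u t (x + v) - u t x - gradient (u t) x \<bullet> v\<bar> \<le> 2 * deriv_bound * norm v"
proof -
  let ?G = "\<lambda>s. gradient (u t) (x + s *\<^sub>R v)"
  define q where "q s = u t (x + s *\<^sub>R v) - s * (gradient (u t) x \<bullet> v)" for s
  have dq: "(q has_derivative (\<lambda>h. h * ((?G s - gradient (u t) x) \<bullet> v))) (at s within {0..1})" for s
  proof -
    have "(u t \<circ> (\<lambda>s. x + s *\<^sub>R v) has_derivative (\<lambda>w. ?G s \<bullet> w) \<circ> (\<lambda>h. h *\<^sub>R v)) (at s)"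
      by (rule diff_chain_at) (auto intro!: derivative_eq_intros frechet_gradient u_differentiable[OF t])
    then have "(q has_derivative (\<lambda>h. h * ((?G s - gradient (u t) x) \<bullet> v))) (at s)"
      unfolding q_def o_def by (auto intro!: derivative_eq_intros simp: algebra_simps inner_diff_left)
    then show ?thesis by (rule has_derivative_at_withinI)
  qed
  have "norm (q 1 - q 0) \<le> (deriv_bound * (norm v)\<^sup>2) * norm (1 - 0 :: real)"
  proof (rule differentiable_bound[where S="{0..1}", OF _ dq])
    fix s :: real assume s: "s \<in> {0..1}"
    have "norm (?G s - gradient (u t) x) \<le> deriv_bound * norm (s *\<^sub>R v)"
      using gradient_lipschitz[OF t, of "x + s *\<^sub>R v" x] by simp
    also have "... \<le> deriv_bound * norm v" using s by (intro mult_left_mono deriv_bound_nonneg) (simp add: mult_left_le_one_le)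
    finally have "\<bar>(?G s - gradient (u t) x) \<bullet> v\<bar> \<le> deriv_bound * norm v * norm v"
      by (meson Cauchy_Schwarz_ineq2 mult_right_mono norm_ge_zero order_trans)
    then have "\<bar>h * ((?G s - gradient (u t) x) \<bullet> v)\<bar> \<le> \<bar>h\<bar> * (deriv_bound * norm v * norm v)" for h
      unfolding abs_mult by (rule mult_left_mono) simp
    then show "onorm (\<lambda>h. h * ((?G s - gradient (u t) x) \<bullet> v)) \<le> deriv_bound * (norm v)\<^sup>2"
      by (intro onorm_le) (simp add: power2_eq_square mult.commute mult.left_commute)
  qed auto
  then show "\<bar>u t (x + v) - u t x - gradient (u t) x \<bullet> v\<bar> \<le> deriv_bound * (norm v)\<^sup>2" by (simp add: q_def algebra_simps)
  have "\<bar>u t (x + v) - u t x\<bar> \<le> deriv_bound * norm v" using u_lipschitz[of t "x + v" x] t by simp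
  moreover have "\<bar>gradient (u t) x \<bullet> v\<bar> \<le> deriv_bound * norm v"
    by (meson Cauchy_Schwarz_ineq2 gradient_bound[OF t] mult_right_mono norm_ge_zero order_trans)
  ultimately show "\<bar>u t (x + v) - u t x - gradient (u t) x \<bullet> v\<bar> \<le> 2 * deriv_bound * norm v" by linarith
qed

text \<open>\<open>a\<close> will be the Gaussian part of an increment over a step h, whose fourth
  moment is of order h squared, so it may enter squared; for \<open>b\<close> only the second moment
  is of that order, so it must enter linearly. The quadratic or the linear bound is used according
  to which of the two parts is larger.\<close>

lemma taylor1_split_bound:
  assumes t: "t \<in> {0..<T}"
  shows "\<bar>u t (x + (a + b)) - u t x - gradient (u t) x \<bullet> (a + b)\<bar> \<le> 4 * deriv_bound * ((norm a)\<^sup>2 + norm b)"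
proof (cases "norm b \<le> norm a")
  case True
  have "(norm (a + b))\<^sup>2 \<le> (2 * norm a)\<^sup>2" using True norm_triangle_ineq[of a b] by (intro power_mono) auto
  then have "deriv_bound * (norm (a + b))\<^sup>2 \<le> deriv_bound * (4 * ((norm a)\<^sup>2 + norm b))"
    using deriv_bound_nonneg norm_ge_zero[of b] by (intro mult_left_mono) (auto simp: power_mult_distrib simp del: norm_ge_zero)
  then show ?thesis using taylor1_bound(1)[OF t, of x "a + b"] by (simp add: algebra_simps)
next
  case False
  have "norm (a + b) \<le> 2 * norm b" using False norm_triangle_ineq[of a b] by linarith
  then have "norm (a + b) \<le> 2 * ((norm a)\<^sup>2 + norm b)" using zero_le_power2[of "norm a"] by argo
  then have "deriv_bound * norm (a + b) \<le> deriv_bound * (2 * ((norm a)\<^sup>2 + norm b))"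
    using deriv_bound_nonneg by (rule mult_left_mono)
  then show ?thesis using taylor1_bound(2)[OF t, of x "a + b"] by (simp add: algebra_simps)
qed

end

lemma continuous_section:
  assumes "continuous_on (A \<times> UNIV) (\<lambda>(t, x). c t x)" "s \<in> A"
  shows "continuous_on UNIV (c s)"
proof -
  have "continuous_on UNIV ((\<lambda>(t, x). c t x) \<circ> (\<lambda>x. (s, x)))"
    by (rule continuous_on_compose) (use assms in \<open>auto intro!: continuous_intros continuous_on_subset[OF assms(1)]\<close>)
  then show ?thesis by (simp add: o_def)
qed

lemma continuous_on_vector_matrix [continuous_intros]:
  fixes f :: "'a::topological_space \<Rightarrow> real ^ 'm" and A :: "'a \<Rightarrow> real ^ 'n ^ 'm"
  assumes "continuous_on S f" "continuous_on S A"
  shows "continuous_on S (\<lambda>x. f x v* A x)"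
  unfolding vector_matrix_mult_def by (intro continuous_on_vec_lambda continuous_intros assms)

lemma continuous_on_column [continuous_intros]:
  fixes A :: "'a::topological_space \<Rightarrow> real ^ 'n ^ 'm"
  assumes "continuous_on S A"
  shows "continuous_on S (\<lambda>x. column k (A x))"
  unfolding column_def by (intro continuous_on_vec_lambda continuous_intros assms)

context linear_setting
begin

section \<open>One step expansions along the forward process\<close>

definition "diffusion r w = \<epsilon> *\<^sub>R \<sigma> r (X r w)"
definition "drift r w = \<mu> r (X r w)"
definition "noise = (SOME I. ito_integral_matrix M F W 0 T diffusion I \<and>
        (AE w in M. \<forall>t\<in>{0..T}. X t w = \<xi> w + (LBINT r:{0..t}. drift r w) + I t w))"

lemma dd: "has_drift_diffusion X drift diffusion"
  using sde_has_drift_diffusion[OF sol eps] by (simp add: diffusion_def[abs_def] drift_def[abs_def])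

lemma
  shows noise_ito: "ito_integral_matrix M F W 0 T diffusion noise"
    and noise_equation: "AE w in M. \<forall>t\<in>{0..T}. X t w = \<xi> w + (LBINT r:{0..t}. drift r w) + noise t w"
proof -
  have "\<exists>I. ito_integral_matrix M F W 0 T diffusion I \<and>
        (AE w in M. \<forall>t\<in>{0..T}. X t w = \<xi> w + (LBINT r:{0..t}. drift r w) + I t w)"
    using dd unfolding has_drift_diffusion_def by blast
  from someI_ex[OF this, folded noise_def]
  show "ito_integral_matrix M F W 0 T diffusion noise"
    and "AE w in M. \<forall>t\<in>{0..T}. X t w = \<xi> w + (LBINT r:{0..t}. drift r w) + noise t w" by auto
qed

lemmas X_F_measurable = dd_F_measurable[OF dd noise_ito noise_equation]
lemmas X_measurable = dd_measurable[OF dd noise_ito noise_equation]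
lemmas X_jm = dd_jm[OF dd noise_ito noise_equation]
lemmas drift_jm = dd_jm_drift[OF dd noise_ito noise_equation]
lemmas diffusion_jm = dd_jm_diffusion[OF dd noise_ito noise_equation]
lemmas drift_bound = dd_bound_drift[OF dd noise_ito noise_equation]
lemmas diffusion_bound = dd_bound_diffusion[OF dd noise_ito noise_equation]
lemmas noise_ito_vec = dd_ito_vec[OF dd noise_ito noise_equation]
lemmas X_increment = dd_increment[OF dd noise_ito noise_equation]
lemmas X_increment_sqn = dd_increment_sqn[OF dd noise_ito noise_equation]
lemmas X_continuous = dd_continuous[OF dd noise_ito noise_equation]

lemma coefficient_F_measurable:
  fixes c :: "real \<Rightarrow> real ^ 'd \<Rightarrow> 'b::topological_space"
  assumes "continuous_on (A \<times> UNIV) (\<lambda>(t, x). c t x)" "s \<in> A" "s \<in> {0..T}"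
  shows "(\<lambda>w. c s (X s w)) \<in> borel_measurable (F s)"
  by (rule measurable_compose[OF X_F_measurable[OF assms(3)] borel_measurable_continuous_onI[OF continuous_section[OF assms(1,2)]]])

lemma diffusion_F_measurable: "s \<in> {0..T} \<Longrightarrow> diffusion s \<in> borel_measurable (F s)"
  unfolding diffusion_def[abs_def]
  by (intro borel_measurable_scaleR borel_measurable_const coefficient_F_measurable[OF sigma_continuous])

definition "uval t w = u t (X t w)"

lemma uval_F_measurable: "t \<in> {0..T} \<Longrightarrow> uval t \<in> borel_measurable (F t)"
  unfolding uval_def[abs_def] by (rule coefficient_F_measurable[OF u_continuous])

lemma uval_measurable: "t \<in> {0..T} \<Longrightarrow> uval t \<in> borel_measurable M"
  using measurable_F[OF uval_F_measurable] by auto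

lemma uval_bound: "t \<in> {0..T} \<Longrightarrow> \<bar>uval t w\<bar> \<le> L"
  by (simp add: uval_def u_bound)

definition "grad s w = gradient (u s) (X s w)"

lemma grad_F_measurable: "s \<in> {0..<T} \<Longrightarrow> grad s \<in> borel_measurable (F s)"
  unfolding grad_def[abs_def] by (rule coefficient_F_measurable[OF gradient_continuous]) auto

lemma grad_measurable: "s \<in> {0..<T} \<Longrightarrow> grad s \<in> borel_measurable M"
  using measurable_F[OF grad_F_measurable] by auto

lemma grad_bound: "s \<in> {0..<T} \<Longrightarrow> norm (grad s w) \<le> deriv_bound"
  by (simp add: grad_def gradient_bound)

text \<open>The martingale part of a step with the diffusion frozen at its initial value;
  \<open>rho\<close> collects the drift and the oscillation of the diffusion and has square norm of
  order \<open>(t - s)\<^sup>2\<close>.\<close>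

definition "frozen s t w = diffusion s w *v (W t w - W s w)"
definition "rho s t w = X t w - X s w - frozen s t w"

lemma diffusion_measurable: "s \<in> {0..T} \<Longrightarrow> diffusion s \<in> borel_measurable M"
  using measurable_F[OF diffusion_F_measurable] by auto

lemma frozen_measurable:
  assumes "0 \<le> s" "s \<le> t" "t \<le> T"
  shows "frozen s t \<in> borel_measurable M"
proof (rule borel_measurable_vecI)
  fix i
  have "(\<lambda>A :: real ^ 'd ^ 'd. A $ i) \<in> borel_measurable borel"
    by (intro borel_measurable_continuous_onI continuous_intros)
  from measurable_compose[OF diffusion_measurable this, of s]
  have "(\<lambda>w. diffusion s w $ i) \<in> borel_measurable M" using assms by auto
  then show "(\<lambda>w. frozen s t w $ i) \<in> borel_measurable M"
    unfolding frozen_def matrix_vector_mul_component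
    by (intro borel_measurable_inner increment_measurable assms)
qed

lemma rho_measurable: "0 \<le> s \<Longrightarrow> s \<le> t \<Longrightarrow> t \<le> T \<Longrightarrow> rho s t \<in> borel_measurable M"
  unfolding rho_def[abs_def] by (intro borel_measurable_diff X_measurable frozen_measurable) auto

lemma frozen_norm_le: "s \<in> {0..T} \<Longrightarrow> w \<in> space M \<Longrightarrow> norm (frozen s t w) \<le> L * norm (W t w - W s w)"
  unfolding frozen_def
  by (rule order_trans[OF norm_matrix_vector_le mult_right_mono[OF diffusion_bound]]) auto

lemma frozen_sqn:
  assumes st: "0 \<le> s" "s \<le> t" "t \<le> T"
  shows "sqn M (frozen s t) \<le> ennreal (L\<^sup>2 * (real CARD('d) * (t - s)))"
proof -
  have "sqn M (frozen s t) \<le> sqn M (\<lambda>w. L *\<^sub>R (W t w - W s w))"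
    by (rule sqn_mono) (use frozen_norm_le st L0 in auto)
  also have "... = ennreal (L\<^sup>2) * ennreal (real CARD('d) * (t - s))"
    by (simp only: sqn_scale[OF increment_measurable[OF st]] increment_sqn[OF st])
  finally show ?thesis by (simp add: ennreal_mult')
qed

text \<open>Mean square moduli: \<open>inc_const\<close> for \<open>X\<close> and
  \<open>osc_const\<close> for the coefficients along \<open>X\<close>, both against
  \<open>t - s\<close>, and \<open>rho_const\<close> for \<open>rho\<close> against
  \<open>(t - s)\<^sup>2\<close>.\<close>

definition "inc_const = 2 * L\<^sup>2 * (T + 1)"
definition "osc_const = 2 * (L\<^sup>2 * inc_const) + 2 * L\<^sup>2"
definition "rho_const = 2 * L\<^sup>2 + 2 * osc_const"

lemma inc_const_nonneg: "inc_const \<ge> 0" and osc_const_nonneg: "osc_const \<ge> 0" and rho_const_nonneg: "rho_const \<ge> 0"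
proof -
  show 1: "inc_const \<ge> 0" using T_pos by (simp add: inc_const_def)
  then show 2: "osc_const \<ge> 0" by (simp add: osc_const_def)
  then show "rho_const \<ge> 0" by (simp add: rho_const_def)
qed

lemma coefficient_oscillation:
  fixes c :: "real \<Rightarrow> real ^ 'd \<Rightarrow> 'b::{real_normed_vector, second_countable_topology}"
  assumes lip: "\<And>t x y. t \<in> {0..T} \<Longrightarrow> norm (c t x - c t y) \<le> L * norm (x - y)"
    and hoelder: "\<And>s t x. s \<in> {0..T} \<Longrightarrow> t \<in> {0..T} \<Longrightarrow> norm (c t x - c s x) \<le> L * sqrt \<bar>t - s\<bar>"
    and st: "0 \<le> s" "s \<le> t" "t \<le> T"
  shows "sqn M (\<lambda>w. c t (X t w) - c s (X s w)) \<le> ennreal (osc_const * (t - s))"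
proof -
  have "(\<lambda>w. X t w - X s w) \<in> borel_measurable M" using st by (intro borel_measurable_diff X_measurable) auto
  from measurable_compose[OF this borel_measurable_norm]
  have m: "(\<lambda>w. norm (X t w - X s w)) \<in> borel_measurable M" .
  have "sqn M (\<lambda>w. c t (X t w) - c s (X s w)) \<le> sqn M (\<lambda>w. L *\<^sub>R norm (X t w - X s w) + L * sqrt (t - s))"
  proof (rule sqn_mono)
    fix w
    have "norm (c t (X t w) - c s (X s w)) \<le> norm (c t (X t w) - c t (X s w)) + norm (c t (X s w) - c s (X s w))"
      using norm_triangle_ineq[of "c t (X t w) - c t (X s w)" "c t (X s w) - c s (X s w)"] by simp
    also have "... \<le> L * norm (X t w - X s w) + L * sqrt \<bar>t - s\<bar>"
      using st by (intro add_mono lip hoelder) auto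
    finally show "norm (c t (X t w) - c s (X s w)) \<le> norm (L *\<^sub>R norm (X t w - X s w) + L * sqrt (t - s))" using st by simp
  qed
  also have "... \<le> 2 * sqn M (\<lambda>w. L *\<^sub>R norm (X t w - X s w)) + 2 * sqn M (\<lambda>_. L * sqrt (t - s))"
    using m by (intro sqn_add_le borel_measurable_scaleR borel_measurable_const)
  also have "... = 2 * (ennreal (L\<^sup>2) * sqn M (\<lambda>w. X t w - X s w)) + 2 * ennreal (L\<^sup>2 * (t - s))"
    using st by (simp only: sqn_scale[OF m] sqn_norm) (simp add: sqn_const emeasure_space_1 power_mult_distrib)
  also have "... \<le> 2 * (ennreal (L\<^sup>2) * ennreal (inc_const * (t - s))) + 2 * ennreal (L\<^sup>2 * (t - s))"
    unfolding inc_const_def using st by (intro add_mono mult_left_mono X_increment_sqn) auto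
  also have "... = ennreal (2 * (L\<^sup>2 * (inc_const * (t - s)))) + ennreal (2 * (L\<^sup>2 * (t - s)))"
    by (simp only: numeral_mult_ennreal' ennreal_mult'[symmetric] zero_le_power2)
  also have "... = ennreal (2 * (L\<^sup>2 * (inc_const * (t - s))) + 2 * (L\<^sup>2 * (t - s)))"
    using st inc_const_nonneg by (intro ennreal_plus[symmetric]) auto
  also have "2 * (L\<^sup>2 * (inc_const * (t - s))) + 2 * (L\<^sup>2 * (t - s)) = osc_const * (t - s)"
    by (simp add: osc_const_def algebra_simps)
  finally show ?thesis .
qed

lemma diffusion_oscillation:
  assumes st: "0 \<le> s" "s \<le> t" "t \<le> T"
  shows "sqn M (\<lambda>w. diffusion t w - diffusion s w) \<le> ennreal (osc_const * (t - s))"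
proof -
  have "sqn M (\<lambda>w. diffusion t w - diffusion s w) \<le> sqn M (\<lambda>w. \<sigma> t (X t w) - \<sigma> s (X s w))"
  proof (rule sqn_mono)
    fix w
    have "norm (diffusion t w - diffusion s w) = \<epsilon> * norm (\<sigma> t (X t w) - \<sigma> s (X s w))"
      using eps by (simp add: diffusion_def scaleR_diff_right[symmetric] del: scaleR_diff_right)
    also have "... \<le> 1 * norm (\<sigma> t (X t w) - \<sigma> s (X s w))" using eps by (intro mult_right_mono) auto
    finally show "norm (diffusion t w - diffusion s w) \<le> norm (\<sigma> t (X t w) - \<sigma> s (X s w))" by simp
  qed
  also have "... \<le> ennreal (osc_const * (t - s))"
    by (rule coefficient_oscillation[OF _ _ st]) (auto intro: sigma_lip sigma_hoelder)
  finally show ?thesis .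
qed

lemma frozen_ito_vec:
  assumes st: "0 \<le> s" "s \<le> t" "t \<le> T"
  shows "ito_vec s t (\<lambda>r w. indicat_real {s<..t} r *\<^sub>R diffusion s w) (frozen s t)"
  unfolding ito_vec_def
proof
  fix i
  have sT: "s \<in> {0..T}" using st by auto
  have "(\<lambda>A :: real ^ 'd ^ 'd. A $ i) \<in> borel_measurable borel"
    by (intro borel_measurable_continuous_onI continuous_intros)
  from measurable_compose[OF diffusion_F_measurable[OF sT] this]
  have m: "(\<lambda>w. diffusion s w $ i) \<in> borel_measurable (F s)" .
  have b: "norm (diffusion s w $ i) \<le> L" if "w \<in> space M" for w
    using diffusion_bound[OF sT that] Finite_Cartesian_Product.norm_nth_le[of "diffusion s w" i] by linarith
  have "elem s t (s, t, \<lambda>w. diffusion s w $ i)" unfolding elem_def using st m b by auto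
  from ito_pair_elem[OF this st(1,3)]
  show "ito_pair s t (\<lambda>r w. (indicat_real {s<..t} r *\<^sub>R diffusion s w) $ i) (\<lambda>w. frozen s t w $ i)"
    by (simp add: eproc_def[abs_def] eint_def[abs_def] frozen_def matrix_vector_mul_component)
qed

text \<open>Both terms are stochastic integrals, so the isometry measures their difference by the
  oscillation of the diffusion, itself of order \<open>r - s\<close>. This gains one power of
  \<open>t - s\<close>.\<close>

lemma noise_frozen_sqn:
  assumes st: "0 \<le> s" "s \<le> t" "t \<le> T"
  shows "sqn M (\<lambda>w. (noise t w - noise s w) - frozen s t w) \<le> ennreal (osc_const * (t - s)\<^sup>2)"
proof -
  have sT: "s \<in> {0..T}" using st by auto
  note iv = ito_vec_diff[OF noise_ito_vec[OF st] frozen_ito_vec[OF st] st(1,3)]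
  have "sqn M (\<lambda>w. (noise t w - noise s w) - frozen s t w) = psq s t (\<lambda>r w. diffusion r w - indicat_real {s<..t} r *\<^sub>R diffusion s w)"
    by (rule ito_vec_isometry[OF iv st(1,3)])
  also have "... \<le> psq s t (\<lambda>r w. diffusion r w - diffusion s w)"
  proof (rule psq_mono_except_left)
    show "jm s t (\<lambda>r w. diffusion r w - diffusion s w)"
      using jm_sub[OF diffusion_jm] st by (intro jm_diff jm_const diffusion_measurable sT) auto
    show "jm s t (\<lambda>r w. diffusion r w - indicat_real {s<..t} r *\<^sub>R diffusion s w)"
      unfolding jm_def by (rule borel_measurable_vecI) (rule jmD[OF ito_pair_jm[OF ito_vec_nth[OF iv]]])
  qed auto
  also have "... \<le> ennreal (t - s) * ennreal (osc_const * (t - s))"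
  proof (rule psq_le[OF _ st(2)])
    show "jm s t (\<lambda>r w. diffusion r w - diffusion s w)"
      using jm_sub[OF diffusion_jm] st by (intro jm_diff jm_const diffusion_measurable sT) auto
    fix r assume r: "r \<in> {s..t}"
    then have "sqn M (\<lambda>w. diffusion r w - diffusion s w) \<le> ennreal (osc_const * (r - s))"
      using st by (intro diffusion_oscillation) auto
    also have "... \<le> ennreal (osc_const * (t - s))"
      using r osc_const_nonneg by (intro ennreal_leI mult_left_mono) auto
    finally show "sqn M (\<lambda>w. diffusion r w - diffusion s w) \<le> ennreal (osc_const * (t - s))" .
  qed
  also have "... = ennreal (osc_const * (t - s)\<^sup>2)"
    using st by (simp add: ennreal_mult'[symmetric] power2_eq_square mult_ac)
  finally show ?thesis .
qed

lemma rho_sqn: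
  assumes st: "0 \<le> s" "s \<le> t" "t \<le> T"
  shows "sqn M (rho s t) \<le> ennreal (rho_const * (t - s)\<^sup>2)"
proof -
  have "sqn M (rho s t) = sqn M (\<lambda>w. (LBINT r:{s..t}. drift r w) + ((noise t w - noise s w) - frozen s t w))"
    by (rule sqn_cong_AE) (use X_increment[OF st] in \<open>auto elim!: eventually_mono simp: rho_def\<close>)
  also have "... \<le> 2 * sqn M (\<lambda>w. LBINT r:{s..t}. drift r w) + 2 * sqn M (\<lambda>w. (noise t w - noise s w) - frozen s t w)"
    using jm_sub[OF drift_jm, of s t] st
    by (intro sqn_add_le measurable_time_integral borel_measurable_diff[OF ito_vec_measurable[OF noise_ito_vec[OF st]]] frozen_measurable) auto
  also have "... \<le> 2 * ennreal (L\<^sup>2 * (t - s)\<^sup>2) + 2 * ennreal (osc_const * (t - s)\<^sup>2)"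
    by (intro add_mono mult_left_mono noise_frozen_sqn st dd_drift_sqn[OF dd noise_ito noise_equation]) auto
  also have "... = ennreal (2 * (L\<^sup>2 * (t - s)\<^sup>2) + 2 * (osc_const * (t - s)\<^sup>2))"
    using osc_const_nonneg by (simp add: numeral_mult_ennreal')
  also have "2 * (L\<^sup>2 * (t - s)\<^sup>2) + 2 * (osc_const * (t - s)\<^sup>2) = rho_const * (t - s)\<^sup>2"
    by (simp add: rho_const_def algebra_simps)
  finally show ?thesis .
qed

text \<open>\<open>grad s\<close> paired with \<open>frozen s t\<close> is the elementary integral
  of \<open>linear_Z\<close> frozen at \<open>s\<close>, so this is the error of a single step in
  the martingale representation.\<close>

definition "remainder s t w = uval t w - uval s w - grad s w \<bullet> frozen s t w"

lemma remainder_measurable: "0 \<le> s \<Longrightarrow> s < t \<Longrightarrow> t \<le> T \<Longrightarrow> remainder s t \<in> borel_measurable M"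
  unfolding remainder_def[abs_def]
  by (intro borel_measurable_diff borel_measurable_inner uval_measurable grad_measurable frozen_measurable) auto

text \<open>The summands belong to the time increment of \<open>u\<close>, the fourth moment of the
  Brownian increment, and \<open>rho\<close>. The factor 5 is 4 from
  \<open>taylor1_split_bound\<close> plus 1 from the gradient paired with
  \<open>rho\<close>.\<close>

definition "remainder_const = 4 * time_bound\<^sup>2 + 4 * ((4 * deriv_bound * L\<^sup>2)\<^sup>2 * (3 * real CARD('d) ^ 2)) + 4 * ((5 * deriv_bound)\<^sup>2 * rho_const)"

lemma remainder_const_nonneg: "remainder_const \<ge> 0"
  unfolding remainder_const_def using rho_const_nonneg by simp

lemma remainder_sqn:
  assumes st: "0 \<le> s" "s < t" "t \<le> T"
  shows "sqn M (remainder s t) \<le> ennreal (remainder_const * (t - s)\<^sup>2)"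
proof -
  have st': "0 \<le> s" "s \<le> t" "t \<le> T" and sT: "s \<in> {0..<T}" "s \<in> {0..T}" "t \<in> {0..T}" using st by auto
  have mW: "(\<lambda>w. (norm (W t w - W s w))\<^sup>2) \<in> borel_measurable M"
    by (intro borel_measurable_power measurable_compose[OF _ borel_measurable_norm] increment_measurable st')
  have mr: "(\<lambda>w. norm (rho s t w)) \<in> borel_measurable M"
    by (rule measurable_compose[OF rho_measurable[OF st'] borel_measurable_norm])
  have "sqn M (remainder s t) \<le> sqn M (\<lambda>w. time_bound * (t - s) + (4 * deriv_bound * L\<^sup>2) *\<^sub>R (norm (W t w - W s w))\<^sup>2
      + (5 * deriv_bound) *\<^sub>R norm (rho s t w))"
  proof (rule sqn_mono)
    fix w assume w: "w \<in> space M"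
    let ?a = "frozen s t w" and ?b = "rho s t w"
    have X: "X t w = X s w + (?a + ?b)" by (simp add: rho_def)
    have 1: "\<bar>u t (X t w) - u s (X t w)\<bar> \<le> time_bound * (t - s)" using u_time_lipschitz[OF sT(2,3)] st by simp
    have 2: "\<bar>u s (X t w) - u s (X s w) - gradient (u s) (X s w) \<bullet> (?a + ?b)\<bar> \<le> 4 * deriv_bound * ((norm ?a)\<^sup>2 + norm ?b)"
      unfolding X by (rule taylor1_split_bound[OF sT(1)])
    have 3: "\<bar>gradient (u s) (X s w) \<bullet> ?b\<bar> \<le> deriv_bound * norm ?b"
      by (meson Cauchy_Schwarz_ineq2 gradient_bound[OF sT(1)] mult_right_mono norm_ge_zero order_trans)
    have "(norm ?a)\<^sup>2 \<le> (L * norm (W t w - W s w))\<^sup>2"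
      by (intro power_mono frozen_norm_le sT w) auto
    then have "4 * deriv_bound * (norm ?a)\<^sup>2 \<le> 4 * deriv_bound * (L\<^sup>2 * (norm (W t w - W s w))\<^sup>2)"
      using deriv_bound_nonneg by (intro mult_left_mono) (auto simp: power_mult_distrib)
    moreover have "remainder s t w = (u t (X t w) - u s (X t w)) + (u s (X t w) - u s (X s w) - gradient (u s) (X s w) \<bullet> (?a + ?b))
       + gradient (u s) (X s w) \<bullet> ?b"
      by (simp add: remainder_def uval_def grad_def inner_add_right)
    ultimately have "\<bar>remainder s t w\<bar> \<le> time_bound * (t - s) + 4 * deriv_bound * (L\<^sup>2 * (norm (W t w - W s w))\<^sup>2) + 5 * deriv_bound * norm ?b"
      using 1 2 3 by (simp add: algebra_simps)
    then show "norm (remainder s t w) \<le> norm (time_bound * (t - s) + (4 * deriv_bound * L\<^sup>2) *\<^sub>R (norm (W t w - W s w))\<^sup>2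
      + (5 * deriv_bound) *\<^sub>R norm (rho s t w))" by (simp add: mult.assoc)
  qed
  also have "... \<le> 4 * sqn M (\<lambda>_. time_bound * (t - s)) + 4 * sqn M (\<lambda>w. (4 * deriv_bound * L\<^sup>2) *\<^sub>R (norm (W t w - W s w))\<^sup>2)
      + 4 * sqn M (\<lambda>w. (5 * deriv_bound) *\<^sub>R norm (rho s t w))"
    by (intro sqn_add3_le borel_measurable_const borel_measurable_scaleR mW mr)
  also have "... = 4 * ennreal ((time_bound * (t - s))\<^sup>2) + 4 * (ennreal ((4 * deriv_bound * L\<^sup>2)\<^sup>2) * sqn M (\<lambda>w. (norm (W t w - W s w))\<^sup>2))
      + 4 * (ennreal ((5 * deriv_bound)\<^sup>2) * sqn M (rho s t))"
    by (simp only: sqn_scale[OF mW] sqn_scale[OF mr] sqn_norm) (simp add: sqn_const emeasure_space_1)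
  also have "... \<le> 4 * ennreal ((time_bound * (t - s))\<^sup>2) + 4 * (ennreal ((4 * deriv_bound * L\<^sup>2)\<^sup>2) * ennreal (3 * real CARD('d) ^ 2 * (t - s)\<^sup>2))
      + 4 * (ennreal ((5 * deriv_bound)\<^sup>2) * ennreal (rho_const * (t - s)\<^sup>2))"
    by (intro add_mono mult_left_mono order_refl increment_fourth_moment rho_sqn st') auto
  also have "... = ennreal (4 * (time_bound * (t - s))\<^sup>2) + ennreal (4 * ((4 * deriv_bound * L\<^sup>2)\<^sup>2 * (3 * real CARD('d) ^ 2 * (t - s)\<^sup>2)))
      + ennreal (4 * ((5 * deriv_bound)\<^sup>2 * (rho_const * (t - s)\<^sup>2)))"
    by (simp only: numeral_mult_ennreal' ennreal_mult'[symmetric] zero_le_power2)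
  also have "... = ennreal (4 * (time_bound * (t - s))\<^sup>2 + 4 * ((4 * deriv_bound * L\<^sup>2)\<^sup>2 * (3 * real CARD('d) ^ 2 * (t - s)\<^sup>2))
      + 4 * ((5 * deriv_bound)\<^sup>2 * (rho_const * (t - s)\<^sup>2)))"
    using rho_const_nonneg by (simp only: ennreal_plus mult_nonneg_nonneg zero_le_power2 zero_le_numeral add_nonneg_nonneg of_nat_0_le_iff zero_le_power)
  also have "4 * (time_bound * (t - s))\<^sup>2 + 4 * ((4 * deriv_bound * L\<^sup>2)\<^sup>2 * (3 * real CARD('d) ^ 2 * (t - s)\<^sup>2))
      + 4 * ((5 * deriv_bound)\<^sup>2 * (rho_const * (t - s)\<^sup>2)) = remainder_const * (t - s)\<^sup>2"
    unfolding remainder_const_def by (simp only: power_mult_distrib distrib_right mult.assoc)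
  finally show ?thesis .
qed

section \<open>The martingale property of the linear part\<close>

definition "hess r w = hessian (u r) (X r w)"
text \<open>Right slopes at \<open>r\<close> are examined along these lengths only; the first of
  them reaches \<open>T\<close>.\<close>

definition "step r k = (T - r) / real (Suc k)"

lemma step_pos: "r < T \<Longrightarrow> step r k > 0"
  by (simp add: step_def)

lemma step_le: "r \<le> T \<Longrightarrow> r + step r k \<le> T"
  using mult_right_mono[of r T "real k"] by (simp add: step_def field_simps)

lemma step_tendsto: "step r \<longlonglongrightarrow> 0"
  using tendsto_mult_right[OF LIMSEQ_inverse_real_of_nat, of "T - r"] unfolding step_def
  by (simp add: divide_inverse mult.commute)

lemma quadratic_bound: "r \<in> {0..<T} \<Longrightarrow> \<bar>(v v* hess r w) \<bullet> v'\<bar> \<le> deriv_bound * norm v * norm v'"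
  unfolding hess_def by (meson Cauchy_Schwarz_ineq2 hessian_bound mult_right_mono norm_ge_zero order_trans)

lemma quadratic_F_measurable:
  assumes r: "r \<in> {0..<T}"
  shows "(\<lambda>w. (column i (diffusion r w) v* hess r w) \<bullet> column j (diffusion r w)) \<in> borel_measurable (F r)"
proof -
  have "continuous_on UNIV (\<lambda>x. (column i (\<epsilon> *\<^sub>R \<sigma> r x) v* hessian (u r) x) \<bullet> column j (\<epsilon> *\<^sub>R \<sigma> r x))"
    using r by (intro continuous_intros continuous_section[OF sigma_continuous] continuous_section[OF hessian_continuous]) auto
  from measurable_compose[OF X_F_measurable borel_measurable_continuous_onI[OF this]] r
  show ?thesis by (simp add: diffusion_def hess_def)
qed

lemma frozen_quadratic_measurable:
  assumes r: "r \<in> {0..<T}" and V: "V \<in> borel_measurable M" and V': "V' \<in> borel_measurable M"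
  shows "(\<lambda>w. (V w v* hess r w) \<bullet> V' w) \<in> borel_measurable M"
proof -
  have "hessian (u r) \<in> borel_measurable borel"
    by (rule borel_measurable_continuous_onI[OF continuous_section[OF hessian_continuous r]])
  from measurable_compose[OF X_measurable this, of r] r
  have h: "hess r \<in> borel_measurable M" unfolding hess_def[abs_def] by auto
  have "continuous_on UNIV (\<lambda>x :: (real ^ 'd) \<times> (real ^ 'd ^ 'd). fst x v* snd x)" by (intro continuous_intros)
  from borel_measurable_continuous_Pair[OF V h this] have "(\<lambda>w. V w v* hess r w) \<in> borel_measurable M" by simp
  then show ?thesis by (intro borel_measurable_inner V')
qed

lemma column_diffusion_bound:
  "r \<in> {0..T} \<Longrightarrow> w \<in> space M \<Longrightarrow> norm (column i (diffusion r w)) \<le> L"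
  using diffusion_bound[of r w] norm_column_le[of i "diffusion r w"] by linarith

lemma frozen_expand:
  "(frozen r t w v* A) \<bullet> frozen r t w = (\<Sum>i\<in>UNIV. \<Sum>j\<in>UNIV.
     ((column i (diffusion r w) v* A) \<bullet> column j (diffusion r w)) * ((W t w - W r w) $ i * (W t w - W r w) $ j))"
proof -
  have lin: "linear (\<lambda>v. v v* A)" for A :: "real ^ 'd ^ 'd"
    by (rule matrix_vector_mul_linear[of "transpose A", unfolded transpose_matrix_vector])
  have f: "frozen r t w = (\<Sum>i\<in>UNIV. (W t w - W r w) $ i *\<^sub>R column i (diffusion r w))"
    unfolding frozen_def matrix_mult_sum by (simp add: scalar_mult_eq_scaleR)
  show ?thesis unfolding f linear_sum[OF lin] inner_sum_left inner_sum_right linear_cmul[OF lin] inner_scaleR_left inner_scaleR_right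
    by (rule trans[OF _ sum.swap], intro sum.cong refl, simp only: sum_distrib_left)
      (intro sum.cong refl, simp only: mult_ac)
qed

text \<open>The second order term of Ito's formula, in the mean: tested against \<open>F r\<close>,
  the Brownian increment has covariance \<open>t - r\<close> times the identity, so only the
  diagonal pairs of columns remain.\<close>

lemma frozen_quadratic_mean:
  assumes r: "0 \<le> r" "r < t" "t \<le> T" and G: "G \<in> borel_measurable (F r)" and B: "\<And>w. w \<in> space M \<Longrightarrow> \<bar>G w\<bar> \<le> B"
  shows "integrable M (\<lambda>w. G w * ((frozen r t w v* hess r w) \<bullet> frozen r t w))"
    and "(\<integral>w. G w * ((frozen r t w v* hess r w) \<bullet> frozen r t w) \<partial>M) =
      (t - r) * (\<integral>w. G w * (\<Sum>i\<in>UNIV. (column i (diffusion r w) v* hess r w) \<bullet> column i (diffusion r w)) \<partial>M)"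
proof -
  let ?K = "\<lambda>i j w. (column i (diffusion r w) v* hess r w) \<bullet> column j (diffusion r w)"
  have rT: "r \<in> {0..<T}" "r \<in> {0..T}" and rt: "0 \<le> r" "r \<le> t" "t \<le> T" using r by auto
  have m: "(\<lambda>w. G w * ?K i j w) \<in> borel_measurable (F r)" for i j
    by (intro borel_measurable_times G quadratic_F_measurable rT)
  have i: "integrable M (\<lambda>w. G w * ?K i j w)" for i j
  proof (rule integrable_const_bound[where B = "B * (deriv_bound * L * L)"])
    show "AE w in M. norm (G w * ?K i j w) \<le> B * (deriv_bound * L * L)"
    proof (rule AE_I2)
      fix w assume w: "w \<in> space M"
      have "\<bar>?K i j w\<bar> \<le> deriv_bound * norm (column i (diffusion r w)) * norm (column j (diffusion r w))"
        by (rule quadratic_bound[OF rT(1)])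
      also have "... \<le> deriv_bound * L * L"
        by (intro mult_mono mult_left_mono column_diffusion_bound rT w deriv_bound_nonneg L0 mult_nonneg_nonneg) auto
      finally show "norm (G w * ?K i j w) \<le> B * (deriv_bound * L * L)"
        unfolding real_norm_def abs_mult using B[OF w] by (intro mult_mono) auto
    qed
    show "(\<lambda>w. G w * ?K i j w) \<in> borel_measurable M" using measurable_F[OF m] rT by auto
  qed
  note c = increment_cond_covariance[OF rt m i]
  have eq: "G w * ((frozen r t w v* hess r w) \<bullet> frozen r t w) =
     (\<Sum>i\<in>UNIV. \<Sum>j\<in>UNIV. (G w * ?K i j w) * ((W t w - W r w) $ i * (W t w - W r w) $ j))" for w
    unfolding frozen_expand by (simp only: sum_distrib_left mult.assoc)
  show "integrable M (\<lambda>w. G w * ((frozen r t w v* hess r w) \<bullet> frozen r t w))"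
    unfolding eq by (intro Bochner_Integration.integrable_sum c(1))
  have "(\<integral>w. G w * ((frozen r t w v* hess r w) \<bullet> frozen r t w) \<partial>M) =
    (\<Sum>i\<in>UNIV. \<Sum>j\<in>UNIV. \<integral>w. (G w * ?K i j w) * ((W t w - W r w) $ i * (W t w - W r w) $ j) \<partial>M)"
    unfolding eq
    by (subst Bochner_Integration.integral_sum, intro Bochner_Integration.integrable_sum c(1))
      (intro sum.cong refl Bochner_Integration.integral_sum c(1))
  also have "... = (\<Sum>i\<in>UNIV. \<Sum>j\<in>UNIV. (if i = j then (t - r) * (\<integral>w. G w * ?K i j w \<partial>M) else 0))"
    by (simp only: c(2))
  also have "... = (t - r) * (\<Sum>i\<in>UNIV. \<integral>w. G w * ?K i i w \<partial>M)" by (simp add: sum_distrib_left)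
  also have "(\<Sum>i\<in>UNIV. \<integral>w. G w * ?K i i w \<partial>M) = (\<integral>w. G w * (\<Sum>i\<in>UNIV. ?K i i w) \<partial>M)"
    unfolding sum_distrib_left using i by (intro Bochner_Integration.integral_sum[symmetric]) auto
  finally show "(\<integral>w. G w * ((frozen r t w v* hess r w) \<bullet> frozen r t w) \<partial>M) =
      (t - r) * (\<integral>w. G w * (\<Sum>i\<in>UNIV. ?K i i w) \<partial>M)" .
qed

lemma noise_gradient_mean:
  assumes r: "0 \<le> r" "r < t" "t \<le> T" and G: "G \<in> borel_measurable (F r)" and B: "\<And>w. w \<in> space M \<Longrightarrow> \<bar>G w\<bar> \<le> B"
  shows "integrable M (\<lambda>w. G w * (grad r w \<bullet> (noise t w - noise r w)))"
    and "(\<integral>w. G w * (grad r w \<bullet> (noise t w - noise r w)) \<partial>M) = 0"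
proof -
  have rT: "r \<in> {0..<T}" "r \<in> {0..T}" and rt: "0 \<le> r" "r \<le> t" "t \<le> T" and tT: "t \<le> T" using r by auto
  note iv = ito_vec_nth[OF noise_ito_vec[OF rt]]
  have m: "(\<lambda>w. G w * grad r w $ i) \<in> borel_measurable (F r)" for i
    by (intro borel_measurable_times G measurable_compose[OF grad_F_measurable[OF rT(1)] borel_measurable_vec_nth'])
  have mM: "(\<lambda>w. G w * grad r w $ i) \<in> borel_measurable M" for i using measurable_F[OF m] rT by auto
  have fin: "sqn M (\<lambda>w. G w * grad r w $ i) < top" for i
  proof (rule order_le_less_trans[OF sqn_bounded])
    fix w assume w: "w \<in> space M"
    have "\<bar>grad r w $ i\<bar> \<le> deriv_bound" using component_le_norm_cart[of "grad r w" i] grad_bound[OF rT(1), of w] by linarith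
    then show "norm (G w * grad r w $ i) \<le> B * deriv_bound"
      unfolding real_norm_def abs_mult using B[OF w] by (intro mult_mono) auto
  qed simp
  have eq: "G w * (grad r w \<bullet> (noise t w - noise r w)) = (\<Sum>i\<in>UNIV. (G w * grad r w $ i) * (noise t w - noise r w) $ i)" for w
    by (simp add: inner_vec_def sum_distrib_left mult.assoc)
  have int: "integrable M (\<lambda>w. (G w * grad r w $ i) * (noise t w - noise r w) $ i)" for i
    by (intro integrable_mult_sqn mM fin ito_pair_measurable[OF iv] ito_pair_finite[OF iv r(1) tT])
  show "integrable M (\<lambda>w. G w * (grad r w \<bullet> (noise t w - noise r w)))"
    unfolding eq by (intro Bochner_Integration.integrable_sum int)
  have "(\<integral>w. G w * (grad r w \<bullet> (noise t w - noise r w)) \<partial>M) = (\<Sum>i\<in>UNIV. \<integral>w. (G w * grad r w $ i) * (noise t w - noise r w) $ i \<partial>M)"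
    unfolding eq by (intro Bochner_Integration.integral_sum int)
  also have "... = 0"
    by (intro sum.neutral ballI ito_pair_orthogonal[OF iv rt m fin])
  finally show "(\<integral>w. G w * (grad r w \<bullet> (noise t w - noise r w)) \<partial>M) = 0" .
qed

lemma drift_measurable: "r \<in> {0..T} \<Longrightarrow> drift r \<in> borel_measurable M"
  using jm_section[OF drift_jm] .

lemma drift_oscillation_integral:
  assumes rt: "0 \<le> r" "r \<le> t" "t \<le> T"
  shows "sqn M (\<lambda>w. LBINT q:{r..t}. drift q w - drift r w) \<le> ennreal (osc_const * (t - r) ^ 3)"
proof -
  have j: "jm r t (\<lambda>q w. drift q w - drift r w)"
    using jm_sub[OF drift_jm] rt by (intro jm_diff jm_const drift_measurable) auto
  have "psq r t (\<lambda>q w. drift q w - drift r w) \<le> ennreal (t - r) * ennreal (osc_const * (t - r))"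
  proof (rule psq_le[OF j rt(2)])
    fix q assume q: "q \<in> {r..t}"
    have "sqn M (\<lambda>w. drift q w - drift r w) \<le> ennreal (osc_const * (q - r))"
      unfolding drift_def using q rt by (intro coefficient_oscillation) (auto intro: mu_lip mu_hoelder)
    also have "... \<le> ennreal (osc_const * (t - r))" using q osc_const_nonneg by (intro ennreal_leI mult_left_mono) auto
    finally show "sqn M (\<lambda>w. drift q w - drift r w) \<le> ennreal (osc_const * (t - r))" .
  qed
  then have "ennreal (t - r) * psq r t (\<lambda>q w. drift q w - drift r w) \<le> ennreal (t - r) * (ennreal (t - r) * ennreal (osc_const * (t - r)))"
    by (rule mult_left_mono) simp
  also have "... = ennreal (osc_const * (t - r) ^ 3)"
    using rt by (simp add: ennreal_mult'[symmetric] power3_eq_cube mult_ac)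
  finally show ?thesis using sqn_time_integral_le[OF j rt(2)] by (rule order_trans[rotated])
qed

lemma drift_integral_split:
  assumes rt: "0 \<le> r" "r \<le> t" "t \<le> T" and w: "w \<in> space M"
  shows "(LBINT q:{r..t}. drift q w) = (t - r) *\<^sub>R drift r w + (LBINT q:{r..t}. drift q w - drift r w)"
proof -
  have i: "set_integrable lborel {r..t} (\<lambda>q. drift q w)"
    by (rule bounded_path_integrable[OF drift_jm w drift_bound[OF _ w]]) (use rt in auto)
  have c: "set_integrable lborel {r..t} (\<lambda>q. drift r w)"
    unfolding set_integrable_def by (intro integrable_scaleR_left integrable_real_indicator) (auto simp: emeasure_lborel_Icc_eq)
  have "(LBINT q:{r..t}. drift r w) = (t - r) *\<^sub>R drift r w" using rt by (simp add: set_lebesgue_integral_def)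
  then show ?thesis using set_integral_diff(2)[OF i c] by simp
qed

text \<open>Remainder of a second order expansion of \<open>uval\<close> from \<open>r\<close>, with
  the full increment of \<open>X\<close> in the linear term but only its frozen part in the
  quadratic one. In mean it is of smaller order than the step.\<close>

definition "theta r t w = uval t w - uval r w - (t - r) * ut r (X r w) - grad r w \<bullet> (X t w - X r w)
   - 1/2 * ((frozen r t w v* hess r w) \<bullet> frozen r t w)"

lemma ut_measurable: "r \<in> {0..<T} \<Longrightarrow> (\<lambda>w. ut r (X r w)) \<in> borel_measurable M"
  using measurable_F[OF coefficient_F_measurable[OF ut_continuous]] by auto

lemma theta_measurable:
  assumes r: "0 \<le> r" "r < t" "t \<le> T"
  shows "theta r t \<in> borel_measurable M"
  unfolding theta_def[abs_def] using r
  by (intro borel_measurable_diff borel_measurable_times borel_measurable_const borel_measurable_inner uval_measurable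
      ut_measurable grad_measurable X_measurable frozen_quadratic_measurable frozen_measurable) auto

text \<open>In the expansion of \<open>uval\<close> the noise has mean 0 against \<open>G\<close>,
  and the terms proportional to \<open>t - r\<close> add up to the left side of the backward
  equation, which vanishes. What is left are errors of smaller order.\<close>

lemma martingale_increment:
  assumes r: "0 \<le> r" "r < t" "t \<le> T" and G: "G \<in> borel_measurable (F r)" and B: "\<And>w. w \<in> space M \<Longrightarrow> \<bar>G w\<bar> \<le> B"
    and th: "integrable M (theta r t)"
  shows "(\<integral>w. G w * (uval t w - uval r w) \<partial>M) =
    (\<integral>w. G w * theta r t w \<partial>M) + (\<integral>w. G w * (grad r w \<bullet> (LBINT q:{r..t}. drift q w - drift r w)) \<partial>M)"
proof -
  let ?K = "\<lambda>w. \<Sum>i\<in>UNIV. (column i (diffusion r w) v* hess r w) \<bullet> column i (diffusion r w)"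
  let ?Q = "\<lambda>w. (frozen r t w v* hess r w) \<bullet> frozen r t w"
  let ?D = "\<lambda>w. LBINT q:{r..t}. drift q w - drift r w"
  have rT: "r \<in> {0..<T}" "r \<in> {0..T}" and rt: "0 \<le> r" "r \<le> t" "t \<le> T" using r by auto
  have GM: "G \<in> borel_measurable M" using measurable_F[OF G] rT by auto
  have Gb: "integrable M (\<lambda>w. G w * h w)" if "integrable M h" for h :: "'w \<Rightarrow> real"
  proof (rule Bochner_Integration.integrable_bound)
    show "integrable M (\<lambda>w. B * h w)" using that by simp
    show "(\<lambda>w. G w * h w) \<in> borel_measurable M" using that GM by auto
    show "AE w in M. norm (G w * h w) \<le> norm (B * h w)"
    proof (rule AE_I2)
      fix w assume "w \<in> space M"
      then show "norm (G w * h w) \<le> norm (B * h w)" using B[of w] by (simp add: abs_mult mult_right_mono)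
    qed
  qed
  have gd: "integrable M (\<lambda>w. grad r w \<bullet> V w)" if "V \<in> borel_measurable M" "sqn M V < top" for V :: "'w \<Rightarrow> real ^ 'd"
    using that by (intro integrable_inner_sqn grad_measurable rT order_le_less_trans[OF sqn_bounded[OF grad_bound]]) auto
  have Dm: "?D \<in> borel_measurable M" using jm_sub[OF drift_jm] rt by (intro measurable_time_integral jm_diff jm_const drift_measurable) auto
  have iD: "integrable M (\<lambda>w. G w * (grad r w \<bullet> ?D w))"
    by (intro Gb gd Dm order_le_less_trans[OF drift_oscillation_integral[OF rt]]) simp
  have idr: "integrable M (\<lambda>w. G w * (grad r w \<bullet> drift r w))"
    by (intro Gb gd drift_measurable rT order_le_less_trans[OF sqn_bounded[OF drift_bound[OF rT(2)]]]) auto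
  have iut: "integrable M (\<lambda>w. G w * ut r (X r w))"
    by (intro Gb integrable_const_bound[where B=time_bound] ut_measurable rT AE_I2) (auto intro: ut_bound rT simp del: atLeastLessThan_iff)
  note inz = noise_gradient_mean[OF r G B]
  note iq = frozen_quadratic_mean[OF r G B]
  have iK: "integrable M (\<lambda>w. G w * ?K w)"
  proof (rule Gb, rule Bochner_Integration.integrable_sum)
    fix i
    show "integrable M (\<lambda>w. (column i (diffusion r w) v* hess r w) \<bullet> column i (diffusion r w))"
    proof (rule integrable_const_bound[where B = "deriv_bound * L * L"])
      show "AE w in M. norm ((column i (diffusion r w) v* hess r w) \<bullet> column i (diffusion r w)) \<le> deriv_bound * L * L"
      proof (rule AE_I2)
        fix w assume w: "w \<in> space M"
        have "\<bar>(column i (diffusion r w) v* hess r w) \<bullet> column i (diffusion r w)\<bar> \<le> deriv_bound * norm (column i (diffusion r w)) * norm (column i (diffusion r w))"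
          by (rule quadratic_bound[OF rT(1)])
        also have "... \<le> deriv_bound * L * L"
          by (intro mult_mono mult_left_mono column_diffusion_bound rT w deriv_bound_nonneg L0 mult_nonneg_nonneg) auto
        finally show "norm ((column i (diffusion r w) v* hess r w) \<bullet> column i (diffusion r w)) \<le> deriv_bound * L * L" by simp
      qed
    qed (use measurable_F[OF quadratic_F_measurable[OF rT(1)]] rT in auto)
  qed
  have "AE w in M. G w * (uval t w - uval r w) =
      G w * theta r t w + (t - r) * (G w * ut r (X r w)) + (t - r) * (G w * (grad r w \<bullet> drift r w)) + G w * (grad r w \<bullet> ?D w)
      + G w * (grad r w \<bullet> (noise t w - noise r w)) + 1/2 * (G w * ?Q w)"
    using X_increment[OF rt] AE_space
  proof eventually_elim
    case (elim w)
    have "grad r w \<bullet> (X t w - X r w) = (t - r) * (grad r w \<bullet> drift r w) + grad r w \<bullet> ?D w + grad r w \<bullet> (noise t w - noise r w)"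
      unfolding elim(1) drift_integral_split[OF rt elim(2)] inner_add_right inner_scaleR_right ..
    then have "uval t w - uval r w = theta r t w + (t - r) * ut r (X r w) + (t - r) * (grad r w \<bullet> drift r w) + grad r w \<bullet> ?D w
      + grad r w \<bullet> (noise t w - noise r w) + 1/2 * ?Q w" unfolding theta_def by linarith
    then show ?case by (simp only: distrib_left mult.left_commute)
  qed
  then have "(\<integral>w. G w * (uval t w - uval r w) \<partial>M) = (\<integral>w. G w * theta r t w + (t - r) * (G w * ut r (X r w)) + (t - r) * (G w * (grad r w \<bullet> drift r w)) + G w * (grad r w \<bullet> ?D w)
      + G w * (grad r w \<bullet> (noise t w - noise r w)) + 1/2 * (G w * ?Q w) \<partial>M)"
  proof (rule integral_cong_AE[rotated 2])
    show "(\<lambda>w. G w * (uval t w - uval r w)) \<in> borel_measurable M"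
      using rt by (intro borel_measurable_times GM borel_measurable_diff uval_measurable) auto
    show "(\<lambda>w. G w * theta r t w + (t - r) * (G w * ut r (X r w)) + (t - r) * (G w * (grad r w \<bullet> drift r w)) + G w * (grad r w \<bullet> ?D w)
      + G w * (grad r w \<bullet> (noise t w - noise r w)) + 1/2 * (G w * ?Q w)) \<in> borel_measurable M"
      by (intro borel_measurable_add borel_measurable_times[OF borel_measurable_const] borel_measurable_integrable Gb[OF th] iut idr iD inz iq)
  qed
  also have "... = (\<integral>w. G w * theta r t w \<partial>M) + (t - r) * (\<integral>w. G w * ut r (X r w) \<partial>M) + (t - r) * (\<integral>w. G w * (grad r w \<bullet> drift r w) \<partial>M)
     + (\<integral>w. G w * (grad r w \<bullet> ?D w) \<partial>M) + (\<integral>w. G w * (grad r w \<bullet> (noise t w - noise r w)) \<partial>M) + 1/2 * (\<integral>w. G w * ?Q w \<partial>M)"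
    by (simp only: Bochner_Integration.integral_add Bochner_Integration.integrable_add integrable_mult_right integral_mult_right_zero Gb[OF th] iut idr iD inz(1) iq(1))
  also have "... = (\<integral>w. G w * theta r t w \<partial>M) + (\<integral>w. G w * (grad r w \<bullet> ?D w) \<partial>M)
     + (t - r) * ((\<integral>w. G w * ut r (X r w) \<partial>M) + (\<integral>w. G w * (grad r w \<bullet> drift r w) \<partial>M) + 1/2 * (\<integral>w. G w * ?K w \<partial>M))"
    by (simp only: inz(2) iq(2)) (simp only: algebra_simps)
  also have "(\<integral>w. G w * ut r (X r w) \<partial>M) + (\<integral>w. G w * (grad r w \<bullet> drift r w) \<partial>M) + 1/2 * (\<integral>w. G w * ?K w \<partial>M)
    = (\<integral>w. G w * ut r (X r w) + G w * (grad r w \<bullet> drift r w) + 1/2 * (G w * ?K w) \<partial>M)"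
    by (simp only: Bochner_Integration.integral_add Bochner_Integration.integrable_add integrable_mult_right integral_mult_right_zero iut idr iK)
  also have "... = (\<integral>w. 0 \<partial>M)"
  proof (rule Bochner_Integration.integral_cong[OF refl])
    fix w
    have cs: "column k (\<epsilon> *\<^sub>R A) = \<epsilon> *\<^sub>R column k A" for k and A :: "real ^ 'd ^ 'd" by (simp add: column_def vec_eq_iff)
    have "?K w = \<epsilon>\<^sup>2 * (\<Sum>k\<in>UNIV. (column k (\<sigma> r (X r w)) v* hess r w) \<bullet> column k (\<sigma> r (X r w)))"
      by (simp add: diffusion_def cs scaleR_vector_matrix sum_distrib_left power2_eq_square mult.assoc)
    then have "ut r (X r w) + grad r w \<bullet> drift r w + 1/2 * ?K w = 0"
      using ut_equation[OF rT(1), of "X r w"] unfolding generator_columns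
      by (simp add: hess_def grad_def drift_def sum_divide_distrib[symmetric])
    then have "G w * (ut r (X r w) + grad r w \<bullet> drift r w + 1/2 * ?K w) = 0" by simp
    then show "G w * ut r (X r w) + G w * (grad r w \<bullet> drift r w) + 1/2 * (G w * ?K w) = 0"
      by (simp only: distrib_left mult.left_commute)
  qed
  finally show ?thesis by simp
qed

lemma sqn_tendsto_zero:
  fixes f :: "nat \<Rightarrow> 'w \<Rightarrow> real"
  assumes "\<And>k. f k \<in> borel_measurable M" "\<And>k w. w \<in> space M \<Longrightarrow> \<bar>f k w\<bar> \<le> B"
    and "AE w in M. (\<lambda>k. f k w) \<longlonglongrightarrow> 0"
  shows "(\<lambda>k. sqn M (f k)) \<longlonglongrightarrow> 0"
proof -
  have "(\<lambda>k. \<integral>w. (f k w)\<^sup>2 \<partial>M) \<longlonglongrightarrow> (\<integral>w. 0 \<partial>M)"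
  proof (rule integral_dominated_convergence[where w = "\<lambda>_. B\<^sup>2"])
    show "AE w in M. (\<lambda>k. (f k w)\<^sup>2) \<longlonglongrightarrow> 0"
      using assms(3)
    proof eventually_elim
      case (elim w)
      from tendsto_power[OF elim, of 2] show ?case by simp
    qed
    show "AE w in M. norm ((f k w)\<^sup>2) \<le> B\<^sup>2" for k
    proof (rule AE_I2)
      fix w assume "w \<in> space M"
      from power_mono[OF assms(2)[OF this, of k] abs_ge_zero, of 2] show "norm ((f k w)\<^sup>2) \<le> B\<^sup>2" by simp
    qed
  qed (use assms(1) in auto)
  then have "(\<lambda>k. ennreal (\<integral>w. (f k w)\<^sup>2 \<partial>M)) \<longlonglongrightarrow> ennreal 0" by (intro tendsto_ennrealI) simp
  moreover have "sqn M (f k) = ennreal (\<integral>w. (f k w)\<^sup>2 \<partial>M)" for k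
  proof -
    have "sqn M (f k) < top"
      by (rule order_le_less_trans[OF sqn_bounded[of "f k" B]]) (use assms(2) in auto)
    from sqn_eq_integral[OF assms(1) this] show ?thesis by simp
  qed
  ultimately show ?thesis by simp
qed

lemma X_path_tendsto:
  assumes "r \<in> {0..T}" "\<And>k. \<tau> k \<in> {0..T}" "\<tau> \<longlonglongrightarrow> r"
  shows "AE w in M. (\<lambda>k. X (\<tau> k) w) \<longlonglongrightarrow> X r w"
  using X_continuous
  by eventually_elim (rule continuous_on_tendsto_compose[OF _ assms(3) assms(1)], use assms(2) in auto)

definition "taylor2 r t w = u r (X t w) - u r (X r w) - grad r w \<bullet> (X t w - X r w)
   - 1/2 * (((X t w - X r w) v* hess r w) \<bullet> (X t w - X r w))"

text \<open>Separates the Taylor remainder into a factor that is bounded and tends to 0 along almost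
  every path, and the squared increment, whose size is controlled in mean. Where the increment is 0,
  division gives the value 0.\<close>

definition "taylor_ratio r t w = \<bar>taylor2 r t w\<bar> / (norm (X t w - X r w))\<^sup>2"

definition "time_defect r t w = \<bar>(u t (X t w) - u r (X t w)) / (t - r) - ut r (X r w)\<bar>"

lemma taylor2_bound:
  assumes r: "r \<in> {0..<T}"
  shows "\<bar>taylor2 r t w\<bar> \<le> 2 * deriv_bound * (norm (X t w - X r w))\<^sup>2"
proof -
  let ?v = "X t w - X r w"
  have "\<bar>u r (X r w + ?v) - u r (X r w) - gradient (u r) (X r w) \<bullet> ?v\<bar> \<le> deriv_bound * (norm ?v)\<^sup>2"
    by (rule taylor1_bound(1)[OF r])
  moreover have "\<bar>(?v v* hess r w) \<bullet> ?v\<bar> \<le> deriv_bound * (norm ?v)\<^sup>2"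
    using quadratic_bound[OF r, of ?v w ?v] by (simp add: power2_eq_square mult.assoc)
  ultimately show ?thesis unfolding taylor2_def grad_def using deriv_bound_nonneg by simp
qed

lemma taylor_ratio_bound: "r \<in> {0..<T} \<Longrightarrow> \<bar>taylor_ratio r t w\<bar> \<le> 2 * deriv_bound"
  using taylor2_bound[of r t w] deriv_bound_nonneg unfolding taylor_ratio_def
  by (cases "X t w = X r w") (auto simp: pos_divide_le_eq)

lemma taylor2_ratio: "r \<in> {0..<T} \<Longrightarrow> \<bar>taylor2 r t w\<bar> = taylor_ratio r t w * (norm (X t w - X r w))\<^sup>2"
  using taylor2_bound[of r t w] by (cases "X t w = X r w") (auto simp: taylor_ratio_def)

lemma taylor2_measurable:
  assumes r: "r \<in> {0..<T}" "t \<in> {0..T}"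
  shows "taylor2 r t \<in> borel_measurable M"
proof -
  have rT: "r \<in> {0..T}" using r by auto
  have "u r \<in> borel_measurable borel"
    by (rule borel_measurable_continuous_onI[OF continuous_section[OF u_continuous rT]])
  from measurable_compose[OF X_measurable[OF r(2)] this] measurable_compose[OF X_measurable[OF rT] this]
  show ?thesis unfolding taylor2_def[abs_def]
    by (intro borel_measurable_diff borel_measurable_times borel_measurable_const borel_measurable_inner
        grad_measurable X_measurable frozen_quadratic_measurable r rT)
qed

lemma taylor_ratio_measurable: "r \<in> {0..<T} \<Longrightarrow> t \<in> {0..T} \<Longrightarrow> taylor_ratio r t \<in> borel_measurable M"
  unfolding taylor_ratio_def[abs_def]
  by (intro borel_measurable_divide borel_measurable_abs taylor2_measurable borel_measurable_power
     measurable_compose[OF _ borel_measurable_norm] borel_measurable_diff X_measurable) auto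

lemma taylor_ratio_tendsto:
  assumes r: "r \<in> {0..<T}" "\<And>k. \<tau> k \<in> {0..T}" "\<tau> \<longlonglongrightarrow> r"
  shows "(\<lambda>k. sqn M (taylor_ratio r (\<tau> k))) \<longlonglongrightarrow> 0"
proof (rule sqn_tendsto_zero)
  show "taylor_ratio r (\<tau> k) \<in> borel_measurable M" for k by (intro taylor_ratio_measurable r)
  show "\<bar>taylor_ratio r (\<tau> k) w\<bar> \<le> 2 * deriv_bound" for k w by (rule taylor_ratio_bound[OF r(1)])
  have rT: "r \<in> {0..T}" using r by auto
  show "AE w in M. (\<lambda>k. taylor_ratio r (\<tau> k) w) \<longlonglongrightarrow> 0"
    using X_path_tendsto[OF rT r(2,3)]
  proof eventually_elim
    case (elim w)
    show ?case
    proof (rule LIMSEQ_I)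
      fix e :: real assume e: "e > 0"
      obtain \<delta> where \<delta>: "\<delta> > 0" "\<And>v. norm v < \<delta> \<Longrightarrow>
        \<bar>u r (X r w + v) - u r (X r w) - gradient (u r) (X r w) \<bullet> v - 1/2 * ((v v* hessian (u r) (X r w)) \<bullet> v)\<bar> \<le> (e / 2) * (norm v)\<^sup>2"
        using taylor2_peano[OF u_differentiable[OF r(1)] gradient_differentiable[OF r(1)], of "e / 2"] e by auto
      obtain n where n: "\<And>k. k \<ge> n \<Longrightarrow> norm (X (\<tau> k) w - X r w) < \<delta>" using LIMSEQ_D[OF elim \<delta>(1)] by blast
      have "norm (taylor_ratio r (\<tau> k) w - 0) < e" if "k \<ge> n" for k
      proof -
        let ?v = "X (\<tau> k) w - X r w"
        have "\<bar>taylor2 r (\<tau> k) w\<bar> \<le> (e / 2) * (norm ?v)\<^sup>2"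
          using \<delta>(2)[OF n[OF that]] by (simp add: taylor2_def grad_def hess_def)
        then have "taylor_ratio r (\<tau> k) w \<le> e / 2" using e
          unfolding taylor_ratio_def by (cases "?v = 0") (auto simp: pos_divide_le_eq)
        moreover have "taylor_ratio r (\<tau> k) w \<ge> 0" by (simp add: taylor_ratio_def)
        ultimately show ?thesis using e by simp
      qed
      then show "\<exists>no. \<forall>k\<ge>no. norm (taylor_ratio r (\<tau> k) w - 0) < e" by blast
    qed
  qed
qed

lemma time_defect_bound:
  assumes "r \<in> {0..<T}" "r < t" "t \<le> T"
  shows "\<bar>time_defect r t w\<bar> \<le> 2 * time_bound"
proof -
  have "\<bar>u t (X t w) - u r (X t w)\<bar> \<le> time_bound * \<bar>t - r\<bar>" using assms by (intro u_time_lipschitz) auto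
  then have "\<bar>(u t (X t w) - u r (X t w)) / (t - r)\<bar> \<le> time_bound" using assms by (simp add: abs_divide pos_divide_le_eq)
  then show ?thesis using ut_bound[OF assms(1), of "X r w"] unfolding time_defect_def by linarith
qed

lemma time_defect_measurable:
  assumes r: "r \<in> {0..<T}" "t \<in> {0..T}"
  shows "time_defect r t \<in> borel_measurable M"
proof -
  have rT: "r \<in> {0..T}" using r by auto
  have "u r \<in> borel_measurable borel" "u t \<in> borel_measurable borel"
    by (rule borel_measurable_continuous_onI[OF continuous_section[OF u_continuous rT]]
        borel_measurable_continuous_onI[OF continuous_section[OF u_continuous r(2)]])+
  from this[THEN measurable_compose[OF X_measurable[OF r(2)]]]
  show ?thesis unfolding time_defect_def[abs_def]
    by (intro borel_measurable_abs borel_measurable_diff borel_measurable_divide borel_measurable_const ut_measurable r)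
qed

text \<open>The difference quotient in time is taken at the moving point
  \<open>X (\<tau> k)\<close>; the mean value theorem turns it into \<open>ut\<close> at an
  intermediate time, and joint continuity of \<open>ut\<close> yields the limit.\<close>

lemma time_defect_tendsto:
  assumes r: "r \<in> {0..<T}" "\<And>k. r < \<tau> k" "\<And>k. \<tau> k \<le> T" "\<tau> \<longlonglongrightarrow> r"
  shows "(\<lambda>k. sqn M (time_defect r (\<tau> k))) \<longlonglongrightarrow> 0"
proof (rule sqn_tendsto_zero)
  have \<tau>: "\<tau> k \<in> {0..T}" for k using r(1) r(2)[of k] r(3)[of k] by auto
  show "time_defect r (\<tau> k) \<in> borel_measurable M" for k by (intro time_defect_measurable r \<tau>)
  show "\<bar>time_defect r (\<tau> k) w\<bar> \<le> 2 * time_bound" for k w by (intro time_defect_bound r)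
  have rT: "r \<in> {0..T}" using r by auto
  show "AE w in M. (\<lambda>k. time_defect r (\<tau> k) w) \<longlonglongrightarrow> 0"
    using X_path_tendsto[OF rT \<tau> r(4)]
  proof eventually_elim
    case (elim w)
    have "\<forall>k. \<exists>q. r < q \<and> q < \<tau> k \<and> u (\<tau> k) (X (\<tau> k) w) - u r (X (\<tau> k) w) = (\<tau> k - r) * ut q (X (\<tau> k) w)"
      using u_mean_value[OF rT \<tau>] r(2) by blast
    then obtain q where q: "\<And>k. r < q k" "\<And>k. q k < \<tau> k"
      "\<And>k. u (\<tau> k) (X (\<tau> k) w) - u r (X (\<tau> k) w) = (\<tau> k - r) * ut (q k) (X (\<tau> k) w)" by metis
    have "q \<longlonglongrightarrow> r"
      by (rule tendsto_sandwich[OF _ _ tendsto_const r(4)]) (auto intro!: always_eventually less_imp_le q)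
    then have "(\<lambda>k. (q k, X (\<tau> k) w)) \<longlonglongrightarrow> (r, X r w)" by (intro tendsto_Pair elim)
    note pair = this
    have "q k \<in> {0..<T}" for k using q(1)[of k] q(2)[of k] r(3)[of k] r(1) by simp
    then have "\<forall>\<^sub>F k in sequentially. (q k, X (\<tau> k) w) \<in> {0..<T} \<times> UNIV" by (intro always_eventually) auto
    moreover have "(r, X r w) \<in> {0..<T} \<times> UNIV" using r(1) by auto
    ultimately have "(\<lambda>k. ut (q k) (X (\<tau> k) w)) \<longlonglongrightarrow> ut r (X r w)"
      using continuous_on_tendsto_compose[OF ut_continuous pair] by simp
    then have "(\<lambda>k. \<bar>ut (q k) (X (\<tau> k) w) - ut r (X r w)\<bar>) \<longlonglongrightarrow> \<bar>ut r (X r w) - ut r (X r w)\<bar>"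
      by (intro tendsto_intros)
    moreover have "time_defect r (\<tau> k) w = \<bar>ut (q k) (X (\<tau> k) w) - ut r (X r w)\<bar>" for k
      using r(2)[of k] by (simp add: time_defect_def q(3))
    ultimately show ?case by simp
  qed
qed

text \<open>Everything is reduced to \<open>frozen\<close> and \<open>rho\<close>. The factor 5 is 4
  from the Taylor remainder, whose ratio is at most \<open>2 * deriv_bound\<close>, plus 1 from
  replacing the full increment by its frozen part in the quadratic term.\<close>

lemma theta_bound:
  assumes r: "0 \<le> r" "r < t" "t \<le> T" and w: "w \<in> space M"
  shows "\<bar>theta r t w\<bar> \<le> (t - r) * time_defect r t w + 2 * L\<^sup>2 * (taylor_ratio r t w * (norm (W t w - W r w))\<^sup>2)
    + 5 * deriv_bound * (norm (rho r t w))\<^sup>2 + deriv_bound * (norm (frozen r t w) * norm (rho r t w))"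
proof -
  let ?a = "frozen r t w" and ?b = "rho r t w"
  have rT: "r \<in> {0..<T}" "r \<in> {0..T}" using r by auto
  have X: "X t w - X r w = ?a + ?b" by (simp add: rho_def)
  have lin: "(v + w) v* A = v v* A + w v* A" for v w :: "real ^ 'd" and A :: "real ^ 'd ^ 'd"
    by (simp add: vector_matrix_mult_def vec_eq_iff algebra_simps sum.distrib)
  have q: "((?a + ?b) v* hess r w) \<bullet> (?a + ?b) - (?a v* hess r w) \<bullet> ?a
     = (?a v* hess r w) \<bullet> ?b + (?b v* hess r w) \<bullet> ?a + (?b v* hess r w) \<bullet> ?b"
    by (simp add: lin inner_add_left inner_add_right)
  have qb: "\<bar>(?a v* hess r w) \<bullet> ?b\<bar> \<le> deriv_bound * (norm ?a * norm ?b)" "\<bar>(?b v* hess r w) \<bullet> ?a\<bar> \<le> deriv_bound * (norm ?a * norm ?b)"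
    "\<bar>(?b v* hess r w) \<bullet> ?b\<bar> \<le> deriv_bound * (norm ?b)\<^sup>2"
    using quadratic_bound[OF rT(1), of ?a w ?b] quadratic_bound[OF rT(1), of ?b w ?a] quadratic_bound[OF rT(1), of ?b w ?b]
    by (simp_all add: mult_ac power2_eq_square)
  have cross: "\<bar>1/2 * (((?a + ?b) v* hess r w) \<bullet> (?a + ?b) - (?a v* hess r w) \<bullet> ?a)\<bar>
     \<le> deriv_bound * (norm ?a * norm ?b) + deriv_bound * (norm ?b)\<^sup>2"
  proof -
    have "\<bar>x1 + x2 + x3\<bar> \<le> 2 * c + d" if "\<bar>x1\<bar> \<le> c" "\<bar>x2\<bar> \<le> c" "\<bar>x3\<bar> \<le> d" for x1 x2 x3 c d :: real
      using that by linarith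
    from this[OF qb]
    show ?thesis unfolding q abs_mult using mult_nonneg_nonneg[OF deriv_bound_nonneg zero_le_power2[of "norm ?b"]] by simp
  qed
  have time: "\<bar>u t (X t w) - u r (X t w) - (t - r) * ut r (X r w)\<bar> = (t - r) * time_defect r t w"
  proof -
    have "u t (X t w) - u r (X t w) - (t - r) * ut r (X r w) = (t - r) * ((u t (X t w) - u r (X t w)) / (t - r) - ut r (X r w))"
      using r by (simp add: field_simps)
    then show ?thesis using r by (simp add: time_defect_def abs_mult)
  qed
  have "(norm (?a + ?b))\<^sup>2 \<le> 2 * (norm ?a)\<^sup>2 + 2 * (norm ?b)\<^sup>2" using norm_add_square_le[of 1 ?a ?b] by simp
  also have "(norm ?a)\<^sup>2 \<le> L\<^sup>2 * (norm (W t w - W r w))\<^sup>2"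
    using power_mono[OF frozen_norm_le[OF rT(2) w, of t], of 2] by (simp add: power_mult_distrib)
  finally have sq: "(norm (?a + ?b))\<^sup>2 \<le> 2 * (L\<^sup>2 * (norm (W t w - W r w))\<^sup>2) + 2 * (norm ?b)\<^sup>2" by simp
  have tr0: "taylor_ratio r t w \<ge> 0" by (simp add: taylor_ratio_def)
  have "\<bar>taylor2 r t w\<bar> \<le> taylor_ratio r t w * (2 * (L\<^sup>2 * (norm (W t w - W r w))\<^sup>2) + 2 * (norm ?b)\<^sup>2)"
    unfolding taylor2_ratio[OF rT(1)] X by (rule mult_left_mono[OF sq tr0])
  also have "... = 2 * L\<^sup>2 * (taylor_ratio r t w * (norm (W t w - W r w))\<^sup>2) + taylor_ratio r t w * (2 * (norm ?b)\<^sup>2)"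
    by (simp add: algebra_simps)
  also have "taylor_ratio r t w * (2 * (norm ?b)\<^sup>2) \<le> 2 * deriv_bound * (2 * (norm ?b)\<^sup>2)"
    using taylor_ratio_bound[OF rT(1), of t w] by (intro mult_right_mono) auto
  finally have tay: "\<bar>taylor2 r t w\<bar> \<le> 2 * L\<^sup>2 * (taylor_ratio r t w * (norm (W t w - W r w))\<^sup>2) + 4 * deriv_bound * (norm ?b)\<^sup>2" by simp
  have "theta r t w = (u t (X t w) - u r (X t w) - (t - r) * ut r (X r w)) + taylor2 r t w
     + 1/2 * (((?a + ?b) v* hess r w) \<bullet> (?a + ?b) - (?a v* hess r w) \<bullet> ?a)"
    unfolding theta_def taylor2_def uval_def X by (simp add: algebra_simps)
  then show ?thesis using time tay cross by linarith
qed

lemma abs_mean_le: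
  fixes G h :: "'w \<Rightarrow> real"
  assumes "G \<in> borel_measurable M" "\<And>w. w \<in> space M \<Longrightarrow> \<bar>G w\<bar> \<le> B" "h \<in> borel_measurable M"
    and "\<And>w. w \<in> space M \<Longrightarrow> \<bar>h w\<bar> \<le> b w" "integrable M b"
  shows "integrable M h" and "\<bar>\<integral>w. G w * h w \<partial>M\<bar> \<le> B * (\<integral>w. b w \<partial>M)"
proof -
  show h: "integrable M h"
  proof (rule Bochner_Integration.integrable_bound[OF assms(5,3)])
    show "AE w in M. norm (h w) \<le> norm (b w)"
      by (rule AE_I2) (metis assms(4) abs_ge_self order_trans real_norm_def)
  qed
  have le: "\<bar>G w * h w\<bar> \<le> B * b w" if "w \<in> space M" for w
    unfolding abs_mult using assms(2,4)[OF that] by (intro mult_mono) auto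
  have "\<bar>\<integral>w. G w * h w \<partial>M\<bar> \<le> (\<integral>w. \<bar>G w * h w\<bar> \<partial>M)" by (rule integral_abs_bound)
  also have "... \<le> (\<integral>w. B * b w \<partial>M)"
  proof (rule integral_mono)
    have "integrable M (\<lambda>w. G w * h w)"
    proof (rule Bochner_Integration.integrable_bound)
      show "integrable M (\<lambda>w. B * b w)" using assms(5) by simp
      show "(\<lambda>w. G w * h w) \<in> borel_measurable M" using assms(1,3) by simp
      show "AE w in M. norm (G w * h w) \<le> norm (B * b w)"
        by (rule AE_I2) (metis le abs_ge_self order_trans real_norm_def)
    qed
    then show "integrable M (\<lambda>w. \<bar>G w * h w\<bar>)" by (rule integrable_abs)
    show "integrable M (\<lambda>w. B * b w)" using assms(5) by simp
  qed (rule le)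
  finally show "\<bar>\<integral>w. G w * h w \<partial>M\<bar> \<le> B * (\<integral>w. b w \<partial>M)" by simp
qed

text \<open>After division by the step length each term of \<open>theta_bound\<close> is a product
  of a factor bounded in L2 and one that tends to 0 in L2: the squared Brownian increment with
  \<open>taylor_ratio\<close>, the rescaled \<open>frozen\<close> or \<open>rho\<close> with the
  rescaled \<open>rho\<close>, and the constant 1 with \<open>time_defect\<close>.\<close>

lemma theta_tendsto:
  assumes r: "0 \<le> r" "r < T" and G: "G \<in> borel_measurable M" "\<And>w. w \<in> space M \<Longrightarrow> \<bar>G w\<bar> \<le> B"
  shows "(\<lambda>k. (\<integral>w. G w * theta r (r + step r k) w \<partial>M) / step r k) \<longlonglongrightarrow> 0"
    and "integrable M (theta r (r + step r k))"
proof -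
  have rT: "r \<in> {0..<T}" "r \<in> {0..T}" "r \<le> T" using r by auto
  let ?t = "\<lambda>k. r + step r k"
  note hp = step_pos[OF r(2)] and hT = step_le[OF rT(3)]
  have t: "0 \<le> r" "r < ?t k" "r \<le> ?t k" "?t k \<le> T" "?t k \<in> {0..T}" for k using r hp[of k] hT[of k] by auto
  have tlim: "?t \<longlonglongrightarrow> r" using tendsto_add[OF tendsto_const step_tendsto, of r r] by simp
  define s where "s k = sqrt (step r k)" for k
  have s: "s k > 0" "(s k)\<^sup>2 = step r k" "s k * s k = step r k" for k
    using hp[of k] by (auto simp: s_def real_sqrt_mult_self)
  define A where "A k w = (1 / s k) *\<^sub>R norm (frozen r (?t k) w)" for k w
  define P where "P k w = (1 / s k) *\<^sub>R norm (rho r (?t k) w)" for k w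
  define V where "V k w = (1 / step r k) *\<^sub>R (norm (W (?t k) w - W r w))\<^sup>2" for k w
  have mfn: "(\<lambda>w. norm (frozen r (?t k) w)) \<in> borel_measurable M" and mrn: "(\<lambda>w. norm (rho r (?t k) w)) \<in> borel_measurable M"
    and mvn: "(\<lambda>w. (norm (W (?t k) w - W r w))\<^sup>2) \<in> borel_measurable M" for k
    by (rule measurable_compose[OF frozen_measurable borel_measurable_norm], use t in auto)
       (rule measurable_compose[OF rho_measurable borel_measurable_norm], use t in auto,
        intro borel_measurable_power measurable_compose[OF increment_measurable borel_measurable_norm], use t in auto)
  have mA: "A k \<in> borel_measurable M" and mP: "P k \<in> borel_measurable M" and mV: "V k \<in> borel_measurable M" for k
    unfolding A_def[abs_def] P_def[abs_def] V_def[abs_def]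
    by (intro borel_measurable_scaleR borel_measurable_const mfn mrn mvn)+
  have cA: "sqn M (A k) \<le> ennreal (L\<^sup>2 * real CARD('d))" for k
  proof -
    have "sqn M (A k) = ennreal ((1 / s k)\<^sup>2) * sqn M (frozen r (?t k))"
      unfolding A_def[abs_def] sqn_scale[OF mfn] by simp
    also have "... \<le> ennreal ((1 / s k)\<^sup>2) * ennreal (L\<^sup>2 * (real CARD('d) * (?t k - r)))"
      by (intro mult_left_mono frozen_sqn t) auto
    also have "... = ennreal (L\<^sup>2 * real CARD('d))"
      using hp[of k] by (simp add: ennreal_mult'[symmetric] power_divide s)
    finally show ?thesis .
  qed
  have cP: "sqn M (P k) \<le> ennreal (rho_const * step r k)" for k
  proof -
    have "sqn M (P k) = ennreal ((1 / s k)\<^sup>2) * sqn M (rho r (?t k))"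
      unfolding P_def[abs_def] sqn_scale[OF mrn] by simp
    also have "... \<le> ennreal ((1 / s k)\<^sup>2) * ennreal (rho_const * (?t k - r)\<^sup>2)"
      by (intro mult_left_mono rho_sqn t) auto
    also have "... = ennreal (rho_const * step r k)"
      using hp[of k] by (simp add: ennreal_mult'[symmetric] power_divide s power2_eq_square[of "step r k"])
    finally show ?thesis .
  qed
  have cV: "sqn M (V k) \<le> ennreal (3 * real CARD('d) ^ 2)" for k
  proof -
    have "sqn M (V k) = ennreal ((1 / step r k)\<^sup>2) * sqn M (\<lambda>w. (norm (W (?t k) w - W r w))\<^sup>2)"
      unfolding V_def[abs_def] sqn_scale[OF mvn] by simp
    also have "... \<le> ennreal ((1 / step r k)\<^sup>2) * ennreal (3 * real CARD('d) ^ 2 * (?t k - r)\<^sup>2)"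
      by (intro mult_left_mono increment_fourth_moment t) auto
    also have "... = ennreal (3 * real CARD('d) ^ 2)"
      using hp[of k] by (simp add: ennreal_mult'[symmetric] power_divide)
    finally show ?thesis .
  qed
  have cP0: "(\<lambda>k. sqn M (P k)) \<longlonglongrightarrow> 0"
  proof (rule tendsto_zero_ennreal_bound[OF cP])
    have "(\<lambda>k. ennreal (rho_const * step r k)) \<longlonglongrightarrow> ennreal (rho_const * 0)"
      by (intro tendsto_ennrealI tendsto_intros step_tendsto)
    then show "(\<lambda>k. ennreal (rho_const * step r k)) \<longlonglongrightarrow> 0" by simp
  qed
  have cPb: "sqn M (P k) \<le> ennreal (rho_const * T)" for k
    using hT[of k] r rho_const_nonneg by (intro order_trans[OF cP] ennreal_leI mult_left_mono) auto
  have w0: "(\<lambda>k. sqn M (taylor_ratio r (?t k))) \<longlonglongrightarrow> 0" by (rule taylor_ratio_tendsto[OF rT(1) t(5) tlim])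
  have mw: "taylor_ratio r (?t k) \<in> borel_measurable M" for k by (intro taylor_ratio_measurable rT t)
  have e0: "(\<lambda>k. sqn M (time_defect r (?t k))) \<longlonglongrightarrow> 0" by (rule time_defect_tendsto[OF rT(1) t(2) t(4) tlim])
  have me: "time_defect r (?t k) \<in> borel_measurable M" for k by (intro time_defect_measurable rT t)
  have fe: "sqn M (time_defect r (?t k)) < top" for k
    using time_defect_bound[OF rT(1) t(2) t(4)] by (intro order_le_less_trans[OF sqn_bounded]) auto
  have fw: "sqn M (taylor_ratio r (?t k)) < top" for k
    using taylor_ratio_bound[OF rT(1)] by (intro order_le_less_trans[OF sqn_bounded]) auto
  have fA: "sqn M (A k) < top" and fP: "sqn M (P k) < top" and fV: "sqn M (V k) < top" for k
    using cA[of k] cP[of k] cV[of k] by (auto intro: order_le_less_trans)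
  define b where "b k w = time_defect r (?t k) w + 2 * L\<^sup>2 * (V k w * taylor_ratio r (?t k) w)
     + 5 * deriv_bound * (P k w * P k w) + deriv_bound * (A k w * P k w)" for k w
  note i1 = integrable_if_sqn_finite[OF me fe] and i2 = integrable_mult_sqn[OF mV mw fV fw]
    and i3 = integrable_mult_sqn[OF mP mP fP fP] and i4 = integrable_mult_sqn[OF mA mP fA fP]
  have ib: "integrable M (b k)" for k
    unfolding b_def[abs_def] by (intro Bochner_Integration.integrable_add integrable_mult_right i1 i2 i3 i4)
  have "(\<integral>w. b k w \<partial>M) = (\<integral>w. 1 * time_defect r (?t k) w \<partial>M) + 2 * L\<^sup>2 * (\<integral>w. V k w * taylor_ratio r (?t k) w \<partial>M)
     + 5 * deriv_bound * (\<integral>w. P k w * P k w \<partial>M) + deriv_bound * (\<integral>w. A k w * P k w \<partial>M)" for k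
    unfolding b_def using i1[of k] i2[of k] i3[of k] i4[of k]
    by (simp only: Bochner_Integration.integral_add Bochner_Integration.integrable_add integrable_mult_right integral_mult_right_zero mult_1)
  moreover have "(\<lambda>k. (\<integral>w. 1 * time_defect r (?t k) w \<partial>M) + 2 * L\<^sup>2 * (\<integral>w. V k w * taylor_ratio r (?t k) w \<partial>M)
     + 5 * deriv_bound * (\<integral>w. P k w * P k w \<partial>M) + deriv_bound * (\<integral>w. A k w * P k w \<partial>M)) \<longlonglongrightarrow> 0 + 2 * L\<^sup>2 * 0 + 5 * deriv_bound * 0 + deriv_bound * 0"
    by (intro tendsto_intros tendsto_integral_mult_sqn_bounded[OF mV mw cV w0] tendsto_integral_mult_sqn_bounded[OF mP mP cPb cP0]
        tendsto_integral_mult_sqn_bounded[OF mA mP cA cP0] tendsto_integral_mult_sqn[OF borel_measurable_const me _ e0])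
      (simp add: sqn_const emeasure_space_1)
  ultimately have lim: "(\<lambda>k. \<integral>w. b k w \<partial>M) \<longlonglongrightarrow> 0" by simp
  have thb: "\<bar>theta r (?t k) w\<bar> \<le> step r k * b k w" if "w \<in> space M" for k w
  proof -
    have "\<bar>theta r (?t k) w\<bar> \<le> step r k * time_defect r (?t k) w + 2 * L\<^sup>2 * (taylor_ratio r (?t k) w * (norm (W (?t k) w - W r w))\<^sup>2)
    + 5 * deriv_bound * (norm (rho r (?t k) w))\<^sup>2 + deriv_bound * (norm (frozen r (?t k) w) * norm (rho r (?t k) w))"
      using theta_bound[OF t(1) t(2) t(4) that, of k] by simp
    moreover have "step r k * (V k w * taylor_ratio r (?t k) w) = taylor_ratio r (?t k) w * (norm (W (?t k) w - W r w))\<^sup>2"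
      using hp[of k] by (simp add: V_def)
    moreover have "step r k * (P k w * P k w) = (norm (rho r (?t k) w))\<^sup>2"
      using hp[of k] s(3)[of k] s(1)[of k] by (simp add: P_def power2_eq_square field_simps)
    moreover have "step r k * (A k w * P k w) = norm (frozen r (?t k) w) * norm (rho r (?t k) w)"
      using hp[of k] s(3)[of k] s(1)[of k] by (simp add: A_def P_def field_simps)
    moreover have "step r k * b k w = step r k * time_defect r (?t k) w + 2 * L\<^sup>2 * (step r k * (V k w * taylor_ratio r (?t k) w))
      + 5 * deriv_bound * (step r k * (P k w * P k w)) + deriv_bound * (step r k * (A k w * P k w))"
      unfolding b_def distrib_left by (simp only: mult_ac)
    ultimately show ?thesis by (simp only:)
  qed
  note am = abs_mean_le[OF G theta_measurable thb integrable_mult_right[OF ib], OF _ t(1) t(2) t(4)]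
  show "integrable M (theta r (r + step r k))" by (rule am(1))
  have "(\<lambda>k. B * (\<integral>w. b k w \<partial>M)) \<longlonglongrightarrow> B * 0" by (intro tendsto_intros lim)
  then have limB: "(\<lambda>k. B * (\<integral>w. b k w \<partial>M)) \<longlonglongrightarrow> 0" by simp
  show "(\<lambda>k. (\<integral>w. G w * theta r (?t k) w \<partial>M) / step r k) \<longlonglongrightarrow> 0"
  proof (rule Lim_null_comparison[OF always_eventually limB], rule allI)
    fix k
    have "\<bar>\<integral>w. G w * theta r (?t k) w \<partial>M\<bar> \<le> B * (step r k * (\<integral>w. b k w \<partial>M))" using am(2)[of k] by simp
    then show "norm ((\<integral>w. G w * theta r (?t k) w \<partial>M) / step r k) \<le> B * (\<integral>w. b k w \<partial>M)"
      using hp[of k] by (simp add: abs_divide pos_divide_le_eq mult_ac)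
  qed
qed

end

lemma power2_norm_matrix: "(norm B)\<^sup>2 = (\<Sum>i\<in>UNIV. \<Sum>j\<in>UNIV. (B $ i $ j)\<^sup>2)" for B :: "real ^ 'p ^ 'q"
  by (simp add: norm_vec_def L2_set_def sum_nonneg)

lemma norm_vector_matrix_le: "norm (x v* A) \<le> norm x * norm A" for A :: "real ^ 'n ^ 'm"
proof -
  have "norm (transpose A *v x) \<le> norm (transpose A) * norm x" by (rule norm_matrix_vector_le)
  moreover have "(norm (transpose A))\<^sup>2 = (norm A)\<^sup>2"
    unfolding power2_norm_matrix by (simp add: transpose_def) (rule sum.swap)
  then have "norm (transpose A) = norm A" by (simp add: power2_eq_iff_nonneg)
  ultimately show ?thesis by (simp add: mult.commute)
qed

context linear_setting
begin

text \<open>The integrated oscillation of the drift has L2 norm of order 3/2 in the step length, so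
  it survives the division.\<close>

lemma gradient_drift_defect_tendsto:
  assumes r: "0 \<le> r" "r < T" and G: "G \<in> borel_measurable M" "\<And>w. w \<in> space M \<Longrightarrow> \<bar>G w\<bar> \<le> B"
  shows "(\<lambda>k. (\<integral>w. G w * (grad r w \<bullet> (LBINT q:{r..r + step r k}. drift q w - drift r w)) \<partial>M) / step r k) \<longlonglongrightarrow> 0"
proof -
  have rT: "r \<in> {0..<T}" "r \<in> {0..T}" "r \<le> T" using r by auto
  let ?t = "\<lambda>k. r + step r k"
  note hp = step_pos[OF r(2)] and hT = step_le[OF rT(3)]
  have t: "0 \<le> r" "r \<le> ?t k" "?t k \<le> T" for k using r hp[of k] hT[of k] by auto
  define D where "D k w = (LBINT q:{r..?t k}. drift q w - drift r w)" for k w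
  have mD: "D k \<in> borel_measurable M" for k unfolding D_def[abs_def]
    using jm_sub[OF drift_jm] t by (intro measurable_time_integral jm_diff jm_const drift_measurable rT) auto
  have mn: "(\<lambda>w. norm (D k w)) \<in> borel_measurable M" for k by (rule measurable_compose[OF mD borel_measurable_norm])
  define g where "g k w = (1 / step r k) * (grad r w \<bullet> D k w)" for k w
  have mg: "g k \<in> borel_measurable M" for k unfolding g_def[abs_def]
    by (intro borel_measurable_times borel_measurable_const borel_measurable_inner grad_measurable rT mD)
  have "sqn M (g k) \<le> ennreal (deriv_bound\<^sup>2 * osc_const * step r k)" for k
  proof -
    have "sqn M (g k) \<le> sqn M (\<lambda>w. (deriv_bound / step r k) *\<^sub>R norm (D k w))"
    proof (rule sqn_mono)
      fix w
      have "\<bar>grad r w \<bullet> D k w\<bar> \<le> deriv_bound * norm (D k w)"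
        by (meson Cauchy_Schwarz_ineq2 grad_bound[OF rT(1)] mult_right_mono norm_ge_zero order_trans)
      then have "\<bar>grad r w \<bullet> D k w\<bar> / step r k \<le> deriv_bound * norm (D k w) / step r k" using hp[of k] by (simp add: divide_right_mono)
      then show "norm (g k w) \<le> norm ((deriv_bound / step r k) *\<^sub>R norm (D k w))"
        using hp[of k] deriv_bound_nonneg by (simp add: g_def abs_mult abs_divide)
    qed
    also have "... = ennreal ((deriv_bound / step r k)\<^sup>2) * sqn M (D k)" unfolding sqn_scale[OF mn] by simp
    also have "... \<le> ennreal ((deriv_bound / step r k)\<^sup>2) * ennreal (osc_const * (?t k - r) ^ 3)"
      unfolding D_def[abs_def] by (intro mult_left_mono drift_oscillation_integral t) auto
    also have "... = ennreal (deriv_bound\<^sup>2 * osc_const * step r k)"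
    proof -
      have "(deriv_bound / step r k)\<^sup>2 * (osc_const * (?t k - r) ^ 3) = deriv_bound\<^sup>2 * osc_const * step r k"
        using hp[of k] by (simp add: power2_eq_square power3_eq_cube)
      then show ?thesis by (simp only: ennreal_mult'[symmetric] zero_le_power2)
    qed
    finally show ?thesis .
  qed
  moreover have "(\<lambda>k. ennreal (deriv_bound\<^sup>2 * osc_const * step r k)) \<longlonglongrightarrow> ennreal (deriv_bound\<^sup>2 * osc_const * 0)"
    by (intro tendsto_ennrealI tendsto_intros step_tendsto)
  then have "(\<lambda>k. ennreal (deriv_bound\<^sup>2 * osc_const * step r k)) \<longlonglongrightarrow> 0" by simp
  ultimately have g0: "(\<lambda>k. sqn M (g k)) \<longlonglongrightarrow> 0" by (rule tendsto_zero_ennreal_bound)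
  have fG: "sqn M G < top" by (rule order_le_less_trans[OF sqn_bounded[of G B]]) (use G(2) in auto)
  have "(\<lambda>k. \<integral>w. G w * g k w \<partial>M) \<longlonglongrightarrow> 0" by (rule tendsto_integral_mult_sqn[OF G(1) mg fG g0])
  moreover have "(\<integral>w. G w * g k w \<partial>M) = (\<integral>w. G w * (grad r w \<bullet> D k w) \<partial>M) / step r k" for k
  proof -
    have "(\<integral>w. G w * g k w \<partial>M) = (\<integral>w. (1 / step r k) * (G w * (grad r w \<bullet> D k w)) \<partial>M)"
      by (intro Bochner_Integration.integral_cong refl) (simp add: g_def)
    then show ?thesis by simp
  qed
  ultimately show ?thesis by (simp add: D_def)
qed

lemma uval_path_tendsto:
  assumes "r \<in> {0..T}" "\<And>k. \<tau> k \<in> {0..T}" "\<tau> \<longlonglongrightarrow> r"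
  shows "AE w in M. (\<lambda>k. uval (\<tau> k) w) \<longlonglongrightarrow> uval r w"
  using X_path_tendsto[OF assms]
proof eventually_elim
  case (elim w)
  have "(\<lambda>k. (\<tau> k, X (\<tau> k) w)) \<longlonglongrightarrow> (r, X r w)" by (intro tendsto_Pair assms elim)
  from continuous_on_tendsto_compose[OF u_continuous this] assms(1,2) show ?case by (auto simp: uval_def)
qed

text \<open>As a function of time the mean of \<open>G * uval\<close> is continuous up to
  \<open>T\<close> and has small right slopes before \<open>T\<close>, so differentiability of
  \<open>u\<close> enters only where it is given, on \<open>{0..<T}\<close>.\<close>

lemma uval_martingale_bounded:
  assumes st: "0 \<le> s" "s \<le> t" "t \<le> T" and G: "G \<in> borel_measurable (F s)" and B: "\<And>w. w \<in> space M \<Longrightarrow> \<bar>G w\<bar> \<le> B"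
  shows "(\<integral>w. G w * uval t w \<partial>M) = (\<integral>w. G w * uval s w \<partial>M)"
proof -
  define \<phi> where "\<phi> r = (\<integral>w. G w * uval r w \<partial>M)" for r
  have GM: "G \<in> borel_measurable M" using measurable_F[OF G] st by auto
  have bnd: "\<bar>G w * uval r w\<bar> \<le> B * L" if "r \<in> {0..T}" "w \<in> space M" for r w
    unfolding abs_mult using B[OF that(2)] uval_bound[OF that(1)] by (intro mult_mono) auto
  have int: "integrable M (\<lambda>w. G w * uval r w)" if "r \<in> {0..T}" for r
    using bnd[OF that] by (intro integrable_const_bound[where B = "B * L"] AE_I2 borel_measurable_times GM uval_measurable that) auto
  have cont: "continuous_on {0..T} \<phi>"
  proof (rule continuous_on_sequentiallyI)
    fix \<tau> r assume \<tau>: "\<forall>n. \<tau> n \<in> {0..T}" "r \<in> {0..T}" "\<tau> \<longlonglongrightarrow> r"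
    show "(\<lambda>n. \<phi> (\<tau> n)) \<longlonglongrightarrow> \<phi> r" unfolding \<phi>_def
    proof (rule integral_dominated_convergence[where w = "\<lambda>_. B * L"])
      show "AE w in M. (\<lambda>n. G w * uval (\<tau> n) w) \<longlonglongrightarrow> G w * uval r w"
        using uval_path_tendsto[OF \<tau>(2) _ \<tau>(3)] \<tau>(1) by (auto elim!: eventually_mono intro: tendsto_mult)
      show "AE w in M. norm (G w * uval (\<tau> n) w) \<le> B * L" for n using bnd \<tau>(1) by (intro AE_I2) simp
    qed (use \<tau> GM in \<open>auto intro!: borel_measurable_times uval_measurable simp del: atLeastAtMost_iff\<close>)
  qed
  have slope: "\<exists>r'. r < r' \<and> r' \<le> T \<and> \<bar>\<phi> r' - \<phi> r\<bar> \<le> e * (r' - r)" if r: "s \<le> r" "r < T" and e: "e > 0" for r e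
  proof -
    have r0: "0 \<le> r" "r \<le> T" "r \<in> {0..T}" using r st by auto
    have Gr: "G \<in> borel_measurable (F r)" by (rule measurable_F_mono[OF G r(1)])
    let ?t = "\<lambda>k. r + step r k"
    note hp = step_pos[OF r(2)] and hT = step_le[OF r0(2)]
    have t: "r < ?t k" "?t k \<le> T" "?t k \<in> {0..T}" for k using r0 hp[of k] hT[of k] by auto
    note thi = theta_tendsto(2)[OF r0(1) r(2) GM B]
    have eq: "\<phi> (?t k) - \<phi> r = (\<integral>w. G w * theta r (?t k) w \<partial>M)
       + (\<integral>w. G w * (grad r w \<bullet> (LBINT q:{r..?t k}. drift q w - drift r w)) \<partial>M)" for k
    proof -
      have "\<phi> (?t k) - \<phi> r = (\<integral>w. G w * (uval (?t k) w - uval r w) \<partial>M)"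
        unfolding \<phi>_def right_diff_distrib using int[OF t(3)[of k]] int[OF r0(3)] by simp
      also have "... = (\<integral>w. G w * theta r (?t k) w \<partial>M)
       + (\<integral>w. G w * (grad r w \<bullet> (LBINT q:{r..?t k}. drift q w - drift r w)) \<partial>M)"
        by (rule martingale_increment[OF r0(1) t(1) t(2) Gr B thi])
      finally show ?thesis .
    qed
    have "(\<lambda>k. (\<integral>w. G w * theta r (?t k) w \<partial>M) / step r k
       + (\<integral>w. G w * (grad r w \<bullet> (LBINT q:{r..?t k}. drift q w - drift r w)) \<partial>M) / step r k) \<longlonglongrightarrow> 0 + 0"
      by (intro tendsto_add theta_tendsto(1)[OF r0(1) r(2) GM B] gradient_drift_defect_tendsto[OF r0(1) r(2) GM B])
    then have "(\<lambda>k. (\<phi> (?t k) - \<phi> r) / step r k) \<longlonglongrightarrow> 0" by (simp add: eq add_divide_distrib)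
    from LIMSEQ_D[OF this e] obtain k where "norm ((\<phi> (?t k) - \<phi> r) / step r k - 0) < e" by blast
    then have "\<bar>\<phi> (?t k) - \<phi> r\<bar> \<le> e * (?t k - r)" using hp[of k] by (simp add: abs_divide pos_divide_less_eq)
    then show ?thesis using t(1,2) by blast
  qed
  \<comment> \<open>The values at \<open>s\<close> and at \<open>t\<close> are both compared with
    the one at \<open>T\<close>, to which continuity extends.\<close>
  have "\<phi> T = \<phi> s"
    by (rule constant_if_right_slopes_vanish[OF continuous_on_subset[OF cont] slope]) (use st in auto)
  moreover have "\<phi> T = \<phi> t"
    by (rule constant_if_right_slopes_vanish[OF continuous_on_subset[OF cont] slope]) (use st in auto)
  ultimately show ?thesis by (simp add: \<phi>_def)
qed

lemma uval_martingale:
  assumes st: "0 \<le> s" "s \<le> t" "t \<le> T" and G: "G \<in> borel_measurable (F s)" "integrable M G"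
  shows "(\<integral>w. G w * (uval t w - uval s w) \<partial>M) = 0"
proof -
  have GM: "G \<in> borel_measurable M" using measurable_F[OF G(1)] st by auto
  have tT: "t \<in> {0..T}" "s \<in> {0..T}" using st by auto
  \<comment> \<open>Truncation keeps \<open>F s\<close>-measurability, so the bounded case applies;
    dominated convergence removes it, since \<open>uval\<close> is bounded.\<close>
  define H where "H k w = max (- real k) (min (real k) (G w))" for k w
  have H: "\<bar>H k w\<bar> \<le> real k" "\<bar>H k w\<bar> \<le> \<bar>G w\<bar>" for k w by (auto simp: H_def)
  have mH: "H k \<in> borel_measurable (F s)" for k unfolding H_def[abs_def]
    by (intro borel_measurable_max borel_measurable_min borel_measurable_const G)
  have mHM: "H k \<in> borel_measurable M" for k using measurable_F[OF mH] st by auto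
  have ub: "\<bar>uval t w - uval s w\<bar> \<le> 2 * L" for w using uval_bound[OF tT(1), of w] uval_bound[OF tT(2), of w] by linarith
  have "(\<lambda>k. \<integral>w. H k w * (uval t w - uval s w) \<partial>M) \<longlonglongrightarrow> (\<integral>w. G w * (uval t w - uval s w) \<partial>M)"
  proof (rule integral_dominated_convergence[where w = "\<lambda>w. \<bar>G w\<bar> * (2 * L)"])
    show "AE w in M. (\<lambda>k. H k w * (uval t w - uval s w)) \<longlonglongrightarrow> G w * (uval t w - uval s w)"
    proof (rule AE_I2)
      fix w
      obtain n where n: "\<bar>G w\<bar> \<le> real n" using real_arch_simple by blast
      have "\<forall>\<^sub>F k in sequentially. H k w = G w"
        unfolding eventually_sequentially using n by (intro exI[of _ n]) (auto simp: H_def)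
      then have "(\<lambda>k. H k w) \<longlonglongrightarrow> G w" by (rule tendsto_eventually)
      then show "(\<lambda>k. H k w * (uval t w - uval s w)) \<longlonglongrightarrow> G w * (uval t w - uval s w)" by (intro tendsto_intros)
    qed
    show "AE w in M. norm (H k w * (uval t w - uval s w)) \<le> \<bar>G w\<bar> * (2 * L)" for k
      unfolding real_norm_def abs_mult by (intro AE_I2 mult_mono H ub) auto
    show "integrable M (\<lambda>w. \<bar>G w\<bar> * (2 * L))" using G(2) by simp
  qed (auto intro!: borel_measurable_times borel_measurable_diff GM mHM uval_measurable tT simp del: atLeastAtMost_iff)
  moreover have "(\<integral>w. H k w * (uval t w - uval s w) \<partial>M) = 0" for k
  proof -
    have int: "integrable M (\<lambda>w. H k w * uval r w)" if r: "r \<in> {0..T}" for r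
    proof (rule integrable_const_bound[where B = "real k * L"])
      show "AE w in M. norm (H k w * uval r w) \<le> real k * L"
        unfolding real_norm_def abs_mult by (intro AE_I2 mult_mono H uval_bound r) auto
    qed (intro borel_measurable_times mHM uval_measurable r)
    show ?thesis
      using uval_martingale_bounded[OF st mH[of k] H(1)] int[OF tT(1)] int[OF tT(2)] by (simp add: right_diff_distrib)
  qed
  ultimately have "(\<lambda>k::nat. 0) \<longlonglongrightarrow> (\<integral>w. G w * (uval t w - uval s w) \<partial>M)" by simp
  then show ?thesis by (simp add: LIMSEQ_const_iff)
qed

text \<open>At time \<open>T\<close> the gradient of \<open>u\<close> is not controlled; the value 0
  there affects a null set and keeps the process bounded and measurable on the whole
  interval.\<close>

definition "integrand s w = (if s < T then linear_Z \<sigma> \<epsilon> u s (X s w) else 0)"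

lemma integrand_eq: "s \<in> {0..<T} \<Longrightarrow> integrand s w = grad s w v* diffusion s w"
  by (simp add: integrand_def linear_Z_def grad_def diffusion_def)

lemma linear_Z_continuous: "continuous_on ({0..<T} \<times> UNIV) (\<lambda>(t, x). linear_Z \<sigma> \<epsilon> u t x)"
proof -
  have "continuous_on ({0..<T} \<times> UNIV) (\<lambda>(t, x). \<sigma> t x)" by (rule continuous_on_subset[OF sigma_continuous]) auto
  with gradient_continuous show ?thesis unfolding linear_Z_def case_prod_beta by (intro continuous_intros)
qed

lemma linear_Z_bound: "t \<in> {0..<T} \<Longrightarrow> norm (linear_Z \<sigma> \<epsilon> u t x) \<le> deriv_bound * L"
proof -
  assume t: "t \<in> {0..<T}"
  then have tT: "t \<in> {0..T}" by auto
  have "norm (linear_Z \<sigma> \<epsilon> u t x) \<le> norm (gradient (u t) x) * norm (\<epsilon> *\<^sub>R \<sigma> t x)"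
    unfolding linear_Z_def by (rule norm_vector_matrix_le)
  also have "... \<le> deriv_bound * (1 * L)"
    using eps sigma_bound[OF tT, of x] deriv_bound_nonneg L0
    by (intro mult_mono gradient_bound t) (auto intro: order_trans[OF mult_left_le_one_le])
  finally show ?thesis by simp
qed

lemma linear_Z_lipschitz:
  assumes t: "t \<in> {0..<T}"
  shows "norm (linear_Z \<sigma> \<epsilon> u t x - linear_Z \<sigma> \<epsilon> u t y) \<le> 2 * deriv_bound * L * norm (x - y)"
proof -
  have tT: "t \<in> {0..T}" using t by auto
  have eq: "linear_Z \<sigma> \<epsilon> u t x - linear_Z \<sigma> \<epsilon> u t y =
    (gradient (u t) x - gradient (u t) y) v* (\<epsilon> *\<^sub>R \<sigma> t x) + gradient (u t) y v* (\<epsilon> *\<^sub>R (\<sigma> t x - \<sigma> t y))"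
    by (simp add: linear_Z_def vector_matrix_mult_def vec_eq_iff algebra_simps sum.distrib sum_subtractf)
  have e: "norm (\<epsilon> *\<^sub>R A) \<le> 1 * norm A" for A :: "real ^ 'd ^ 'd" using eps by (simp add: mult_left_le_one_le)
  have "norm (linear_Z \<sigma> \<epsilon> u t x - linear_Z \<sigma> \<epsilon> u t y) \<le>
    norm (gradient (u t) x - gradient (u t) y) * norm (\<epsilon> *\<^sub>R \<sigma> t x) + norm (gradient (u t) y) * norm (\<epsilon> *\<^sub>R (\<sigma> t x - \<sigma> t y))"
    unfolding eq by (intro norm_triangle_le add_mono norm_vector_matrix_le)
  also have "... \<le> (deriv_bound * norm (x - y)) * (1 * L) + deriv_bound * (1 * (L * norm (x - y)))"
    by (intro add_mono mult_mono gradient_lipschitz gradient_bound t order_trans[OF e] mult_left_mono sigma_bound sigma_lip tT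
        mult_nonneg_nonneg deriv_bound_nonneg) auto
  finally show ?thesis by (simp add: mult_ac)
qed

lemma integrand_F_measurable: "s \<in> {0..T} \<Longrightarrow> integrand s \<in> borel_measurable (F s)"
  unfolding integrand_def[abs_def]
  by (cases "s < T") (auto intro!: coefficient_F_measurable[OF linear_Z_continuous])

lemma integrand_bound: "s \<in> {0..T} \<Longrightarrow> norm (integrand s w) \<le> deriv_bound * L"
  using linear_Z_bound[of s "X s w"] deriv_bound_nonneg L0 by (auto simp: integrand_def)

lemma jm_linear_Z:
  assumes "jm 0 T X'"
  shows "jm 0 T (\<lambda>r w. if r < T then linear_Z \<sigma> \<epsilon> u r (X' r w) else 0)"
proof -
  have c: "(\<lambda>z. indicator ({0..<T} \<times> UNIV) z *\<^sub>R (\<lambda>(t, x). linear_Z \<sigma> \<epsilon> u t x) z) \<in> borel_measurable borel"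
    by (intro borel_measurable_continuous_on_indicator linear_Z_continuous)
      (auto simp: borel_prod[symmetric])
  have "jm 0 T (\<lambda>r _. r)" by (intro jm_time) simp
  from jm_comp_pair[OF this assms c] show ?thesis by (rule jm_cong[THEN iffD1, rotated]) (auto simp: indicator_def)
qed

lemma integrand_jm: "jm 0 T integrand"
  unfolding integrand_def[abs_def] by (rule jm_linear_Z[OF X_jm])

lemma integrand_elem:
  assumes st: "0 \<le> s" "s \<le> t" "t \<le> T"
  shows "elem s t (s, t, integrand s)"
  unfolding elem_def using st integrand_F_measurable[of s] integrand_bound[of s] by auto

lemma remainder_eq: "0 \<le> s \<Longrightarrow> s < T \<Longrightarrow> remainder s t w = uval t w - uval s w - eint (s, t, integrand s) w"
  by (simp add: remainder_def eint_def integrand_eq frozen_def dot_lmul_matrix)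

lemma remainder_F_measurable:
  assumes st: "0 \<le> s" "s < t" "t \<le> T"
  shows "remainder s t \<in> borel_measurable (F t)"
proof -
  have "(\<lambda>w. uval t w - uval s w - eint (s, t, integrand s) w) \<in> borel_measurable (F t)"
    using st by (intro borel_measurable_diff uval_F_measurable measurable_F_mono[OF uval_F_measurable, of s t]
        eint_F_measurable[OF integrand_elem]) auto
  then show ?thesis by (rule measurable_cong[THEN iffD1, rotated]) (use st in \<open>auto simp: remainder_eq\<close>)
qed

lemma remainder_orthogonal:
  assumes st: "0 \<le> s" "s < t" "t \<le> T" and G: "G \<in> borel_measurable (F s)" "integrable M G"
  shows "(\<integral>w. G w * remainder s t w \<partial>M) = 0"
proof -
  have st': "0 \<le> s" "s \<le> t" "t \<le> T" and tT: "s \<in> {0..T}" "t \<in> {0..T}" using st by auto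
  have GM: "G \<in> borel_measurable M" using measurable_F[OF G(1)] st by auto
  have i: "integrable M (\<lambda>w. G w * (uval t w - uval s w))"
  proof (rule Bochner_Integration.integrable_bound)
    show "integrable M (\<lambda>w. \<bar>G w\<bar> * (2 * L))" using G(2) by simp
    show "AE w in M. norm (G w * (uval t w - uval s w)) \<le> norm (\<bar>G w\<bar> * (2 * L))"
    proof (rule AE_I2)
      fix w
      have "\<bar>uval t w - uval s w\<bar> \<le> 2 * L" using uval_bound[OF tT(1), of w] uval_bound[OF tT(2), of w] by linarith
      then show "norm (G w * (uval t w - uval s w)) \<le> norm (\<bar>G w\<bar> * (2 * L))"
        using L0 by (simp add: abs_mult mult_left_mono)
    qed
  qed (intro borel_measurable_times borel_measurable_diff GM uval_measurable tT)
  note e = eint_orthogonal[OF G integrand_elem[OF st'] st'(1,3)]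
  have "(\<integral>w. G w * remainder s t w \<partial>M) = (\<integral>w. G w * (uval t w - uval s w) - G w * eint (s, t, integrand s) w \<partial>M)"
    using st by (simp add: remainder_eq right_diff_distrib)
  also have "... = 0" using i e uval_martingale[OF st' G] by simp
  finally show ?thesis .
qed

end

section \<open>The martingale representation of the linear part\<close>

lemma crossing_index:
  fixes f :: "nat \<Rightarrow> real"
  assumes "f 0 < r" "r \<le> f n"
  shows "\<exists>i<n. f i < r \<and> r \<le> f (Suc i)"
  using assms(2)
proof (induction n)
  case (Suc n)
  then show ?case by (cases "r \<le> f n") (auto intro: less_SucI)
qed (use assms(1) in auto)

lemma (in prob_space) psq_TM:
  assumes "jm s t H"
  shows "psq s t H = (\<integral>\<^sup>+r. sqn M (H r) \<partial>TM s t)"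
  unfolding psq_fst[OF assms] by (simp add: nn_integral_restrict_space)

context linear_setting
begin

lemma representation:
  assumes st: "0 \<le> s" "s < t" "t \<le> T"
  shows "ito_pair s t integrand (\<lambda>w. uval t w - uval s w)"
proof -
  define h where "h n = (t - s) / real (Suc n)" for n
  define \<tau> where "\<tau> n i = s + real i * h n" for n i
  define xs where "xs n = map (\<lambda>i. (\<tau> n i, \<tau> n (Suc i), integrand (\<tau> n i))) [0..<Suc n]" for n
  have h: "h n > 0" for n using st by (simp add: h_def)
  have \<tau>0: "\<tau> n 0 = s" and \<tau>S: "\<tau> n (Suc i) = \<tau> n i + h n" for n i
    by (simp_all add: \<tau>_def distrib_right)
  have \<tau>N: "\<tau> n (Suc n) = t" for n by (simp add: \<tau>_def h_def del: of_nat_Suc)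
  have \<tau>_mono: "\<tau> n i \<le> \<tau> n j" if "i \<le> j" for n i j
    using that h[of n] by (simp add: \<tau>_def mult_right_mono)
  have \<tau>: "0 \<le> \<tau> n i" "\<tau> n i < \<tau> n (Suc i)" "\<tau> n (Suc i) \<le> T" "\<tau> n i < T" "s \<le> \<tau> n i" "\<tau> n (Suc i) \<le> t" if "i < Suc n" for n i
    using \<tau>_mono[of 0 i n] \<tau>_mono[of "Suc i" "Suc n" n] that st h[of n] by (auto simp: \<tau>0 \<tau>N \<tau>S)
  have el: "\<forall>x\<in>set (xs n). elem s t x" for n
  proof
    fix x assume "x \<in> set (xs n)"
    then obtain i where i: "i < Suc n" "x = (\<tau> n i, \<tau> n (Suc i), integrand (\<tau> n i))" by (auto simp: xs_def simp del: upt_Suc)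
    show "elem s t x" unfolding i(2)
      by (rule elem_weaken[OF integrand_elem]) (use \<tau>[OF i(1)] in auto)
  qed
  have sT: "0 \<le> s" "t \<le> T" using st by auto
  have jl: "jm s t (lproc (xs n))" for n by (rule lproc_jm[OF el sT(2)])
  have jI: "jm s t integrand" using jm_sub[OF integrand_jm] st by auto
  have lint_eq: "uval t w - uval s w - lint (xs n) w = (\<Sum>i<Suc n. remainder (\<tau> n i) (\<tau> n (Suc i)) w)" for n w
  proof -
    have "(\<Sum>i<Suc n. remainder (\<tau> n i) (\<tau> n (Suc i)) w) =
      (\<Sum>i<Suc n. (uval (\<tau> n (Suc i)) w - uval (\<tau> n i) w) - eint (\<tau> n i, \<tau> n (Suc i), integrand (\<tau> n i)) w)"
      using \<tau> by (intro sum.cong refl remainder_eq) auto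
    also have "... = (\<Sum>i<Suc n. uval (\<tau> n (Suc i)) w - uval (\<tau> n i) w) - (\<Sum>i<Suc n. eint (\<tau> n i, \<tau> n (Suc i), integrand (\<tau> n i)) w)"
      by (rule sum_subtractf)
    also have "(\<Sum>i<Suc n. uval (\<tau> n (Suc i)) w - uval (\<tau> n i) w) = uval t w - uval s w"
      using sum_lessThan_telescope[of "\<lambda>i. uval (\<tau> n i) w" "Suc n"] by (simp only: \<tau>0 \<tau>N)
    also have "(\<Sum>i<Suc n. eint (\<tau> n i, \<tau> n (Suc i), integrand (\<tau> n i)) w) = lint (xs n) w"
      unfolding lint_def xs_def map_map o_def
      by (subst sum_list_distinct_conv_sum_set) (simp_all del: upt_Suc sum.lessThan_Suc add: atLeast0LessThan)
    finally show ?thesis ..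
  qed
  \<comment> \<open>Measurability at the grid time is carried through the induction, since the next
    remainder is orthogonal only to what is known by then.\<close>
  have partial: "sqn M (\<lambda>w. \<Sum>i<j. remainder (\<tau> n i) (\<tau> n (Suc i)) w) \<le> ennreal (real j * (remainder_const * (h n)\<^sup>2))
     \<and> (\<lambda>w. \<Sum>i<j. remainder (\<tau> n i) (\<tau> n (Suc i)) w) \<in> borel_measurable (F (\<tau> n j))"
    if "j \<le> Suc n" for n j
    using that
  proof (induction j)
    case (Suc j)
    let ?S = "\<lambda>w. \<Sum>i<j. remainder (\<tau> n i) (\<tau> n (Suc i)) w"
    let ?R = "remainder (\<tau> n j) (\<tau> n (Suc j))"
    have j: "j < Suc n" using Suc.prems by simp
    note t = \<tau>[OF j]
    have IH: "sqn M ?S \<le> ennreal (real j * (remainder_const * (h n)\<^sup>2))" "?S \<in> borel_measurable (F (\<tau> n j))"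
      using Suc.IH Suc.prems by auto
    have SM: "?S \<in> borel_measurable M" using measurable_F[OF IH(2)] t by auto
    have RM: "?R \<in> borel_measurable M" by (rule remainder_measurable[OF t(1-3)])
    have Rle: "sqn M ?R \<le> ennreal (remainder_const * (h n)\<^sup>2)" using remainder_sqn[OF t(1-3)] by (simp add: \<tau>S)
    have fin: "sqn M ?S < top" "sqn M ?R < top" using IH(1) Rle by (auto intro: order_le_less_trans)
    have "sqn M (\<lambda>w. ?S w + ?R w) = sqn M ?S + sqn M ?R"
      by (rule sqn_pythagoras[OF SM RM fin remainder_orthogonal[OF t(1-3) IH(2) integrable_if_sqn_finite[OF SM fin(1)]]])
    also have "... \<le> ennreal (real j * (remainder_const * (h n)\<^sup>2)) + ennreal (remainder_const * (h n)\<^sup>2)"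
      by (intro add_mono IH Rle)
    also have "... = ennreal (real (Suc j) * (remainder_const * (h n)\<^sup>2))"
      using remainder_const_nonneg by (simp add: ennreal_plus[symmetric] algebra_simps del: ennreal_plus)
    finally have 1: "sqn M (\<lambda>w. \<Sum>i<Suc j. remainder (\<tau> n i) (\<tau> n (Suc i)) w) \<le> ennreal (real (Suc j) * (remainder_const * (h n)\<^sup>2))"
      by (simp only: sum.lessThan_Suc)
    have "(\<lambda>w. ?S w + ?R w) \<in> borel_measurable (F (\<tau> n (Suc j)))"
      by (rule borel_measurable_add[OF measurable_F_mono[OF IH(2)] remainder_F_measurable[OF t(1-3)]]) (use t in auto)
    then show ?case using 1 by (simp only: sum.lessThan_Suc)
  qed simp
  have "(\<lambda>n. sqn M (\<lambda>w. lint (xs n) w - (uval t w - uval s w))) \<longlonglongrightarrow> 0"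
  proof (rule tendsto_zero_ennreal_bound)
    fix n
    have "sqn M (\<lambda>w. lint (xs n) w - (uval t w - uval s w)) = sqn M (\<lambda>w. \<Sum>i<Suc n. remainder (\<tau> n i) (\<tau> n (Suc i)) w)"
      unfolding lint_eq[symmetric] by (rule sqn_minus_commute)
    also have "... \<le> ennreal (real (Suc n) * (remainder_const * (h n)\<^sup>2))" using partial[of "Suc n" n] by blast
    also have "real (Suc n) * (remainder_const * (h n)\<^sup>2) = remainder_const * (t - s)\<^sup>2 * inverse (real (Suc n))"
      by (simp add: h_def power2_eq_square field_simps del: of_nat_Suc)
    finally show "sqn M (\<lambda>w. lint (xs n) w - (uval t w - uval s w)) \<le> ennreal (remainder_const * (t - s)\<^sup>2 * inverse (real (Suc n)))" .
  next
    have "(\<lambda>n. ennreal (remainder_const * (t - s)\<^sup>2 * inverse (real (Suc n)))) \<longlonglongrightarrow> ennreal (remainder_const * (t - s)\<^sup>2 * 0)"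
      by (intro tendsto_ennrealI tendsto_intros LIMSEQ_inverse_real_of_nat)
    then show "(\<lambda>n. ennreal (remainder_const * (t - s)\<^sup>2 * inverse (real (Suc n)))) \<longlonglongrightarrow> 0" by simp
  qed
  moreover have "(\<lambda>n. psq s t (\<lambda>r w. lproc (xs n) r w - integrand r w)) \<longlonglongrightarrow> 0"
  proof -
    define c where "c = deriv_bound * L"
    have c: "c \<ge> 0" unfolding c_def using deriv_bound_nonneg L0 by simp
    have at: "\<exists>i<Suc n. \<tau> n i < r \<and> r \<le> \<tau> n i + h n \<and> (\<forall>w. lproc (xs n) r w = integrand (\<tau> n i) w)" if r: "s < r" "r \<le> t" for n r
    proof -
      obtain i where i: "i < Suc n" "\<tau> n i < r" "r \<le> \<tau> n (Suc i)"
        using crossing_index[of "\<tau> n" r "Suc n"] r by (auto simp: \<tau>0 \<tau>N)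
      have "lproc (xs n) r w = integrand (\<tau> n i) w" for w
      proof -
        have "lproc (xs n) r w = (\<Sum>j<Suc n. indicat_real {\<tau> n j<..\<tau> n (Suc j)} r *\<^sub>R integrand (\<tau> n j) w)"
          unfolding lproc_def xs_def map_map o_def eproc_def prod.case
          by (subst sum_list_distinct_conv_sum_set) (simp_all del: upt_Suc sum.lessThan_Suc add: atLeast0LessThan)
        also have "... = indicat_real {\<tau> n i<..\<tau> n (Suc i)} r *\<^sub>R integrand (\<tau> n i) w
           + (\<Sum>j\<in>{..<Suc n} - {i}. indicat_real {\<tau> n j<..\<tau> n (Suc j)} r *\<^sub>R integrand (\<tau> n j) w)"
          using i(1) by (intro sum.remove) auto
        also have "(\<Sum>j\<in>{..<Suc n} - {i}. indicat_real {\<tau> n j<..\<tau> n (Suc j)} r *\<^sub>R integrand (\<tau> n j) w) = 0"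
        proof (rule sum.neutral, rule ballI)
          fix j assume "j \<in> {..<Suc n} - {i}"
          then have "Suc j \<le> i \<or> Suc i \<le> j" by auto
          then have "r \<notin> {\<tau> n j<..\<tau> n (Suc j)}" using i(2,3) \<tau>_mono[of "Suc j" i n] \<tau>_mono[of "Suc i" j n] by auto
          then show "indicat_real {\<tau> n j<..\<tau> n (Suc j)} r *\<^sub>R integrand (\<tau> n j) w = 0" by simp
        qed
        finally show ?thesis using i by simp
      qed
      then show ?thesis using i by (auto simp: \<tau>S)
    qed
    have point: "(\<lambda>n. sqn M (\<lambda>w. lproc (xs n) r w - integrand r w)) \<longlonglongrightarrow> 0" if r: "s < r" "r \<le> t" "r < T" for r
    proof -
      have rT: "r \<in> {0..T}" "r \<in> {0..<T}" using r st by auto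
      obtain i where i: "\<And>n. i n < Suc n" "\<And>n. \<tau> n (i n) < r" "\<And>n. r \<le> \<tau> n (i n) + h n" "\<And>n w. lproc (xs n) r w = integrand (\<tau> n (i n)) w"
        using at[OF r(1,2)] by metis
      define \<kappa> where "\<kappa> n = \<tau> n (i n)" for n
      have \<kappa>: "\<kappa> n \<in> {0..T}" "\<kappa> n \<in> {0..<T}" "\<kappa> n < r" "r - h n \<le> \<kappa> n" for n
        using \<tau>[OF i(1)[of n]] i(2)[of n] i(3)[of n] r by (auto simp: \<kappa>_def)
      have "(\<lambda>n. r - h n) \<longlonglongrightarrow> r - (t - s) * 0"
        unfolding h_def divide_inverse by (intro tendsto_intros LIMSEQ_inverse_real_of_nat)
      then have hlim: "(\<lambda>n. r - h n) \<longlonglongrightarrow> r" by simp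
      have \<kappa>lim: "\<kappa> \<longlonglongrightarrow> r"
        by (rule tendsto_sandwich[OF _ _ hlim tendsto_const]) (auto intro!: always_eventually less_imp_le \<kappa>)
      have mI: "integrand q \<in> borel_measurable M" if "q \<in> {0..T}" for q using measurable_F[OF integrand_F_measurable[OF that]] that by auto
      have "(\<lambda>n. sqn M (\<lambda>w. norm (integrand (\<kappa> n) w - integrand r w))) \<longlonglongrightarrow> 0"
      proof (rule sqn_tendsto_zero)
        show "(\<lambda>w. norm (integrand (\<kappa> n) w - integrand r w)) \<in> borel_measurable M" for n
          by (rule measurable_compose[OF borel_measurable_diff[OF mI[OF \<kappa>(1)] mI[OF rT(1)]] borel_measurable_norm])
        show "\<bar>norm (integrand (\<kappa> n) w - integrand r w)\<bar> \<le> 2 * c" for n w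
          using integrand_bound[OF \<kappa>(1)[of n], of w] integrand_bound[OF rT(1), of w] norm_triangle_ineq4[of "integrand (\<kappa> n) w" "integrand r w"]
          unfolding c_def abs_norm_cancel by linarith
        show "AE w in M. (\<lambda>n. norm (integrand (\<kappa> n) w - integrand r w)) \<longlonglongrightarrow> 0"
          using X_path_tendsto[OF rT(1) \<kappa>(1) \<kappa>lim]
        proof eventually_elim
          case (elim w)
          have pair: "(\<lambda>n. (\<kappa> n, X (\<kappa> n) w)) \<longlonglongrightarrow> (r, X r w)" by (intro tendsto_Pair elim \<kappa>lim)
          have "\<forall>\<^sub>F n in sequentially. (\<kappa> n, X (\<kappa> n) w) \<in> {0..<T} \<times> UNIV" using \<kappa>(2) by (intro always_eventually) auto
          from continuous_on_tendsto_compose[OF linear_Z_continuous pair _ this] rT(2)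
          have "(\<lambda>n. linear_Z \<sigma> \<epsilon> u (\<kappa> n) (X (\<kappa> n) w)) \<longlonglongrightarrow> linear_Z \<sigma> \<epsilon> u r (X r w)" by simp
          moreover have "integrand (\<kappa> n) w = linear_Z \<sigma> \<epsilon> u (\<kappa> n) (X (\<kappa> n) w)" for n using \<kappa>(2)[of n] by (simp add: integrand_def)
          ultimately have "(\<lambda>n. integrand (\<kappa> n) w) \<longlonglongrightarrow> integrand r w" using rT by (simp add: integrand_def)
          then have "(\<lambda>n. norm (integrand (\<kappa> n) w - integrand r w)) \<longlonglongrightarrow> norm (integrand r w - integrand r w)" by (intro tendsto_intros)
          then show ?case by simp
        qed
      qed
      then show ?thesis by (simp add: i(4) \<kappa>_def)
    qed
    have jd: "jm s t (\<lambda>r w. lproc (xs n) r w - integrand r w)" for n by (rule jm_diff[OF jl jI])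
    \<comment> \<open>The left endpoint is lost because the steps are left-open, and
      \<open>T\<close> because \<open>linear_Z\<close> is continuous only before it.\<close>
    have ae: "AE r in TM s t. s < r \<and> r \<le> t \<and> r < T"
      using AE_lborel_singleton[of s] AE_lborel_singleton[of T] st by (auto simp: AE_restrict_space_iff elim!: eventually_elim2)
    have "(\<lambda>n. \<integral>\<^sup>+r. sqn M (\<lambda>w. lproc (xs n) r w - integrand r w) \<partial>TM s t) \<longlonglongrightarrow> (\<integral>\<^sup>+r. 0 \<partial>TM s t)"
    proof (rule nn_integral_dominated_convergence[where w = "\<lambda>_. ennreal ((2 * c)\<^sup>2)"])
      show "(\<lambda>r. sqn M (\<lambda>w. lproc (xs n) r w - integrand r w)) \<in> borel_measurable (TM s t)" for n
        by (rule sqn_section_measurable[OF jd])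
      show "AE r in TM s t. sqn M (\<lambda>w. lproc (xs n) r w - integrand r w) \<le> ennreal ((2 * c)\<^sup>2)" for n
        using ae
      proof eventually_elim
        case (elim r)
        then obtain i where i: "i < Suc n" "\<And>w. lproc (xs n) r w = integrand (\<tau> n i) w" using at[of r n] by blast
        have m: "\<tau> n i \<in> {0..T}" "r \<in> {0..T}" using \<tau>[OF i(1)] elim st by auto
        show ?case unfolding i(2)
        proof (rule sqn_bounded)
          fix w
          show "norm (integrand (\<tau> n i) w - integrand r w) \<le> 2 * c"
            using integrand_bound[OF m(1), of w] integrand_bound[OF m(2), of w] norm_triangle_ineq4[of "integrand (\<tau> n i) w" "integrand r w"]
            unfolding c_def by linarith
        qed
      qed
      show "(\<integral>\<^sup>+r. ennreal ((2 * c)\<^sup>2) \<partial>TM s t) < \<infinity>"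
        using st by (simp add: emeasure_restrict_space ennreal_mult_less_top)
      show "AE r in TM s t. (\<lambda>n. sqn M (\<lambda>w. lproc (xs n) r w - integrand r w)) \<longlonglongrightarrow> 0"
        using ae by eventually_elim (auto intro: point)
    qed auto
    then show ?thesis by (simp add: psq_TM[OF jd])
  qed
  moreover have "(\<lambda>w. uval t w - uval s w) \<in> borel_measurable M" using st by (intro borel_measurable_diff uval_measurable) auto
  ultimately show ?thesis unfolding ito_pair_def using jI el by blast
qed

end

section \<open>Stability of the controlled equation\<close>

lemma standing_assumptions_regular:
  assumes "standing_assumptions T \<mu> \<sigma> f g"
  shows "\<exists>L. regular_coefficients T \<mu> \<sigma> g L"
proof -
  note sa = assms[unfolded standing_assumptions_def]
  have Cmu: "Cb {0..T} k \<mu>" and Csig: "Cb {0..T} k \<sigma>" and Cg: "Cb UNIV 2 (\<lambda>_. g)" for k using sa by simp_all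
  have Cg': "Cb UNIV (Suc (Suc 0)) (\<lambda>_. g)" using Cg by (simp add: numeral_2_eq_2)
  obtain b1 where b1: "b1 \<ge> 0" "\<And>t x. t \<in> {0..T} \<Longrightarrow> norm (\<mu> t x) \<le> b1" using Cb_bounded[OF Cmu] by blast
  obtain b2 where b2: "b2 \<ge> 0" "\<And>t x. t \<in> {0..T} \<Longrightarrow> norm (\<sigma> t x) \<le> b2" using Cb_bounded[OF Csig] by blast
  obtain b3 where b3: "b3 \<ge> 0" "\<And>x. \<bar>g x\<bar> \<le> b3" using Cb_bounded[OF Cg] by auto
  obtain l1 where l1: "l1 \<ge> 0" "\<And>t x y. t \<in> {0..T} \<Longrightarrow> norm (\<mu> t x - \<mu> t y) \<le> l1 * norm (x - y)"
    using Cb_Suc_lipschitz[OF Cmu] by blast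
  obtain l2 where l2: "l2 \<ge> 0" "\<And>t x y. t \<in> {0..T} \<Longrightarrow> norm (\<sigma> t x - \<sigma> t y) \<le> l2 * norm (x - y)"
    using Cb_Suc_lipschitz[OF Csig] by blast
  obtain l3 where l3: "l3 \<ge> 0" "\<And>x y. \<bar>g x - g y\<bar> \<le> l3 * norm (x - y)"
    using Cb_Suc_lipschitz[OF Cg'] by auto
  obtain m1 where m1: "m1 \<ge> 0" "\<And>t x1 x2 x3 x4. t \<in> {0..T} \<Longrightarrow> norm (\<mu> t x1 - \<mu> t x2 - \<mu> t x3 + \<mu> t x4)
           \<le> m1 * (norm (x1 - x2 - x3 + x4) + norm (x1 - x2) * norm (x1 - x3))"
    using Cb2_mixed_difference[OF Cmu] by blast
  obtain m2 where m2: "m2 \<ge> 0" "\<And>t x1 x2 x3 x4. t \<in> {0..T} \<Longrightarrow> norm (\<sigma> t x1 - \<sigma> t x2 - \<sigma> t x3 + \<sigma> t x4)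
           \<le> m2 * (norm (x1 - x2 - x3 + x4) + norm (x1 - x2) * norm (x1 - x3))"
    using Cb2_mixed_difference[OF Csig] by blast
  obtain m3 where m3: "m3 \<ge> 0" "\<And>x1 x2 x3 x4. \<bar>g x1 - g x2 - g x3 + g x4\<bar>
           \<le> m3 * (norm (x1 - x2 - x3 + x4) + norm (x1 - x2) * norm (x1 - x3))"
    using Cb2_mixed_difference[OF Cg] by auto
  have h1: "\<exists>K. \<forall>s\<in>{0..T}. \<forall>t\<in>{0..T}. \<forall>x. norm (\<mu> t x - \<mu> s x) \<le> K * sqrt \<bar>t - s\<bar>"
    using sa by (elim conjE)
  have h2: "\<exists>K. \<forall>s\<in>{0..T}. \<forall>t\<in>{0..T}. \<forall>x. norm (\<sigma> t x - \<sigma> s x) \<le> K * sqrt \<bar>t - s\<bar>"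
    using sa by (elim conjE)
  obtain h1 where h1: "\<And>s t x. s \<in> {0..T} \<Longrightarrow> t \<in> {0..T} \<Longrightarrow> norm (\<mu> t x - \<mu> s x) \<le> h1 * sqrt \<bar>t - s\<bar>"
    using h1 by blast
  obtain h2 where h2: "\<And>s t x. s \<in> {0..T} \<Longrightarrow> t \<in> {0..T} \<Longrightarrow> norm (\<sigma> t x - \<sigma> s x) \<le> h2 * sqrt \<bar>t - s\<bar>"
    using h2 by blast
  define L where "L = Max {b1, b2, b3, l1, l2, l3, m1, m2, m3, h1, h2}"
  have L: "b1 \<le> L" "b2 \<le> L" "b3 \<le> L" "l1 \<le> L" "l2 \<le> L" "l3 \<le> L" "m1 \<le> L" "m2 \<le> L" "m3 \<le> L" "h1 \<le> L" "h2 \<le> L"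
    unfolding L_def by (intro Max_ge; simp)+
  have larger: "a \<le> L * c" if "a \<le> l * c" "l \<le> L" "0 \<le> c" for a l c
    using that by (meson mult_right_mono order_trans)
  have "regular_coefficients T \<mu> \<sigma> g L"
  proof
    show "L \<ge> 0" using b1(1) L(1) by linarith
  qed (use b1(2) b2(2) b3(2) L(1-3) in \<open>blast intro: order_trans\<close>,
      use b1(2) b2(2) b3(2) L(1-3) in \<open>blast intro: order_trans\<close>,
      use b1(2) b2(2) b3(2) L(1-3) in \<open>blast intro: order_trans\<close>,
      rule larger[OF l1(2) L(4)], simp, simp, rule larger[OF l2(2) L(5)], simp, simp, rule larger[OF l3(2) L(6)], simp,
      rule larger[OF m1(2) L(7)], simp, simp, rule larger[OF m2(2) L(8)], simp, simp, rule larger[OF m3(2) L(9)], simp,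
      rule larger[OF h1 L(10)], simp_all, rule larger[OF h2 L(11)], simp_all)
  then show ?thesis ..
qed

text \<open>No integrability of \<open>F\<close> is assumed: where it fails the Bochner integral is 0, which the
  estimate tolerates, and integrability then follows from the estimate.\<close>

lemma integral_equation_path:
  fixes F \<beta> :: "real \<Rightarrow> real"
  assumes F: "F \<in> borel_measurable (restrict_space lborel {0..T})"
    and q: "(\<lambda>t. LBINT s:{0..t}. F s) \<in> borel_measurable (restrict_space lborel {0..T})"
    and bound: "\<And>s. s \<in> {0..T} \<Longrightarrow> \<bar>F s\<bar> \<le> \<beta> s + K * \<bar>LBINT r:{0..s}. F r\<bar>"
    and \<beta>: "set_integrable lborel {0..T} \<beta>" "\<And>s. s \<in> {0..T} \<Longrightarrow> \<beta> s \<ge> 0" and K: "K > 0" and T: "T > 0"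
  shows "set_integrable lborel {0..T} F"
    and "t \<in> {0..T} \<Longrightarrow> \<bar>LBINT s:{0..t}. F s\<bar> \<le> 2 * exp (2 * K * T) * (LBINT s:{0..T}. \<beta> s)"
proof -
  define Q where "Q t = \<bar>LBINT s:{0..t}. F s\<bar>" for t
  define B where "B = (LBINT s:{0..T}. \<beta> s)"
  have B0: "B \<ge> 0" unfolding B_def set_lebesgue_integral_def
    by (intro integral_nonneg_AE AE_I2) (auto simp: indicator_def \<beta>(2))
  have Bnn: "(\<integral>\<^sup>+s\<in>{0..T}. ennreal (\<beta> s) \<partial>lborel) = ennreal B"
    unfolding B_def set_lebesgue_integral_def
    by (subst nn_integral_eq_integral[symmetric])
      (use \<beta> in \<open>auto simp: set_integrable_def indicator_def intro!: nn_integral_cong AE_I2 split: if_splits\<close>)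
  have Qbound: "Q t \<le> 2 * B * exp (2 * K * T)" if t: "t \<in> {0..T}" for t
  proof (cases "set_integrable lborel {0..t} F")
    case False
    then have "Q t = 0" by (simp add: Q_def set_lebesgue_integral_def set_integrable_def not_integrable_integral_eq)
    then show ?thesis using B0 by simp
  next
    \<comment> \<open>Integrability on \<open>{0..t}\<close> supplies a finite bound for
      \<open>Q\<close> on this interval, from which the Gronwall iteration can start.\<close>
    case True
    have sub: "set_integrable lborel {0..r} F" if "r \<in> {0..t}" for r
      using True by (rule set_integrable_subset) (use that in auto)
    have ab: "set_integrable lborel {0..r} (\<lambda>s. \<bar>F s\<bar>)" if "r \<in> {0..t}" for r
      using set_integrable_abs[OF sub[OF that]] .
    have Qle: "ennreal (Q r) \<le> (\<integral>\<^sup>+s\<in>{0..r}. ennreal \<bar>F s\<bar> \<partial>lborel)" if r: "r \<in> {0..t}" for r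
    proof -
      have "Q r \<le> (LBINT s:{0..r}. \<bar>F s\<bar>)"
        unfolding Q_def using set_integral_norm_bound[OF sub[OF r]] by simp
      moreover have "ennreal (LBINT s:{0..r}. \<bar>F s\<bar>) = (\<integral>\<^sup>+s\<in>{0..r}. ennreal \<bar>F s\<bar> \<partial>lborel)"
        unfolding set_lebesgue_integral_def
        by (subst nn_integral_eq_integral[symmetric])
          (use ab[OF r] in \<open>auto simp: set_integrable_def indicator_def intro!: nn_integral_cong split: if_splits\<close>)
      ultimately show ?thesis by (metis ennreal_leI)
    qed
    have meas: "(\<lambda>s. ennreal (Q s) * indicator {0..r} s) \<in> borel_measurable lborel"
      "(\<lambda>s. ennreal (\<beta> s) * indicator {0..r} s) \<in> borel_measurable lborel" if r: "r \<in> {0..t}" for r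
    proof -
      have "(\<lambda>s. ennreal (Q s)) \<in> borel_measurable (restrict_space lborel {0..T})"
        unfolding Q_def by (intro measurable_compose[OF borel_measurable_abs[OF q] measurable_ennreal])
      then have "(\<lambda>s. ennreal (Q s)) \<in> borel_measurable (restrict_space lborel {0..r})"
        by (rule measurable_restrict_mono) (use r t in auto)
      then show "(\<lambda>s. ennreal (Q s) * indicator {0..r} s) \<in> borel_measurable lborel"
        by (subst (asm) borel_measurable_restrict_space_iff_ennreal) simp_all
      have "(\<lambda>s. ennreal (indicator {0..r} s *\<^sub>R \<beta> s)) \<in> borel_measurable lborel"
        using set_integrable_subset[OF \<beta>(1), of "{0..r}"] r t
        by (intro measurable_compose[OF _ measurable_ennreal] borel_measurable_integrable) (auto simp: set_integrable_def)
      then show "(\<lambda>s. ennreal (\<beta> s) * indicator {0..r} s) \<in> borel_measurable lborel"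
        by (rule measurable_cong[THEN iffD1, rotated]) (auto simp: indicator_def)
    qed
    have "ennreal (Q t) \<le> ennreal (2 * B * exp (2 * K * t))"
    proof (rule gronwall_ennreal[where T = t])
      fix r assume r: "r \<in> {0..t}"
      have "ennreal (Q r) \<le> (\<integral>\<^sup>+s. ennreal (\<beta> s) * indicator {0..r} s + ennreal K * (ennreal (Q s) * indicator {0..r} s) \<partial>lborel)"
      proof (rule order_trans[OF Qle[OF r] nn_integral_mono])
        fix s
        show "ennreal \<bar>F s\<bar> * indicator {0..r} s
          \<le> ennreal (\<beta> s) * indicator {0..r} s + ennreal K * (ennreal (Q s) * indicator {0..r} s)"
        proof (cases "s \<in> {0..r}")
          case True
          then have s: "s \<in> {0..T}" using r t by auto
          have "ennreal \<bar>F s\<bar> \<le> ennreal (\<beta> s + K * Q s)" by (rule ennreal_leI) (use bound[OF s] in \<open>simp add: Q_def\<close>)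
          also have "... = ennreal (\<beta> s) + ennreal K * ennreal (Q s)"
            using \<beta>(2)[OF s] K by (simp add: ennreal_plus ennreal_mult Q_def)
          finally show ?thesis using True by simp
        qed simp
      qed
      also have "... = (\<integral>\<^sup>+s\<in>{0..r}. ennreal (\<beta> s) \<partial>lborel) + ennreal K * (\<integral>\<^sup>+s\<in>{0..r}. ennreal (Q s) \<partial>lborel)"
        using meas[OF r] by (simp add: nn_integral_add nn_integral_cmult del: measurable_lborel1)
      also have "(\<integral>\<^sup>+s\<in>{0..r}. ennreal (\<beta> s) \<partial>lborel) \<le> ennreal B"
        unfolding Bnn[symmetric] by (intro nn_integral_mono) (use r t in \<open>auto simp: indicator_def\<close>)
      finally show "ennreal (Q r) \<le> ennreal B + ennreal K * (\<integral>\<^sup>+s\<in>{0..r}. ennreal (Q s) \<partial>lborel)"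
        by (simp add: add_right_mono)
    next
      fix r assume r: "r \<in> {0..t}"
      have "Q r \<le> (LBINT s:{0..r}. \<bar>F s\<bar>)"
        unfolding Q_def using set_integral_norm_bound[OF sub[OF r]] by simp
      also have "... \<le> (LBINT s:{0..t}. \<bar>F s\<bar>)"
        unfolding set_lebesgue_integral_def
        by (rule integral_mono) (use ab[OF r] ab[of t] r t in \<open>auto simp: set_integrable_def indicator_def\<close>)
      finally show "ennreal (Q r) \<le> ennreal (LBINT s:{0..t}. \<bar>F s\<bar>)" by (rule ennreal_leI)
    next
      show "0 \<le> (LBINT s:{0..t}. \<bar>F s\<bar>)"
        unfolding set_lebesgue_integral_def by (intro integral_nonneg_AE AE_I2) simp
    qed (use B0 K t in auto)
    then have "Q t \<le> 2 * B * exp (2 * K * t)" using B0 by simp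
    also have "... \<le> 2 * B * exp (2 * K * T)" using B0 K t by (intro mult_left_mono) auto
    finally show ?thesis .
  qed
  then show "t \<in> {0..T} \<Longrightarrow> \<bar>LBINT s:{0..t}. F s\<bar> \<le> 2 * exp (2 * K * T) * (LBINT s:{0..T}. \<beta> s)"
    by (simp add: Q_def B_def mult_ac)
  have F': "set_borel_measurable lborel {0..T} F"
    using F by (subst (asm) borel_measurable_restrict_space_iff) (simp_all add: set_borel_measurable_def)
  have "set_integrable lborel {0..T} (\<lambda>s. \<beta> s + K * (2 * B * exp (2 * K * T)))"
    by (intro set_integral_add \<beta>(1) borel_integrable_atLeastAtMost' continuous_on_const)
  then show "set_integrable lborel {0..T} F"
  proof (rule set_integrable_bound[OF _ F'], intro AE_I2 impI)
    fix s assume s: "s \<in> {0..T}"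
    have "\<bar>F s\<bar> \<le> \<beta> s + K * Q s" using bound[OF s] by (simp add: Q_def)
    also have "K * Q s \<le> K * (2 * B * exp (2 * K * T))" using K Qbound[OF s] by (intro mult_left_mono) auto
    finally show "norm (F s) \<le> norm (\<beta> s + K * (2 * B * exp (2 * K * T)))" by simp
  qed
qed

context prob_space
begin

text \<open>The upper limit is moved into the integrand as a cutoff, which makes the running
  integral a parametric integral over a fixed interval.\<close>

lemma jm_running_integral:
  fixes H :: "real \<Rightarrow> 'a \<Rightarrow> real"
  assumes "jm s t H"
  shows "jm s t (\<lambda>r w. LBINT q:{s..r}. H q w)"
proof -
  interpret T: sigma_finite_measure "TM s t" by (rule sigma_finite_TM)
  have H: "(\<lambda>w. H (snd w) (snd (fst w))) \<in> borel_measurable (PM s t \<Otimes>\<^sub>M TM s t)"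
    using measurable_compose[OF measurable_Pair[OF measurable_snd measurable_compose[OF measurable_fst measurable_snd]] jmD[OF assms]]
    by simp
  have id: "(\<lambda>x::real. x) \<in> borel_measurable (TM s t)" by (rule measurable_restrict_space1) simp
  have [measurable]: "(\<lambda>w. fst (fst w)) \<in> borel_measurable (PM s t \<Otimes>\<^sub>M TM s t)"
    "(\<lambda>w. snd w) \<in> borel_measurable (PM s t \<Otimes>\<^sub>M TM s t)"
    by (rule measurable_compose[OF measurable_compose[OF measurable_fst measurable_fst] id], rule measurable_compose[OF measurable_snd id])
  have "(\<lambda>w. if snd w \<le> fst (fst w) then H (snd w) (snd (fst w)) else 0) \<in> borel_measurable (PM s t \<Otimes>\<^sub>M TM s t)"
    using H by measurable
  then have "(\<lambda>z. \<integral>q. (if q \<le> fst z then H q (snd z) else 0) \<partial>TM s t) \<in> borel_measurable (PM s t)"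
    by (intro T.borel_measurable_lebesgue_integral) (simp add: case_prod_beta)
  then show ?thesis unfolding jm_def
  proof (rule measurable_cong[THEN iffD1, rotated])
    fix z assume "z \<in> space (PM s t)"
    then have z: "fst z \<in> {s..t}" by (auto simp: space_PM)
    have "(\<integral>q. (if q \<le> fst z then H q (snd z) else 0) \<partial>TM s t)
      = (\<integral>q. indicator {s..t} q *\<^sub>R (if q \<le> fst z then H q (snd z) else 0) \<partial>lborel)"
      by (simp add: integral_restrict_space)
    also have "... = (LBINT q:{s..fst z}. H q (snd z))"
      unfolding set_lebesgue_integral_def using z by (intro Bochner_Integration.integral_cong) (auto simp: indicator_def)
    finally show "(\<integral>q. (if q \<le> fst z then H q (snd z) else 0) \<partial>TM s t) = (LBINT q:{s..fst z}. H q (snd z))" .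
  qed
qed

lemma psq_finite_path:
  fixes H :: "real \<Rightarrow> 'a \<Rightarrow> real"
  assumes H: "jm s t H" and f: "psq s t H < top"
  shows "AE w in M. set_integrable lborel {s..t} (\<lambda>r. H r w)"
proof -
  interpret T: sigma_finite_measure "TM s t" by (rule sigma_finite_TM)
  have "AE w in M. sqn (TM s t) (\<lambda>r. H r w) \<noteq> \<infinity>"
  proof (rule nn_integral_noteq_infinite)
    have "(\<lambda>z. H (snd z) (fst z)) \<in> borel_measurable (M \<Otimes>\<^sub>M TM s t)"
      using measurable_compose[OF measurable_pair_swap' jmD[OF H]] by (simp add: case_prod_beta)
    then show "(\<lambda>w. sqn (TM s t) (\<lambda>r. H r w)) \<in> borel_measurable M"
      unfolding sqn_def by (intro T.borel_measurable_nn_integral) (simp add: case_prod_beta)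
    show "(\<integral>\<^sup>+w. sqn (TM s t) (\<lambda>r. H r w) \<partial>M) \<noteq> \<infinity>" using f by (simp add: psq_snd[OF H])
  qed
  then show ?thesis
  proof (rule AE_mp, intro AE_I2 impI)
    fix w assume w: "w \<in> space M" and fin: "sqn (TM s t) (\<lambda>r. H r w) \<noteq> \<infinity>"
    have m: "(\<lambda>r. H r w) \<in> borel_measurable (TM s t)" by (rule jm_path[OF H w])
    have "emeasure (TM s t) (space (TM s t)) < top"
      by (simp add: space_restrict_space emeasure_restrict_space emeasure_lborel_Icc_eq)
    then have one: "sqn (TM s t) (\<lambda>_. 1::real) < top" by (simp add: sqn_const)
    have "integrable (TM s t) (\<lambda>r. H r w * 1)"
      by (rule integrable_mult_sqn[OF m _ _ one]) (use fin in \<open>auto simp: less_top[symmetric]\<close>)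
    then show "set_integrable lborel {s..t} (\<lambda>r. H r w)"
      by (simp add: set_integrable_def integrable_restrict_space)
  qed
qed

end

lemma (in prob_space) psq_add_finite:
  fixes H G :: "real \<Rightarrow> 'a \<Rightarrow> 'b::{real_normed_vector, second_countable_topology}"
  assumes "jm s t H" "jm s t G" "psq s t H < top" "psq s t G < top"
  shows "psq s t (\<lambda>r w. H r w + G r w) < top"
proof -
  have "psq s t (\<lambda>r w. H r w + G r w) \<le> 2 * psq s t H + 2 * psq s t G"
    unfolding psq_def by (rule sqn_add_le[OF jmD[OF assms(1)] jmD[OF assms(2)]])
  also have "... < top" using assms(3,4) by (simp add: ennreal_mult_less_top ennreal_add_less_top)
  finally show ?thesis .
qed

lemma (in prob_space) psq_scale_finite:
  fixes H :: "real \<Rightarrow> 'a \<Rightarrow> 'b::{real_normed_vector, second_countable_topology}"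
  assumes "jm s t H" "psq s t H < top"
  shows "psq s t (\<lambda>r w. c *\<^sub>R H r w) < top"
  unfolding psq_def sqn_scale[OF jmD[OF assms(1)]] using assms(2)
  by (simp add: psq_def[symmetric] ennreal_mult_less_top)

lemma (in prob_space) psq_diff_finite:
  fixes H G :: "real \<Rightarrow> 'a \<Rightarrow> 'b::{real_normed_vector, second_countable_topology}"
  assumes "jm s t H" "jm s t G" "psq s t H < top" "psq s t G < top"
  shows "psq s t (\<lambda>r w. H r w - G r w) < top"
  using psq_add_finite[OF assms(1) jm_scaleR[OF assms(2), of "-1"] assms(3) psq_scale_finite[OF assms(2,4), of "-1"]] by simp

lemma (in prob_space) psq_bounded_finite:
  assumes st: "s \<le> t" and B: "\<And>r w. r \<in> {s..t} \<Longrightarrow> w \<in> space M \<Longrightarrow> norm (H r w) \<le> B"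
  shows "psq s t H < top"
proof -
  have "psq s t H \<le> psq s t (\<lambda>_ _. B)" by (intro psq_mono) (use B in fastforce)
  also have "... \<le> ennreal (t - s) * ennreal (B\<^sup>2)"
    by (rule psq_le[OF jm_const st]) (simp_all add: sqn_const emeasure_space_1)
  also have "... < top" by (simp add: ennreal_mult_less_top)
  finally show ?thesis .
qed

section \<open>The driver of the controlled equation\<close>

locale bsde_setting = linear_setting M T W \<xi> F \<mu> \<sigma> g L \<epsilon> X u
  for M :: "'w measure" and T :: real and W :: "real \<Rightarrow> 'w \<Rightarrow> real ^ 'd" and \<xi> F
    and \<mu> :: "real \<Rightarrow> real ^ 'd \<Rightarrow> real ^ 'd" and \<sigma> g L \<epsilon> X u +
  fixes f :: "real \<Rightarrow> real ^ 'd \<Rightarrow> real \<Rightarrow> real ^ 'd \<Rightarrow> real" and K \<alpha> :: real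
  assumes K: "K > 0" and alpha: "\<alpha> \<in> {0<..<1}"
    and f_lip: "\<And>t x x' y y' z z'. t \<in> {0..T} \<Longrightarrow>
        \<bar>f t x y z - f t x' y' z'\<bar> \<le> K * (norm (x - x') + \<bar>y - y'\<bar> + norm (z - z'))"
    and f_growth: "\<And>t x y z. t \<in> {0..T} \<Longrightarrow> \<bar>f t x y z\<bar> \<le> K * (1 + norm x + \<bar>y\<bar> + norm z)"
    and f_hoelder: "\<And>s t x y z. s \<in> {0..T} \<Longrightarrow> t \<in> {0..T} \<Longrightarrow> \<bar>f t x y z - f s x y z\<bar> \<le> K * sqrt \<bar>t - s\<bar>"
begin

lemma jm_driver:
  assumes "jm 0 T X'" "jm 0 T Y'" "jm 0 T Z'"
  shows "jm 0 T (\<lambda>r w. f r (X' r w) (Y' r w) (Z' r w))"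
proof -
  have j: "jm 0 T (\<lambda>r w. (X' r w, Y' r w, Z' r w))"
    unfolding jm_def borel_prod[symmetric]
    by (intro measurable_Pair jmD assms)
  have c: "continuous_on ({0..T} \<times> UNIV) (\<lambda>(t, p). case p of (x, y, z) \<Rightarrow> f t x y z)"
  proof (rule continuous_coefficient[where K = "3 * K"])
    fix t and p q :: "(real ^ 'd) \<times> real \<times> (real ^ 'd)" assume t: "t \<in> {0..T}"
    obtain x y z where p: "p = (x, y, z)" by (cases p) auto
    obtain x' y' z' where q: "q = (x', y', z')" by (cases q) auto
    have "norm (x - x') \<le> norm (p - q)" "norm (y - y') \<le> norm (p - q)" "norm (z - z') \<le> norm (p - q)"
      using norm_fst_le[of "x - x'" "(y - y', z - z')"] norm_snd_le[of "(y - y', z - z')" "x - x'"]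
        norm_fst_le[of "y - y'" "z - z'"] norm_snd_le[of "z - z'" "y - y'"]
      by (simp_all add: p q)
    then have "norm (x - x') + \<bar>y - y'\<bar> + norm (z - z') \<le> 3 * norm (p - q)" by simp
    then have "K * (norm (x - x') + \<bar>y - y'\<bar> + norm (z - z')) \<le> K * (3 * norm (p - q))"
      using K by (intro mult_left_mono) auto
    then show "norm ((case p of (x, y, z) \<Rightarrow> f t x y z) - (case q of (x, y, z) \<Rightarrow> f t x y z)) \<le> 3 * K * norm (p - q)"
      using f_lip[OF t, of x y z x' y' z'] by (simp add: p q)
  next
    fix s t and p :: "(real ^ 'd) \<times> real \<times> (real ^ 'd)" assume st: "s \<in> {0..T}" "t \<in> {0..T}"
    obtain x y z where p: "p = (x, y, z)" by (cases p) auto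
    have "K * sqrt \<bar>t - s\<bar> \<le> 3 * K * sqrt \<bar>t - s\<bar>" using K by (intro mult_right_mono) auto
    then show "norm ((case p of (x, y, z) \<Rightarrow> f t x y z) - (case p of (x, y, z) \<Rightarrow> f s x y z)) \<le> 3 * K * sqrt \<bar>t - s\<bar>"
      using f_hoelder[OF st, of x y z] by (simp add: p)
  qed
  have "jm 0 T (\<lambda>r _. r)" by (rule jm_time) simp
  from jm_coefficient[OF c _ this _ j] show ?thesis by simp
qed

text \<open>The gradient of \<open>u T\<close> plays no role: the value at the single time T is set to 0.\<close>

definition zbar :: "(real \<Rightarrow> 'w \<Rightarrow> real ^ 'd) \<Rightarrow> real \<Rightarrow> 'w \<Rightarrow> real ^ 'd" where
  "zbar X' r w = (if r < T then linear_Z \<sigma> \<epsilon> u r (X' r w) else 0)"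

lemma zbar_jm: "jm 0 T X' \<Longrightarrow> jm 0 T (zbar X')"
  unfolding zbar_def[abs_def] by (rule jm_linear_Z)

lemma zbar_bound: "r \<in> {0..T} \<Longrightarrow> norm (zbar X' r w) \<le> deriv_bound * L"
  using linear_Z_bound[of r] deriv_bound_nonneg L0 by (auto simp: zbar_def)

lemma u_path_jm:
  assumes "jm 0 T X'"
  shows "jm 0 T (\<lambda>r w. u r (X' r w))"
  using jm_coefficient[OF u_continuous _ jm_time _ assms, of "\<lambda>r. r"] by simp

text \<open>Formed with \<open>zbar\<close> instead of \<open>linear_Z\<close>, which affects the
  time \<open>T\<close> only and gives joint measurability up to \<open>T\<close>.\<close>

definition driver ::
    "(real \<Rightarrow> 'w \<Rightarrow> real ^ 'd) \<Rightarrow> (real \<Rightarrow> 'w \<Rightarrow> real) \<Rightarrow> (real \<Rightarrow> 'w \<Rightarrow> real ^ 'd) \<Rightarrow> real \<Rightarrow> 'w \<Rightarrow> real" where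
  "driver X' Y' Z' r w = f r (X' r w) (u r (X' r w) + \<alpha> * Y' r w) (zbar X' r w + \<alpha> *\<^sub>R Z' r w)"

lemma driver_jm:
  assumes "jm 0 T X'" "jm 0 T Y'" "jm 0 T Z'"
  shows "jm 0 T (driver X' Y' Z')"
  unfolding driver_def[abs_def]
  using jm_scaleR[OF assms(2), of \<alpha>]
  by (intro jm_driver jm_add assms u_path_jm zbar_jm jm_scaleR) simp

lemma driver_growth:
  assumes "r \<in> {0..T}"
  shows "\<bar>driver X' Y' Z' r w\<bar>
    \<le> K * (1 + L + deriv_bound * L + norm (X' r w) + \<bar>Y' r w\<bar> + norm (Z' r w))"
proof -
  have "\<bar>driver X' Y' Z' r w\<bar> \<le> K * (1 + norm (X' r w) + \<bar>u r (X' r w) + \<alpha> * Y' r w\<bar> + norm (zbar X' r w + \<alpha> *\<^sub>R Z' r w))"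
    unfolding driver_def by (rule f_growth[OF assms])
  also have "... \<le> K * (1 + norm (X' r w) + (L + \<bar>Y' r w\<bar>) + (deriv_bound * L + norm (Z' r w)))"
  proof (intro mult_left_mono add_mono order_refl)
    have "\<bar>\<alpha> * Y' r w\<bar> \<le> \<bar>Y' r w\<bar>" using alpha by (simp add: abs_mult mult_left_le_one_le)
    then show "\<bar>u r (X' r w) + \<alpha> * Y' r w\<bar> \<le> L + \<bar>Y' r w\<bar>" using u_bound[OF assms, of "X' r w"] by linarith
    have "norm (\<alpha> *\<^sub>R Z' r w) \<le> norm (Z' r w)" using alpha by (simp add: mult_left_le_one_le)
    then show "norm (zbar X' r w + \<alpha> *\<^sub>R Z' r w) \<le> deriv_bound * L + norm (Z' r w)"
      using zbar_bound[OF assms, of X' w] norm_triangle_ineq[of "zbar X' r w" "\<alpha> *\<^sub>R Z' r w"] by linarith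
  qed (use K in auto)
  finally show ?thesis by (simp add: algebra_simps)
qed

lemma driver_integral:
  assumes "t \<le> T"
  shows "(LBINT s:{0..t}. f s (X' s w) (u s (X' s w) + \<alpha> * Y' s w) (linear_Z \<sigma> \<epsilon> u s (X' s w) + \<alpha> *\<^sub>R Z' s w))
    = (LBINT s:{0..t}. driver X' Y' Z' s w)"
  unfolding set_lebesgue_integral_def
  by (rule integral_discrete_difference[of "{T}"]) (use assms in \<open>auto simp: driver_def zbar_def indicator_def\<close>)

lemma square_integrable_psq:
  assumes "square_integrable_process M F 0 T H"
  shows "jm 0 T H" "psq 0 T H < top"
proof -
  show j: "jm 0 T H" using assms T_pos by (intro progressive_jm) (auto simp: square_integrable_process_def)
  show "psq 0 T H < top" using assms by (simp add: psq_eq_iterated[OF j] square_integrable_process_def)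
qed

lemma psq_dominated_finite:
  fixes H P Q R :: "real \<Rightarrow> 'w \<Rightarrow> real"
  assumes "\<And>r w. r \<in> {0..T} \<Longrightarrow> w \<in> space M \<Longrightarrow> \<bar>H r w\<bar> \<le> b + \<bar>P r w\<bar> + \<bar>Q r w\<bar> + \<bar>R r w\<bar>"
    and P: "jm 0 T P" "psq 0 T P < top" and Q: "jm 0 T Q" "psq 0 T Q < top" and R: "jm 0 T R" "psq 0 T R < top"
    and b: "b \<ge> 0"
  shows "psq 0 T H < top"
proof -
  have a: "jm 0 T (\<lambda>r w. \<bar>V r w\<bar>)" "psq 0 T (\<lambda>r w. \<bar>V r w\<bar>) < top" if "jm 0 T V" "psq 0 T V < top" for V :: "real \<Rightarrow> 'w \<Rightarrow> real"
    using jm_comp[OF that(1), of abs] that(2) psq_mono[of 0 T "\<lambda>r w. \<bar>V r w\<bar>" V] by (auto intro: le_less_trans)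
  have "psq 0 T (\<lambda>r w. b + \<bar>P r w\<bar> + \<bar>Q r w\<bar> + \<bar>R r w\<bar>) < top"
    by (intro psq_add_finite jm_add a P Q R jm_const psq_bounded_finite[where B = "\<bar>b\<bar>"]) (use T_pos in auto)
  then show ?thesis
    by (rule le_less_trans[OF psq_mono, rotated]) (use assms(1) b in \<open>auto intro: order_trans[OF assms(1) abs_ge_self]\<close>)
qed

end

text \<open>Finiteness of \<open>S\<close> is what allows the half to be moved to the left.\<close>

lemma ennreal_absorb_half:
  fixes S B :: ennreal
  assumes "S \<le> B + ennreal (1/2) * S" "S < top"
  shows "S \<le> 2 * B"
proof (cases B)
  case (real b)
  obtain s where s: "S = ennreal s" "s \<ge> 0" using assms(2) by (cases S) auto
  have "ennreal s \<le> ennreal b + ennreal (1/2 * s)"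
    using assms(1) unfolding real s by (simp only: ennreal_mult'[of "1/2" s, symmetric])
  also have "... = ennreal (b + 1/2 * s)" using real s by (simp add: ennreal_plus)
  finally have "ennreal s \<le> ennreal (b + 1/2 * s)" .
  then have "s \<le> b + 1/2 * s" using real s by (subst (asm) ennreal_le_iff) auto
  then show ?thesis using real s by (simp add: numeral_mult_ennreal' ennreal_leI)
qed (simp add: ennreal_mult_top)

text \<open>A backward Gronwall argument on windows of length \<tau>. As a window is no longer than
  1, the supremum \<open>S\<close> over it is at most \<open>2 * d t\<close> plus half of
  \<open>A + S\<close>, and it is finite by \<open>bounded\<close>; absorbing \<open>S\<close> costs
  a factor 4 per window.\<close>

lemma backward_iteration:
  fixes d :: "real \<Rightarrow> ennreal"
  assumes step: "\<And>s t. 0 \<le> s \<Longrightarrow> s \<le> t \<Longrightarrow> t \<le> T \<Longrightarrow> t - s \<le> \<tau> \<Longrightarrow>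
      d s \<le> 2 * d t + ennreal (1/2) * (A + (\<integral>\<^sup>+r\<in>{s..t}. d r \<partial>lborel))"
    and bounded: "\<And>t. t \<in> {0..T} \<Longrightarrow> d t \<le> ennreal M0" and \<tau>: "0 < \<tau>" "\<tau> \<le> 1" and T: "T > 0"
  shows "d 0 \<le> 4 ^ nat \<lceil>T / \<tau>\<rceil> * (d T + A)"
proof -
  have short: "d s \<le> 4 * d t + A" if st: "0 \<le> s" "s \<le> t" "t \<le> T" "t - s \<le> \<tau>" for s t
  proof -
    define S where "S = (SUP r\<in>{s..t}. d r)"
    have up: "d r \<le> S" if "r \<in> {s..t}" for r unfolding S_def by (rule SUP_upper[OF that])
    have "S \<le> ennreal M0" unfolding S_def by (rule SUP_least) (use st bounded in auto)
    then have fin: "S < top" by (rule le_less_trans) simp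
    have "S \<le> (2 * d t + ennreal (1/2) * A) + ennreal (1/2) * S"
      unfolding S_def
    proof (rule SUP_least)
      fix r assume r: "r \<in> {s..t}"
      have "(\<integral>\<^sup>+q\<in>{r..t}. d q \<partial>lborel) \<le> (\<integral>\<^sup>+q\<in>{r..t}. S \<partial>lborel)"
        by (intro nn_integral_mono) (use up r in \<open>auto simp: indicator_def\<close>)
      also have "... = S * ennreal (t - r)" using r by (simp add: nn_integral_cmult_indicator)
      also have "... \<le> S * 1" using r st \<tau> by (intro mult_left_mono) (auto simp: ennreal_le_1)
      finally have "(\<integral>\<^sup>+q\<in>{r..t}. d q \<partial>lborel) \<le> S" by simp
      then have "2 * d t + ennreal (1/2) * (A + (\<integral>\<^sup>+q\<in>{r..t}. d q \<partial>lborel)) \<le> 2 * d t + ennreal (1/2) * (A + S)"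
        by (intro add_left_mono mult_left_mono) auto
      with step[of r t] r st show "d r \<le> (2 * d t + ennreal (1/2) * A) + ennreal (1/2) * (SUP r\<in>{s..t}. d r)"
        unfolding S_def by (auto simp: distrib_left add.assoc intro: order_trans)
    qed
    from ennreal_absorb_half[OF this fin] have "S \<le> 2 * (2 * d t + ennreal (1/2) * A)" .
    also have "... = 4 * d t + (2 * ennreal (1/2)) * A"
      unfolding distrib_left mult.assoc[symmetric] by simp
    also have "2 * ennreal (1/2) = 1" unfolding numeral_mult_ennreal' by simp
    finally have "S \<le> 4 * d t + A" by simp
    with up[of s] st show ?thesis by (auto intro: order_trans)
  qed
  \<comment> \<open>With \<open>A\<close> added on the left, one window multiplies the whole
    quantity by 4, so the windows compose.\<close>
  have iter: "d s + A \<le> 4 ^ k * (d T + A)" if "0 \<le> s" "s \<le> T" "T - s \<le> real k * \<tau>" for s k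
    using that
  proof (induction k arbitrary: s)
    case 0
    then show ?case by simp
  next
    case (Suc k)
    define t where "t = min T (s + \<tau>)"
    have t: "s \<le> t" "t \<le> T" "t - s \<le> \<tau>" "T - t \<le> real k * \<tau>" "0 \<le> t"
      using Suc.prems \<tau> by (auto simp: t_def algebra_simps min_def)
    have "d s + A \<le> (4 * d t + A) + A" by (intro add_right_mono short Suc.prems t)
    also have "... = 4 * d t + 2 * A" by (simp add: add.assoc mult_2)
    also have "... \<le> 4 * d t + 4 * A" by (intro add_left_mono mult_right_mono) auto
    also have "... = 4 * (d t + A)" by (simp add: distrib_left)
    also have "... \<le> 4 * (4 ^ k * (d T + A))" by (intro mult_left_mono Suc.IH t) auto
    finally show ?case by (simp add: mult.assoc)
  qed
  have "T / \<tau> \<le> real (nat \<lceil>T / \<tau>\<rceil>)" by (rule real_nat_ceiling_ge)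
  then have "T \<le> real (nat \<lceil>T / \<tau>\<rceil>) * \<tau>" using \<tau> by (simp add: pos_divide_le_eq)
  from iter[of 0 "nat \<lceil>T / \<tau>\<rceil>"] this T have "d 0 + A \<le> 4 ^ nat \<lceil>T / \<tau>\<rceil> * (d T + A)" by simp
  then show ?thesis by (rule order_trans[rotated]) simp
qed

context bsde_setting
begin

text \<open>Neither integrability of the driver nor square integrability of \<open>Y2\<close> is
  part of \<open>controlled_process\<close>. Both come from the growth of \<open>f\<close>: almost
  surely \<open>c = Y2 + q\<close> no longer contains the driver, so the driver is bounded by
  \<beta> plus \<open>K\<close> times the modulus of its own running integral \<open>q\<close>, and
  \<open>integral_equation_path\<close> applies path by path.\<close>

lemma controlled_apriori:
  assumes Xb: "jm 0 T Xb" "psq 0 T Xb < top"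
    and y0: "y0 \<in> borel_measurable M" "sqn M y0 < top"
    and I: "ito_integral M F W 0 T Z2 I" and Y2: "jm 0 T Y2"
    and eq: "AE w in M. \<forall>t\<in>{0..T}. Y2 t w = y0 w - (LBINT s:{0..t}. driver Xb Y2 Z2 s w) + I t w"
  shows "psq 0 T Y2 < top"
    and "AE w in M. set_integrable lborel {0..T} (\<lambda>s. driver Xb Y2 Z2 s w)"
proof -
  define G where "G = driver Xb Y2 Z2"
  define q where "q t w = (LBINT s:{0..t}. G s w)" for t w
  define c where "c t w = Y2 t w + q t w" for t w
  have sqZ: "square_integrable_process M F 0 T Z2" using I by (simp add: ito_integral_def)
  note Z2 = square_integrable_psq[OF sqZ]
  have jG: "jm 0 T G" unfolding G_def by (rule driver_jm[OF Xb(1) Y2 Z2(1)])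
  have jq: "jm 0 T q" unfolding q_def[abs_def] by (rule jm_running_integral[OF jG])
  have jc: "jm 0 T c" unfolding c_def[abs_def] by (rule jm_add[OF Y2 jq])
  have sc: "sqn M (c t) \<le> 2 * sqn M y0 + 2 * psq 0 T Z2" if t: "t \<in> {0..T}" for t
  proof -
    have p: "ito_pair 0 t Z2 (\<lambda>w. I t w - I 0 w)"
      by (rule ito_integral_imp_ito_pair[OF I]) (use t in auto)
    have "sqn M (c t) = sqn M (\<lambda>w. y0 w + (I t w - I 0 w))"
    proof (rule sqn_cong_AE)
      show "AE w in M. c t w = y0 w + (I t w - I 0 w)"
        using eq ito_integral_start[OF I] T_pos t by (auto simp: c_def q_def G_def)
    qed
    also have "... \<le> 2 * sqn M y0 + 2 * sqn M (\<lambda>w. I t w - I 0 w)"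
      by (rule sqn_add_le[OF y0(1) ito_pair_measurable[OF p]])
    also have "sqn M (\<lambda>w. I t w - I 0 w) = psq 0 t Z2" by (rule ito_pair_isometry[OF p]) (use t in auto)
    also have "2 * sqn M y0 + 2 * psq 0 t Z2 \<le> 2 * sqn M y0 + 2 * psq 0 T Z2"
      by (intro add_left_mono mult_left_mono psq_interval_mono Z2) (use t in auto)
    finally show ?thesis .
  qed
  have "psq 0 T c \<le> ennreal (T - 0) * (2 * sqn M y0 + 2 * psq 0 T Z2)"
    by (rule psq_le[OF jc _ sc]) (use T_pos in auto)
  also have "... < top" using y0(2) Z2(2) by (simp add: ennreal_mult_less_top)
  finally have pc: "psq 0 T c < top" .
  define b where "b = K * (1 + L + deriv_bound * L)"
  define \<beta> where "\<beta> r w = b + \<bar>K * norm (Xb r w)\<bar> + \<bar>K * norm (Z2 r w)\<bar> + \<bar>K * c r w\<bar>" for r w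
  have b0: "b \<ge> 0" using K L0 deriv_bound_nonneg by (simp add: b_def)
  have kn: "jm 0 T (\<lambda>r w. K * norm (V r w))" "psq 0 T (\<lambda>r w. K * norm (V r w)) < top"
    if V: "jm 0 T V" "psq 0 T V < top" for V :: "real \<Rightarrow> 'w \<Rightarrow> real ^ 'd"
  proof -
    have j: "jm 0 T (\<lambda>r w. norm (V r w))" by (rule jm_comp[OF V(1)]) simp
    have p: "psq 0 T (\<lambda>r w. norm (V r w)) < top" using V(2) by (simp add: psq_def)
    show "jm 0 T (\<lambda>r w. K * norm (V r w))" using jm_scaleR[OF j, of K] by simp
    show "psq 0 T (\<lambda>r w. K * norm (V r w)) < top" using psq_scale_finite[OF j p, of K] by simp
  qed
  have kc: "jm 0 T (\<lambda>r w. K * c r w)" "psq 0 T (\<lambda>r w. K * c r w) < top"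
    using jm_scaleR[OF jc, of K] psq_scale_finite[OF jc pc, of K] by simp_all
  have ja: "jm 0 T (\<lambda>r w. \<bar>V r w\<bar>)" if "jm 0 T V" for V :: "real \<Rightarrow> 'w \<Rightarrow> real"
    by (rule jm_comp[OF that]) simp
  have j\<beta>: "jm 0 T \<beta>" unfolding \<beta>_def[abs_def]
    by (intro jm_add ja kn(1) kc(1) Xb Z2 jm_const) simp
  have p\<beta>: "psq 0 T \<beta> < top"
    by (rule psq_dominated_finite[OF _ kn[OF Xb] kn[OF Z2] kc b0]) (use b0 in \<open>simp add: \<beta>_def\<close>)
  define C where "C = 2 * exp (2 * K * T)"
  have path: "AE w in M. set_integrable lborel {0..T} (\<lambda>s. G s w) \<and>
      (\<forall>t\<in>{0..T}. \<bar>q t w\<bar> \<le> C * (LBINT s:{0..T}. \<beta> s w))"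
  proof (rule AE_mp[OF psq_finite_path[OF j\<beta> p\<beta>]], intro AE_I2 impI)
    fix w assume w: "w \<in> space M" and int: "set_integrable lborel {0..T} (\<lambda>s. \<beta> s w)"
    have bd: "\<bar>G s w\<bar> \<le> \<beta> s w + K * \<bar>LBINT r:{0..s}. G r w\<bar>" if s: "s \<in> {0..T}" for s
    proof -
      have "\<bar>Y2 s w\<bar> \<le> \<bar>c s w\<bar> + \<bar>q s w\<bar>" by (simp add: c_def)
      then have "K * \<bar>Y2 s w\<bar> \<le> K * (\<bar>c s w\<bar> + \<bar>q s w\<bar>)" using K by (intro mult_left_mono) auto
      with driver_growth[OF s, of Xb Y2 Z2 w] K show ?thesis
        by (simp add: G_def[symmetric] \<beta>_def b_def q_def[symmetric] abs_mult distrib_left)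
    qed
    have pos: "\<beta> s w \<ge> 0" for s using b0 by (simp add: \<beta>_def)
    note * = integral_equation_path[where F = "\<lambda>s. G s w" and \<beta> = "\<lambda>s. \<beta> s w", OF jm_path[OF jG w]
        jm_path[OF jq w, unfolded q_def] bd int pos K T_pos]
    show "set_integrable lborel {0..T} (\<lambda>s. G s w) \<and> (\<forall>t\<in>{0..T}. \<bar>q t w\<bar> \<le> C * (LBINT s:{0..T}. \<beta> s w))"
      using *(1) *(2) unfolding q_def C_def by blast
  qed
  then show "AE w in M. set_integrable lborel {0..T} (\<lambda>s. driver Xb Y2 Z2 s w)"
    by (auto simp: G_def)
  have sq: "sqn M (q t) \<le> ennreal (C\<^sup>2) * (ennreal (T - 0) * psq 0 T \<beta>)" if t: "t \<in> {0..T}" for t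
  proof -
    have m: "(\<lambda>w. LBINT s:{0..T}. \<beta> s w) \<in> borel_measurable M" by (rule measurable_time_integral[OF j\<beta>])
    have "AE w in M. norm (q t w) \<le> norm (C *\<^sub>R (LBINT s:{0..T}. \<beta> s w))"
      using path by eventually_elim (use t in fastforce)
    then have "sqn M (q t) \<le> sqn M (\<lambda>w. C *\<^sub>R (LBINT s:{0..T}. \<beta> s w))" by (rule sqn_mono_AE)
    also have "... = ennreal (C\<^sup>2) * sqn M (\<lambda>w. LBINT s:{0..T}. \<beta> s w)" by (rule sqn_scale[OF m])
    also have "... \<le> ennreal (C\<^sup>2) * (ennreal (T - 0) * psq 0 T \<beta>)"
      by (intro mult_left_mono sqn_time_integral_le[OF j\<beta>]) (use T_pos in auto)
    finally show ?thesis .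
  qed
  have "psq 0 T q \<le> ennreal (T - 0) * (ennreal (C\<^sup>2) * (ennreal (T - 0) * psq 0 T \<beta>))"
    by (rule psq_le[OF jq _ sq]) (use T_pos in auto)
  also have "... < top" using p\<beta> by (simp add: ennreal_mult_less_top)
  finally have pq: "psq 0 T q < top" .
  have "psq 0 T Y2 = psq 0 T (\<lambda>r w. c r w - q r w)" by (intro psq_cong) (simp add: c_def)
  also have "... < top" by (rule psq_diff_finite[OF jc jq pc pq])
  finally show "psq 0 T Y2 < top" .
qed

end

lemma (in diffusion_setting) drift_diffusion_psq_finite:
  assumes X: "has_drift_diffusion X m H"
  shows "psq 0 T X < top"
proof -
  obtain I where I: "ito_integral_matrix M F W 0 T H I"
    "AE w in M. \<forall>t\<in>{0..T}. X t w = \<xi> w + (LBINT r:{0..t}. m r w) + I t w"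
    using X unfolding has_drift_diffusion_def by auto
  have "sqn M \<xi> < top" using xi_square xi_measurable by (simp add: sqn_finite_iff_integrable)
  have "psq 0 T X \<le> ennreal (T - 0) * (2 * sqn M \<xi> + ennreal (4 * L\<^sup>2 * (T + 1) * T))"
    by (rule psq_le[OF dd_jm[OF X I] _ dd_sqn_bounded[OF X I]]) (use T_pos in auto)
  also have "... < top" using \<open>sqn M \<xi> < top\<close> by (simp add: ennreal_mult_less_top)
  finally show ?thesis .
qed

context bsde_setting
begin

text \<open>Adds the Lipschitz constants in x of the arguments of \<open>f\<close>: 1 for x itself,
  \<open>deriv_bound\<close> for \<open>u\<close>, and \<open>2 * deriv_bound * L\<close> for
  \<open>linear_Z\<close>. The number 16 in \<open>step_size\<close> makes
  \<open>2 * step_size * (4 * K\<^sup>2)\<close> at most one half, as the absorption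
  requires.\<close>

definition gap_const :: real where "gap_const = 1 + deriv_bound + 2 * deriv_bound * L"

definition step_size :: real where "step_size = min 1 (1 / (16 * K\<^sup>2))"

lemma step_size: "0 < step_size" "step_size \<le> 1" "2 * step_size * (4 * K\<^sup>2) \<le> 1/2"
proof -
  have "step_size \<le> 1 / (16 * K\<^sup>2)" by (simp add: step_size_def)
  then have "step_size * (16 * K\<^sup>2) \<le> 1" using K by (simp add: pos_le_divide_eq)
  then show "2 * step_size * (4 * K\<^sup>2) \<le> 1/2" by simp
  show "0 < step_size" "step_size \<le> 1" using K by (simp_all add: step_size_def)
qed

text \<open>The arguments of \<open>f\<close> differ by \<alpha> times the scaled differences
  \<open>Dv\<close> and \<open>Zv\<close>, plus errors from \<open>X - Xb\<close>. Bounding \<alpha>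
  by 1 leaves an estimate in the scaled quantities with a constant free of \<alpha>.\<close>

lemma driver_gap:
  assumes r: "r \<in> {0..T}"
  shows "\<bar>f r (X r w) y z - driver Xb Y2 Z2 r w\<bar> \<le> K * gap_const * norm (X r w - Xb r w)
    + K * \<bar>(1 / \<alpha>) * (y - uval r w) - Y2 r w\<bar> + K * norm ((1 / \<alpha>) *\<^sub>R (z - integrand r w) - Z2 r w)"
proof -
  define Dv where "Dv = (1 / \<alpha>) * (y - uval r w) - Y2 r w"
  define Zv where "Zv = (1 / \<alpha>) *\<^sub>R (z - integrand r w) - Z2 r w"
  define n where "n = norm (X r w - Xb r w)"
  have a: "0 < \<alpha>" "\<alpha> < 1" using alpha by auto
  have y: "y - (u r (Xb r w) + \<alpha> * Y2 r w) = \<alpha> * Dv + (u r (X r w) - u r (Xb r w))"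
    using a by (simp add: Dv_def uval_def field_simps)
  have z: "z - (zbar Xb r w + \<alpha> *\<^sub>R Z2 r w) = \<alpha> *\<^sub>R Zv + (integrand r w - zbar Xb r w)"
    using a by (simp add: Zv_def algebra_simps)
  have "\<bar>\<alpha> * Dv\<bar> \<le> \<bar>Dv\<bar>" using a by (simp add: abs_mult mult_left_le_one_le)
  then have ya: "\<bar>y - (u r (Xb r w) + \<alpha> * Y2 r w)\<bar> \<le> \<bar>Dv\<bar> + deriv_bound * n"
    unfolding y using u_lipschitz[OF r, of "X r w" "Xb r w"] by (simp add: n_def)
  have "norm (integrand r w - zbar Xb r w) \<le> 2 * deriv_bound * L * n"
    using linear_Z_lipschitz[of r "X r w" "Xb r w"] r deriv_bound_nonneg L0
    by (auto simp: integrand_def zbar_def n_def)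
  moreover have "norm (\<alpha> *\<^sub>R Zv) \<le> norm Zv" using a by (simp add: mult_left_le_one_le)
  ultimately have za: "norm (z - (zbar Xb r w + \<alpha> *\<^sub>R Z2 r w)) \<le> norm Zv + 2 * deriv_bound * L * n"
    unfolding z using norm_triangle_ineq[of "\<alpha> *\<^sub>R Zv" "integrand r w - zbar Xb r w"] by linarith
  have "\<bar>f r (X r w) y z - driver Xb Y2 Z2 r w\<bar>
    \<le> K * (norm (X r w - Xb r w) + \<bar>y - (u r (Xb r w) + \<alpha> * Y2 r w)\<bar> + norm (z - (zbar Xb r w + \<alpha> *\<^sub>R Z2 r w)))"
    unfolding driver_def by (rule f_lip[OF r])
  also have "... \<le> K * (n + (\<bar>Dv\<bar> + deriv_bound * n) + (norm Zv + 2 * deriv_bound * L * n))"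
    using ya za K by (intro mult_left_mono add_mono) (auto simp: n_def)
  finally show ?thesis by (simp add: Dv_def Zv_def n_def gap_const_def algebra_simps)
qed

section \<open>The energy estimate for the difference\<close>

context
  fixes Y :: "real \<Rightarrow> 'w \<Rightarrow> real" and Z :: "real \<Rightarrow> 'w \<Rightarrow> real ^ 'd" and IY :: "real \<Rightarrow> 'w \<Rightarrow> real"
    and Xb :: "real \<Rightarrow> 'w \<Rightarrow> real ^ 'd" and Y2 :: "real \<Rightarrow> 'w \<Rightarrow> real" and Z2 :: "real \<Rightarrow> 'w \<Rightarrow> real ^ 'd"
    and I2 :: "real \<Rightarrow> 'w \<Rightarrow> real" and y0 :: "'w \<Rightarrow> real" and E :: real
  assumes Y: "square_integrable_process M F 0 T Y" and IY: "ito_integral M F W 0 T Z IY"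
    and eqY: "AE w in M. \<forall>t\<in>{0..T}. Y t w = g (X T w)
        + (LBINT s:{t..T}. \<alpha> * f s (X s w) (Y s w) (Z s w)) - (IY T w - IY t w)"
    and Xb: "jm 0 T Xb" "psq 0 T Xb < top"
    and Xerr: "\<And>t. t \<in> {0..T} \<Longrightarrow> sqn M (\<lambda>w. X t w - Xb t w) \<le> ennreal E" and E: "E \<ge> 0"
    and y0: "y0 \<in> borel_measurable M" "sqn M y0 < top"
    and I2: "ito_integral M F W 0 T Z2 I2" and Y2: "progressive F 0 T Y2"
    and eq2: "AE w in M. \<forall>t\<in>{0..T}. Y2 t w = y0 w - (LBINT s:{0..t}. driver Xb Y2 Z2 s w) + I2 t w"
    and fin: "sqn M (Y2 T) < top"
begin

definition "D t w = (1 / \<alpha>) * (Y t w - uval t w) - Y2 t w"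
definition "\<zeta> t w = (1 / \<alpha>) *\<^sub>R (Z t w - integrand t w) - Z2 t w"
definition "\<delta> t w = f t (X t w) (Y t w) (Z t w) - driver Xb Y2 Z2 t w"

lemma jms: "jm 0 T Y" "jm 0 T Z" "jm 0 T Y2" "jm 0 T Z2" "jm 0 T uval"
  and psqs: "psq 0 T Y < top" "psq 0 T Z < top" "psq 0 T Z2 < top"
proof -
  have "square_integrable_process M F 0 T Z" "square_integrable_process M F 0 T Z2"
    using IY I2 by (auto simp: ito_integral_def)
  from Y this[THEN square_integrable_psq(1)] this[THEN square_integrable_psq(2)]
  show "jm 0 T Y" "jm 0 T Z" "jm 0 T Z2" "psq 0 T Y < top" "psq 0 T Z < top" "psq 0 T Z2 < top"
    by (auto intro: square_integrable_psq)
  show "jm 0 T Y2" using Y2 T_pos by (intro progressive_jm) auto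
  show "jm 0 T uval" unfolding uval_def[abs_def] by (rule u_path_jm[OF X_jm])
qed

lemma psq_Y2: "psq 0 T Y2 < top"
  and driver2_integrable: "AE w in M. set_integrable lborel {0..T} (\<lambda>s. driver Xb Y2 Z2 s w)"
  using controlled_apriori[OF Xb y0 I2 jms(3) eq2] by auto

lemma jm_D: "jm 0 T D" and jm_\<zeta>: "jm 0 T \<zeta>" and jm_\<delta>: "jm 0 T \<delta>"
  and psq_D: "psq 0 T D < top" and psq_\<zeta>: "psq 0 T \<zeta> < top"
proof -
  have pu: "psq 0 T uval < top" by (rule psq_bounded_finite[where B = L]) (use T_pos u_bound in \<open>auto simp: uval_def\<close>)
  have pi: "psq 0 T integrand < top"
    by (rule psq_bounded_finite[where B = "deriv_bound * L"]) (use T_pos integrand_bound in auto)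
  note d = jm_diff[OF jms(1) jms(5)] psq_diff_finite[OF jms(1) jms(5) psqs(1) pu]
  have d': "jm 0 T (\<lambda>r w. (1 / \<alpha>) * (Y r w - uval r w))" "psq 0 T (\<lambda>r w. (1 / \<alpha>) * (Y r w - uval r w)) < top"
    using jm_scaleR[OF d(1), of "1 / \<alpha>"] psq_scale_finite[OF d, of "1 / \<alpha>"] by simp_all
  show "jm 0 T D" "psq 0 T D < top" unfolding D_def[abs_def]
    by (rule jm_diff[OF d'(1) jms(3)], rule psq_diff_finite[OF d'(1) jms(3) d'(2) psq_Y2])
  note e = jm_diff[OF jms(2) integrand_jm] psq_diff_finite[OF jms(2) integrand_jm psqs(2) pi]
  show "jm 0 T \<zeta>" "psq 0 T \<zeta> < top" unfolding \<zeta>_def[abs_def]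
    by (rule jm_diff[OF jm_scaleR[OF e(1)] jms(4)],
        rule psq_diff_finite[OF jm_scaleR[OF e(1)] jms(4) psq_scale_finite[OF e] psqs(3)])
  show "jm 0 T \<delta>" unfolding \<delta>_def[abs_def]
    by (intro jm_diff jm_driver X_jm driver_jm jms Xb)
qed

lemma psq_error:
  assumes st: "0 \<le> s" "s \<le> t" "t \<le> T"
  shows "psq s t (\<lambda>r w. X r w - Xb r w) \<le> ennreal (t - s) * ennreal E"
  by (rule psq_le[OF jm_sub[OF jm_diff[OF X_jm Xb(1)]]]) (use st Xerr in auto)

lemma psq_\<delta>:
  assumes st: "0 \<le> s" "s \<le> t" "t \<le> T"
  shows "psq s t \<delta> \<le> ennreal (4 * K\<^sup>2) * (ennreal (gap_const\<^sup>2 * E * (t - s)) + psq s t D + psq s t \<zeta>)"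
proof -
  define a where "a r w = (K * gap_const) *\<^sub>R norm (X r w - Xb r w)" for r w
  define b where "b r w = K *\<^sub>R \<bar>D r w\<bar>" for r w
  define c where "c r w = K *\<^sub>R norm (\<zeta> r w)" for r w
  have sub: "jm s t H" if "jm 0 T H" for H :: "real \<Rightarrow> 'w \<Rightarrow> 'x::topological_space" by (rule jm_sub[OF that]) (use st in auto)
  have jx: "jm s t (\<lambda>r w. X r w - Xb r w)" by (rule sub[OF jm_diff[OF X_jm Xb(1)]])
  have j1: "jm s t (\<lambda>r w. norm (X r w - Xb r w))" by (rule jm_comp[OF jx borel_measurable_norm])
  have j2: "jm s t (\<lambda>r w. \<bar>D r w\<bar>)" by (rule jm_comp[OF sub[OF jm_D]]) simp
  have j3: "jm s t (\<lambda>r w. norm (\<zeta> r w))" by (rule jm_comp[OF sub[OF jm_\<zeta>] borel_measurable_norm])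
  have p1: "psq s t a = ennreal ((K * gap_const)\<^sup>2) * psq s t (\<lambda>r w. X r w - Xb r w)"
    unfolding psq_def a_def sqn_scale[OF jmD[OF j1]] by simp
  have p2: "psq s t b = ennreal (K\<^sup>2) * psq s t D"
    unfolding psq_def b_def sqn_scale[OF jmD[OF j2]] by (simp add: real_norm_def[symmetric] del: real_norm_def)
  have p3: "psq s t c = ennreal (K\<^sup>2) * psq s t \<zeta>"
    unfolding psq_def c_def sqn_scale[OF jmD[OF j3]] by simp
  have ja: "jm s t a" "jm s t b" "jm s t c"
    unfolding a_def[abs_def] b_def[abs_def] c_def[abs_def] by (rule jm_scaleR[OF j1], rule jm_scaleR[OF j2], rule jm_scaleR[OF j3])
  have "psq s t \<delta> \<le> psq s t (\<lambda>r w. a r w + b r w + c r w)"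
  proof (rule psq_mono)
    fix r w assume r: "r \<in> {s..t}"
    have "\<bar>\<delta> r w\<bar> \<le> a r w + b r w + c r w"
      using driver_gap[of r w "Y r w" "Z r w" Xb Y2 Z2] r st
      by (simp add: \<delta>_def a_def b_def c_def D_def \<zeta>_def)
    then show "norm (\<delta> r w) \<le> norm (a r w + b r w + c r w)" by simp
  qed
  also have "... \<le> 4 * psq s t a + 4 * psq s t b + 4 * psq s t c"
    unfolding psq_def by (rule sqn_add3_le[OF jmD[OF ja(1)] jmD[OF ja(2)] jmD[OF ja(3)]])
  also have "psq s t a \<le> ennreal ((K * gap_const)\<^sup>2) * (ennreal (t - s) * ennreal E)"
    unfolding p1 by (intro mult_left_mono psq_error st) simp
  also have "ennreal ((K * gap_const)\<^sup>2) * (ennreal (t - s) * ennreal E) = ennreal (K\<^sup>2) * ennreal (gap_const\<^sup>2 * E * (t - s))"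
    using st E by (simp add: ennreal_mult'[symmetric] power_mult_distrib mult_ac)
  finally have "psq s t \<delta> \<le> 4 * (ennreal (K\<^sup>2) * ennreal (gap_const\<^sup>2 * E * (t - s))) + 4 * psq s t b + 4 * psq s t c"
    by (simp add: add_right_mono mult_left_mono)
  also have "... = 4 * (ennreal (K\<^sup>2) * (ennreal (gap_const\<^sup>2 * E * (t - s)) + psq s t D + psq s t \<zeta>))"
    unfolding p2 p3 by (simp only: distrib_left)
  also have "... = ennreal (4 * K\<^sup>2) * (ennreal (gap_const\<^sup>2 * E * (t - s)) + psq s t D + psq s t \<zeta>)"
    unfolding mult.assoc[symmetric] numeral_mult_ennreal' ..
  finally show ?thesis .
qed

lemma \<delta>_finite: "psq 0 T \<delta> < top"
proof -
  have "psq 0 T \<delta> \<le> ennreal (4 * K\<^sup>2) * (ennreal (gap_const\<^sup>2 * E * (T - 0)) + psq 0 T D + psq 0 T \<zeta>)"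
    by (rule psq_\<delta>) (use T_pos in auto)
  also have "... < top" using psq_D psq_\<zeta> by (simp add: ennreal_mult_less_top)
  finally show ?thesis .
qed

text \<open>Division by \<alpha> removes the factor in front of \<open>f\<close>, and
  \<open>representation\<close> turns the increment of \<open>uval\<close> into a stochastic
  integral, so that the three integrals combine to that of \<zeta>.\<close>

lemma increment:
  assumes st: "0 \<le> s" "s < t" "t \<le> T"
  shows "\<exists>J. ito_pair s t \<zeta> J \<and> (AE w in M. D s w + J w = D t w + (LBINT r:{s..t}. \<delta> r w))"
proof -
  define J where "J w = (1 / \<alpha>) * ((IY t w - IY s w) - (uval t w - uval s w)) - (I2 t w - I2 s w)" for w
  have a: "0 < \<alpha>" using alpha by auto
  have pY: "ito_pair s t Z (\<lambda>w. IY t w - IY s w)" by (rule ito_integral_imp_ito_pair[OF IY]) (use st in auto)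
  have p2: "ito_pair s t Z2 (\<lambda>w. I2 t w - I2 s w)" by (rule ito_integral_imp_ito_pair[OF I2]) (use st in auto)
  have "ito_pair s t \<zeta> J"
    unfolding \<zeta>_def[abs_def] J_def[abs_def]
    by (rule ito_pair_diff[OF ito_pair_scale[OF ito_pair_diff[OF pY representation[OF st] st(1,3)] st(1,3)] p2 st(1,3)])
  moreover have "AE w in M. D s w + J w = D t w + (LBINT r:{s..t}. \<delta> r w)"
    using eqY eq2 driver2_integrable psq_finite_path[OF jm_\<delta> \<delta>_finite]
  proof eventually_elim
    fix w
    assume Yeq: "\<forall>t\<in>{0..T}. Y t w = g (X T w)
        + (LBINT s:{t..T}. \<alpha> * f s (X s w) (Y s w) (Z s w)) - (IY T w - IY t w)"
      and Y2eq: "\<forall>t\<in>{0..T}. Y2 t w = y0 w - (LBINT s:{0..t}. driver Xb Y2 Z2 s w) + I2 t w"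
      and i2: "set_integrable lborel {0..T} (\<lambda>s. driver Xb Y2 Z2 s w)"
      and id: "set_integrable lborel {0..T} (\<lambda>s. \<delta> s w)"
    define FY where "FY r = f r (X r w) (Y r w) (Z r w)" for r
    \<comment> \<open>Integrability of \<open>f\<close> along the forward process is inherited from
      \<delta>, which is known in L2, and from the controlled driver.\<close>
    have iY: "set_integrable lborel {0..T} FY"
      using set_integral_add(1)[OF id i2] by (simp add: \<delta>_def FY_def[abs_def])
    have sub: "set_integrable lborel {p..q} h" if "set_integrable lborel {0..T} h" "0 \<le> p" "q \<le> T" for p q and h :: "real \<Rightarrow> real"
      by (rule set_integrable_subset[OF that(1)]) (use that in auto)
    have 1: "(LBINT r:{s..T}. FY r) = (LBINT r:{s..t}. FY r) + (LBINT r:{t..T}. FY r)"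
      by (rule set_integral_split_interval) (use st in \<open>auto intro: sub iY\<close>)
    have 2: "(LBINT r:{0..t}. driver Xb Y2 Z2 r w) = (LBINT r:{0..s}. driver Xb Y2 Z2 r w) + (LBINT r:{s..t}. driver Xb Y2 Z2 r w)"
      by (rule set_integral_split_interval) (use st in \<open>auto intro: sub i2\<close>)
    have 3: "(LBINT r:{s..t}. \<delta> r w) = (LBINT r:{s..t}. FY r) - (LBINT r:{s..t}. driver Xb Y2 Z2 r w)"
      unfolding \<delta>_def FY_def[symmetric] by (rule set_integral_diff(2)) (use st in \<open>auto intro: sub iY i2\<close>)
    have Ys: "Y s w = g (X T w) + \<alpha> * (LBINT r:{s..T}. FY r) - (IY T w - IY s w)"
      and Yt: "Y t w = g (X T w) + \<alpha> * (LBINT r:{t..T}. FY r) - (IY T w - IY t w)"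
      using Yeq st by (auto simp: FY_def)
    have Y2s: "Y2 s w = y0 w - (LBINT r:{0..s}. driver Xb Y2 Z2 r w) + I2 s w"
      and Y2t: "Y2 t w = y0 w - (LBINT r:{0..t}. driver Xb Y2 Z2 r w) + I2 t w"
      using Y2eq st by auto
    show "D s w + J w = D t w + (LBINT r:{s..t}. \<delta> r w)"
      using a unfolding D_def J_def Ys Yt Y2s Y2t 1 2 3 by (simp add: field_simps)
  qed
  ultimately show ?thesis by blast
qed

lemma D_measurable: "t \<in> {0..T} \<Longrightarrow> D t \<in> borel_measurable M"
  by (rule jm_section[OF jm_D])

text \<open>Almost surely \<open>Y T\<close> and \<open>uval T\<close> both equal
  \<open>g (X T)\<close>, so only \<open>- Y2 T\<close> remains.\<close>

lemma D_terminal: "sqn M (D T) = sqn M (Y2 T)"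
proof -
  have "AE w in M. D T w = - Y2 T w" using eqY
  proof eventually_elim
    case (elim w)
    have "(LBINT s:{T..T}. \<alpha> * f s (X s w) (Y s w) (Z s w)) = 0"
      unfolding set_lebesgue_integral_def
      by (subst integral_discrete_difference[of "{T}" _ _ "\<lambda>_. 0"]) (auto simp: indicator_def)
    moreover have "Y T w = g (X T w) + (LBINT s:{T..T}. \<alpha> * f s (X s w) (Y s w) (Z s w)) - (IY T w - IY T w)"
      using elim T_pos by (meson atLeastAtMost_iff order_refl less_imp_le)
    moreover have "u T (X T w) = g (X T w)" using pde by (simp add: backward_pde_solution_def)
    ultimately show ?case using alpha by (auto simp: D_def uval_def)
  qed
  then have "sqn M (D T) = sqn M (\<lambda>w. - Y2 T w)" by (rule sqn_cong_AE)
  then show ?thesis by (simp add: sqn_minus)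
qed

text \<open>Some uniform bound, however large, has to precede Pythagoras in \<open>energy\<close>
  and the absorption in \<open>backward_iteration\<close>; only its finiteness is used
  there.\<close>

lemma D_finite:
  "\<exists>M0. \<forall>t\<in>{0..T}. sqn M (D t) \<le> ennreal M0"
proof -
  define B where "B = 4 * sqn M (D T) + 4 * (ennreal T * psq 0 T \<delta>) + 4 * psq 0 T \<zeta>"
  have "B < top" using fin \<delta>_finite psq_\<zeta> by (simp add: B_def D_terminal ennreal_mult_less_top)
  have "sqn M (D s) \<le> B" if s: "0 \<le> s" "s < T" for s
  proof -
    obtain J where J: "ito_pair s T \<zeta> J" "AE w in M. D s w + J w = D T w + (LBINT r:{s..T}. \<delta> r w)"
      using increment[OF s order_refl] by blast
    have j\<delta>: "jm s T \<delta>" by (rule jm_sub[OF jm_\<delta>]) (use s in auto)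
    have m: "D T \<in> borel_measurable M" "(\<lambda>w. LBINT r:{s..T}. \<delta> r w) \<in> borel_measurable M" "(\<lambda>w. - J w) \<in> borel_measurable M"
      using D_measurable[of T] T_pos measurable_time_integral[OF j\<delta>] ito_pair_measurable[OF J(1)] by auto
    have "sqn M (D s) = sqn M (\<lambda>w. D T w + (LBINT r:{s..T}. \<delta> r w) + - J w)"
      by (rule sqn_cong_AE) (use J(2) in eventually_elim, simp)
    also have "... \<le> 4 * sqn M (D T) + 4 * sqn M (\<lambda>w. LBINT r:{s..T}. \<delta> r w) + 4 * sqn M (\<lambda>w. - J w)"
      by (rule sqn_add3_le[OF m])
    also have "... \<le> B" unfolding B_def
    proof (intro add_mono mult_left_mono order_refl)
      have "sqn M (\<lambda>w. LBINT r:{s..T}. \<delta> r w) \<le> ennreal (T - s) * psq s T \<delta>"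
        by (rule sqn_time_integral_le[OF j\<delta>]) (use s in auto)
      also have "... \<le> ennreal T * psq 0 T \<delta>"
        by (intro mult_mono ennreal_leI psq_interval_mono[OF jm_\<delta>]) (use s in auto)
      finally show "sqn M (\<lambda>w. LBINT r:{s..T}. \<delta> r w) \<le> ennreal T * psq 0 T \<delta>" .
      show "sqn M (\<lambda>w. - J w) \<le> psq 0 T \<zeta>"
        unfolding sqn_minus ito_pair_isometry[OF J(1) s(1) order_refl]
        by (rule psq_interval_mono[OF jm_\<zeta>]) (use s in auto)
    qed auto
    finally show ?thesis .
  qed
  moreover have "sqn M (D T) \<le> B"
  proof -
    have "sqn M (D T) \<le> 4 * sqn M (D T)" using mult_right_mono[of 1 4 "sqn M (D T)"] by simp
    also have "... \<le> B" unfolding B_def add.assoc by simp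
    finally show ?thesis .
  qed
  ultimately have "\<forall>t\<in>{0..T}. sqn M (D t) \<le> B" by (metis atLeastAtMost_iff less_eq_real_def)
  then have "\<forall>t\<in>{0..T}. sqn M (D t) \<le> ennreal (enn2real B)" using \<open>B < top\<close> by simp
  then show ?thesis ..
qed

lemma D_adapted: "t \<in> {0..T} \<Longrightarrow> D t \<in> borel_measurable (F t)"
  unfolding D_def[abs_def]
  using progressive_section[of 0 T Y t] progressive_section[OF Y2, of t] uval_F_measurable[of t] Y
  by (auto simp: square_integrable_process_def)

text \<open>\<open>D s\<close> is known at time \<open>s\<close>, hence orthogonal to the stochastic
  integral after \<open>s\<close>; Pythagoras yields both squares at once, in place of Ito's formula
  for the square of \<open>D\<close>.\<close>

lemma energy:
  assumes st: "0 \<le> s" "s < t" "t \<le> T"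
  shows "sqn M (D s) + psq s t \<zeta> \<le> 2 * sqn M (D t) + 2 * (ennreal (t - s) * psq s t \<delta>)"
proof -
  obtain J where J: "ito_pair s t \<zeta> J" "AE w in M. D s w + J w = D t w + (LBINT r:{s..t}. \<delta> r w)"
    using increment[OF st] by blast
  have mem: "s \<in> {0..T}" "t \<in> {0..T}" and le: "s \<le> t" using st by auto
  have j\<delta>: "jm s t \<delta>" by (rule jm_sub[OF jm_\<delta>]) (use st in auto)
  have Ds: "sqn M (D s) < top" using D_finite mem by (meson ennreal_less_top le_less_trans)
  have "sqn M (D s) + psq s t \<zeta> = sqn M (D s) + sqn M J" by (simp add: ito_pair_isometry[OF J(1) st(1,3)])
  also have "... = sqn M (\<lambda>w. D s w + J w)"
    by (rule sqn_pythagoras[OF D_measurable[OF mem(1)] ito_pair_measurable[OF J(1)] Ds ito_pair_finite[OF J(1) st(1,3)]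
        ito_pair_orthogonal[OF J(1) st(1) le st(3) D_adapted[OF mem(1)] Ds], symmetric])
  also have "... = sqn M (\<lambda>w. D t w + (LBINT r:{s..t}. \<delta> r w))" by (rule sqn_cong_AE[OF J(2)])
  also have "... \<le> 2 * sqn M (D t) + 2 * sqn M (\<lambda>w. LBINT r:{s..t}. \<delta> r w)"
    by (rule sqn_add_le[OF D_measurable[OF mem(2)] measurable_time_integral[OF j\<delta>]])
  also have "... \<le> 2 * sqn M (D t) + 2 * (ennreal (t - s) * psq s t \<delta>)"
    by (intro add_left_mono mult_left_mono sqn_time_integral_le[OF j\<delta> le]) simp
  finally show ?thesis .
qed

lemma energy_step:
  assumes st: "0 \<le> s" "s \<le> t" "t \<le> T" "t - s \<le> step_size"
  shows "sqn M (D s) \<le> 2 * sqn M (D t) + ennreal (1/2) * (ennreal (gap_const\<^sup>2 * E) + (\<integral>\<^sup>+r\<in>{s..t}. sqn M (D r) \<partial>lborel))"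
proof (cases "s = t")
  case True
  then have "sqn M (D s) \<le> 2 * sqn M (D t)" using mult_right_mono[of 1 2 "sqn M (D t)"] by simp
  then show ?thesis by (rule order_trans) simp
next
  case False
  then have st': "s < t" using st by simp
  define P where "P = ennreal (gap_const\<^sup>2 * E) + psq s t D"
  have z: "psq s t \<zeta> < top"
    using psq_interval_mono[OF jm_\<zeta> st(1,3)] psq_\<zeta> by (rule le_less_trans)
  \<comment> \<open>The choice of \<open>step_size\<close> leaves one half in front of everything
    that \<delta> contributes, including \<open>psq s t \<zeta>\<close>.\<close>
  have "2 * (t - s) * (4 * K\<^sup>2) \<le> 2 * step_size * (4 * K\<^sup>2)" using st by (intro mult_right_mono) auto
  with step_size(3) have small: "2 * (t - s) * (4 * K\<^sup>2) \<le> 1/2" by linarith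
  have gap: "gap_const\<^sup>2 * E * (t - s) \<le> gap_const\<^sup>2 * E"
    using st step_size(2) E by (intro mult_right_le_one_le) auto
  have factor: "ennreal (2 * ((t - s) * (4 * K\<^sup>2))) = 2 * (ennreal (t - s) * ennreal (4 * K\<^sup>2))"
    using st by (simp only: ennreal_mult'[symmetric] numeral_mult_ennreal' diff_ge_0_iff_ge)
  have "2 * (ennreal (t - s) * psq s t \<delta>)
    \<le> 2 * (ennreal (t - s) * (ennreal (4 * K\<^sup>2) * (ennreal (gap_const\<^sup>2 * E * (t - s)) + psq s t D + psq s t \<zeta>)))"
    by (intro mult_left_mono psq_\<delta> st) auto
  also have "... = ennreal (2 * (t - s) * (4 * K\<^sup>2)) * (ennreal (gap_const\<^sup>2 * E * (t - s)) + psq s t D + psq s t \<zeta>)"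
    by (simp only: factor mult.assoc)
  also have "... \<le> ennreal (1/2) * (P + psq s t \<zeta>)"
    unfolding P_def by (rule mult_mono[OF ennreal_leI[OF small] add_right_mono[OF add_right_mono[OF ennreal_leI[OF gap]]]]) auto
  finally have "sqn M (D s) + psq s t \<zeta> \<le> 2 * sqn M (D t) + ennreal (1/2) * (P + psq s t \<zeta>)"
    using energy[OF st(1) st' st(3)] by (meson add_left_mono order_trans)
  also have "... = (2 * sqn M (D t) + ennreal (1/2) * P) + ennreal (1/2) * psq s t \<zeta>"
    by (simp only: distrib_left add.assoc)
  \<comment> \<open>The half is enlarged to the full \<open>psq s t \<zeta>\<close>, which cancels
    against the left side because it is finite.\<close>
  also have "... \<le> (2 * sqn M (D t) + ennreal (1/2) * P) + psq s t \<zeta>"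
    by (rule add_left_mono, rule mult_right_mono[of "ennreal (1/2)" 1, unfolded mult_1_left]) (simp_all only: ennreal_le_1, simp_all)
  finally have "sqn M (D s) \<le> 2 * sqn M (D t) + ennreal (1/2) * P"
    using z by (auto simp: add.commute[of _ "psq s t \<zeta>"] ennreal_add_left_cancel_le)
  then show ?thesis unfolding P_def psq_fst[OF jm_sub[OF jm_D st(1,3)]] .
qed

lemma stability: "sqn M (\<lambda>w. (1 / \<alpha>) * (Y 0 w - uval 0 w) - Y2 0 w) \<le> 4 ^ nat \<lceil>T / step_size\<rceil> * (sqn M (Y2 T) + ennreal (gap_const\<^sup>2 * E))"
proof -
  obtain M0 where "\<forall>t\<in>{0..T}. sqn M (D t) \<le> ennreal M0" using D_finite by blast
  then show ?thesis
    unfolding D_terminal[symmetric] D_def[symmetric]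
    by (intro backward_iteration energy_step step_size T_pos) auto
qed

end

end

theorem theorem2:
  fixes M :: "'w measure"
    and F :: "real \<Rightarrow> 'w measure"
    and T :: real
    and W :: "real \<Rightarrow> 'w \<Rightarrow> real ^ 'd"
    and \<xi> :: "'w \<Rightarrow> real ^ 'd"
    and \<mu> :: "real \<Rightarrow> real ^ 'd \<Rightarrow> real ^ 'd"
    and \<sigma> :: "real \<Rightarrow> real ^ 'd \<Rightarrow> real ^ 'd ^ 'd"
    and f :: "real \<Rightarrow> real ^ 'd \<Rightarrow> real \<Rightarrow> real ^ 'd \<Rightarrow> real"
    and g :: "real ^ 'd \<Rightarrow> real"
    and X :: "real \<Rightarrow> real \<Rightarrow> 'w \<Rightarrow> real ^ 'd"
    and Y :: "real \<Rightarrow> real \<Rightarrow> real \<Rightarrow> 'w \<Rightarrow> real"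
    and Z :: "real \<Rightarrow> real \<Rightarrow> real \<Rightarrow> 'w \<Rightarrow> real ^ 'd"
    and U1 :: "real \<Rightarrow> real \<Rightarrow> real ^ 'd \<Rightarrow> real"
    and Xbar :: "real \<Rightarrow> nat \<Rightarrow> real \<Rightarrow> 'w \<Rightarrow> real ^ 'd"
  assumes "prob_space M"
    and "T > 0"
    and "brownian_motion M T W"
    and "\<xi> \<in> borel_measurable M"
    and "integrable M (\<lambda>\<omega>. (norm (\<xi> \<omega>))\<^sup>2)"
    and "indep_of_path M \<xi> T W"
    and "F = generated_filtration M (\<lambda>t \<omega>. W t \<omega> + \<xi> \<omega>)"
    and "standing_assumptions T \<mu> \<sigma> f g"
    and "\<And>\<epsilon> \<alpha>. \<epsilon> \<in> {0<..<1} \<Longrightarrow> \<alpha> \<in> {0<..<1} \<Longrightarrow>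
           unique_fbsde_solution M F W T \<mu> \<sigma> f g \<xi> \<epsilon> \<alpha> (X \<epsilon>) (Y \<epsilon> \<alpha>) (Z \<epsilon> \<alpha>)"
    and "\<And>\<epsilon>. \<epsilon> \<in> {0<..<1} \<Longrightarrow> linear_part M F W T \<mu> \<sigma> g \<epsilon> (U1 \<epsilon>)"
    and "\<And>\<epsilon> n. \<epsilon> \<in> {0<..<1} \<Longrightarrow> n \<ge> 1 \<Longrightarrow>
           euler_maruyama M F W T \<mu> \<sigma> \<xi> \<epsilon> n (Xbar \<epsilon> n)"
  shows "\<exists>C>0. \<forall>\<epsilon>\<in>{0<..<1}. \<forall>\<alpha>\<in>{0<..<1}. \<forall>n\<ge>1. \<forall>Y2_0 Z2 Y2.
           admissible M F T Y2_0 Z2 \<longrightarrow>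
           controlled_process M F W T \<sigma> f \<epsilon> \<alpha> (U1 \<epsilon>) (Xbar \<epsilon> n) Y2_0 Z2 Y2 \<longrightarrow>
           (\<integral>\<^sup>+\<omega>. ennreal (\<bar>Y \<epsilon> \<alpha> 0 \<omega> - (U1 \<epsilon> 0 (X \<epsilon> 0 \<omega>) + \<alpha> * Y2_0 \<omega>)\<bar>\<^sup>2) \<partial>M)
             \<le> ennreal (\<alpha>\<^sup>2 * C) *
               (ennreal (1 / real n) + (\<integral>\<^sup>+\<omega>. ennreal (\<bar>Y2 T \<omega>\<bar>\<^sup>2) \<partial>M))"
proof -
  interpret prob_space M by fact
  have TT: "T \<in> {0..T}" "0 \<in> {0..T}" using assms(2) by auto
  obtain L where L: "regular_coefficients T \<mu> \<sigma> g L" using standing_assumptions_regular[OF assms(8)] by blast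
  interpret regular_coefficients T \<mu> \<sigma> g L by fact
  have bs: "brownian_setting M T W \<xi> F"
    using assms(1-4,6,7) by (simp add: brownian_setting_def brownian_setting_axioms_def)
  interpret brownian_setting M T W \<xi> F by fact
  interpret diffusion_setting M T W \<xi> F \<mu> \<sigma> g L by unfold_locales (rule assms(5))
  note sa = assms(8)[unfolded standing_assumptions_def]
  have f1: "\<exists>L. \<forall>t\<in>{0..T}. \<forall>x x' y y' z z'.
      \<bar>f t x y z - f t x' y' z'\<bar> \<le> L * (norm (x - x') + \<bar>y - y'\<bar> + norm (z - z'))"
    using sa by (elim conjE)
  have f2: "\<exists>L. \<forall>t\<in>{0..T}. \<forall>x y z. \<bar>f t x y z\<bar> \<le> L * (1 + norm x + \<bar>y\<bar> + norm z)"
    using sa by (elim conjE)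
  have f3: "\<exists>K. \<forall>s\<in>{0..T}. \<forall>t\<in>{0..T}. \<forall>x y z. \<bar>f t x y z - f s x y z\<bar> \<le> K * sqrt \<bar>t - s\<bar>"
    using sa by (elim conjE)
  obtain K1 where K1: "\<And>t x x' y y' z z'. t \<in> {0..T} \<Longrightarrow>
      \<bar>f t x y z - f t x' y' z'\<bar> \<le> K1 * (norm (x - x') + \<bar>y - y'\<bar> + norm (z - z'))" using f1 by blast
  obtain K2 where K2: "\<And>t x y z. t \<in> {0..T} \<Longrightarrow> \<bar>f t x y z\<bar> \<le> K2 * (1 + norm x + \<bar>y\<bar> + norm z)" using f2 by blast
  obtain K3 where K3: "\<And>s t x y z. s \<in> {0..T} \<Longrightarrow> t \<in> {0..T} \<Longrightarrow> \<bar>f t x y z - f s x y z\<bar> \<le> K3 * sqrt \<bar>t - s\<bar>"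
    using f3 by blast
  define K where "K = Max {1, K1, K2, K3}"
  have K: "1 \<le> K" "K1 \<le> K" "K2 \<le> K" "K3 \<le> K" unfolding K_def by (intro Max_ge; simp)+
  have larger: "a \<le> K * c" if "a \<le> l * c" "l \<le> K" "0 \<le> c" for a l c
    using that by (meson mult_right_mono order_trans)
  obtain Ce where Ce: "Ce \<ge> 0" "\<And>\<epsilon> n X X' t. \<epsilon> \<in> {0<..<1} \<Longrightarrow> n \<ge> 1 \<Longrightarrow> sde_solution M F W T \<mu> \<sigma> \<epsilon> 0 \<xi> X \<Longrightarrow>
      euler_maruyama M F W T \<mu> \<sigma> \<xi> \<epsilon> n X' \<Longrightarrow> t \<in> {0..T} \<Longrightarrow> sqn M (\<lambda>w. X t w - X' t w) \<le> ennreal (Ce / real n)"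
    using euler_error by blast
  \<comment> \<open>Copies of \<open>step_size\<close> and \<open>gap_const\<close>, fixed before
    \<epsilon>, \<alpha>, \<open>n\<close> and the controls, so that \<open>C\<close> is uniform in
    them.\<close>
  define \<tau> where "\<tau> = min 1 (1 / (16 * K\<^sup>2))"
  define c where "c = (1 + deriv_bound + 2 * deriv_bound * L)\<^sup>2 * Ce"
  define C where "C = 4 ^ nat \<lceil>T / \<tau>\<rceil> * max 1 c"
  have "C > 0" by (simp add: C_def less_max_iff_disj)
  moreover have "(\<integral>\<^sup>+w. ennreal (\<bar>Y \<epsilon> \<alpha> 0 w - (U1 \<epsilon> 0 (X \<epsilon> 0 w) + \<alpha> * Y2_0 w)\<bar>\<^sup>2) \<partial>M)
      \<le> ennreal (\<alpha>\<^sup>2 * C) * (ennreal (1 / real n) + (\<integral>\<^sup>+w. ennreal (\<bar>Y2 T w\<bar>\<^sup>2) \<partial>M))"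
    if eps: "\<epsilon> \<in> {0<..<1}" and alpha: "\<alpha> \<in> {0<..<1}" and n: "n \<ge> 1"
      and adm: "admissible M F T Y2_0 Z2"
      and ctrl: "controlled_process M F W T \<sigma> f \<epsilon> \<alpha> (U1 \<epsilon>) (Xbar \<epsilon> n) Y2_0 Z2 Y2" for \<epsilon> \<alpha> n Y2_0 Z2 Y2
  \<comment> \<open>An infinite loss makes the right hand side infinite, as the factor in front is
    positive; a finite loss is the starting point for the bounds on \<open>D\<close>.\<close>
  proof (cases "sqn M (Y2 T) < top")
    case False
    then have "(\<integral>\<^sup>+w. ennreal (\<bar>Y2 T w\<bar>\<^sup>2) \<partial>M) = top" by (simp add: sqn_def less_top[symmetric])
    moreover have "\<alpha>\<^sup>2 * C > 0" using alpha \<open>C > 0\<close> by simp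
    ultimately show ?thesis by (auto simp: ennreal_mult_top)
  next
    case fin: True
    have a0: "\<alpha> > 0" "\<alpha> \<noteq> 0" using alpha by auto
    have fb: "fbsde_solution M F W T \<mu> \<sigma> f g \<xi> \<epsilon> \<alpha> (X \<epsilon>) (Y \<epsilon> \<alpha>) (Z \<epsilon> \<alpha>)"
      using assms(9)[OF eps alpha] by (simp add: unique_fbsde_solution_def)
    then have solX: "sde_solution M F W T \<mu> \<sigma> \<epsilon> 0 \<xi> (X \<epsilon>)" and sqY: "square_integrable_process M F 0 T (Y \<epsilon> \<alpha>)"
      by (auto simp: fbsde_solution_def)
    obtain IY where IY: "ito_integral M F W 0 T (Z \<epsilon> \<alpha>) IY" and eqY: "AE w in M. \<forall>t\<in>{0..T}. Y \<epsilon> \<alpha> t w = g (X \<epsilon> T w)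
        + (LBINT s:{t..T}. \<alpha> * f s (X \<epsilon> s w) (Y \<epsilon> \<alpha> s w) (Z \<epsilon> \<alpha> s w)) - (IY T w - IY t w)"
      using fb unfolding fbsde_solution_def by blast
    have lin: "linear_part M F W T \<mu> \<sigma> g \<epsilon> (U1 \<epsilon>)" by (rule assms(10)[OF eps])
    have ub: "\<bar>U1 \<epsilon> t x\<bar> \<le> L" if t: "t \<in> {0..T}" for t x
    proof -
      obtain X' where "U1 \<epsilon> t x = (\<integral>w. g (X' T w) \<partial>M)" using lin t unfolding linear_part_def by blast
      also have "\<bar>...\<bar> \<le> L"
      \<comment> \<open>If \<open>g (X' T)\<close> is not integrable, its mean is 0 by convention
        and the bound still holds.\<close>
      proof (cases "integrable M (\<lambda>w. g (X' T w))")
        case True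
        have "\<bar>\<integral>w. g (X' T w) \<partial>M\<bar> \<le> (\<integral>w. \<bar>g (X' T w)\<bar> \<partial>M)" by (rule integral_abs_bound)
        also have "... \<le> (\<integral>w. L \<partial>M)" by (rule integral_mono) (use True g_bound in auto)
        finally show ?thesis by (simp add: prob_space)
      qed (simp add: not_integrable_integral_eq L0)
      finally show ?thesis .
    qed
    interpret bsde_setting M T W \<xi> F \<mu> \<sigma> g L \<epsilon> "X \<epsilon>" "U1 \<epsilon>" f K \<alpha>
    proof unfold_locales
      show "backward_pde_solution T \<mu> \<sigma> g \<epsilon> (U1 \<epsilon>)" using lin by (simp add: linear_part_def)
      fix t x x' y y' and z z' :: "real ^ 'd" assume t: "t \<in> {0..T}"
      show "\<bar>f t x y z - f t x' y' z'\<bar> \<le> K * (norm (x - x') + \<bar>y - y'\<bar> + norm (z - z'))"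
        by (rule larger[OF K1[OF t] K(2)]) simp
      show "\<bar>f t x y z\<bar> \<le> K * (1 + norm x + \<bar>y\<bar> + norm z)"
        by (rule larger[OF K2[OF t] K(3)]) simp
      fix s assume s: "s \<in> {0..T}"
      show "\<bar>f t x y z - f s x y z\<bar> \<le> K * sqrt \<bar>t - s\<bar>"
        by (rule larger[OF K3[OF s t] K(4)]) simp
    qed (use eps alpha solX ub K(1) in auto)
    have eul: "euler_maruyama M F W T \<mu> \<sigma> \<xi> \<epsilon> n (Xbar \<epsilon> n)" by (rule assms(11)[OF eps n])
    note dd = euler_has_drift_diffusion[OF eul eps n]
    have jXb: "jm 0 T (Xbar \<epsilon> n)" using eul T_pos by (intro progressive_jm) (auto simp: euler_maruyama_def)
    obtain I2 where I2: "ito_integral M F W 0 T Z2 I2" and eq2: "AE w in M. \<forall>t\<in>{0..T}. Y2 t w = Y2_0 w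
        - (LBINT s:{0..t}. f s (Xbar \<epsilon> n s w) (U1 \<epsilon> s (Xbar \<epsilon> n s w) + \<alpha> * Y2 s w)
            (linear_Z \<sigma> \<epsilon> (U1 \<epsilon>) s (Xbar \<epsilon> n s w) + \<alpha> *\<^sub>R Z2 s w)) + I2 t w"
      using ctrl unfolding controlled_process_def by blast
    have progY2: "progressive F 0 T Y2" using ctrl by (simp add: controlled_process_def)
    from eq2 have eq2': "AE w in M. \<forall>t\<in>{0..T}. Y2 t w = Y2_0 w - (LBINT s:{0..t}. driver (Xbar \<epsilon> n) Y2 Z2 s w) + I2 t w"
      by eventually_elim (simp add: driver_integral)
    have y0: "Y2_0 \<in> borel_measurable M" "sqn M Y2_0 < top"
    proof -
      have "Y2_0 \<in> borel_measurable (F 0)" using adm by (simp add: admissible_def)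
      then show m: "Y2_0 \<in> borel_measurable M" by (rule measurable_F) (use T_pos in auto)
      show "sqn M Y2_0 < top" using adm by (simp add: sqn_finite_iff_integrable[OF m] admissible_def)
    qed
    define D0 where "D0 w = (1 / \<alpha>) * (Y \<epsilon> \<alpha> 0 w - uval 0 w) - Y2 0 w" for w
    have const: "gap_const\<^sup>2 * (Ce / real n) = c / real n" by (simp add: c_def gap_const_def)
    have st: "sqn M D0 \<le> 4 ^ nat \<lceil>T / \<tau>\<rceil> * (sqn M (Y2 T) + ennreal (c / real n))"
      using stability[OF sqY IY eqY jXb drift_diffusion_psq_finite[OF dd] Ce(2)[OF eps n solX eul] _ y0 I2 progY2 eq2' fin] Ce(1)
      unfolding const D0_def[abs_def] \<tau>_def step_size_def by simp
    have D0m: "D0 \<in> borel_measurable M"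
      unfolding D0_def[abs_def]
      using jm_section[OF square_integrable_psq(1)[OF sqY] TT(2)] uval_measurable[OF TT(2)]
        jm_section[OF progressive_jm[OF progY2] TT(2)] T_pos by simp
    \<comment> \<open>\<open>stability\<close> speaks of the process at time 0; it agrees almost
      surely with the initial datum, since both integrals vanish there.\<close>
    have "AE w in M. Y2 0 w = Y2_0 w"
      using eq2' ito_integral_start[OF I2 less_imp_le[OF T_pos]]
    proof eventually_elim
      case (elim w)
      have "(LBINT s:{0..0}. driver (Xbar \<epsilon> n) Y2 Z2 s w) = 0"
        unfolding set_lebesgue_integral_def
        by (subst integral_discrete_difference[of "{0}" _ _ "\<lambda>_. 0"]) (auto simp: indicator_def)
      then show ?case using bspec[OF elim(1) TT(2)] elim(2) TT by simp
    qed
    then have "AE w in M. Y \<epsilon> \<alpha> 0 w - (U1 \<epsilon> 0 (X \<epsilon> 0 w) + \<alpha> * Y2_0 w) = \<alpha> *\<^sub>R D0 w"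
      by eventually_elim (use a0 in \<open>simp add: D0_def uval_def field_simps\<close>)
    then have "sqn M (\<lambda>w. Y \<epsilon> \<alpha> 0 w - (U1 \<epsilon> 0 (X \<epsilon> 0 w) + \<alpha> * Y2_0 w)) = sqn M (\<lambda>w. \<alpha> *\<^sub>R D0 w)"
      by (rule sqn_cong_AE)
    also have "... = ennreal (\<alpha>\<^sup>2) * sqn M D0" by (rule sqn_scale[OF D0m])
    also have "... \<le> ennreal (\<alpha>\<^sup>2) * (ennreal C * (ennreal (1 / real n) + sqn M (Y2 T)))"
    proof (intro mult_left_mono)
      \<comment> \<open>\<open>max 1 c\<close> serves both summands: \<open>c\<close> for 1/n and 1
        for the loss.\<close>
      have "ennreal (c / real n) \<le> ennreal (max 1 c) * ennreal (1 / real n)"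
        by (subst ennreal_mult'[symmetric]) (auto intro!: ennreal_leI divide_right_mono)
      moreover have "sqn M (Y2 T) \<le> ennreal (max 1 c) * sqn M (Y2 T)"
        using mult_right_mono[of 1 "ennreal (max 1 c)" "sqn M (Y2 T)"] by simp
      ultimately have "sqn M (Y2 T) + ennreal (c / real n) \<le> ennreal (max 1 c) * (ennreal (1 / real n) + sqn M (Y2 T))"
        by (subst add.commute) (simp add: distrib_left add_mono)
      then have "4 ^ nat \<lceil>T / \<tau>\<rceil> * (sqn M (Y2 T) + ennreal (c / real n))
        \<le> 4 ^ nat \<lceil>T / \<tau>\<rceil> * (ennreal (max 1 c) * (ennreal (1 / real n) + sqn M (Y2 T)))"
        by (intro mult_left_mono) auto
      also have "... = ennreal C * (ennreal (1 / real n) + sqn M (Y2 T))"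
        unfolding C_def by (simp add: ennreal_mult ennreal_power[symmetric] mult.assoc)
      finally show "sqn M D0 \<le> ennreal C * (ennreal (1 / real n) + sqn M (Y2 T))" using st by (rule order_trans[rotated])
    qed simp
    also have "... = ennreal (\<alpha>\<^sup>2 * C) * (ennreal (1 / real n) + sqn M (Y2 T))"
      using \<open>C > 0\<close> by (simp add: ennreal_mult mult.assoc)
    finally show ?thesis by (simp add: sqn_def)
  qed
  ultimately show ?thesis by blast
qed

end
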